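(* Let $(K^{\cdot,\cdot},d,N,\ell,\psi)$ be the polarized bigraded Lefschetz module associated to a Riemann surface $X_{/\mathbb{C}}$ of genus $g\ge2$, and let $\Gamma\subset\mathrm{SL}(2,\mathbb{C})$ be a choice of Schottky uniformization for $X_{/\mathbb{C}}$. Let $\tilde\Gamma$ be a lift to $\mathrm{SL}(2,\mathbb{C})$ of the $\Gamma$-stabilizer of the two connected components of $\mathbb{P}^1(\mathbb{C})\setminus C$, with $C$ a quasi-circle for $\Gamma$. Consider the representation $\rho:\mathbb{R}[\tilde\Gamma]\to{\mathcal B}(\mathbb{H}^\cdot(K,d))$ induced by the Lefschetz representation $\sigma_2$ of $\mathrm{SL}(2,\mathbb{R})$ via $\gamma\mapsto\sigma\{1,\alpha_2\gamma\alpha_2^{-1}\}$, and the corresponding representation $\rho:\mathbb{R}[\tilde\Gamma]\to{\mathcal B}(\mathrm{Ker}(N))$. Let ${\rm A}(\tilde\Gamma)=\rho(\mathbb{R}[\tilde\Gamma])$. Then: (i) $\tilde\Gamma$ acts, via $\rho$, by bounded operators on the Hilbert completion of $\mathbb{H}^\cdot(K,d)$ in the inner product defined by the polarization $\psi$, and $\tilde\Phi$ has bounded commutators with all elements of ${\rm A}(\tilde\Gamma)$; (ii) the inner product defined by $\psi$ induces an inner product on $H^\cdot(X^* )$, $\rho$ induces an action of $\mathbb{R}[\tilde\Gamma]$ by bounded operators on the real Hilbert space completion of $H^\cdot(X^* )$, and, for the data $({\rm A}(\tilde\Gamma),H^\cdot(X^* ),\Phi)$, the operator $\Phi$ satisfies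 the properties of a $1$-summable Dirac operator, with bounded commutators with the elements of ${\rm A}(\tilde\Gamma)$.
   Context: **The complex.** $(A^{a,b}\oplus A^{b,a})_{\mathbb{R}}$ denotes the real $C^\infty$ forms on $X_{/\mathbb{C}}$ of type $(a,b)+(b,a)$, and $(\cdot)(p)=(2\pi\sqrt{-1})^p(\cdot)$. $K^{i,j,k}=\bigoplus_{a+b=j+1,|a-b|\le2k-i}(A^{a,b}\oplus A^{b,a})_{\mathbb{R}}(\frac{1+j-i}{2})$ if $1+j-i$ is even and $k\ge\max(0,i)$, and $0$ otherwise; $K^{i,j}=\bigoplus_kK^{i,j,k}$. $d=d'+d''$, $d'=\partial+\bar\partial:K^{i,j,k}\to K^{i+1,j+1,k+1}$, $d''=P^\perp\sqrt{-1}(\bar\partial-\partial):K^{i,j,k}\to K^{i+1,j+1,k}$ ($P^\perp$ the orthogonal projection onto the target). $N:K^{i,j,k}\to K^{i+2,j,k+1}$, $N(f)=(2\pi\sqrt{-1})^{-1}f$; $\ell:K^{i,j,k}\to K^{i,j+2,k}$, $\ell(f)=(2\pi\sqrt{-1})f\wedge\omega$, $\omega$ a K\"ahler form. $\psi(x,y)=\frac{1}{2\pi\sqrt{-1}}\epsilon(1-j)(-1)^k\int x\wedge Cy$ on $K^{-i,-j,k}\otimes K^{i,j,k+i}$, $\epsilon(m)=(-1)^{m(m+1)/2}$, $C$ here the Weil operator $(\sqrt{-1})^{a-b}$ on type $(a,b)$. It is known that this is a polarized bigraded Lefschetz module, equivalently a representation $\sigma$ of $\mathrm{SL}(2,\mathbb{R})\times\mathrm{SL}(2,\mathbb{R})$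 with $\sigma\{\mathrm{diag}(a,a^{-1}),\mathrm{diag}(b,b^{-1})\}x=a^ib^jx$ on $K^{i,j}$, $d\sigma\{E,0\}=N$, $d\sigma\{0,E\}=\ell$, $E=\begin{pmatrix}0&1\\0&0\end{pmatrix}$; with $w=\begin{pmatrix}0&1\\-1&0\end{pmatrix}$ the form $\langle x,y\rangle=\psi(x,\sigma(\{w,w\})y)$ is symmetric positive definite; all this descends to $\mathbb{H}^\cdot(K,d)=H^\cdot(\tilde X^* )$. $\sigma_2$ is the restriction of $\sigma$ to the second factor. $\tilde\Phi$ is multiplication by $\frac{1+j-i}{2}$ on $K^{i,j,k}$. **Cohomologies.** $gr^w_{2p}H^q(\tilde X^* )$ is the cohomology of $d$ at $K^{q-2p,q-1}$; $gr^w_{2p}H^q(X^* )$ is the cohomology of the mapping cone of $N$, on pairs $(a,b)\in K^{q-2p,q-1}\oplus K^{q-2p+1,q-2}$ with $D(a,b)=(-da,Na+db)$; $H^q(\cdot)=\bigoplus_pgr^w_{2p}H^q(\cdot)$. For $q\ge2p$, $gr^w_{2p}H^q(X^* )=\ker(N)\subset gr^w_{2p}H^q(\tilde X^* )$, and for $q\le2(p-1)$, $gr^w_{2p}H^{q+1}(X^* )=\mathrm{coker}(N:gr^w_{2p}H^q(\tilde X^* )\to gr^w_{2(p-1)}H^q(\tilde X^* ))$; the inner product on $H^\cdot(X^* )$ is induced through these identifications. Powers of $N$ give isomorphisms $\delta_q:gr^w_{2p}H^q(X^* )\to gr^w_{2(q-p+1)}H^{q+1}(X^* )$, $q\ge2p$,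 $\delta=\bigoplus\delta_q$; the induced action on $H^\cdot(X^* )$ is $\rho$ on $\mathrm{Ker}(N)$ and $\delta\rho\delta^{-1}$ on the dual part. $\Phi$ acts on $gr^w_{2p}H^q(X^* )$ as $p$ if $q\ge2p$ and as $p-1$ if $q\le2p-1$. **Uniformization.** $\Gamma$ is (a lift to $\mathrm{SL}(2,\mathbb{C})$ of) a discrete purely loxodromic free group of rank $g$ with $X_{/\mathbb{C}}=\Gamma\backslash\Omega_\Gamma$, $\Omega_\Gamma$ the domain of discontinuity. A quasi-circle $C$ for $\Gamma$ is a $\Gamma$-invariant Jordan curve in $\mathbb{P}^1(\mathbb{C})$ (it contains the limit set); let $\Omega_1,\Omega_2$ be the components of its complement and $\alpha_i:\Omega_i\to U_i$ conformal equivalences onto the two hemispheres of $\mathbb{P}^1(\mathbb{C})\setminus\mathbb{P}^1(\mathbb{R})$. $\tilde\Gamma$ is the subgroup of $\gamma\in\Gamma$ with $\gamma(\Omega_i)=\Omega_i$; then $\alpha_2\gamma\alpha_2^{-1}$, $\gamma\in\tilde\Gamma$, lie in $\mathrm{SL}(2,\mathbb{R})$ (after lifting). **Dirac operator properties.** Self-adjoint; compact resolvent $(\Phi-\lambda)^{-1}$ for $\lambda\notin\mathbb{R}$; $1$-summable means that $|\Phi|^{-1}$, on the complement of the zero modes, has eigenvalues $\lambda_k=O(k^{-1})$. *)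

theory Defs
  imports
    "HOL-Analysis.Analysis"
    "HOL-Homology.Homology"
    "HOL-Library.Function_Algebras"
begin

text \<open>Pointwise real vector space structure on functions; the additive structure is that of
  \<^theory>\<open>HOL-Library.Function_Algebras\<close>.\<close>

instantiation "fun" :: (type, real_vector) real_vector
begin

definition scaleR_fun :: "real \<Rightarrow> ('a \<Rightarrow> 'b) \<Rightarrow> 'a \<Rightarrow> 'b"
  where "scaleR_fun r f = (\<lambda>x. r *\<^sub>R f x)"

instance
  by standard (auto simp: scaleR_fun_def fun_eq_iff algebra_simps)

end


section \<open>Riemann surfaces\<close>

type_synonym 'a chart = "'a set \<times> ('a \<Rightarrow> complex)"

abbreviation cinv :: "'a chart \<Rightarrow> complex \<Rightarrow> 'a"
  where "cinv c \<equiv> inv_into (fst c) (snd c)"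

text \<open>Only the values of a chart map on its domain matter.  Second countability is automatic
  (Rado).\<close>

definition riemann_surface :: "'a topology \<Rightarrow> 'a chart set \<Rightarrow> bool" where
  "riemann_surface X A \<longleftrightarrow>
     Hausdorff_space X \<and> connected_space X \<and> topspace X \<noteq> {} \<and>
     (\<Union>c\<in>A. fst c) = topspace X \<and>
     (\<forall>c\<in>A. openin X (fst c) \<and> open (snd c ` fst c) \<and>
        homeomorphic_map (subtopology X (fst c)) (top_of_set (snd c ` fst c)) (snd c)) \<and>
     (\<forall>c\<in>A. \<forall>c'\<in>A. (snd c' \<circ> cinv c) holomorphic_on snd c ` (fst c \<inter> fst c'))"

definition has_genus :: "'a topology \<Rightarrow> nat \<Rightarrow> bool" where
  "has_genus X g \<longleftrightarrow> homology_group 1 X \<cong> free_Abelian_group {..<2 * g}"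

text \<open>\<open>f\<close> is a holomorphic map from the open subset \<open>S\<close> of \<open>(X, A)\<close> to \<open>(Y, B)\<close>.\<close>

definition holo_map ::
  "'a topology \<Rightarrow> 'a chart set \<Rightarrow> 'a set \<Rightarrow> 'b topology \<Rightarrow> 'b chart set \<Rightarrow> ('a \<Rightarrow> 'b) \<Rightarrow> bool" where
  "holo_map X A S Y B f \<longleftrightarrow>
     continuous_map (subtopology X S) Y f \<and>
     (\<forall>c\<in>A. \<forall>e\<in>B. (snd e \<circ> f \<circ> cinv c) holomorphic_on snd c ` (fst c \<inter> S \<inter> f -` fst e))"


section \<open>The Riemann sphere, Schottky groups, quasi-circles\<close>

text \<open>\<open>None\<close> is the point at infinity.\<close>

definition P1 :: "complex option topology" where
  "P1 = Alexandroff_compactification euclidean"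

definition P1_atlas :: "complex option chart set" where
  "P1_atlas = {(range Some, the),
     (- {Some 0}, \<lambda>z. case z of None \<Rightarrow> 0 | Some u \<Rightarrow> inverse u)}"

definition moebius :: "complex^2^2 \<Rightarrow> complex option \<Rightarrow> complex option" where
  "moebius m z = (case z of
      None \<Rightarrow> if m$2$1 = 0 then None else Some (m$1$1 / m$2$1)
    | Some u \<Rightarrow> if m$2$1 * u + m$2$2 = 0 then None
        else Some ((m$1$1 * u + m$1$2) / (m$2$1 * u + m$2$2)))"

definition SL2 :: "('a::comm_ring_1^2^2) set" where
  "SL2 = {m. det m = 1}"

definition complex_mat :: "real^2^2 \<Rightarrow> complex^2^2" where
  "complex_mat m = (\<chi> i j. complex_of_real (m$i$j))"

definition diag2 :: "'a::zero \<Rightarrow> 'a \<Rightarrow> 'a^2^2" where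
  "diag2 a b = vector [vector [a, 0], vector [0, b]]"

definition loxodromic :: "complex^2^2 \<Rightarrow> bool" where
  "loxodromic m \<longleftrightarrow> (\<exists>P \<mu>. invertible P \<and> \<mu> \<noteq> 0 \<and> norm \<mu> \<noteq> 1 \<and>
     m = P ** diag2 \<mu> (inverse \<mu>) ** matrix_inv P)"

text \<open>Words in the letters \<open>(s, True) = s\<close> and \<open>(s, False) = s\<^sup>-\<^sup>1\<close>.\<close>

definition word_value :: "((complex^2^2) \<times> bool) list \<Rightarrow> complex^2^2" where
  "word_value w = foldr (\<lambda>(s, b) m. (if b then s else matrix_inv s) ** m) w (mat 1)"

definition reduced :: "('a \<times> bool) list \<Rightarrow> bool" where
  "reduced w \<longleftrightarrow> (\<forall>i. Suc i < length w \<longrightarrow>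
     \<not> (fst (w ! i) = fst (w ! Suc i) \<and> snd (w ! i) \<noteq> snd (w ! Suc i)))"

definition free_basis :: "(complex^2^2) set \<Rightarrow> (complex^2^2) set \<Rightarrow> bool" where
  "free_basis G S \<longleftrightarrow> G = word_value ` lists (S \<times> UNIV) \<and>
     (\<forall>w \<in> lists (S \<times> UNIV). reduced w \<and> w \<noteq> [] \<longrightarrow> word_value w \<noteq> mat 1)"

definition schottky_group :: "nat \<Rightarrow> (complex^2^2) set \<Rightarrow> bool" where
  "schottky_group g G \<longleftrightarrow> G \<subseteq> SL2 \<and> discrete G \<and> (\<forall>m\<in>G. m \<noteq> mat 1 \<longrightarrow> loxodromic m) \<and>
     (\<exists>S. S \<subseteq> SL2 \<and> finite S \<and> card S = g \<and> free_basis G S)"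

definition discontinuity_domain :: "(complex^2^2) set \<Rightarrow> complex option set" where
  "discontinuity_domain G =
     {z. \<exists>U. openin P1 U \<and> z \<in> U \<and> finite {m\<in>G. moebius m ` U \<inter> U \<noteq> {}}}"

text \<open>\<open>pr\<close> exhibits \<open>(X, A)\<close> as the quotient of the domain of discontinuity by \<open>G\<close>.\<close>

definition uniformizes ::
  "(complex^2^2) set \<Rightarrow> 'x topology \<Rightarrow> 'x chart set \<Rightarrow> (complex option \<Rightarrow> 'x) \<Rightarrow> bool" where
  "uniformizes G X A pr \<longleftrightarrow>
     holo_map P1 P1_atlas (discontinuity_domain G) X A pr \<and>
     pr ` discontinuity_domain G = topspace X \<and>
     (\<forall>z\<in>discontinuity_domain G. \<forall>z'\<in>discontinuity_domain G.
        pr z = pr z' \<longleftrightarrow> (\<exists>m\<in>G. z' = moebius m z))"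

definition jordan_curve :: "complex option set \<Rightarrow> bool" where
  "jordan_curve C \<longleftrightarrow> (\<exists>f. continuous_map (top_of_set (sphere (0::complex) 1)) P1 f \<and>
     inj_on f (sphere 0 1) \<and> f ` sphere 0 1 = C)"

definition quasi_circle :: "(complex^2^2) set \<Rightarrow> complex option set \<Rightarrow> bool" where
  "quasi_circle G C \<longleftrightarrow> jordan_curve C \<and> (\<forall>m\<in>G. moebius m ` C = C)"

definition hemispheres :: "complex option set set" where
  "hemispheres = {Some ` {z. Im z > 0}, Some ` {z. Im z < 0}}"

definition conformal_equiv ::
  "complex option set \<Rightarrow> complex option set \<Rightarrow> (complex option \<Rightarrow> complex option) \<Rightarrow> bool" where
  "conformal_equiv S T f \<longleftrightarrow> bij_betw f S T \<and> holo_map P1 P1_atlas S P1 P1_atlas f \<and>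
     holo_map P1 P1_atlas T P1 P1_atlas (inv_into S f)"

definition stabilizer ::
  "(complex^2^2) set \<Rightarrow> complex option set \<Rightarrow> complex option set \<Rightarrow> (complex^2^2) set" where
  "stabilizer G W1 W2 = {m\<in>G. moebius m ` W1 = W1 \<and> moebius m ` W2 = W2}"

text \<open>\<open>h\<close> is a lift to a homomorphism into \<open>SL(2,\<real>)\<close> of \<open>\<gamma> \<mapsto> \<alpha> \<gamma> \<alpha>\<^sup>-\<^sup>1\<close>, \<open>\<alpha>\<close> being defined on \<open>W\<close>.\<close>

definition conjugation_lift ::
  "(complex^2^2) set \<Rightarrow> complex option set \<Rightarrow> (complex option \<Rightarrow> complex option) \<Rightarrow>
   (complex^2^2 \<Rightarrow> real^2^2) \<Rightarrow> bool" where
  "conjugation_lift G W \<alpha> h \<longleftrightarrow> h ` G \<subseteq> SL2 \<and>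
     (\<forall>m\<in>G. \<forall>m'\<in>G. h (m ** m') = h m ** h m') \<and>
     (\<forall>m\<in>G. \<forall>z\<in>W. \<alpha> (moebius m z) = moebius (complex_mat (h m)) (\<alpha> z))"


section \<open>Differential forms\<close>

primrec ck_on :: "nat \<Rightarrow> complex set \<Rightarrow> (complex \<Rightarrow> complex) \<Rightarrow> bool" where
  "ck_on 0 S f \<longleftrightarrow> continuous_on S f"
| "ck_on (Suc n) S f \<longleftrightarrow> f differentiable_on S \<and>
     (\<forall>v. ck_on n S (\<lambda>z. frechet_derivative f (at z) v))"

definition smooth_on :: "complex set \<Rightarrow> (complex \<Rightarrow> complex) \<Rightarrow> bool" where
  "smooth_on S f \<longleftrightarrow> (\<forall>n. ck_on n S f)"

definition wirt :: "(complex \<Rightarrow> complex) \<Rightarrow> complex \<Rightarrow> complex" where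
  "wirt f z = (frechet_derivative f (at z) 1 - \<i> * frechet_derivative f (at z) \<i>) / 2"

definition wirt_bar :: "(complex \<Rightarrow> complex) \<Rightarrow> complex \<Rightarrow> complex" where
  "wirt_bar f z = (frechet_derivative f (at z) 1 + \<i> * frechet_derivative f (at z) \<i>) / 2"

text \<open>For a form \<open>\<eta>\<close>, \<open>\<eta> a b c x\<close> is the coefficient at the point \<open>x\<close> of \<open>dz\<^sup>a \<and> dzbar\<^sup>b\<close> in the
  coordinate \<open>z\<close> of the chart \<open>c\<close>.  It is \<open>0\<close> unless \<open>a, b \<le> 1\<close>, \<open>c\<close> is in the atlas and \<open>x\<close> is in
  its domain, so that forms with the same meaning are equal.\<close>

type_synonym 'x form = "nat \<Rightarrow> nat \<Rightarrow> 'x chart \<Rightarrow> 'x \<Rightarrow> complex"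

definition forms :: "'x chart set \<Rightarrow> 'x form set" where
  "forms A = {\<eta>.
     (\<forall>a b c x. \<not> (a \<le> 1 \<and> b \<le> 1 \<and> c \<in> A \<and> x \<in> fst c) \<longrightarrow> \<eta> a b c x = 0) \<and>
     (\<forall>a b. \<forall>c\<in>A. smooth_on (snd c ` fst c) (\<lambda>z. \<eta> a b c (cinv c z))) \<and>
     (\<forall>a b. \<forall>c\<in>A. \<forall>c'\<in>A. \<forall>x\<in>fst c \<inter> fst c'.
        \<eta> a b c x = \<eta> a b c' x * deriv (snd c' \<circ> cinv c) (snd c x) ^ a
                              * cnj (deriv (snd c' \<circ> cinv c) (snd c x)) ^ b)}"

definition cscale :: "complex \<Rightarrow> 'x form \<Rightarrow> 'x form" where
  "cscale u \<eta> = (\<lambda>a b c x. u * \<eta> a b c x)"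

definition form_cnj :: "'x form \<Rightarrow> 'x form" where
  "form_cnj \<eta> = (\<lambda>a b c x. (-1) ^ (a * b) * cnj (\<eta> b a c x))"

definition wedge :: "'x form \<Rightarrow> 'x form \<Rightarrow> 'x form" where
  "wedge \<eta> \<theta> = (\<lambda>a b c x. if a \<le> 1 \<and> b \<le> 1
     then \<Sum>a'\<le>a. \<Sum>b'\<le>b. (-1) ^ (b' * (a - a')) * \<eta> a' b' c x * \<theta> (a - a') (b - b') c x
     else 0)"

definition del :: "'x form \<Rightarrow> 'x form" where
  "del \<eta> = (\<lambda>a b c x. if a = 1 \<and> x \<in> fst c
     then wirt (\<lambda>z. \<eta> 0 b c (cinv c z)) (snd c x) else 0)"

definition delbar :: "'x form \<Rightarrow> 'x form" where
  "delbar \<eta> = (\<lambda>a b c x. if b = 1 \<and> x \<in> fst c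
     then (-1) ^ a * wirt_bar (\<lambda>z. \<eta> a 0 c (cinv c z)) (snd c x) else 0)"

definition weil :: "'x form \<Rightarrow> 'x form" where
  "weil \<eta> = (\<lambda>a b c x. \<i> powi (int a - int b) * \<eta> a b c x)"

text \<open>Integral of the (1,1)-component over a compact surface: \<open>X\<close> is cut into Borel pieces, each
  inside one chart of a finite list, and \<open>dz \<and> dzbar = -2\<i> dx \<and> dy\<close>.  The value does not depend
  on the list.\<close>

definition surface_integral :: "'x topology \<Rightarrow> 'x chart set \<Rightarrow> 'x form \<Rightarrow> complex" where
  "surface_integral X A \<eta> =
     (let cs = (SOME cs. set cs \<subseteq> A \<and> (\<Union>c\<in>set cs. fst c) = topspace X)
      in \<Sum>n<length cs.
           integral (snd (cs ! n) ` (fst (cs ! n) - (\<Union>m<n. fst (cs ! m))))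
             (\<lambda>z. - 2 * \<i> * \<eta> 1 1 (cs ! n) (cinv (cs ! n) z)))"

text \<open>In dimension one the closedness of \<open>\<omega>\<close> is automatic; in the coordinate \<open>z = x + \<i> y\<close> one has
  \<open>\<omega> = (-2\<i> \<omega>\<^sub>1\<^sub>1) dx \<and> dy\<close>.\<close>

definition kaehler_form :: "'x chart set \<Rightarrow> 'x form \<Rightarrow> bool" where
  "kaehler_form A \<omega> \<longleftrightarrow> \<omega> \<in> forms A \<and> form_cnj \<omega> = \<omega> \<and>
     (\<forall>a b. (a, b) \<noteq> (1, 1) \<longrightarrow> \<omega> a b = 0) \<and>
     (\<forall>c\<in>A. \<forall>x\<in>fst c. Re (- 2 * \<i> * \<omega> 1 1 c x) > 0)"


section \<open>The complex \<open>K\<close>\<close>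

text \<open>An element of the total complex is a family of forms indexed by \<open>(i, j, k)\<close>.\<close>

type_synonym 'x kfam = "int \<times> int \<times> int \<Rightarrow> 'x form"

definition tpi :: complex where
  "tpi = 2 * of_real pi * \<i>"

definition K_ok :: "int \<Rightarrow> int \<Rightarrow> int \<Rightarrow> bool" where
  "K_ok i j k \<longleftrightarrow> even (1 + j - i) \<and> k \<ge> max 0 i"

definition K_type :: "int \<Rightarrow> int \<Rightarrow> int \<Rightarrow> nat \<Rightarrow> nat \<Rightarrow> bool" where
  "K_type i j k a b \<longleftrightarrow> int a + int b = j + 1 \<and> \<bar>int a - int b\<bar> \<le> 2 * k - i"

definition K3 :: "'x chart set \<Rightarrow> int \<Rightarrow> int \<Rightarrow> int \<Rightarrow> 'x form set" where
  "K3 A i j k = (if K_ok i j k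
     then {cscale (tpi powi ((1 + j - i) div 2)) \<eta> | \<eta>. \<eta> \<in> forms A \<and> form_cnj \<eta> = \<eta> \<and>
             (\<forall>a b. \<not> K_type i j k a b \<longrightarrow> \<eta> a b = 0)}
     else {0})"

definition Ktot :: "'x chart set \<Rightarrow> 'x kfam set" where
  "Ktot A = {x. finite {t. x t \<noteq> 0} \<and> (\<forall>i j k. x (i, j, k) \<in> K3 A i j k)}"

definition K2 :: "'x chart set \<Rightarrow> int \<Rightarrow> int \<Rightarrow> 'x kfam set" where
  "K2 A i j = {x \<in> Ktot A. \<forall>i' j' k. (i', j') \<noteq> (i, j) \<longrightarrow> x (i', j', k) = 0}"

text \<open>Orthogonal projection onto the forms of the types occurring in \<open>K3 A i j k\<close>: forms of distinct
  types are orthogonal.\<close>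

definition K_proj :: "int \<Rightarrow> int \<Rightarrow> int \<Rightarrow> 'x form \<Rightarrow> 'x form" where
  "K_proj i j k \<eta> = (\<lambda>a b. if K_ok i j k \<and> K_type i j k a b then \<eta> a b else 0)"

definition Kd :: "'x kfam \<Rightarrow> 'x kfam" where
  "Kd x = (\<lambda>(i, j, k).
     (del (x (i - 1, j - 1, k - 1)) + delbar (x (i - 1, j - 1, k - 1)))
     + K_proj i j k (cscale \<i> (delbar (x (i - 1, j - 1, k)) - del (x (i - 1, j - 1, k)))))"

text \<open>The projection makes \<open>N\<close> vanish where its target \<open>K3 A (i + 2) j (k + 1)\<close> is zero.\<close>

definition KN :: "'x kfam \<Rightarrow> 'x kfam" where
  "KN x = (\<lambda>(i, j, k). K_proj i j k (cscale (inverse tpi) (x (i - 2, j, k - 1))))"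

definition Kell :: "'x form \<Rightarrow> 'x kfam \<Rightarrow> 'x kfam" where
  "Kell \<omega> x = (\<lambda>(i, j, k). cscale tpi (wedge (x (i, j - 2, k)) \<omega>))"

definition eps :: "int \<Rightarrow> complex" where
  "eps m = (-1) powi (m * (m + 1) div 2)"

text \<open>The sum is real for \<open>x, y\<close> in \<open>Ktot A\<close>.\<close>

definition Kpsi :: "'x topology \<Rightarrow> 'x chart set \<Rightarrow> 'x kfam \<Rightarrow> 'x kfam \<Rightarrow> real" where
  "Kpsi X A x y = Re (\<Sum>(i, j, k) \<in> {(i, j, k). x (- i, - j, k) \<noteq> 0}.
     inverse tpi * eps (1 - j) * (-1) powi k *
       surface_integral X A (wedge (x (- i, - j, k)) (weil (y (i, j, k + i)))))"

definition cocycles :: "'x chart set \<Rightarrow> 'x kfam set" where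
  "cocycles A = {x \<in> Ktot A. Kd x = 0}"

definition cone_D :: "'x kfam \<times> 'x kfam \<Rightarrow> 'x kfam \<times> 'x kfam" where
  "cone_D = (\<lambda>(a, b). (- Kd a, KN a + Kd b))"

definition cone_cocycles :: "'x chart set \<Rightarrow> ('x kfam \<times> 'x kfam) set" where
  "cone_cocycles A = {z \<in> Ktot A \<times> Ktot A. cone_D z = 0}"


section \<open>Cohomology\<close>

text \<open>\<open>cls\<close> realizes the real vector space \<open>'v\<close> as the quotient of \<open>Z\<close> by its subspace \<open>B\<close>.\<close>

definition quotient_by :: "'k::real_vector set \<Rightarrow> 'k set \<Rightarrow> ('k \<Rightarrow> 'v::real_vector) \<Rightarrow> bool" where
  "quotient_by Z B cls \<longleftrightarrow>
     (\<forall>x\<in>Z. \<forall>y\<in>Z. cls (x + y) = cls x + cls y) \<and>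
     (\<forall>r. \<forall>x\<in>Z. cls (r *\<^sub>R x) = r *\<^sub>R cls x) \<and>
     cls ` Z = UNIV \<and> (\<forall>x\<in>Z. cls x = 0 \<longleftrightarrow> x \<in> B)"

definition cohomology :: "'x chart set \<Rightarrow> ('x kfam \<Rightarrow> 'v::real_vector) \<Rightarrow> bool" where
  "cohomology A cls \<longleftrightarrow> quotient_by (cocycles A) (Kd ` Ktot A) cls"

definition cone_cohomology ::
  "'x chart set \<Rightarrow> ('x kfam \<times> 'x kfam \<Rightarrow> 'u::real_vector) \<Rightarrow> bool" where
  "cone_cohomology A ccls \<longleftrightarrow>
     quotient_by (cone_cocycles A) (cone_D ` (Ktot A \<times> Ktot A)) ccls"

definition H2 :: "'x chart set \<Rightarrow> ('x kfam \<Rightarrow> 'v) \<Rightarrow> int \<Rightarrow> int \<Rightarrow> 'v set" where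
  "H2 A cls i j = cls ` (cocycles A \<inter> K2 A i j)"

text \<open>\<open>grX A ccls p q\<close> is the graded piece of weight \<open>2 p\<close> of \<open>H\<^sup>q(X*)\<close>.\<close>

definition grX :: "'x chart set \<Rightarrow> ('x kfam \<times> 'x kfam \<Rightarrow> 'u) \<Rightarrow> int \<Rightarrow> int \<Rightarrow> 'u set" where
  "grX A ccls p q = ccls ` (cone_cocycles A \<inter>
     (K2 A (q - 2 * p) (q - 1) \<times> K2 A (q - 2 * p + 1) (q - 2)))"

text \<open>In all uses below the value does not depend on the chosen representative.\<close>

definition induced :: "'k set \<Rightarrow> ('k \<Rightarrow> 'v) \<Rightarrow> ('k \<Rightarrow> 'w) \<Rightarrow> 'v \<Rightarrow> 'w" where
  "induced Z cls f v = f (inv_into Z cls v)"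

definition HN :: "'x chart set \<Rightarrow> ('x kfam \<Rightarrow> 'v) \<Rightarrow> 'v \<Rightarrow> 'v" where
  "HN A cls = induced (cocycles A) cls (\<lambda>x. cls (KN x))"

definition Hell :: "'x chart set \<Rightarrow> 'x form \<Rightarrow> ('x kfam \<Rightarrow> 'v) \<Rightarrow> 'v \<Rightarrow> 'v" where
  "Hell A \<omega> cls = induced (cocycles A) cls (\<lambda>x. cls (Kell \<omega> x))"

definition PhiTilde :: "'x chart set \<Rightarrow> ('x kfam \<Rightarrow> 'v) \<Rightarrow> 'v \<Rightarrow> 'v" where
  "PhiTilde A cls = induced (cocycles A) cls
     (\<lambda>x. cls (\<lambda>(i, j, k). (real_of_int (1 + j - i) / 2) *\<^sub>R x (i, j, k)))"


section \<open>Lefschetz representation and polarization\<close>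

definition inner_product_on :: "('v::real_vector \<Rightarrow> 'v \<Rightarrow> real) \<Rightarrow> bool" where
  "inner_product_on ip \<longleftrightarrow> (\<forall>x. linear (ip x)) \<and> (\<forall>x y. ip x y = ip y x) \<and>
     (\<forall>x. x \<noteq> 0 \<longrightarrow> ip x x > 0)"

definition matE :: "real^2^2" where
  "matE = vector [vector [0, 1], vector [0, 0]]"

definition matw :: "real^2^2" where
  "matw = vector [vector [0, 1], vector [-1, 0]]"

text \<open>Since \<open>E\<^sup>2 = 0\<close>, \<open>exp (t E) = 1 + t E\<close>.  The space carries no topology at this point; orbits of
  the one-parameter groups stay in finite-dimensional subspaces, so that their derivatives may be
  tested on linear functionals.\<close>

definition lefschetz_rep ::
  "(int \<Rightarrow> int \<Rightarrow> 'v::real_vector set) \<Rightarrow> ('v \<Rightarrow> 'v) \<Rightarrow> ('v \<Rightarrow> 'v) \<Rightarrow>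
   (real^2^2 \<Rightarrow> real^2^2 \<Rightarrow> 'v \<Rightarrow> 'v) \<Rightarrow> bool" where
  "lefschetz_rep H N l \<sigma> \<longleftrightarrow>
     (\<forall>g\<in>SL2. \<forall>h\<in>SL2. linear (\<sigma> g h)) \<and>
     \<sigma> (mat 1) (mat 1) = id \<and>
     (\<forall>g\<in>SL2. \<forall>h\<in>SL2. \<forall>g'\<in>SL2. \<forall>h'\<in>SL2. \<sigma> (g ** g') (h ** h') = \<sigma> g h \<circ> \<sigma> g' h') \<and>
     (\<forall>a b i j. a \<noteq> 0 \<and> b \<noteq> 0 \<longrightarrow>
        (\<forall>x\<in>H i j. \<sigma> (diag2 a (inverse a)) (diag2 b (inverse b)) x = (a powi i * b powi j) *\<^sub>R x)) \<and>
     (\<forall>x f. linear f \<longrightarrow>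
        ((\<lambda>t. f (\<sigma> (mat 1 + t *\<^sub>R matE) (mat 1) x)) has_real_derivative f (N x)) (at 0) \<and>
        ((\<lambda>t. f (\<sigma> (mat 1) (mat 1 + t *\<^sub>R matE) x)) has_real_derivative f (l x)) (at 0))"

definition polarization_ip ::
  "('v \<Rightarrow> 'v \<Rightarrow> real) \<Rightarrow> (real^2^2 \<Rightarrow> real^2^2 \<Rightarrow> 'v \<Rightarrow> 'v) \<Rightarrow> 'v \<Rightarrow> 'v \<Rightarrow> real" where
  "polarization_ip \<psi> \<sigma> x y = \<psi> x (\<sigma> matw matw y)"

text \<open>The polarized bigraded Lefschetz module structure on the cohomology of \<open>(K, d)\<close> to which
  \<open>(K, d, N, \<ell>, \<psi>)\<close> descends.\<close>

definition polarized_lefschetz_cohomology ::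
  "'x topology \<Rightarrow> 'x chart set \<Rightarrow> 'x form \<Rightarrow> ('x kfam \<Rightarrow> 'v::real_vector) \<Rightarrow>
   (real^2^2 \<Rightarrow> real^2^2 \<Rightarrow> 'v \<Rightarrow> 'v) \<Rightarrow> ('v \<Rightarrow> 'v \<Rightarrow> real) \<Rightarrow> bool" where
  "polarized_lefschetz_cohomology X A \<omega> cls \<sigma> \<psi> \<longleftrightarrow>
     cohomology A cls \<and>
     lefschetz_rep (H2 A cls) (HN A cls) (Hell A \<omega> cls) \<sigma> \<and>
     (\<forall>x\<in>cocycles A. \<forall>y\<in>cocycles A. \<psi> (cls x) (cls y) = Kpsi X A x y) \<and>
     inner_product_on (polarization_ip \<psi> \<sigma>)"


section \<open>Structures induced on the cohomology of the cone\<close>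

text \<open>The map \<open>[(a, b)] \<mapsto> [a]\<close> to \<open>ker N\<close> and the map \<open>[b] \<mapsto> [(0, b)]\<close> from \<open>coker N\<close>.\<close>

definition to_ker ::
  "'x chart set \<Rightarrow> ('x kfam \<Rightarrow> 'v) \<Rightarrow> ('x kfam \<times> 'x kfam \<Rightarrow> 'u) \<Rightarrow> 'u \<Rightarrow> 'v" where
  "to_ker A cls ccls = induced (cone_cocycles A) ccls (\<lambda>z. cls (fst z))"

definition from_coker ::
  "'x chart set \<Rightarrow> ('x kfam \<Rightarrow> 'v) \<Rightarrow> ('x kfam \<times> 'x kfam \<Rightarrow> 'u) \<Rightarrow> 'v \<Rightarrow> 'u" where
  "from_coker A cls ccls = induced (cocycles A) cls (\<lambda>b. ccls (0, b))"

text \<open>The sum of the pieces with \<open>q \<ge> 2 p\<close>, on which \<open>to_ker\<close> is an isomorphism onto \<open>ker N\<close>.\<close>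

definition ker_part ::
  "'x chart set \<Rightarrow> ('x kfam \<times> 'x kfam \<Rightarrow> 'u::real_vector) \<Rightarrow> 'u set" where
  "ker_part A ccls = span (\<Union>p q. if q \<ge> 2 * p then grX A ccls p q else {})"

text \<open>\<open>ker N\<close> has the restricted inner product, \<open>coker N\<close> that of the orthogonal complement of the
  image of \<open>N\<close>, and the two parts are orthogonal.\<close>

definition induced_ip ::
  "'x chart set \<Rightarrow> ('x kfam \<Rightarrow> 'v::real_vector) \<Rightarrow> ('x kfam \<times> 'x kfam \<Rightarrow> 'u::real_vector) \<Rightarrow>
   ('v \<Rightarrow> 'v \<Rightarrow> real) \<Rightarrow> ('u \<Rightarrow> 'u \<Rightarrow> real) \<Rightarrow> bool" where
  "induced_ip A cls ccls ip ipX \<longleftrightarrow>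
     (\<forall>u\<in>ker_part A ccls. \<forall>v\<in>ker_part A ccls.
        ipX u v = ip (to_ker A cls ccls u) (to_ker A cls ccls v)) \<and>
     (\<forall>x y. (\<forall>z. ip x (HN A cls z) = 0 \<and> ip y (HN A cls z) = 0) \<longrightarrow>
        ipX (from_coker A cls ccls x) (from_coker A cls ccls y) = ip x y) \<and>
     (\<forall>u\<in>ker_part A ccls. \<forall>x.
        ipX u (from_coker A cls ccls x) = 0 \<and> ipX (from_coker A cls ccls x) u = 0)"

text \<open>On the piece \<open>(p, q)\<close>, \<open>q \<ge> 2 p\<close>, which is \<open>ker N\<close> in degree \<open>(q - 2 p, q - 1)\<close>, \<open>\<delta>\<close> is the
  inverse of the isomorphism \<open>N\<^sup>q\<^sup>-\<^sup>2\<^sup>p\<close> from degree \<open>(2 p - q, q - 1)\<close>, followed by the passage to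
  \<open>coker N\<close>.  Its values on the other pieces are irrelevant.\<close>

definition duality_map ::
  "'x chart set \<Rightarrow> ('x kfam \<Rightarrow> 'v) \<Rightarrow> ('x kfam \<times> 'x kfam \<Rightarrow> 'u::real_vector) \<Rightarrow> ('u \<Rightarrow> 'u) \<Rightarrow> bool"
  where
  "duality_map A cls ccls \<delta> \<longleftrightarrow> linear \<delta> \<and>
     (\<forall>p q. \<forall>u\<in>grX A ccls p q. \<forall>y\<in>H2 A cls (2 * p - q) (q - 1).
        q \<ge> 2 * p \<and> (HN A cls ^^ nat (q - 2 * p)) y = to_ker A cls ccls u \<longrightarrow>
        \<delta> u = from_coker A cls ccls y)"

definition dirac_grading ::
  "'x chart set \<Rightarrow> ('x kfam \<times> 'x kfam \<Rightarrow> 'u::real_vector) \<Rightarrow> ('u \<Rightarrow> 'u) \<Rightarrow> bool" where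
  "dirac_grading A ccls \<Phi> \<longleftrightarrow> linear \<Phi> \<and>
     (\<forall>p q. \<forall>u\<in>grX A ccls p q.
        \<Phi> u = (if q \<ge> 2 * p then real_of_int p else real_of_int (p - 1)) *\<^sub>R u)"

text \<open>\<open>\<rho>X\<close> is \<open>\<rho>\<close> on the part \<open>ker N\<close> and \<open>\<delta> \<rho> \<delta>\<^sup>-\<^sup>1\<close> on the dual part.\<close>

definition induced_action ::
  "'x chart set \<Rightarrow> ('x kfam \<Rightarrow> 'v) \<Rightarrow> ('x kfam \<times> 'x kfam \<Rightarrow> 'u::real_vector) \<Rightarrow> ('u \<Rightarrow> 'u) \<Rightarrow>
   'm set \<Rightarrow> ('m \<Rightarrow> 'v \<Rightarrow> 'v) \<Rightarrow> ('m \<Rightarrow> 'u \<Rightarrow> 'u) \<Rightarrow> bool" where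
  "induced_action A cls ccls \<delta> G \<rho> \<rho>X \<longleftrightarrow> (\<forall>\<gamma>\<in>G. linear (\<rho>X \<gamma>) \<and>
     (\<forall>u\<in>ker_part A ccls. \<rho>X \<gamma> u \<in> ker_part A ccls \<and>
        to_ker A cls ccls (\<rho>X \<gamma> u) = \<rho> \<gamma> (to_ker A cls ccls u) \<and>
        \<rho>X \<gamma> (\<delta> u) = \<delta> (\<rho>X \<gamma> u)))"


section \<open>Hilbert completions and unbounded operators\<close>

definition hilbert_completion ::
  "('v::real_vector \<Rightarrow> 'v \<Rightarrow> real) \<Rightarrow> ('v \<Rightarrow> 'h::{real_inner, complete_space}) \<Rightarrow> bool" where
  "hilbert_completion ip \<iota> \<longleftrightarrow>
     linear \<iota> \<and> (\<forall>x y. \<iota> x \<bullet> \<iota> y = ip x y) \<and> closure (range \<iota>) = UNIV"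

definition bounded_action ::
  "(complex^2^2) set \<Rightarrow> (complex^2^2 \<Rightarrow> 'v \<Rightarrow> 'v) \<Rightarrow> ('v \<Rightarrow> 'h::real_inner) \<Rightarrow>
   (complex^2^2 \<Rightarrow> 'h \<Rightarrow> 'h) \<Rightarrow> bool" where
  "bounded_action G \<rho> \<iota> R \<longleftrightarrow>
     (\<forall>\<gamma>\<in>G. bounded_linear (R \<gamma>) \<and> (\<forall>x. R \<gamma> (\<iota> x) = \<iota> (\<rho> \<gamma> x))) \<and>
     R (mat 1) = id \<and> (\<forall>\<gamma>\<in>G. \<forall>\<gamma>'\<in>G. R (\<gamma> ** \<gamma>') = R \<gamma> \<circ> R \<gamma>')"

text \<open>Elements of the real group ring are finitely supported functions; \<open>group_ring_image G R\<close> is the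
  image of the group ring under the linear extension of \<open>R\<close>.\<close>

definition group_ring :: "'m set \<Rightarrow> ('m \<Rightarrow> real) set" where
  "group_ring G = {f. finite {\<gamma>. f \<gamma> \<noteq> 0} \<and> {\<gamma>. f \<gamma> \<noteq> 0} \<subseteq> G}"

definition group_ring_image :: "'m set \<Rightarrow> ('m \<Rightarrow> 'h::real_vector \<Rightarrow> 'h) \<Rightarrow> ('h \<Rightarrow> 'h) set" where
  "group_ring_image G R =
     (\<lambda>f. \<lambda>x. \<Sum>\<gamma> \<in> {\<gamma>. f \<gamma> \<noteq> 0}. f \<gamma> *\<^sub>R R \<gamma> x) ` group_ring G"

text \<open>An unbounded operator is given by its graph; \<open>op_closure \<iota> \<Phi>\<close> is the closure of \<open>\<Phi>\<close>, seen as an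
  operator with domain \<open>range \<iota>\<close>.\<close>

definition op_closure :: "('v \<Rightarrow> 'h::real_inner) \<Rightarrow> ('v \<Rightarrow> 'v) \<Rightarrow> ('h \<times> 'h) set" where
  "op_closure \<iota> \<Phi> = closure (range (\<lambda>x. (\<iota> x, \<iota> (\<Phi> x))))"

definition self_adjoint_op :: "('h::real_inner \<times> 'h) set \<Rightarrow> bool" where
  "self_adjoint_op T \<longleftrightarrow> closure (Domain T) = UNIV \<and>
     T = {(y, z). \<forall>(x, w)\<in>T. w \<bullet> y = x \<bullet> z}"

text \<open>The graph of \<open>T - \<zeta>\<close> on the complexification, with \<open>(x, y)\<close> standing for \<open>x + \<i> y\<close>.\<close>

definition complex_shift :: "('h::real_inner \<times> 'h) set \<Rightarrow> complex \<Rightarrow> (('h \<times> 'h) \<times> ('h \<times> 'h)) set" where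
  "complex_shift T \<zeta> = {((x, y), (x' - Re \<zeta> *\<^sub>R x + Im \<zeta> *\<^sub>R y, y' - Re \<zeta> *\<^sub>R y - Im \<zeta> *\<^sub>R x)) |
     x y x' y'. (x, x') \<in> T \<and> (y, y') \<in> T}"

definition compact_op :: "('h::real_normed_vector \<Rightarrow> 'k::real_normed_vector) \<Rightarrow> bool" where
  "compact_op R \<longleftrightarrow> bounded_linear R \<and> compact (closure (R ` cball 0 1))"

definition compact_resolvent :: "('h::real_inner \<times> 'h) set \<Rightarrow> bool" where
  "compact_resolvent T \<longleftrightarrow>
     (\<forall>\<zeta>. \<zeta> \<notin> \<real> \<longrightarrow> (\<exists>R. compact_op R \<and> complex_shift T \<zeta> = range (\<lambda>v. (R v, v))))"

definition op_kernel :: "('h::real_inner \<times> 'h) set \<Rightarrow> 'h set" where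
  "op_kernel T = {x. (x, 0) \<in> T}"

text \<open>\<open>P\<close> is \<open>|T|\<^sup>-\<^sup>1\<close> on the complement of the zero modes, i.e. the positive square root of the inverse
  of \<open>T\<^sup>2\<close> there, extended by \<open>0\<close> to the zero modes.\<close>

definition abs_inverse :: "('h::real_inner \<times> 'h) set \<Rightarrow> ('h \<Rightarrow> 'h) \<Rightarrow> bool" where
  "abs_inverse T P \<longleftrightarrow> bounded_linear P \<and> (\<forall>x y. P x \<bullet> y = x \<bullet> P y) \<and> (\<forall>x. x \<bullet> P x \<ge> 0) \<and>
     (\<forall>x\<in>op_kernel T. P x = 0) \<and>
     (\<forall>x\<in>(op_kernel T)\<^sup>\<bottom>. \<exists>y. (P (P x), y) \<in> T \<and> (y, x) \<in> T)"

text \<open>The eigenvalues \<open>\<lambda>\<^sub>k\<close> of \<open>|T|\<^sup>-\<^sup>1\<close> on the complement of the zero modes are listed with multiplicity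
  and in decreasing order; the index set \<open>I\<close> is finite if that complement is finite-dimensional.\<close>

definition one_summable :: "('h::real_inner \<times> 'h) set \<Rightarrow> bool" where
  "one_summable T \<longleftrightarrow> (\<exists>P I e ev. abs_inverse T P \<and>
     (I = UNIV \<or> (\<exists>n. I = {..<n::nat})) \<and>
     (\<forall>k\<in>I. \<forall>l\<in>I. e k \<bullet> e l = (if k = l then 1 else 0)) \<and>
     closure (span (e ` I)) = (op_kernel T)\<^sup>\<bottom> \<and>
     (\<forall>k\<in>I. P (e k) = ev k *\<^sub>R e k) \<and>
     (\<forall>k\<in>I. \<forall>l\<in>I. k \<le> l \<longrightarrow> ev l \<le> ev k) \<and>
     (\<exists>C. \<forall>k\<in>I. ev k \<le> C / real (Suc k)))"

text \<open>\<open>a\<close> preserves the domain of \<open>T\<close>, and \<open>T a - a T\<close> extends to a bounded operator \<open>B\<close>.\<close>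

definition bounded_commutator :: "('h::real_inner \<times> 'h) set \<Rightarrow> ('h \<Rightarrow> 'h) \<Rightarrow> bool" where
  "bounded_commutator T a \<longleftrightarrow> bounded_linear a \<and>
     (\<exists>B. bounded_linear B \<and> (\<forall>(x, w)\<in>T. (a x, a w + B x) \<in> T))"

end

theory Submission
  imports Defs
begin

text \<open>By the Bruhat decomposition, \<open>SL(2,\<real>)\<close> is generated by diagonal matrices, the Weyl element \<open>w\<close> and
  the unipotents \<open>1 + t E\<close>.  On a surface the second degree \<open>j\<close> takes only the values \<open>-1, 0, 1\<close>, so
  \<open>\<ell>\<^sup>2 = 0\<close> and \<open>\<ell>\<close> agrees with \<open>\<sigma>(1, w)\<close>, an isometry, where it does not vanish.  Hence \<open>\<sigma>(1, g)\<close> is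
  bounded.  It commutes with the first factor, and the eigenvalue \<open>(1 + j - i) / 2\<close> differs from \<open>- i / 2\<close>
  by a bounded term, whence the bounded commutators.

  Every element is the sum of an element of the image of \<open>N\<close> and of an element orthogonal to it, because
  the orbits of the first factor span finite-dimensional spaces.  So the cohomology of the cone is the
  sum of \<open>ker N\<close>, in degrees \<open>i \<ge> 0\<close>, and of the orthogonal complement of \<open>im N\<close>, in degrees \<open>i \<le> 0\<close>.
  Both are invariant under \<open>\<sigma>(1, g)\<close>; \<open>\<sigma>(w, 1)\<close> exchanges them and equals \<open>\<delta>\<close> up to a factor that depends
  only on \<open>i\<close>.

  The operator \<open>\<Phi>\<close> is diagonal with integral eigenvalues, so all its properties follow from a bound
  on the multiplicities.  A class in \<open>ker N\<close> is represented by a closed real function or \<open>1\<close>-form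
  up to a power of \<open>2\<pi>\<i>\<close>, and an exact form has class \<open>0\<close>.  So it suffices that the first
  de Rham cohomology is finite-dimensional, and this follows by gluing local primitives on finitely
  many coordinate balls.\<close>

section \<open>Graded representations of \<open>SL(2,\<real>)\<close>\<close>

text \<open>The cohomology carries no topology, and the one-parameter groups are known only through
  weak derivatives at \<open>0\<close>. That \<open>1 + t E\<close> acts as \<open>exp (t N)\<close>
  rests on homogeneity: conjugation by diagonal matrices rescales \<open>t\<close>, so each weight
  component of an orbit is a monomial in \<open>t\<close>, and finiteness of supports then makes
  \<open>N\<close> nilpotent on each homogeneous vector. The two factors behave differently. The
  weights \<open>j\<close> of the second one are at most \<open>1\<close> in absolute value, while
  no bound on the weights \<open>i\<close> of the first one is available, so boundedness is claimed
  for the second factor only. The inner product space need not be complete, and a projection onto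
  the image of \<open>N\<close> has to be found inside a finite-dimensional invariant subspace.
  Summability requires a bound on the multiplicities that is uniform in the eigenvalue. It exists
  because, up to a power of \<open>tpi\<close>, the classes in degrees \<open>(i, j)\<close> with
  \<open>j\<close> fixed come from the same closed real forms for every \<open>i\<close>.\<close>

text \<open>Derivatives of orbits are available only after composition with a linear functional, so
  points and subspaces have to be separated by functionals. A basis of \<open>M\<close> stays
  independent when \<open>y\<close> is added, and values on an independent set can be
  prescribed.\<close>

lemma exists_separating_functional:
  fixes y :: "'v::real_vector"
  assumes "subspace M" "y \<notin> M"
  obtains f :: "'v \<Rightarrow> real" where "linear f" "\<And>m. m \<in> M \<Longrightarrow> f m = 0" "f y = 1"
proof -
  obtain B where B: "B \<subseteq> M" "independent B" "span B = M"
    using basis_exists[of M] assms(1) by (metis span_subspace)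
  have ind: "independent (insert y B)"
    using B assms(2) by (simp add: independent_insert)
  obtain f where f: "linear f" "\<forall>x\<in>insert y B. f x = (if x = y then 1 else (0::real))"
    using linear_independent_extend[OF ind, of "\<lambda>x. if x = y then 1 else 0"] by blast
  have "f m = 0" if "m \<in> M" for m
  proof -
    have "m \<in> span B" using that B by simp
    then show ?thesis
    proof (rule linear_eq_0_on_span[OF f(1), rotated])
      show "f b = 0" if "b \<in> B" for b using that f(2) B assms(2) by auto
    qed
  qed
  then show ?thesis using that f by auto
qed

lemma eq_if_functionals_eq:
  fixes x y :: "'v::real_vector"
  assumes "\<And>f. linear f \<Longrightarrow> f x = (f y :: real)"
  shows "x = y"
proof (rule ccontr)
  assume "x \<noteq> y"
  then have "x - y \<notin> {0}" by simp
  then obtain f :: "'v \<Rightarrow> real" where "linear f" "f (x - y) = 1"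
    by (rule exists_separating_functional[OF subspace_single_0]) blast
  then show False using assms[of f] by (simp add: linear_diff)
qed

lemma scaleR_eq_imp_div:
  fixes x y :: "'v::real_vector"
  shows "a \<noteq> 0 \<Longrightarrow> b *\<^sub>R y = a *\<^sub>R x \<Longrightarrow> x = (b / a) *\<^sub>R y"
  by (metis divide_inverse mult.commute right_inverse scaleR_one scaleR_scaleR)

section \<open>Generators of \<open>SL(2,\<real>)\<close>\<close>

definition upper_unipotent :: "real \<Rightarrow> real^2^2" where
  "upper_unipotent t = mat 1 + t *\<^sub>R matE"

lemmas mat2_defs = vec_eq_iff matrix_matrix_mult_def forall_2 sum_2 mat_def matE_def matw_def
  diag2_def vector_2 upper_unipotent_def

text \<open>Since \<open>- matw\<close> is the inverse of \<open>matw\<close>, the bracket in the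
  last identity is the conjugate of \<open>upper_unipotent 1\<close> by \<open>matw\<close>, a lower
  unipotent matrix. The identity contains \<open>matw\<close> on both sides; comparing weights in it
  is what later ties \<open>matw\<close> to \<open>N\<close>.\<close>

lemma upper_unipotent_0: "upper_unipotent 0 = mat 1"
  and upper_unipotent_add: "upper_unipotent (s + t) = upper_unipotent s ** upper_unipotent t"
  and diag2_upper_unipotent:
    "a \<noteq> 0 \<Longrightarrow> diag2 a (inverse a) ** upper_unipotent t = upper_unipotent (a\<^sup>2 * t) ** diag2 a (inverse a)"
  and matw_square: "matw ** matw = diag2 (-1) (-1)"
  and diag2_matw: "diag2 a (inverse a) ** matw = matw ** diag2 (inverse a) (inverse (inverse a))"
  and matw_factorization:
    "matw = upper_unipotent 1 ** (matw ** upper_unipotent 1 ** diag2 (-1) (-1) ** matw) ** upper_unipotent 1"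
  by (auto simp: mat2_defs power2_eq_square algebra_simps)

lemma SL2_upper_unipotent: "upper_unipotent t \<in> SL2"
  and SL2_diag2: "a \<noteq> 0 \<Longrightarrow> diag2 a (inverse a) \<in> (SL2 :: (real^2^2) set)"
  and SL2_matw: "matw \<in> SL2"
  and SL2_mat_1: "mat 1 \<in> (SL2 :: (real^2^2) set)"
  by (auto simp: SL2_def det_2 mat2_defs)

lemma SL2_mult: "g \<in> SL2 \<Longrightarrow> h \<in> SL2 \<Longrightarrow> g ** h \<in> (SL2 :: (real^2^2) set)"
  by (auto simp: SL2_def det_mul)

lemma SL2_diag2_minus_one: "diag2 (-1) (-1) \<in> (SL2 :: (real^2^2) set)"
  using SL2_diag2[of "-1"] by simp

text \<open>The Borel subgroup is \<open>g$2$1 = 0\<close>. In the other cell, with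
  \<open>c = g$2$1\<close>, comparison of entries forces \<open>a = - 1 / c\<close>,
  \<open>s = g$1$1 / c\<close> and \<open>t = g$2$2 / c\<close>; the entry \<open>g$1$2\<close> then
  agrees because the determinant is \<open>1\<close>.\<close>

lemma SL2_bruhat_cases:
  fixes g :: "real^2^2"
  assumes "g \<in> SL2"
  obtains a t where "a \<noteq> 0" "g = diag2 a (inverse a) ** upper_unipotent t"
  | s a t where "a \<noteq> 0"
      "g = upper_unipotent s ** (diag2 a (inverse a) ** (matw ** upper_unipotent t))"
proof (cases "g$2$1 = 0")
  case True
  have d: "g$1$1 * g$2$2 = 1" using assms True by (simp add: SL2_def det_2)
  then have "g$1$1 \<noteq> 0" by auto
  moreover have "g = diag2 (g$1$1) (inverse (g$1$1)) ** upper_unipotent (g$1$2 / g$1$1)"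
    using d True calculation by (auto simp: mat2_defs field_simps)
  ultimately show ?thesis by (rule that(1))
next
  case False
  define c where "c = g$2$1"
  have c: "c \<noteq> 0" using False by (simp add: c_def)
  have d: "g$1$1 * g$2$2 - g$1$2 * c = 1" using assms by (simp add: SL2_def det_2 c_def)
  have "g = upper_unipotent (g$1$1 / c) **
      (diag2 (- inverse c) (inverse (- inverse c)) ** (matw ** upper_unipotent (g$2$2 / c)))"
    using c d by (auto simp: mat2_defs field_simps c_def[symmetric])
  then show ?thesis by (rule that(2)[rotated]) (simp add: c)
qed

section \<open>Algebraic gradings and diagonal operators\<close>

text \<open>A direct sum decomposition given by its projections. The index type is left open, since
  the same theory serves the bidegrees, each of the two weights alone, and the eigenvalues of the
  Dirac operator.\<close>

locale grading =
  fixes pr :: "'i \<Rightarrow> 'v::real_vector \<Rightarrow> 'v"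
  assumes linear_pr: "linear (pr i)"
    and pr_pr: "pr i (pr j x) = (if i = j then pr i x else 0)"
    and finite_pr: "finite {i. pr i x \<noteq> 0}"
    and sum_pr: "(\<Sum>i | pr i x \<noteq> 0. pr i x) = x"
begin

lemma pr_eq: "pr i x = x \<Longrightarrow> i \<noteq> j \<Longrightarrow> pr j x = 0"
  by (metis pr_pr)

lemma sum_pr_superset: "finite I \<Longrightarrow> {i. pr i x \<noteq> 0} \<subseteq> I \<Longrightarrow> (\<Sum>i\<in>I. pr i x) = x"
  by (subst (2) sum_pr[of x, symmetric]) (rule sum.mono_neutral_right, auto)

lemma pr_eqI:
  assumes "\<And>i. pr i x = pr i y" shows "x = y"
proof -
  have "(\<Sum>i | pr i x \<noteq> 0. pr i x) = (\<Sum>i | pr i y \<noteq> 0. pr i y)" by (simp only: assms)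
  then show ?thesis by (simp only: sum_pr)
qed

lemma pr_0: "pr i 0 = 0"
  by (rule linear_0[OF linear_pr])

lemma pr_all_zero: "(\<And>i. pr i x = 0) \<Longrightarrow> x = 0"
  by (rule pr_eqI) (simp add: pr_0)

lemma pr_sum: "pr j (\<Sum>i\<in>I. f i) = (\<Sum>i\<in>I. pr j (f i))"
  by (rule linear_sum[OF linear_pr])

lemma linear_eq_on_pr:
  assumes "linear f" "linear g" "\<And>i. f (pr i x) = g (pr i x)"
  shows "f x = g x"
proof -
  have "f (\<Sum>i | pr i x \<noteq> 0. pr i x) = g (\<Sum>i | pr i x \<noteq> 0. pr i x)"
    by (simp only: linear_sum[OF assms(1)] linear_sum[OF assms(2)] assms(3))
  then show ?thesis by (simp only: sum_pr)
qed

text \<open>The diagonal operator with eigenvalue \<open>c i\<close> in degree \<open>i\<close>.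
  Finite supports make it total even for unbounded \<open>c\<close>, so the Dirac operator itself is
  of this kind.\<close>

definition dmap :: "('i \<Rightarrow> real) \<Rightarrow> 'v \<Rightarrow> 'v" where
  "dmap c x = (\<Sum>i | pr i x \<noteq> 0. c i *\<^sub>R pr i x)"

lemma dmap_superset:
  "finite I \<Longrightarrow> {i. pr i x \<noteq> 0} \<subseteq> I \<Longrightarrow> dmap c x = (\<Sum>i\<in>I. c i *\<^sub>R pr i x)"
  unfolding dmap_def by (rule sum.mono_neutral_left) auto

lemma pr_dmap: "pr i (dmap c x) = c i *\<^sub>R pr i x"
proof -
  let ?I = "insert i {i. pr i x \<noteq> 0}"
  have fin: "finite ?I" by (simp add: finite_pr)
  have "dmap c x = (\<Sum>k\<in>?I. c k *\<^sub>R pr k x)" by (rule dmap_superset[OF fin]) auto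
  then have "pr i (dmap c x) = (\<Sum>k\<in>?I. c k *\<^sub>R pr i (pr k x))"
    by (simp only: pr_sum linear_scale[OF linear_pr])
  also have "\<dots> = (\<Sum>k\<in>?I. if i = k then c i *\<^sub>R pr i x else 0)"
    by (intro sum.cong) (auto simp: pr_pr)
  also have "\<dots> = c i *\<^sub>R pr i x"
    using fin by (simp add: sum.delta')
  finally show ?thesis .
qed

lemma linear_dmap: "linear (dmap c)"
  by (rule linearI; rule pr_eqI)
    (simp_all add: pr_dmap linear_add[OF linear_pr] linear_scale[OF linear_pr] scaleR_add_right)

lemma dmap_homogeneous: "pr i x = x \<Longrightarrow> dmap c x = c i *\<^sub>R x"
  by (rule pr_eqI) (metis pr_dmap pr_pr linear_scale[OF linear_pr] scaleR_zero_right)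

lemma dmap_pr: "dmap c (pr i x) = c i *\<^sub>R pr i x"
  by (rule dmap_homogeneous) (simp add: pr_pr)

lemma dmap_eqI:
  assumes "linear f" "\<And>i x. pr i x = x \<Longrightarrow> f x = c i *\<^sub>R x"
  shows "f x = dmap c x"
  by (rule linear_eq_on_pr[OF assms(1) linear_dmap]) (simp add: assms(2) dmap_pr pr_pr)

lemma dmap_dmap: "dmap c (dmap c' x) = dmap (\<lambda>i. c i * c' i) x"
  by (rule pr_eqI) (simp add: pr_dmap)

lemma dmap_cong: "(\<And>i. pr i x \<noteq> 0 \<Longrightarrow> c i = c' i) \<Longrightarrow> dmap c x = dmap c' x"
  unfolding dmap_def by (rule sum.cong) auto

text \<open>With \<open>fst\<close> and \<open>snd\<close> this isolates the weights of the two
  factors; with the eigenvalue as function it produces the spectral decomposition of the Dirac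
  operator.\<close>

definition coarsen :: "('i \<Rightarrow> 'k) \<Rightarrow> 'k \<Rightarrow> 'v \<Rightarrow> 'v" where
  "coarsen f k = dmap (\<lambda>i. if f i = k then 1 else 0)"

lemma pr_coarsen: "pr i (coarsen f k x) = (if f i = k then pr i x else 0)"
  by (simp add: coarsen_def pr_dmap)

lemma coarsen_pr: "coarsen f k (pr i x) = (if f i = k then pr i x else 0)"
  by (simp add: coarsen_def dmap_pr)

lemma coarsen_grading: "grading (coarsen f)"
proof (rule grading.intro)
  show "linear (coarsen f k)" for k unfolding coarsen_def by (rule linear_dmap)
  show "coarsen f k (coarsen f k' x) = (if k = k' then coarsen f k x else 0)" for k k' x
    by (rule pr_eqI) (simp add: pr_coarsen pr_0)
  have sub: "{k. coarsen f k x \<noteq> 0} \<subseteq> f ` {i. pr i x \<noteq> 0}" for x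
  proof
    fix k assume "k \<in> {k. coarsen f k x \<noteq> 0}"
    then obtain i where "pr i (coarsen f k x) \<noteq> 0" using pr_all_zero by blast
    then show "k \<in> f ` {i. pr i x \<noteq> 0}" by (auto simp: pr_coarsen split: if_splits)
  qed
  show fin: "finite {k. coarsen f k x \<noteq> 0}" for x
    by (rule finite_subset[OF sub]) (simp add: finite_pr)
  show "(\<Sum>k | coarsen f k x \<noteq> 0. coarsen f k x) = x" for x
  proof (rule pr_eqI)
    fix i
    have "f i \<in> {k. coarsen f k x \<noteq> 0}" if "pr i x \<noteq> 0"
    proof -
      have "pr i (coarsen f (f i) x) \<noteq> 0" using that by (simp add: pr_coarsen)
      then show ?thesis using pr_0 by auto
    qed
    then show "pr i (\<Sum>k | coarsen f k x \<noteq> 0. coarsen f k x) = pr i x"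
      using fin[of x] by (simp add: pr_sum pr_coarsen) blast
  qed
qed

end

section \<open>Weights and the exponential of \<open>N\<close>\<close>

text \<open>One factor of \<open>\<sigma>\<close> at a time. Besides the group law, only the action
  of diagonal matrices and a weak derivative at \<open>0\<close> are given; linearity of
  \<open>N\<close>, its nilpotency on homogeneous vectors and the exponential formula are
  consequences.\<close>

locale graded_SL2_rep = grading pr
  for pr :: "int \<Rightarrow> 'v::real_vector \<Rightarrow> 'v" +
  fixes \<tau> :: "real^2^2 \<Rightarrow> 'v \<Rightarrow> 'v" and N :: "'v \<Rightarrow> 'v"
  assumes linear_\<tau>: "g \<in> SL2 \<Longrightarrow> linear (\<tau> g)"
    and \<tau>_1: "\<tau> (mat 1) = id"
    and \<tau>_mult: "g \<in> SL2 \<Longrightarrow> h \<in> SL2 \<Longrightarrow> \<tau> (g ** h) = \<tau> g \<circ> \<tau> h"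
    and \<tau>_diag2: "a \<noteq> 0 \<Longrightarrow> \<tau> (diag2 a (inverse a)) (pr i x) = (a powi i) *\<^sub>R pr i x"
    and weak_derivative: "linear f \<Longrightarrow>
      ((\<lambda>t. f (\<tau> (mat 1 + t *\<^sub>R matE) x)) has_real_derivative f (N x)) (at 0)"
begin

definition u :: "real \<Rightarrow> 'v \<Rightarrow> 'v" where "u t = \<tau> (upper_unipotent t)"
definition w :: "'v \<Rightarrow> 'v" where "w = \<tau> matw"
definition dg :: "real \<Rightarrow> 'v \<Rightarrow> 'v" where "dg a = \<tau> (diag2 a (inverse a))"

lemma linear_u: "linear (u t)" and linear_w: "linear w" and linear_dg: "a \<noteq> 0 \<Longrightarrow> linear (dg a)"
  by (auto simp: u_def w_def dg_def linear_\<tau> SL2_upper_unipotent SL2_matw SL2_diag2)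

lemma dg_pr: "a \<noteq> 0 \<Longrightarrow> dg a (pr i x) = (a powi i) *\<^sub>R pr i x"
  by (simp add: dg_def \<tau>_diag2)

lemma dg_eq_dmap: "a \<noteq> 0 \<Longrightarrow> dg a x = dmap (\<lambda>i. a powi i) x"
  by (rule dmap_eqI[OF linear_dg]) (simp, metis dg_pr)

lemma pr_\<tau>_diag2: "a \<noteq> 0 \<Longrightarrow> pr i (dg a x) = (a powi i) *\<^sub>R pr i x"
  by (simp add: dg_eq_dmap pr_dmap)

text \<open>A single diagonal matrix detects the weight, because distinct integral powers of
  \<open>2\<close> are distinct.\<close>

lemma weight_vectorI:
  assumes "dg 2 x = (2 powi i) *\<^sub>R x"
  shows "pr i x = x"
proof (rule pr_eqI)
  fix j
  have "(2 powi j) *\<^sub>R pr j x = (2 powi i :: real) *\<^sub>R pr j x"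
    using pr_\<tau>_diag2[of 2 j x] by (simp only: assms linear_scale[OF linear_pr])
  then have "pr j x = 0 \<or> (2 powi j :: real) = 2 powi i"
    by (metis scaleR_cancel_right)
  then have "pr j x = 0 \<or> i = j"
    by (metis power_int_strict_increasing one_less_numeral_iff semiring_norm(76) less_irrefl linorder_less_linear)
  then show "pr j (pr i x) = pr j x" by (auto simp: pr_pr)
qed

lemma \<tau>_diag2_weight: "a \<noteq> 0 \<Longrightarrow> pr i x = x \<Longrightarrow> dg a x = (a powi i) *\<^sub>R x"
  using dg_pr[of a i x] by simp

lemma u_add: "u (s + t) x = u s (u t x)"
  by (simp add: u_def upper_unipotent_add \<tau>_mult SL2_upper_unipotent)

lemma u_0: "u 0 x = x"
  by (simp add: u_def upper_unipotent_0 \<tau>_1)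

lemma u_minus: "u (- t) (u t x) = x" "u t (u (- t) x) = x"
  using u_add[of "-t" t x] u_add[of t "-t" x] by (simp_all add: u_0)

lemma w_weight: "pr i x = x \<Longrightarrow> pr (- i) (w x) = w x"
proof (rule weight_vectorI)
  assume x: "pr i x = x"
  have "dg 2 (w x) = w (dg (inverse 2) x)"
    using fun_cong[OF \<tau>_mult[of "diag2 2 (inverse 2)" matw], of x]
      fun_cong[OF \<tau>_mult[of matw "diag2 (inverse 2) (inverse (inverse 2))"], of x]
      SL2_diag2[of 2] SL2_diag2[of "inverse 2"] SL2_matw diag2_matw[of 2]
    by (simp add: w_def dg_def)
  also have "\<dots> = (2 powi (- i)) *\<^sub>R w x"
    by (subst \<tau>_diag2_weight[OF _ x])
      (simp_all only: linear_scale[OF linear_w] power_int_minus power_int_inverse, simp)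
  finally show "dg 2 (w x) = (2 powi (- i)) *\<^sub>R w x" .
qed

lemma pr_w: "pr i (w x) = w (pr (- i) x)"
proof -
  have "w x = (\<Sum>k | pr k x \<noteq> 0. w (pr k x))"
    by (subst sum_pr[of x, symmetric]) (simp add: linear_sum[OF linear_w])
  then have "pr i (w x) = (\<Sum>k | pr k x \<noteq> 0. pr i (w (pr k x)))"
    by (simp only: pr_sum)
  also have "\<dots> = (\<Sum>k | pr k x \<noteq> 0. if k = - i then w (pr (- i) x) else 0)"
  proof (intro sum.cong refl)
    fix k
    have "pr (- k) (w (pr k x)) = w (pr k x)" by (rule w_weight) (simp add: pr_pr)
    then show "pr i (w (pr k x)) = (if k = - i then w (pr (- i) x) else 0)"
      using pr_eq[of "- k" "w (pr k x)" i] by auto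
  qed
  also have "\<dots> = w (pr (- i) x)"
    using linear_0[OF linear_w] by (auto simp: finite_pr)
  finally show ?thesis .
qed

lemma w_w: "w (w x) = dg (-1) x"
  using fun_cong[OF \<tau>_mult[OF SL2_matw SL2_matw], of x] by (simp add: w_def dg_def matw_square)

lemma w_w_weight: "pr i x = x \<Longrightarrow> w (w x) = ((-1) powi i) *\<^sub>R x"
  using \<tau>_diag2_weight[of "-1" i x] by (simp add: w_w)

lemma pr_w_w: "pr i (w (w x)) = ((-1) powi i) *\<^sub>R pr i x"
  using pr_\<tau>_diag2[of "-1" i x] by (simp add: w_w)

lemma w_w_w_w: "w (w (w (w x))) = x"
  by (rule pr_eqI) (simp add: pr_w_w power_int_minus_left)

lemma w_w_commute:
  assumes "g \<in> SL2" shows "\<tau> g (w (w x)) = w (w (\<tau> g x))"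
proof -
  have "g ** diag2 (-1) (-1) = diag2 (-1) (-1) ** g" by (auto simp: mat2_defs)
  then show ?thesis
    using fun_cong[OF \<tau>_mult[OF assms SL2_diag2_minus_one], of x]
      fun_cong[OF \<tau>_mult[OF SL2_diag2_minus_one assms], of x] by (simp add: w_w dg_def)
qed

text \<open>The group law moves the derivative from \<open>0\<close> to \<open>t\<close>:
  \<open>f \<circ> u t\<close> is again a linear functional.\<close>

lemma u_derivative:
  assumes "linear f"
  shows "((\<lambda>s. f (u s x)) has_real_derivative f (u t (N x))) (at t)"
proof -
  have "linear (f \<circ> u t)" using assms linear_u by (intro linear_compose)
  from weak_derivative[OF this, of x]
  have "((\<lambda>s. f (u t (u s x))) has_real_derivative f (u t (N x))) (at 0)"
    by (simp add: u_def upper_unipotent_def)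
  then have "((\<lambda>s. f (u (t + s) x)) has_real_derivative f (u t (N x))) (at 0)"
    by (simp add: u_add)
  then show ?thesis
    using DERIV_shift[of "\<lambda>s. f (u s x)" "f (u t (N x))" 0 t] by (simp add: add.commute)
qed

lemma N_eqI:
  assumes "\<And>f. linear f \<Longrightarrow> ((\<lambda>t. f (u t x)) has_real_derivative f y) (at 0)"
  shows "N x = y"
proof (rule eq_if_functionals_eq)
  fix f :: "'v \<Rightarrow> real" assume "linear f"
  then show "f (N x) = f y"
    using assms u_derivative[of f x 0] DERIV_unique by (fastforce simp: u_0)
qed

lemma linear_N: "linear N"
proof (rule linearI)
  show "N (x + y) = N x + N y" for x y
  proof (rule N_eqI)
    fix f :: "'v \<Rightarrow> real" assume f: "linear f"
    show "((\<lambda>t. f (u t (x + y))) has_real_derivative f (N x + N y)) (at 0)"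
      using DERIV_add[OF u_derivative[OF f, of x 0] u_derivative[OF f, of y 0]]
      by (simp add: linear_add[OF f] linear_add[OF linear_u] u_0)
  qed
  show "N (r *\<^sub>R x) = r *\<^sub>R N x" for r x
  proof (rule N_eqI)
    fix f :: "'v \<Rightarrow> real" assume f: "linear f"
    show "((\<lambda>t. f (u t (r *\<^sub>R x))) has_real_derivative f (r *\<^sub>R N x)) (at 0)"
      using DERIV_cmult[OF u_derivative[OF f, of x 0], of r]
      by (simp add: linear_scale[OF f] linear_scale[OF linear_u] u_0)
  qed
qed

lemma N_commute:
  assumes "linear g" "\<And>t x. g (u t x) = u t (g x)"
  shows "N (g x) = g (N x)"
proof (rule N_eqI)
  fix f :: "'v \<Rightarrow> real" assume "linear f"
  then have "linear (f \<circ> g)" using assms(1) by (intro linear_compose)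
  from u_derivative[OF this, of x 0] show "((\<lambda>t. f (u t (g x))) has_real_derivative f (g (N x))) (at 0)"
    by (simp add: assms(2) u_0)
qed

text \<open>Every subspace behaves like a closed one: a functional that vanishes on \<open>M\<close>
  but not at \<open>N x\<close> would be zero along the orbit and yet have nonzero
  derivative.\<close>

lemma N_in_subspace:
  assumes "subspace M" "\<And>t. u t x \<in> M"
  shows "N x \<in> M"
proof (rule ccontr)
  assume "N x \<notin> M"
  then obtain f :: "'v \<Rightarrow> real" where f: "linear f" "\<And>m. m \<in> M \<Longrightarrow> f m = 0" "f (N x) = 1"
    using exists_separating_functional[OF assms(1)] by metis
  have "((\<lambda>t. f (u t x)) has_real_derivative 1) (at 0)"
    using u_derivative[OF f(1), of x 0] f(3) by (simp add: u_0)
  then have "((\<lambda>t. 0) has_real_derivative (1::real)) (at (0::real))"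
    using assms(2) f(2) by simp
  then show False using DERIV_const DERIV_unique by (metis zero_neq_one)
qed

lemma diag2_u:
  assumes "a \<noteq> 0"
  shows "dg a (u t x) = u (a\<^sup>2 * t) (dg a x)"
  using fun_cong[OF \<tau>_mult[OF SL2_diag2[OF assms] SL2_upper_unipotent], of t x]
    fun_cong[OF \<tau>_mult[OF SL2_upper_unipotent SL2_diag2[OF assms]], of "a\<^sup>2 * t" x]
  by (simp add: u_def dg_def diag2_upper_unipotent[OF assms])

text \<open>The diagonal matrix with entry \<open>a = sqrt s\<close> conjugates \<open>u t\<close>
  into \<open>u (s * t)\<close>. It acts by \<open>a powi i\<close> on \<open>x\<close> and by
  \<open>a powi m\<close> on the component of weight \<open>m\<close>; the quotient is the stated
  power of \<open>s\<close>.\<close>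

lemma pr_u_scale:
  assumes "pr i x = x" "s > 0"
  shows "pr m (u (s * t) x) = (s powr (of_int (m - i) / 2)) *\<^sub>R pr m (u t x)"
proof -
  define a where "a = sqrt s"
  have a: "a > 0" "a\<^sup>2 = s" using assms by (auto simp: a_def)
  have "(a powi m) *\<^sub>R pr m (u t x) = pr m (dg a (u t x))"
    using a by (simp add: pr_\<tau>_diag2)
  also have "\<dots> = (a powi i) *\<^sub>R pr m (u (s * t) x)"
    using a assms(1)
    by (simp add: diag2_u \<tau>_diag2_weight linear_scale[OF linear_u] linear_scale[OF linear_pr])
  finally have "pr m (u (s * t) x) = (a powi m / a powi i) *\<^sub>R pr m (u t x)"
    using a scaleR_eq_imp_div[of "a powi i"] by (metis power_int_eq_0_iff less_irrefl)
  moreover have "s powr (of_int (m - i) / 2) = a powi m / a powi i"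
    using assms(2) a
    by (simp add: a_def powr_half_sqrt[symmetric] powr_powr diff_divide_distrib powr_diff
        flip: powr_real_of_int')
  ultimately show ?thesis by simp
qed

lemma N_weight:
  assumes "pr i x = x" shows "pr (i + 2) (N x) = N x"
proof (rule weight_vectorI, rule sym, rule eq_if_functionals_eq)
  fix f :: "'v \<Rightarrow> real" assume f: "linear f"
  let ?D = "dg 2"
  have D: "linear ?D" by (simp add: linear_dg)
  have "linear (f \<circ> ?D)" using f D by (intro linear_compose)
  from u_derivative[OF this, of x 0]
  have 1: "((\<lambda>t. f (?D (u t x))) has_real_derivative f (?D (N x))) (at 0)" by (simp add: u_0)
  \<comment> \<open>The \<open>4\<close> is the square of the diagonal entry \<open>2\<close>;
    differentiation turns it into the factor by which the eigenvalue of \<open>N x\<close> exceeds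
    that of \<open>x\<close>.\<close>
  have e: "f (?D (u t x)) = (2 powi i) * f (u (t * 4) x)" for t
    using diag2_u[of 2 t x] assms
    by (simp add: \<tau>_diag2_weight linear_scale[OF linear_u] linear_scale[OF f] mult.commute)
  have "((\<lambda>t. f (u (t * 4) x)) has_real_derivative f (N x) * 4) (at 0)"
    by (rule DERIV_chain'[where f = "\<lambda>t. t * 4" and g = "\<lambda>t. f (u t x)", simplified])
      (auto intro!: derivative_eq_intros u_derivative[OF f, of x 0, simplified u_0])
  from DERIV_cmult[OF this, of "2 powi i"]
  have "((\<lambda>t. f (?D (u t x))) has_real_derivative 2 powi i * (f (N x) * 4)) (at 0)"
    by (simp add: e)
  with 1 have "f (?D (N x)) = 2 powi i * (f (N x) * 4)" by (rule DERIV_unique)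
  then show "f ((2 powi (i + 2)) *\<^sub>R N x) = f (?D (N x))"
    by (simp add: linear_scale[OF f] power_int_add)
qed

lemma N_pow_weight: "pr i x = x \<Longrightarrow> pr (i + 2 * int n) ((N ^^ n) x) = (N ^^ n) x"
proof (induction n)
  case (Suc n)
  then show ?case using N_weight[of "i + 2 * int n" "(N ^^ n) x"] by (simp add: algebra_simps)
qed simp

lemma pr_N: "pr i (N x) = N (pr (i - 2) x)"
proof -
  have "N x = (\<Sum>k | pr k x \<noteq> 0. N (pr k x))"
    by (subst sum_pr[of x, symmetric]) (simp add: linear_sum[OF linear_N])
  then have "pr i (N x) = (\<Sum>k | pr k x \<noteq> 0. pr i (N (pr k x)))"
    by (simp only: pr_sum)
  also have "\<dots> = (\<Sum>k | pr k x \<noteq> 0. if k = i - 2 then N (pr (i - 2) x) else 0)"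
  proof (intro sum.cong refl)
    fix k
    have "pr (k + 2) (N (pr k x)) = N (pr k x)" by (rule N_weight) (simp add: pr_pr)
    then show "pr i (N (pr k x)) = (if k = i - 2 then N (pr (i - 2) x) else 0)"
      using pr_eq[of "k + 2" "N (pr k x)" i] by auto
  qed
  also have "\<dots> = N (pr (i - 2) x)"
    using linear_0[OF linear_N] by (auto simp: finite_pr)
  finally show ?thesis .
qed

text \<open>The two constraints on \<open>f (pr m (u t x))\<close>, homogeneity in \<open>t\<close> and the differential equation
  \<open>u' = u N\<close>, are compared at \<open>s = 1\<close> on the ray through \<open>t\<close>.\<close>

lemma pr_u_N:
  assumes "pr i x = x"
  shows "t *\<^sub>R pr m (u t (N x)) = (of_int (m - i) / 2) *\<^sub>R pr m (u t x)"
proof (rule eq_if_functionals_eq)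
  fix f :: "'v \<Rightarrow> real" assume f: "linear f"
  let ?c = "of_int (m - i) / 2 :: real"
  have fm: "linear (f \<circ> pr m)" using f linear_pr by (intro linear_compose)
  have "((\<lambda>s. (f \<circ> pr m) (u (s * t) x)) has_real_derivative (f \<circ> pr m) (u t (N x)) * t) (at 1)"
    by (rule DERIV_chain'[where f = "\<lambda>s. s * t" and g = "\<lambda>t. (f \<circ> pr m) (u t x)"])
      (auto intro!: derivative_eq_intros u_derivative[OF fm, of x t, simplified])
  moreover have "((\<lambda>s. (f \<circ> pr m) (u (s * t) x)) has_real_derivative ?c * f (pr m (u t x))) (at 1)"
  proof (rule has_field_derivative_transform_within_open[where S = "{0<..}"])
    show "((\<lambda>s. s powr ?c * f (pr m (u t x))) has_real_derivative ?c * f (pr m (u t x))) (at 1)"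
      by (auto intro!: derivative_eq_intros)
    show "s powr ?c * f (pr m (u t x)) = (f \<circ> pr m) (u (s * t) x)" if "s \<in> {0<..}" for s
      using that pr_u_scale[OF assms, of s m t] by (simp add: linear_scale[OF f])
  qed auto
  ultimately have "f (pr m (u t (N x))) * t = ?c * f (pr m (u t x))"
    using DERIV_unique by fastforce
  then show "f (t *\<^sub>R pr m (u t (N x))) = f (?c *\<^sub>R pr m (u t x))"
    by (simp add: linear_scale[OF f] mult.commute)
qed

text \<open>Homogeneity has the negative exponent \<open>(m - i) / 2\<close>, so a nonzero component
  would blow up as the parameter tends to \<open>0\<close>. Continuity at \<open>0\<close> forces
  the limit \<open>pr m x\<close>, which is \<open>0\<close>.\<close>

lemma pr_u_below:
  assumes "pr i x = x" "m < i"
  shows "pr m (u t x) = 0"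
proof (rule eq_if_functionals_eq)
  fix f :: "'v \<Rightarrow> real" assume f: "linear f"
  let ?c = "of_int (m - i) / 2 :: real"
  have fm: "linear (f \<circ> pr m)" using f linear_pr by (intro linear_compose)
  have "isCont (\<lambda>s. f (pr m (u s x))) 0"
    using DERIV_isCont[OF u_derivative[OF fm, of x 0]] by (simp add: o_def)
  moreover have "((\<lambda>s. s * t) \<longlongrightarrow> 0) (at_right (0::real))"
    by (auto intro!: tendsto_eq_intros)
  ultimately have lim: "((\<lambda>s. f (pr m (u (s * t) x))) \<longlongrightarrow> 0) (at_right 0)"
    using isCont_tendsto_compose[of 0 "\<lambda>s. f (pr m (u s x))" "\<lambda>s. s * t"]
      assms pr_eq[of i x m] linear_0[OF f] by (simp add: u_0)
  have "((\<lambda>s. s powr (- ?c) * f (pr m (u (s * t) x))) \<longlongrightarrow> 0 * 0) (at_right 0)"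
  proof (rule tendsto_mult[OF _ lim])
    have "((\<lambda>s::real. s powr (- ?c)) \<longlongrightarrow> 0 powr (- ?c)) (at_right 0)"
      using assms(2) by (intro tendsto_powr') (auto simp: eventually_at_right_less intro!: tendsto_eq_intros eventually_at_rightI[where b = 1])
    then show "((\<lambda>s::real. s powr (- ?c)) \<longlongrightarrow> 0) (at_right 0)" by simp
  qed
  moreover have "eventually (\<lambda>s. s powr (- ?c) * f (pr m (u (s * t) x)) = f (pr m (u t x))) (at_right 0)"
  proof (rule eventually_at_rightI[where b = 1])
    fix s :: real assume "s \<in> {0<..<1}"
    then show "s powr (- ?c) * f (pr m (u (s * t) x)) = f (pr m (u t x))"
      using pr_u_scale[OF assms(1), of s m t] by (simp add: linear_scale[OF f] powr_minus)
  qed auto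
  ultimately have "((\<lambda>s::real. f (pr m (u t x))) \<longlongrightarrow> 0) (at_right 0)"
    by (simp add: tendsto_cong)
  then show "f (pr m (u t x)) = f 0"
    using linear_0[OF f] by (simp add: tendsto_const_iff)
qed

text \<open>The derivative in \<open>t\<close> is the component of weight \<open>i\<close> in the
  orbit of \<open>N x\<close>. As \<open>N x\<close> has weight \<open>i + 2\<close>, this component
  vanishes by \<open>pr_u_below\<close>.\<close>

lemma pr_u_same:
  assumes "pr i x = x"
  shows "pr i (u t x) = x"
proof (rule eq_if_functionals_eq)
  fix f :: "'v \<Rightarrow> real" assume f: "linear f"
  have fm: "linear (f \<circ> pr i)" using f linear_pr by (intro linear_compose)
  have "pr i (u s (N x)) = 0" for s
    using N_weight[OF assms] by (intro pr_u_below) auto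
  then have "((\<lambda>s. f (pr i (u s x))) has_real_derivative 0) (at s)" for s
    using u_derivative[OF fm, of x s] linear_0[OF f] by (simp add: o_def)
  then have "f (pr i (u t x)) = f (pr i (u 0 x))"
    using DERIV_isconst_all by blast
  then show "f (pr i (u t x)) = f x" by (simp add: u_0 assms)
qed

text \<open>Iteration of \<open>pr_u_N\<close>. Each application of \<open>N\<close> raises
  \<open>i\<close> by \<open>2\<close> and so lowers \<open>(m - i) / 2\<close> by \<open>1\<close>;
  the product is the falling factorial of this number.\<close>

lemma pr_u_N_pow:
  assumes "pr i x = x"
  shows "t ^ n *\<^sub>R pr m (u t ((N ^^ n) x)) = (\<Prod>r<n. of_int (m - i) / 2 - real r) *\<^sub>R pr m (u t x)"
proof (induction n)
  case (Suc n)
  have "t ^ Suc n *\<^sub>R pr m (u t ((N ^^ Suc n) x)) = t ^ n *\<^sub>R (t *\<^sub>R pr m (u t (N ((N ^^ n) x))))"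
    by simp
  also have "\<dots> = (of_int (m - (i + 2 * int n)) / 2) *\<^sub>R (t ^ n *\<^sub>R pr m (u t ((N ^^ n) x)))"
    by (subst pr_u_N[OF N_pow_weight[OF assms]]) simp
  also have "\<dots> = (\<Prod>r<Suc n. of_int (m - i) / 2 - real r) *\<^sub>R pr m (u t x)"
    by (subst Suc.IH) (simp add: diff_divide_distrib add_divide_distrib algebra_simps)
  finally show ?case .
qed simp

text \<open>At \<open>m = i + 2 * int n\<close> the falling factorial is \<open>fact n\<close>,
  while \<open>pr_u_same\<close> evaluates the component of the orbit of \<open>(N ^^ n) x\<close>.
  These are the terms of the exponential series of \<open>t N\<close>.\<close>

lemma pr_u_exp:
  assumes "pr i x = x"
  shows "pr (i + 2 * int n) (u t x) = (t ^ n / fact n) *\<^sub>R (N ^^ n) x"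
proof -
  have "(\<Prod>r<n. real n - real r) = fact n"
    by (simp add: fact_prod_rev lessThan_atLeast0 of_nat_diff)
  then have "t ^ n *\<^sub>R (N ^^ n) x = fact n *\<^sub>R pr (i + 2 * int n) (u t x)"
    using pr_u_N_pow[OF assms, of t n "i + 2 * int n"] pr_u_same[OF N_pow_weight[OF assms], of n t]
    by simp
  then show ?thesis using scaleR_eq_imp_div[of "fact n :: real"] by (metis fact_nonzero)
qed

text \<open>For \<open>m\<close> above \<open>i\<close> but off the progression no factor of the
  falling factorial vanishes, whereas enough applications of \<open>N\<close> push the weight beyond
  \<open>m\<close>, where \<open>pr_u_below\<close> gives zero.\<close>

lemma pr_u_zero:
  assumes "pr i x = x" "\<And>n. m \<noteq> i + 2 * int n"
  shows "pr m (u t x) = 0"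
proof (cases "m < i")
  case True
  then show ?thesis using assms pr_u_below by blast
next
  case False
  let ?n = "Suc (nat (m - i))"
  have "pr m (u t ((N ^^ ?n) x)) = 0"
    using False by (intro pr_u_below[OF N_pow_weight[OF assms(1)]]) auto
  then have "(\<Prod>r<?n. of_int (m - i) / 2 - real r) *\<^sub>R pr m (u t x) = 0"
    using pr_u_N_pow[OF assms(1), of t ?n m] by simp
  moreover have "of_int (m - i) / 2 - real r \<noteq> 0" for r
    using assms(2)[of r] by (auto simp: field_simps)
  ultimately show ?thesis by auto
qed

text \<open>The vectors \<open>(N ^^ n) x\<close> are, up to the factor \<open>fact n\<close>,
  distinct components of the single vector \<open>u 1 x\<close>, which has only finitely
  many.\<close>

lemma N_nilpotent:
  assumes "pr i x = x"
  obtains n where "\<And>m. m \<ge> n \<Longrightarrow> (N ^^ m) x = 0"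
proof -
  let ?S = "{n. (N ^^ n) x \<noteq> 0}"
  have inj: "inj_on (\<lambda>n. i + 2 * int n) ?S" by (auto intro: inj_onI)
  have "(\<lambda>n. i + 2 * int n) ` ?S \<subseteq> {m. pr m (u 1 x) \<noteq> 0}"
    using pr_u_exp[OF assms, of _ 1] by auto
  then have "finite ?S"
    by (rule finite_imageD[OF finite_subset[OF _ finite_pr] inj])
  then obtain n where "\<forall>m\<in>?S. m < n" using finite_nat_set_iff_bounded by blast
  then show ?thesis by (intro that[of n]) (metis (mono_tags) mem_Collect_eq not_less)
qed

lemma u_in_span: "pr i x = x \<Longrightarrow> u t x \<in> span (range (\<lambda>n. (N ^^ n) x))"
proof -
  assume x: "pr i x = x"
  have "pr m (u t x) \<in> span (range (\<lambda>n. (N ^^ n) x))" for m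
  proof (cases "\<exists>n. m = i + 2 * int n")
    case True
    then obtain n where "pr m (u t x) = (t ^ n / fact n) *\<^sub>R (N ^^ n) x"
      using pr_u_exp[OF x] by blast
    then show ?thesis by (metis rangeI span_base span_scale)
  next
    case False
    then show ?thesis using pr_u_zero[OF x, of m t] by (simp add: span_zero)
  qed
  then have "(\<Sum>m | pr m (u t x) \<noteq> 0. pr m (u t x)) \<in> span (range (\<lambda>n. (N ^^ n) x))"
    by (intro span_sum)
  then show ?thesis by (simp only: sum_pr)
qed

lemma N_pow_finite: "pr i x = x \<Longrightarrow> finite (range (\<lambda>n. (N ^^ n) x))"
proof -
  assume "pr i x = x"
  then obtain n where "\<And>m. m \<ge> n \<Longrightarrow> (N ^^ m) x = 0" using N_nilpotent by blast
  then have "range (\<lambda>m. (N ^^ m) x) \<subseteq> insert 0 ((\<lambda>m. (N ^^ m) x) ` {..<n})"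
    by (metis (no_types, lifting) image_subsetI insertCI imageI lessThan_iff not_less)
  then show ?thesis by (rule finite_subset) auto
qed

lemma u_fixed: "pr i x = x \<Longrightarrow> N x = 0 \<Longrightarrow> u t x = x"
proof -
  assume x: "pr i x = x" and N: "N x = 0"
  have "(N ^^ n) x = 0" if "n > 0" for n
    using that N linear_0[OF linear_N] by (induction n) (auto, metis funpow_0 neq0_conv)
  then have "range (\<lambda>n. (N ^^ n) x) \<subseteq> {x, 0}" by (auto) (metis funpow_0 neq0_conv)
  have "pr m (u t x) = pr m x" for m
  proof (cases "\<exists>n. m = i + 2 * int n")
    case True
    then obtain n where n: "m = i + 2 * int n" by blast
    show ?thesis
    proof (cases "n = 0")
      case True
      then show ?thesis using pr_u_same[OF x] n x by simp
    next
      case False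
      then show ?thesis using pr_u_exp[OF x, of n t] n pr_eq[OF x, of m] \<open>\<And>n. n > 0 \<Longrightarrow> _ = 0\<close>[of n] by simp
    qed
  next
    case False
    then have "m \<noteq> i" by (metis add.right_neutral mult_zero_right of_nat_0)
    then show ?thesis using False pr_u_zero[OF x, of m t] pr_eq[OF x, of m] by auto
  qed
  then show ?thesis by (rule pr_eqI)
qed

lemma w_factorization: "w x = u 1 (w (u 1 (w (w (w (u 1 x))))))"
proof -
  have "w x = \<tau> (upper_unipotent 1 ** (matw ** upper_unipotent 1 ** diag2 (-1) (-1) ** matw) ** upper_unipotent 1) x"
    unfolding w_def by (subst matw_factorization) (rule refl)
  also have "\<dots> = u 1 (w (u 1 (dg (-1) (w (u 1 x)))))"
    by (simp add: \<tau>_mult SL2_mult SL2_upper_unipotent SL2_matw SL2_diag2_minus_one u_def w_def dg_def)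
  finally show ?thesis unfolding w_w[of "w (u 1 x)"] .
qed

text \<open>For \<open>x\<close> fixed by \<open>u\<close>, the factorization of \<open>w\<close> reads
  \<open>u (- 1) (w x) = w (u 1 (w\<^sup>-\<^sup>1 x))\<close>; the weights on the left are \<open>\<ge> - i\<close>, those on the right \<open>\<le> i\<close>.\<close>

lemma primitive_identity:
  assumes "pr i x = x" "N x = 0"
  shows "u (-1) (w x) = ((-1) powi i) *\<^sub>R w (u 1 (w x))"
proof -
  have "u 1 x = x" using assms by (rule u_fixed)
  then have "u (-1) (w x) = w (u 1 (w (w (w x))))"
    using w_factorization[of x] u_minus(1)[of 1] by metis
  also have "w (w (w x)) = ((-1) powi i) *\<^sub>R w x"
    using w_w_weight[OF assms(1)] by (simp add: linear_scale[OF linear_w])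
  finally show ?thesis
    by (simp add: linear_scale[OF linear_w] linear_scale[OF linear_u])
qed

text \<open>The component of weight \<open>- i\<close> in \<open>primitive_identity\<close> is
  \<open>w x\<close> on the left. On the right it is, up to sign, the image under \<open>w\<close>
  of a component of weight \<open>i\<close> in the orbit of \<open>w x\<close>, and
  \<open>i < - i\<close> makes it zero.\<close>

lemma primitive_weight_neg:
  assumes "pr i x = x" "N x = 0" "i < 0"
  shows "x = 0"
proof -
  have "pr (- i) (u (-1) (w x)) = w x"
    using pr_u_same[OF w_weight[OF assms(1)]] by simp
  moreover have "pr (- i) (w (u 1 (w x))) = w (pr i (u 1 (w x)))"
    by (simp add: pr_w)
  moreover have "pr i (u 1 (w x)) = 0"
    using assms by (intro pr_u_below[OF w_weight[OF assms(1)]]) auto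
  ultimately have "w x = 0"
    using primitive_identity[OF assms(1,2)] linear_0[OF linear_w]
    by (simp add: linear_scale[OF linear_pr])
  then show ?thesis using w_w_w_w[of x] linear_0[OF linear_w] by simp
qed

text \<open>Comparison of the components of weight \<open>n\<close> in
  \<open>primitive_identity\<close>: the left side gives the last term of the exponential series at
  \<open>t = -1\<close>, the right side gives \<open>x\<close>, as the sign there is the one by
  which \<open>w\<close> squared acts.\<close>

lemma primitive_eq_N_pow:
  assumes "pr (int n) x = x" "N x = 0"
  shows "x = ((-1) ^ n / fact n) *\<^sub>R (N ^^ n) (w x)"
proof -
  have wx: "pr (- int n) (w x) = w x" using w_weight[OF assms(1)] .
  have "- int n + 2 * int n = int n" by simp
  then have "pr (int n) (u (-1) (w x)) = ((-1) ^ n / fact n) *\<^sub>R (N ^^ n) (w x)"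
    using pr_u_exp[OF wx, of n "-1"] by metis
  moreover have "pr (int n) (w (u 1 (w x))) = w (w x)"
    using pr_u_same[OF wx, of 1] pr_w[of "int n" "u 1 (w x)"] by argo
  moreover have "w (w x) = ((-1) powi int n) *\<^sub>R x" using w_w_weight[OF assms(1)] .
  ultimately have "((-1) ^ n / fact n) *\<^sub>R (N ^^ n) (w x) = ((-1) ^ n * (-1) ^ n) *\<^sub>R x"
    using primitive_identity[OF assms] linear_scale[OF linear_pr] by (metis power_int_of_nat scaleR_scaleR)
  then show ?thesis by (simp flip: power_mult_distrib)
qed

text \<open>By the Bruhat decomposition an element of the group involves at most two unipotent
  factors and one Weyl element. Each unipotent factor contributes only finitely many vectors,
  because \<open>N\<close> is nilpotent on homogeneous vectors.\<close>

lemma finite_dimensional_orbit: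
  obtains B where "finite B" "\<And>g. g \<in> SL2 \<Longrightarrow> \<tau> g x \<in> span B"
proof -
  have *: "\<exists>B. finite B \<and> (\<forall>g\<in>SL2. \<tau> g x \<in> span B)" if x: "pr i x = x" for i x
  proof -
    \<comment> \<open>The span of \<open>B1\<close> contains what the first unipotent factor
      reaches; \<open>B2\<close> arises from \<open>B1\<close> by the Weyl element and the second
      unipotent factor. All elements are homogeneous, so diagonal matrices preserve both
      spans.\<close>
    define B1 where "B1 = range (\<lambda>n. (N ^^ n) x)"
    define B2 where "B2 = (\<Union>y\<in>B1. range (\<lambda>n. (N ^^ n) (w y)))"
    have w1: "\<exists>k. pr k y = y" if y: "y \<in> B1" for y
    proof -
      obtain n where "y = (N ^^ n) x" using y unfolding B1_def by blast
      then show ?thesis using N_pow_weight[OF x, of n] by blast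
    qed
    have w2: "\<exists>k. pr k y = y" if y: "y \<in> B2" for y
    proof -
      obtain n z where z: "z \<in> B1" "y = (N ^^ n) (w z)" using y by (auto simp: B2_def)
      then obtain k where "pr k z = z" using w1 by blast
      then show ?thesis using N_pow_weight[OF w_weight, of k z n] z(2) by blast
    qed
    have D: "dg a y \<in> span S" if a: "a \<noteq> 0" and y: "y \<in> span S" and S: "\<And>y. y \<in> S \<Longrightarrow> \<exists>k. pr k y = y"
      for a y S
      using y
    proof (induction rule: span_induct_alt)
      case base
      then show ?case using linear_0[OF linear_dg] a by (simp add: span_zero)
    next
      case (step c y z)
      obtain k where "pr k y = y" using step S by blast
      then have "dg a y = (a powi k) *\<^sub>R y" using a \<tau>_diag2_weight by blast
      then have "dg a (c *\<^sub>R y + z) = c *\<^sub>R (a powi k) *\<^sub>R y + dg a z"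
        by (simp only: linear_add[OF linear_dg[OF a]] linear_scale[OF linear_dg[OF a]])
      then show ?case
        using step(1,2) by (simp add: span_add span_scale span_base)
    qed
    have U: "u t y \<in> span B1" if y: "y \<in> B1" for t y
    proof -
      obtain n where n: "y = (N ^^ n) x" using y by (auto simp: B1_def)
      have "range (\<lambda>m. (N ^^ m) y) \<subseteq> B1"
      proof (rule image_subsetI)
        fix m
        have "(N ^^ m) y = (N ^^ (m + n)) x" by (simp add: n funpow_add)
        then show "(N ^^ m) y \<in> B1" unfolding B1_def by blast
      qed
      then show ?thesis
        using u_in_span[OF N_pow_weight[OF x], of t n] n span_mono by blast
    qed
    have W: "u t (w y) \<in> span B2" if y: "y \<in> B1" for t y
    proof -
      obtain k where "pr k y = y" using w1 y by blast
      from u_in_span[OF w_weight[OF this], of t] show ?thesis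
        using y span_mono[of "range (\<lambda>n. (N ^^ n) (w y))" B2] by (auto simp: B2_def)
    qed
    have fin: "finite (B1 \<union> B2)"
    proof -
      have f1: "finite B1" unfolding B1_def using N_pow_finite[OF x] .
      moreover have "finite (range (\<lambda>n. (N ^^ n) (w y)))" if "y \<in> B1" for y
        using w1[OF that] N_pow_finite w_weight by blast
      ultimately show ?thesis unfolding B2_def by auto
    qed
    have xB: "x \<in> B1" unfolding B1_def by (metis funpow_0 rangeI)
    have "\<tau> g x \<in> span (B1 \<union> B2)" if "g \<in> SL2" for g
      using that
    proof (cases rule: SL2_bruhat_cases)
      case (1 a t)
      have "\<tau> g x = dg a (u t x)"
        unfolding 1(2) by (simp add: \<tau>_mult SL2_diag2 1(1) SL2_upper_unipotent u_def dg_def)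
      also have "\<dots> \<in> span B1" using D[OF 1(1) U[OF xB] w1] .
      finally show ?thesis using span_mono[of B1 "B1 \<union> B2"] by auto
    next
      case (2 s a t)
      have e: "\<tau> g x = u s (dg a (w (u t x)))"
        unfolding 2(2)
        by (simp add: \<tau>_mult SL2_mult SL2_diag2 2(1) SL2_upper_unipotent SL2_matw u_def w_def dg_def)
      have key: "u s (dg a (w z)) \<in> span B2" if "z \<in> span B1" for z
        using that
      proof (induction rule: span_induct_alt)
        case base
        then show ?case using linear_0[OF linear_dg] linear_0[OF linear_u]
          linear_0[OF linear_w] 2(1) by (simp add: span_zero)
      next
        case (step c y z)
        obtain k where "pr k y = y" using step w1 by blast
        then have "dg a (w y) = a powi (- k) *\<^sub>R w y"
          using w_weight \<tau>_diag2_weight 2(1) by blast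
        moreover have "u s (w y) \<in> span B2" using W step by blast
        moreover have "u s (dg a (w (c *\<^sub>R y + z))) = c *\<^sub>R u s (dg a (w y)) + u s (dg a (w z))"
          by (simp only: linear_add[OF linear_dg[OF 2(1)]] linear_scale[OF linear_dg[OF 2(1)]]
            linear_add[OF linear_u] linear_scale[OF linear_u]
            linear_add[OF linear_w] linear_scale[OF linear_w])
        ultimately show ?case
          using step(2) by (simp add: linear_scale[OF linear_u] span_add span_scale)
      qed
      have "\<tau> g x \<in> span B2" unfolding e by (rule key[OF U[OF xB]])
      then show ?thesis using span_mono[of B2 "B1 \<union> B2"] by auto
    qed
    then show ?thesis using fin by blast
  qed
  have "\<exists>B. finite B \<and> (\<forall>g\<in>SL2. \<tau> g (pr i x) \<in> span B)" for i
    by (rule *[of i]) (simp add: pr_pr)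
  then have "\<exists>B. \<forall>i. finite (B i) \<and> (\<forall>g\<in>SL2. \<tau> g (pr i x) \<in> span (B i))"
    by (intro choice allI) blast
  then obtain B where B: "\<And>i. finite (B i)" "\<And>i g. g \<in> SL2 \<Longrightarrow> \<tau> g (pr i x) \<in> span (B i)" by blast
  let ?B = "\<Union>i\<in>{i. pr i x \<noteq> 0}. B i"
  have "\<tau> g x \<in> span ?B" if g: "g \<in> SL2" for g
  proof -
    have "\<tau> g x = (\<Sum>i | pr i x \<noteq> 0. \<tau> g (pr i x))"
      by (subst sum_pr[of x, symmetric]) (simp add: linear_sum[OF linear_\<tau>[OF g]])
    also have "\<dots> \<in> span ?B"
    proof (rule span_sum)
      fix i assume "i \<in> {i. pr i x \<noteq> 0}"
      then show "\<tau> g (pr i x) \<in> span ?B"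
        using B(2)[OF g, of i] span_mono[of "B i" ?B] by blast
    qed
    finally show ?thesis .
  qed
  moreover have "finite ?B" using B(1) finite_pr by auto
  ultimately show ?thesis using that by blast
qed

end


section \<open>Lefschetz modules\<close>

lemma inner_product_onD:
  assumes "inner_product_on ip"
  shows "linear (ip x)" "ip x y = ip y x" "x \<noteq> 0 \<Longrightarrow> ip x x > 0" "ip x x \<ge> 0"
    "ip x (y + z) = ip x y + ip x z" "ip (y + z) x = ip y x + ip z x"
    "ip x (r *\<^sub>R y) = r * ip x y" "ip (r *\<^sub>R y) x = r * ip y x"
    "ip x 0 = 0" "ip 0 x = 0" "ip x (- y) = - ip x y" "ip (- y) x = - ip y x"
    "ip x (y - z) = ip x y - ip x z" "ip (y - z) x = ip y x - ip z x"
    "ip x (sum f A) = (\<Sum>a\<in>A. ip x (f a))" "ip (sum f A) x = (\<Sum>a\<in>A. ip (f a) x)"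
proof -
  have l: "linear (ip x)" for x using assms by (simp add: inner_product_on_def)
  have s: "ip x y = ip y x" for x y using assms by (simp add: inner_product_on_def)
  have p: "x \<noteq> 0 \<Longrightarrow> ip x x > 0" for x using assms by (simp add: inner_product_on_def)
  show "linear (ip x)" "ip x y = ip y x" "x \<noteq> 0 \<Longrightarrow> ip x x > 0" by fact+
  show "ip x x \<ge> 0" using p[of x] linear_0[OF l[of x]] by (cases "x = 0") auto
  show "ip x (y + z) = ip x y + ip x z" "ip (y + z) x = ip y x + ip z x"
    using linear_add[OF l[of x]] s by simp_all
  show "ip x (r *\<^sub>R y) = r * ip x y" "ip (r *\<^sub>R y) x = r * ip y x"
    using linear_scale[OF l[of x]] s by simp_all
  show "ip x 0 = 0" "ip 0 x = 0" using linear_0[OF l[of x]] s by simp_all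
  show "ip x (- y) = - ip x y" "ip (- y) x = - ip y x"
    using linear_neg[OF l[of x]] s by simp_all
  show "ip x (y - z) = ip x y - ip x z" "ip (y - z) x = ip y x - ip z x"
    using linear_diff[OF l[of x]] s by simp_all
  show "ip x (sum f A) = (\<Sum>a\<in>A. ip x (f a))" "ip (sum f A) x = (\<Sum>a\<in>A. ip (f a) x)"
    using linear_sum[OF l[of x]] s by simp_all
qed

section \<open>Bounded operators and orthogonal gradings before completion\<close>

text \<open>Stated with squared norms: \<open>C\<close> is the square of a bound for the operator
  norm.\<close>

definition bounded_wrt :: "('v::real_vector \<Rightarrow> 'v \<Rightarrow> real) \<Rightarrow> ('v \<Rightarrow> 'v) \<Rightarrow> bool" where
  "bounded_wrt ip f \<longleftrightarrow> linear f \<and> (\<exists>C\<ge>0. \<forall>x. ip (f x) (f x) \<le> C * ip x x)"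

lemma bounded_wrt_linear: "bounded_wrt ip f \<Longrightarrow> linear f"
  by (simp add: bounded_wrt_def)

lemma bounded_wrt_compose:
  assumes "bounded_wrt ip f" "bounded_wrt ip g"
  shows "bounded_wrt ip (\<lambda>x. f (g x))"
proof -
  obtain C D where C: "C \<ge> 0" "\<And>x. ip (f x) (f x) \<le> C * ip x x"
    and D: "D \<ge> 0" "\<And>x. ip (g x) (g x) \<le> D * ip x x"
    using assms unfolding bounded_wrt_def by blast
  have "ip (f (g x)) (f (g x)) \<le> (C * D) * ip x x" for x
    using C(2)[of "g x"] mult_left_mono[OF D(2)[of x] C(1)] by (simp add: mult.assoc)
  moreover have "linear (\<lambda>x. f (g x))"
    using linear_compose[of g f] assms by (simp add: bounded_wrt_def o_def)
  ultimately show ?thesis using C D unfolding bounded_wrt_def by (meson mult_nonneg_nonneg)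
qed

lemma bounded_wrt_add:
  assumes ip: "inner_product_on ip" and "bounded_wrt ip f" "bounded_wrt ip g"
  shows "bounded_wrt ip (\<lambda>x. f x + g x)"
proof -
  note ip = inner_product_onD[OF ip]
  obtain C D where C: "C \<ge> 0" "\<And>x. ip (f x) (f x) \<le> C * ip x x"
    and D: "D \<ge> 0" "\<And>x. ip (g x) (g x) \<le> D * ip x x"
    using assms unfolding bounded_wrt_def by blast
  \<comment> \<open>The factors \<open>2\<close> come from expanding
    \<open>ip (f x - g x) (f x - g x) \<ge> 0\<close>.\<close>
  have "ip (f x + g x) (f x + g x) \<le> (2 * C + 2 * D) * ip x x" for x
    using C(2)[of x] D(2)[of x] ip(4)[of "f x - g x"] ip(2)[of "f x" "g x"]
    by (simp add: ip(5,6,13,14) distrib_right)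
  moreover have "linear (\<lambda>x. f x + g x)"
    using assms by (auto simp: bounded_wrt_def intro: linear_compose_add)
  ultimately show ?thesis using C D unfolding bounded_wrt_def
    by (intro conjI exI[of _ "2 * C + 2 * D"]) auto
qed

lemma bounded_wrt_scale:
  assumes ip: "inner_product_on ip" and "bounded_wrt ip f"
  shows "bounded_wrt ip (\<lambda>x. r *\<^sub>R f x)"
proof -
  note ip = inner_product_onD[OF ip]
  obtain C where C: "C \<ge> 0" "\<And>x. ip (f x) (f x) \<le> C * ip x x"
    using assms unfolding bounded_wrt_def by blast
  have "ip (r *\<^sub>R f x) (r *\<^sub>R f x) \<le> (r\<^sup>2 * C) * ip x x" for x
    using mult_left_mono[OF C(2)[of x], of "r\<^sup>2"] by (simp add: ip(7,8) power2_eq_square mult.assoc)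
  moreover have "linear (\<lambda>x. r *\<^sub>R f x)"
    using assms by (auto simp: bounded_wrt_def intro: linear_compose_scale_right)
  ultimately show ?thesis using C unfolding bounded_wrt_def
    by (intro conjI exI[of _ "r\<^sup>2 * C"]) auto
qed

lemma bounded_wrt_diff:
  assumes "inner_product_on ip" and "bounded_wrt ip f" "bounded_wrt ip g"
  shows "bounded_wrt ip (\<lambda>x. f x - g x)"
  using bounded_wrt_add[OF assms(1,2) bounded_wrt_scale[OF assms(1,3), of "-1"]] by simp

locale orthogonal_grading = grading pr for pr :: "'i \<Rightarrow> 'v::real_vector \<Rightarrow> 'v" +
  fixes ip :: "'v \<Rightarrow> 'v \<Rightarrow> real"
  assumes ip: "inner_product_on ip"
    and pr_orthogonal: "i \<noteq> j \<Longrightarrow> ip (pr i x) (pr j y) = 0"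
begin

lemmas ip_simps = inner_product_onD(5-)[OF ip]

lemma ip_sym: "ip x y = ip y x"
  and ip_pos: "x \<noteq> 0 \<Longrightarrow> ip x x > 0"
  and ip_nonneg: "ip x x \<ge> 0"
  using inner_product_onD[OF ip] by blast+

lemma ip_eq_0: "ip x x = 0 \<Longrightarrow> x = 0"
  using ip_pos[of x] by auto

lemma ip_pr: "ip (pr i x) y = ip (pr i x) (pr i y)"
proof -
  let ?I = "insert i {i. pr i y \<noteq> 0}"
  have fin: "finite ?I" by (simp add: finite_pr)
  have "ip (pr i x) (\<Sum>j\<in>?I. pr j y) = (\<Sum>j\<in>?I. if j = i then ip (pr i x) (pr i y) else 0)"
    using pr_orthogonal by (simp only: ip_simps) (intro sum.cong, auto)
  also have "\<dots> = ip (pr i x) (pr i y)" using fin by simp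
  finally show ?thesis by (simp only: sum_pr_superset[OF fin subset_insertI])
qed

lemma ip_pr_swap: "ip (pr i x) y = ip x (pr i y)"
  by (metis ip_pr ip_sym)

lemma ip_expand:
  assumes "finite I" "{i. pr i x \<noteq> 0} \<subseteq> I"
  shows "ip x y = (\<Sum>i\<in>I. ip (pr i x) (pr i y))"
proof -
  have "ip (\<Sum>i\<in>I. pr i x) y = (\<Sum>i\<in>I. ip (pr i x) (pr i y))"
    by (simp only: ip_simps ip_pr[of _ x y])
  then show ?thesis by (simp only: sum_pr_superset[OF assms])
qed

text \<open>The coefficients have to be bounded only in degrees that occur. For functions of the
  second weight these are three values of \<open>j\<close>.\<close>

lemma bounded_dmap:
  assumes "\<And>i x. pr i x \<noteq> 0 \<Longrightarrow> \<bar>c i\<bar> \<le> C"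
  shows "bounded_wrt ip (dmap c)"
proof -
  have "ip (dmap c x) (dmap c x) \<le> C\<^sup>2 * ip x x" for x
  proof -
    let ?I = "{i. pr i x \<noteq> 0}"
    have "ip (dmap c x) (dmap c x) = (\<Sum>i\<in>?I. ip (pr i (dmap c x)) (pr i (dmap c x)))"
      by (rule ip_expand[OF finite_pr]) (auto simp: pr_dmap)
    also have "\<dots> \<le> (\<Sum>i\<in>?I. C\<^sup>2 * ip (pr i x) (pr i x))"
    proof (rule sum_mono)
      fix i assume "i \<in> ?I"
      then have "\<bar>c i\<bar> \<le> C" using assms[of i x] by simp
      then have "(c i)\<^sup>2 \<le> C\<^sup>2" using abs_le_square_iff[of "c i" C] by linarith
      then show "ip (pr i (dmap c x)) (pr i (dmap c x)) \<le> C\<^sup>2 * ip (pr i x) (pr i x)"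
        using mult_right_mono[OF _ ip_nonneg[of "pr i x"]]
        by (simp add: pr_dmap ip_simps power2_eq_square mult.assoc[symmetric])
    qed
    also have "\<dots> = C\<^sup>2 * ip x x"
      by (simp add: ip_expand[OF finite_pr[of x], of x] sum_distrib_left)
    finally show ?thesis .
  qed
  then show ?thesis unfolding bounded_wrt_def using linear_dmap by (intro conjI exI[of _ "C\<^sup>2"]) auto
qed

lemma ip_dmap: "ip (dmap c x) y = ip x (dmap c y)"
proof -
  let ?I = "{i. pr i x \<noteq> 0} \<union> {i. pr i y \<noteq> 0}"
  have fin: "finite ?I" by (simp add: finite_pr)
  have "ip (dmap c x) y = (\<Sum>i\<in>?I. ip (pr i (dmap c x)) (pr i y))"
    by (rule ip_expand[OF fin]) (auto simp: pr_dmap)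
  also have "\<dots> = (\<Sum>i\<in>?I. ip (pr i x) (pr i (dmap c y)))"
    by (simp add: pr_dmap ip_simps)
  also have "\<dots> = ip x (dmap c y)"
    by (rule ip_expand[OF fin, symmetric]) auto
  finally show ?thesis .
qed

end

text \<open>Gram--Schmidt; the versions in the library need the inner product of a type class.\<close>

lemma orthogonal_decomposition:
  assumes "inner_product_on ip" "finite B"
  shows "\<exists>y\<in>span B. \<forall>b\<in>span B. ip (x - y) b = 0"
  using assms(2)
proof (induction B arbitrary: x rule: finite_induct)
  case empty
  then show ?case using inner_product_onD(9)[OF assms(1)] by simp
next
  case (insert e B)
  note ip = inner_product_onD[OF assms(1)]
  obtain p where p: "p \<in> span B" "\<forall>b\<in>span B. ip (e - p) b = 0" using insert.IH by blast
  obtain q where q: "q \<in> span B" "\<forall>b\<in>span B. ip (x - q) b = 0" using insert.IH by blast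
  have sub: "span B \<subseteq> span (insert e B)" by (simp add: span_mono subset_insertI)
  \<comment> \<open>\<open>f\<close> is \<open>0\<close> if \<open>e\<close> already lies in
    \<open>span B\<close>; the quotient in \<open>y\<close> is then \<open>0\<close> by the
    convention on division, and \<open>y\<close> reduces to \<open>q\<close>.\<close>
  define f where "f = e - p"
  define y where "y = q + (ip (x - q) f / ip f f) *\<^sub>R f"
  have f: "f \<in> span (insert e B)" using p(1) sub by (auto simp: f_def intro: span_diff span_base)
  have y: "y \<in> span (insert e B)" unfolding y_def using q(1) sub f by (auto intro: span_add span_scale)
  have 1: "ip (x - y) b = 0" if b: "b \<in> span B" for b
  proof -
    have "ip (x - q) b = 0" "ip f b = 0" using q(2) p(2) b by (auto simp: f_def)
    moreover have "x - y = (x - q) - (ip (x - q) f / ip f f) *\<^sub>R f" by (simp add: y_def)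
    ultimately show ?thesis by (simp only: ip(14) ip(8))
  qed
  have 2: "ip (x - y) f = 0"
  proof -
    have "x - y = (x - q) - (ip (x - q) f / ip f f) *\<^sub>R f" by (simp add: y_def)
    then have "ip (x - y) f = ip (x - q) f - (ip (x - q) f / ip f f) * ip f f"
      by (simp only: ip(14) ip(8))
    then show ?thesis using ip(3)[of f] ip(9) by (cases "f = 0") auto
  qed
  have "ip (x - y) b = 0" if "b \<in> span (insert e B)" for b
  proof -
    obtain k where k: "b - k *\<^sub>R e \<in> span B" using \<open>b \<in> _\<close> by (auto simp: span_insert)
    then have "b - k *\<^sub>R f \<in> span B"
      using span_add[OF k span_scale[OF p(1), of k]] by (simp add: f_def scaleR_diff_right algebra_simps)
    then have "ip (x - y) (b - k *\<^sub>R f) = 0" by (rule 1)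
    then show ?thesis using 2 by (simp add: ip(13) ip(7))
  qed
  then show ?case using y by blast
qed

section \<open>Two commuting actions and the polarization\<close>

text \<open>The hypothesis \<open>weights\<close> is what a surface contributes: forms have degree
  \<open>j + 1\<close> in \<open>{0, 1, 2}\<close>, and \<open>1 + j - i\<close> is even wherever
  \<open>K\<close> is nonzero.\<close>

locale lefschetz_module = grading pr for pr :: "int \<times> int \<Rightarrow> 'v::real_vector \<Rightarrow> 'v" +
  fixes \<sigma> :: "real^2^2 \<Rightarrow> real^2^2 \<Rightarrow> 'v \<Rightarrow> 'v" and N l :: "'v \<Rightarrow> 'v" and \<psi> :: "'v \<Rightarrow> 'v \<Rightarrow> real"
  assumes linear_\<sigma>: "g \<in> SL2 \<Longrightarrow> h \<in> SL2 \<Longrightarrow> linear (\<sigma> g h)"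
    and \<sigma>_1: "\<sigma> (mat 1) (mat 1) = id"
    and \<sigma>_mult: "g \<in> SL2 \<Longrightarrow> h \<in> SL2 \<Longrightarrow> g' \<in> SL2 \<Longrightarrow> h' \<in> SL2 \<Longrightarrow>
      \<sigma> (g ** g') (h ** h') = \<sigma> g h \<circ> \<sigma> g' h'"
    and \<sigma>_diag2: "a \<noteq> 0 \<Longrightarrow> b \<noteq> 0 \<Longrightarrow>
      \<sigma> (diag2 a (inverse a)) (diag2 b (inverse b)) (pr (i, j) x) = (a powi i * b powi j) *\<^sub>R pr (i, j) x"
    and weak_derivative_N: "linear f \<Longrightarrow>
      ((\<lambda>t. f (\<sigma> (mat 1 + t *\<^sub>R matE) (mat 1) x)) has_real_derivative f (N x)) (at 0)"
    and weak_derivative_l: "linear f \<Longrightarrow>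
      ((\<lambda>t. f (\<sigma> (mat 1) (mat 1 + t *\<^sub>R matE) x)) has_real_derivative f (l x)) (at 0)"
    and weights: "pr (i, j) x \<noteq> 0 \<Longrightarrow> \<bar>j\<bar> \<le> 1 \<and> odd (i + j)"
    and \<psi>_N: "\<psi> (N x) y = - \<psi> x (N y)"
    and \<psi>_l: "\<psi> (l x) y = - \<psi> x (l y)"
    and \<psi>_antisym: "\<psi> y x = - \<psi> x y"
    and \<psi>_degree: "(i', j') \<noteq> (- i, - j) \<Longrightarrow> \<psi> (pr (i, j) x) (pr (i', j') y) = 0"
    and inner_product: "inner_product_on (polarization_ip \<psi> \<sigma>)"
begin

abbreviation "ip \<equiv> polarization_ip \<psi> \<sigma>"

lemmas mat1 = SL2_mat_1

lemma diag2_1: "diag2 1 (inverse 1) = (mat 1 :: real^2^2)"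
  by (auto simp: mat2_defs)

lemma coarsen_linear_eq:
  assumes "linear f" "\<And>i. k i = m \<Longrightarrow> f (pr i x) = r *\<^sub>R pr i x"
  shows "f (coarsen k m x) = r *\<^sub>R coarsen k m x"
proof -
  have "coarsen k m x = (\<Sum>i | pr i x \<noteq> 0 \<and> k i = m. pr i x)"
    unfolding coarsen_def dmap_def
    by (rule sum.mono_neutral_cong_right) (auto simp: finite_pr)
  then show ?thesis
    by (simp add: linear_sum[OF assms(1)] assms(2) scaleR_sum_right)
qed

sublocale A: graded_SL2_rep "coarsen fst" "\<lambda>g. \<sigma> g (mat 1)" N
proof (intro graded_SL2_rep.intro graded_SL2_rep_axioms.intro)
  show "grading (coarsen fst)" by (rule coarsen_grading)
  show "\<sigma> (diag2 a (inverse a)) (mat 1) (coarsen fst i x) = a powi i *\<^sub>R coarsen fst i x"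
    if "a \<noteq> 0" for a i x
  proof (rule coarsen_linear_eq)
    show "linear (\<sigma> (diag2 a (inverse a)) (mat 1))"
      using linear_\<sigma>[OF SL2_diag2[OF that] mat1] .
    show "\<sigma> (diag2 a (inverse a)) (mat 1) (pr p x) = a powi i *\<^sub>R pr p x" if "fst p = i" for p
      using \<sigma>_diag2[OF \<open>a \<noteq> 0\<close> one_neq_zero, of "fst p" "snd p" x] that
      by (cases p) (simp add: diag2_1[simplified])
  qed
qed (use linear_\<sigma>[OF _ mat1] \<sigma>_1 \<sigma>_mult[OF _ mat1 _ mat1] weak_derivative_N in \<open>simp_all\<close>)

sublocale B: graded_SL2_rep "coarsen snd" "\<sigma> (mat 1)" l
proof (intro graded_SL2_rep.intro graded_SL2_rep_axioms.intro)
  show "grading (coarsen snd)" by (rule coarsen_grading)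
  show "\<sigma> (mat 1) (diag2 a (inverse a)) (coarsen snd i x) = a powi i *\<^sub>R coarsen snd i x"
    if "a \<noteq> 0" for a i x
  proof (rule coarsen_linear_eq)
    show "linear (\<sigma> (mat 1) (diag2 a (inverse a)))"
      using linear_\<sigma>[OF mat1 SL2_diag2[OF that]] .
    show "\<sigma> (mat 1) (diag2 a (inverse a)) (pr p x) = a powi i *\<^sub>R pr p x" if "snd p = i" for p
      using \<sigma>_diag2[OF one_neq_zero \<open>a \<noteq> 0\<close>, of "fst p" "snd p" x] that
      by (cases p) (simp add: diag2_1[simplified])
  qed
qed (use linear_\<sigma>[OF mat1] \<sigma>_1 \<sigma>_mult[OF mat1 _ mat1] weak_derivative_l in \<open>simp_all\<close>)

lemma \<sigma>_split: "g \<in> SL2 \<Longrightarrow> h \<in> SL2 \<Longrightarrow> \<sigma> g h x = \<sigma> g (mat 1) (\<sigma> (mat 1) h x)"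
  using fun_cong[OF \<sigma>_mult[of g "mat 1" "mat 1" h], of x] mat1 by simp

lemma \<sigma>_commute: "g \<in> SL2 \<Longrightarrow> h \<in> SL2 \<Longrightarrow> \<sigma> g (mat 1) (\<sigma> (mat 1) h x) = \<sigma> (mat 1) h (\<sigma> g (mat 1) x)"
  using fun_cong[OF \<sigma>_mult[of g "mat 1" "mat 1" h], of x]
    fun_cong[OF \<sigma>_mult[of "mat 1" h g "mat 1"], of x] mat1 by simp

lemma linear_A: "g \<in> SL2 \<Longrightarrow> linear (\<sigma> g (mat 1))" and linear_B: "g \<in> SL2 \<Longrightarrow> linear (\<sigma> (mat 1) g)"
  using linear_\<sigma> mat1 by blast+

lemma N_\<sigma>2: "g \<in> SL2 \<Longrightarrow> N (\<sigma> (mat 1) g x) = \<sigma> (mat 1) g (N x)"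
  by (rule A.N_commute) (simp_all add: linear_B A.u_def SL2_upper_unipotent \<sigma>_commute)

lemma w1_\<sigma>2: "g \<in> SL2 \<Longrightarrow> A.w (\<sigma> (mat 1) g x) = \<sigma> (mat 1) g (A.w x)"
  by (simp add: A.w_def SL2_matw \<sigma>_commute)

lemma w1_w2: "A.w (B.w x) = B.w (A.w x)"
  unfolding B.w_def by (rule w1_\<sigma>2[OF SL2_matw])

lemma N_w2: "N (B.w x) = B.w (N x)"
  unfolding B.w_def by (rule N_\<sigma>2[OF SL2_matw])

text \<open>The second factor commutes with the diagonal matrices of the first, and the weight
  spaces are their eigenspaces.\<close>

lemma weight_A_\<sigma>2:
  assumes "g \<in> SL2"
  shows "coarsen fst i (\<sigma> (mat 1) g x) = \<sigma> (mat 1) g (coarsen fst i x)"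
proof (rule A.linear_eq_on_pr[of "\<lambda>x. coarsen fst i (\<sigma> (mat 1) g x)" "\<lambda>x. \<sigma> (mat 1) g (coarsen fst i x)"])
  show "linear (\<lambda>x. coarsen fst i (\<sigma> (mat 1) g x))"
    using linear_compose[OF linear_B[OF assms] A.linear_pr[of i]] by (simp add: o_def)
  show "linear (\<lambda>x. \<sigma> (mat 1) g (coarsen fst i x))"
    using linear_compose[OF A.linear_pr[of i] linear_B[OF assms]] by (simp add: o_def)
  fix k
  have "A.dg 2 (\<sigma> (mat 1) g (coarsen fst k x)) = \<sigma> (mat 1) g (A.dg 2 (coarsen fst k x))"
    unfolding A.dg_def by (rule \<sigma>_commute[OF SL2_diag2 assms]) simp
  also have "\<dots> = (2 powi k) *\<^sub>R \<sigma> (mat 1) g (coarsen fst k x)"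
    by (simp add: A.dg_pr linear_scale[OF linear_B[OF assms]])
  finally have e: "coarsen fst k (\<sigma> (mat 1) g (coarsen fst k x)) = \<sigma> (mat 1) g (coarsen fst k x)"
    by (rule A.weight_vectorI)
  show "coarsen fst i (\<sigma> (mat 1) g (coarsen fst k x)) = \<sigma> (mat 1) g (coarsen fst i (coarsen fst k x))"
    using e A.pr_eq[OF e, of i] linear_0[OF linear_B[OF assms]] by (auto simp: A.pr_pr)
qed

lemma pr_split: "pr (i, j) x = coarsen fst i (coarsen snd j x)"
  by (rule pr_eqI) (auto simp: pr_coarsen pr_pr)

lemma weight_B_w1: "coarsen snd j (A.w x) = A.w (coarsen snd j x)"
proof (rule B.linear_eq_on_pr[of "\<lambda>x. coarsen snd j (A.w x)" "\<lambda>x. A.w (coarsen snd j x)"])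
  show "linear (\<lambda>x. coarsen snd j (A.w x))"
    using linear_compose[OF A.linear_w B.linear_pr[of j]] by (simp add: o_def)
  show "linear (\<lambda>x. A.w (coarsen snd j x))"
    using linear_compose[OF B.linear_pr[of j] A.linear_w] by (simp add: o_def)
  fix k
  have "B.dg 2 (A.w (coarsen snd k x)) = A.w (B.dg 2 (coarsen snd k x))"
    unfolding B.dg_def by (rule w1_\<sigma>2[symmetric, OF SL2_diag2]) simp
  also have "\<dots> = (2 powi k) *\<^sub>R A.w (coarsen snd k x)"
    by (simp add: B.dg_pr linear_scale[OF A.linear_w])
  finally have e: "coarsen snd k (A.w (coarsen snd k x)) = A.w (coarsen snd k x)"
    by (rule B.weight_vectorI)
  show "coarsen snd j (A.w (coarsen snd k x)) = A.w (coarsen snd j (coarsen snd k x))"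
    using e B.pr_eq[OF e, of j] linear_0[OF A.linear_w] by (auto simp: B.pr_pr)
qed

lemma weight_B_N: "coarsen snd j (N x) = N (coarsen snd j x)"
proof (rule A.N_commute[symmetric, OF B.linear_pr])
  fix t x
  show "coarsen snd j (A.u t x) = A.u t (coarsen snd j x)"
  proof (rule B.linear_eq_on_pr[of "\<lambda>x. coarsen snd j (A.u t x)" "\<lambda>x. A.u t (coarsen snd j x)"])
    show "linear (\<lambda>x. coarsen snd j (A.u t x))"
      using linear_compose[OF A.linear_u B.linear_pr[of j]] by (simp add: o_def)
    show "linear (\<lambda>x. A.u t (coarsen snd j x))"
      using linear_compose[OF B.linear_pr[of j] A.linear_u] by (simp add: o_def)
    fix k
    have "B.dg 2 (A.u t (coarsen snd k x)) = A.u t (B.dg 2 (coarsen snd k x))"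
      unfolding B.dg_def A.u_def
      by (rule \<sigma>_commute[symmetric, OF SL2_upper_unipotent SL2_diag2]) simp
    also have "\<dots> = (2 powi k) *\<^sub>R A.u t (coarsen snd k x)"
      by (simp add: B.dg_pr linear_scale[OF A.linear_u])
    finally have e: "coarsen snd k (A.u t (coarsen snd k x)) = A.u t (coarsen snd k x)"
      by (rule B.weight_vectorI)
    show "coarsen snd j (A.u t (coarsen snd k x)) = A.u t (coarsen snd j (coarsen snd k x))"
      using e B.pr_eq[OF e, of j] linear_0[OF A.linear_u] by (auto simp: B.pr_pr)
  qed
qed

lemma pr_N: "pr (i, j) (N x) = N (pr (i - 2, j) x)"
  by (simp add: pr_split weight_B_N A.pr_N)

lemma pr_w1: "pr (i, j) (A.w x) = A.w (pr (- i, j) x)"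
  by (simp add: pr_split weight_B_w1 A.pr_w)

lemma pr_w2: "pr (i, j) (B.w x) = B.w (pr (i, - j) x)"
  using weight_A_\<sigma>2[OF SL2_matw, of i] by (simp add: pr_split B.pr_w flip: B.w_def)

definition W :: "'v \<Rightarrow> 'v" where "W = \<sigma> matw matw"

lemma W_eq: "W x = A.w (B.w x)"
  unfolding W_def A.w_def B.w_def by (rule \<sigma>_split[OF SL2_matw SL2_matw])

lemma linear_W: "linear W"
  unfolding W_def by (rule linear_\<sigma>[OF SL2_matw SL2_matw])

lemma pr_W: "pr (i, j) (W x) = W (pr (- i, - j) x)"
  by (simp add: W_eq pr_w1 pr_w2)

lemma w1_w1: "A.w (A.w x) = dmap (\<lambda>(i, j). (-1) powi i) x"
proof (rule dmap_eqI)
  show "linear (\<lambda>x. A.w (A.w x))"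
    using linear_compose[OF A.linear_w A.linear_w] by (simp add: o_def)
  fix p x assume "pr p x = x"
  then have "coarsen fst (fst p) x = x" by (metis coarsen_pr)
  then show "A.w (A.w x) = (case p of (i, j) \<Rightarrow> (-1) powi i) *\<^sub>R x"
    using A.w_w_weight by (simp add: case_prod_unfold)
qed

lemma w2_w2: "B.w (B.w x) = dmap (\<lambda>(i, j). (-1) powi j) x"
proof (rule dmap_eqI)
  show "linear (\<lambda>x. B.w (B.w x))"
    using linear_compose[OF B.linear_w B.linear_w] by (simp add: o_def)
  fix p x assume "pr p x = x"
  then have "coarsen snd (snd p) x = x" by (metis coarsen_pr)
  then show "B.w (B.w x) = (case p of (i, j) \<Rightarrow> (-1) powi j) *\<^sub>R x"
    using B.w_w_weight by (simp add: case_prod_unfold)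
qed

text \<open>The squares of \<open>A.w\<close> and \<open>B.w\<close> act in degree
  \<open>(i, j)\<close> by \<open>(-1) powi i\<close> and \<open>(-1) powi j\<close>, and
  \<open>i + j\<close> is odd.\<close>

lemma W_W: "W (W x) = - x"
proof -
  have "W (W x) = A.w (A.w (B.w (B.w x)))" by (simp add: W_eq w1_w2)
  also have "\<dots> = dmap (\<lambda>i. -1) x"
    unfolding w1_w1 w2_w2 dmap_dmap
  proof (rule dmap_cong)
    fix p assume "pr p x \<noteq> 0"
    then have "odd (fst p + snd p)" using weights[of "fst p" "snd p" x] by simp
    then show "(case p of (i, j) \<Rightarrow> (- 1) powi i) * (case p of (i, j) \<Rightarrow> (- 1) powi j) = (-1::real)"
      by (auto simp: case_prod_unfold power_int_minus_left)
  qed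
  also have "\<dots> = - x"
    by (rule dmap_eqI[symmetric]) (auto intro: linear_uminus)
  finally show ?thesis .
qed

lemma \<psi>_ip: "\<psi> x y = - ip x (W y)"
proof -
  have "ip x (W (- y)) = \<psi> x y"
    unfolding polarization_ip_def
    using W_W[of "- y"] by (simp add: W_def)
  then show ?thesis
    using inner_product_onD(11)[OF inner_product] by (simp add: linear_neg[OF linear_W])
qed

lemma ip_\<psi>: "ip x y = \<psi> x (W y)"
  by (simp add: polarization_ip_def W_def)

lemma \<psi>_add: "\<psi> x (y + z) = \<psi> x y + \<psi> x z" "\<psi> (y + z) x = \<psi> y x + \<psi> z x"
  and \<psi>_scale: "\<psi> x (r *\<^sub>R y) = r * \<psi> x y" "\<psi> (r *\<^sub>R y) x = r * \<psi> y x"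
  and \<psi>_neg: "\<psi> x (- y) = - \<psi> x y" "\<psi> (- y) x = - \<psi> y x"
  by (simp_all add: \<psi>_ip linear_add[OF linear_W] linear_scale[OF linear_W] linear_neg[OF linear_W]
      inner_product_onD(5-)[OF inner_product])

sublocale O: orthogonal_grading pr ip
proof
  show "inner_product_on ip" by (rule inner_product)
  fix p q :: "int \<times> int" and x y assume "p \<noteq> q"
  obtain i j i' j' where pq: "p = (i, j)" "q = (i', j')" by fastforce
  have "W (pr (i', j') y) = pr (- i', - j') (W y)" by (simp add: pr_W)
  then show "ip (pr p x) (pr q y) = 0"
    using \<open>p \<noteq> q\<close> by (auto simp: pq ip_\<psi> intro: \<psi>_degree)
qed

text \<open>\<open>\<psi>\<close> is antisymmetric and \<open>W\<close> has square
  \<open>-1\<close>, so the two signs cancel. In terms of \<open>\<psi>\<close> this is invariance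
  under \<open>W\<close>.\<close>

lemma ip_W: "ip (W x) (W y) = ip x y"
proof -
  have "ip (W x) (W y) = - ip (W y) (W (W (W x)))"
    by (simp add: W_W O.ip_simps linear_neg[OF linear_W] O.ip_sym)
  also have "\<dots> = \<psi> (W y) (W (W x))" by (simp add: \<psi>_ip)
  also have "\<dots> = - \<psi> (W (W x)) (W y)" by (rule \<psi>_antisym)
  also have "\<dots> = ip x y" by (simp add: W_W ip_\<psi> \<psi>_neg)
  finally show ?thesis .
qed

lemma \<psi>_W: "\<psi> (W x) (W y) = \<psi> x y"
  using ip_W[of x "W y"] by (simp add: \<psi>_ip)

lemma coarsen_snd_zero:
  assumes "\<bar>j\<bar> > 1" shows "coarsen snd j x = 0"
proof (rule pr_all_zero)
  fix p :: "int \<times> int"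
  obtain a b where p: "p = (a, b)" by fastforce
  show "pr p (coarsen snd j x) = 0"
    using weights[of a b x] assms by (cases "pr (a, b) x = 0") (auto simp: p pr_coarsen)
qed

lemma l_top: "coarsen snd j x = x \<Longrightarrow> j \<ge> 0 \<Longrightarrow> l x = 0"
proof -
  assume x: "coarsen snd j x = x" and j: "j \<ge> 0"
  have "l x = coarsen snd (j + 2) (l x)" using B.N_weight[OF x] by simp
  also have "\<dots> = 0" using j by (intro coarsen_snd_zero) simp
  finally show ?thesis .
qed

lemma l_l: "l (l x) = 0"
proof -
  have lin: "linear (\<lambda>x. l (l x))" using linear_compose[OF B.linear_N B.linear_N] by (simp add: o_def)
  have "l (l (coarsen snd j x)) = 0" for j x
  proof (cases "j \<ge> -1")
    case True
    show ?thesis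
    proof (rule l_top)
      show "coarsen snd (j + 2) (l (coarsen snd j x)) = l (coarsen snd j x)"
        by (rule B.N_weight) (simp add: B.pr_pr)
    qed (use True in simp)
  next
    case False
    then show ?thesis using linear_0[OF lin] coarsen_snd_zero[of j x] by simp
  qed
  then show ?thesis by (rule B.linear_eq_on_pr[OF lin linear_zero])
qed

text \<open>The exponential series of \<open>t l\<close> stops after the linear term by
  \<open>l_l\<close>.\<close>

lemma u2_eq: "B.u t x = x + t *\<^sub>R l x"
proof -
  have lin: "linear (\<lambda>x. x + t *\<^sub>R l x)"
    using B.linear_N by (intro linear_compose_add linear_id[unfolded id_def] linear_compose_scale_right)
  show ?thesis
  proof (rule B.linear_eq_on_pr[OF B.linear_u lin])
    fix j
    define y where "y = coarsen snd j x"
    have y: "coarsen snd j y = y" by (simp add: y_def B.pr_pr)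
    have ly: "coarsen snd (j + 2) (l y) = l y" by (rule B.N_weight[OF y])
    have "B.u t y = y + t *\<^sub>R l y"
    proof (rule B.pr_eqI)
      fix k
      have r: "coarsen snd k (y + t *\<^sub>R l y) = (if k = j then y else 0) + (if k = j + 2 then t *\<^sub>R l y else 0)"
        using y ly B.pr_eq[OF y, of k] B.pr_eq[OF ly, of k]
        by (auto simp: linear_add[OF B.linear_pr] linear_scale[OF B.linear_pr])
      show "coarsen snd k (B.u t y) = coarsen snd k (y + t *\<^sub>R l y)"
      proof (cases "\<exists>n. k = j + 2 * int n")
        case True
        then obtain n where n: "k = j + 2 * int n" by blast
        have p: "coarsen snd k (B.u t y) = (t ^ n / fact n) *\<^sub>R (l ^^ n) y"
          unfolding n by (rule B.pr_u_exp[OF y])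
        consider "n = 0" | "n = 1" | m where "n = Suc (Suc m)" by (metis One_nat_def nat.exhaust)
        then show ?thesis
        proof cases
          case 3
          have "(l ^^ n) y = (l ^^ m) (l (l y))"
            unfolding 3 by (metis comp_apply funpow_Suc_right)
          also have "\<dots> = 0" unfolding l_l by (induction m) (auto simp: linear_0[OF B.linear_N])
          finally show ?thesis unfolding r p using 3 n by simp
        qed (use r p n in auto)
      next
        case False
        then have "k \<noteq> j" "k \<noteq> j + 2" by (metis add.right_neutral mult_zero_right of_nat_0, metis mult.right_neutral of_nat_1)
        then show ?thesis unfolding r using False B.pr_u_zero[OF y, of k t] by auto
      qed
    qed
    then show "B.u t (coarsen snd j x) = coarsen snd j x + t *\<^sub>R l (coarsen snd j x)"
      by (simp add: y_def)
  qed
qed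

text \<open>The terms linear in \<open>t\<close> cancel by \<open>\<psi>_l\<close>; the quadratic
  one is \<open>- \<psi> x (l (l y))\<close> times the square of \<open>t\<close>, hence
  zero.\<close>

lemma \<psi>_u2: "\<psi> (B.u t x) (B.u t y) = \<psi> x y"
  using \<psi>_l[of x y] \<psi>_l[of x "l y"]
  by (simp add: u2_eq \<psi>_add \<psi>_scale l_l) (simp add: \<psi>_ip linear_0[OF linear_W] O.ip_simps)

text \<open>\<open>B.w\<close> is the product of \<open>B.u 1\<close>, its lower unipotent conjugate
  \<open>v\<close>, and \<open>B.u 1\<close>. In \<open>v\<close> the conjugation by
  \<open>B.w\<close> may be replaced by that by \<open>W\<close>, since the first factor commutes
  with \<open>B.u 1\<close>; and \<open>W\<close> preserves \<open>\<psi>\<close>.\<close>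

lemma \<psi>_w2: "\<psi> (B.w x) (B.w y) = \<psi> x y"
proof -
  define v where "v z = B.w (B.u 1 (B.w (B.w (B.w z))))" for z
  have v: "v z = - W (B.u 1 (W z))" for z
  proof -
    have "W (B.u 1 (W z)) = A.w (A.w (B.w (B.u 1 (B.w z))))"
      by (simp add: W_eq B.u_def w1_\<sigma>2 SL2_upper_unipotent w1_w2)
    also have "\<dots> = A.w (A.w (B.w (B.w (B.w (B.w (B.w (B.u 1 (B.w z))))))))"
      by (simp add: B.w_w_w_w)
    also have "\<dots> = W (W (B.w (B.w (B.w (B.u 1 (B.w z))))))"
      by (simp add: W_eq w1_w2)
    also have "\<dots> = - B.w (B.w (B.w (B.u 1 (B.w z))))" by (rule W_W)
    also have "B.w (B.w (B.w (B.u 1 (B.w z)))) = v z"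
      unfolding v_def B.u_def B.w_w_commute[OF SL2_upper_unipotent, symmetric] by simp
    finally show ?thesis by simp
  qed
  have "\<psi> (v x) (v y) = \<psi> x y" for x y
    by (simp add: v \<psi>_neg \<psi>_W \<psi>_u2)
  moreover have "B.w z = B.u 1 (v (B.u 1 z))" for z
    unfolding v_def by (rule B.w_factorization)
  ultimately show ?thesis by (simp add: \<psi>_u2)
qed

lemma ip_w2: "ip (B.w x) (B.w y) = ip x y"
proof -
  have "W (B.w y) = B.w (W y)" by (simp add: W_eq w1_w2)
  then show ?thesis by (simp add: ip_\<psi> \<psi>_w2)
qed

text \<open>With \<open>B.u t\<close> linear in \<open>t\<close>, the factorization of
  \<open>B.w\<close> expands to \<open>(x + f) + (2 *\<^sub>R l x + l f)\<close>, where the brackets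
  have weights \<open>-1\<close> and \<open>1\<close>. But \<open>B.w x\<close> has weight
  \<open>1\<close>, so \<open>f = - x\<close>, and what remains is \<open>l x\<close>.\<close>

lemma l_eq_w2:
  assumes x: "coarsen snd (-1) x = x"
  shows "l x = B.w x"
proof -
  define f where "f = B.w (l (B.w (B.w (B.w (l x)))))"
  have www: "coarsen snd (- j) (B.w (B.w (B.w z))) = B.w (B.w (B.w z))" if "coarsen snd j z = z" for j z
    using B.w_weight[OF B.w_weight[OF B.w_weight[OF that]]] by simp
  have lx: "coarsen snd 1 (l x) = l x" using B.N_weight[OF x] by simp
  have l1: "l (B.w (B.w (B.w x))) = 0"
    by (rule l_top[of 1]) (use www[OF x] in auto)
  have f: "coarsen snd (-1) f = f"
    unfolding f_def using B.w_weight[OF B.N_weight[OF www[OF lx]]] by simp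
  have "B.w x = B.u 1 (B.w (B.u 1 (B.w (B.w (B.w (x + l x))))))"
    using B.w_factorization[of x] by (simp add: u2_eq)
  also have "B.u 1 (B.w (B.w (B.w (x + l x)))) = B.w (B.w (B.w x)) + B.w (B.w (B.w (l x))) + l (B.w (B.w (B.w (l x))))"
    by (simp add: u2_eq linear_add[OF B.linear_w] linear_add[OF B.linear_N] l1)
  also have "B.w \<dots> = x + l x + f"
    by (simp add: linear_add[OF B.linear_w] B.w_w_w_w f_def)
  also have "B.u 1 (x + l x + f) = (x + f) + (2 *\<^sub>R l x + l f)"
    by (simp add: u2_eq linear_add[OF B.linear_N] l_l scaleR_2)
  finally have w: "B.w x = (x + f) + (2 *\<^sub>R l x + l f)" .
  have w1: "coarsen snd 1 (B.w x) = B.w x" using B.w_weight[OF x] by simp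
  have r: "coarsen snd 1 (2 *\<^sub>R l x + l f) = 2 *\<^sub>R l x + l f"
    using lx B.N_weight[OF f] by (simp add: linear_add[OF B.linear_pr] linear_scale[OF B.linear_pr])
  have "coarsen snd (-1) (B.w x) = x + f"
    unfolding w using B.pr_eq[OF r, of "-1"] x f by (simp add: linear_add[OF B.linear_pr])
  moreover have "coarsen snd (-1) (B.w x) = 0" using B.pr_eq[OF w1, of "-1"] by simp
  ultimately have "f = - x" by (simp add: eq_neg_iff_add_eq_0 add.commute)
  then show ?thesis using w by (simp add: linear_neg[OF B.linear_N] scaleR_2)
qed

lemma bounded_w2: "bounded_wrt ip B.w"
  unfolding bounded_wrt_def using B.linear_w by (intro conjI exI[of _ 1]) (simp_all add: ip_w2)

text \<open>\<open>l\<close> is the isometry \<open>B.w\<close> preceded by the projection onto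
  \<open>j = -1\<close>.\<close>

lemma bounded_u2: "bounded_wrt ip (B.u t)"
proof -
  have lw: "l x = B.w (coarsen snd (-1) x)" for x
  proof (rule B.linear_eq_on_pr[of l "\<lambda>x. B.w (coarsen snd (-1) x)", OF B.linear_N])
    show "linear (\<lambda>x. B.w (coarsen snd (-1) x))"
      using linear_compose[OF B.linear_pr B.linear_w] by (simp add: o_def)
    fix j :: int
    consider "j = -1" | "j \<ge> 0" | "j < -1" by linarith
    then show "l (coarsen snd j x) = B.w (coarsen snd (-1) (coarsen snd j x))"
    proof cases
      case 1
      then show ?thesis using l_eq_w2[of "coarsen snd (-1) x"] by (simp add: B.pr_pr)
    next
      case 2
      then show ?thesis using l_top[of j "coarsen snd j x"] linear_0[OF B.linear_w] by (simp add: B.pr_pr)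
    next
      case 3
      then show ?thesis using coarsen_snd_zero[of j x] linear_0[OF B.linear_w] linear_0[OF B.linear_N] B.pr_0 by simp
    qed
  qed
  have "bounded_wrt ip (coarsen snd (-1))"
    unfolding coarsen_def by (rule O.bounded_dmap[where C = 1]) auto
  from bounded_wrt_compose[OF bounded_w2 this] have "bounded_wrt ip l" by (simp add: lw[abs_def])
  moreover have "bounded_wrt ip (\<lambda>x. x)"
    unfolding bounded_wrt_def by (intro conjI exI[of _ 1]) (simp_all add: linear_id[unfolded id_def])
  ultimately have "bounded_wrt ip (\<lambda>x. x + t *\<^sub>R l x)"
    by (intro bounded_wrt_add bounded_wrt_scale inner_product)
  then show ?thesis by (simp add: u2_eq[abs_def])
qed

lemma bounded_dg2:
  assumes "a \<noteq> 0" shows "bounded_wrt ip (B.dg a)"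
proof -
  have "B.dg a x = dmap (\<lambda>(i, j). a powi j) x" for x
  proof (rule dmap_eqI[OF B.linear_dg[OF assms]])
    fix p x assume "pr p x = x"
    then have "coarsen snd (snd p) x = x" by (metis coarsen_pr)
    then show "B.dg a x = (case p of (i, j) \<Rightarrow> a powi j) *\<^sub>R x"
      using B.\<tau>_diag2_weight[OF assms] by (simp add: case_prod_unfold)
  qed
  moreover have "bounded_wrt ip (dmap (\<lambda>(i, j). a powi j))"
  proof (rule O.bounded_dmap)
    fix p x assume "pr p x \<noteq> 0"
    then have "\<bar>snd p\<bar> \<le> 1" using weights[of "fst p" "snd p" x] by simp
    then have "snd p = -1 \<or> snd p = 0 \<or> snd p = 1" by linarith
    \<comment> \<open>One summand for each of the values \<open>0\<close>, \<open>1\<close> and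
      \<open>-1\<close> of \<open>j\<close>.\<close>
    then show "\<bar>case p of (i, j) \<Rightarrow> a powi j\<bar> \<le> 1 + \<bar>a\<bar> + \<bar>inverse a\<bar>"
      by (auto simp: case_prod_unfold power_int_minus)
  qed
  ultimately show ?thesis by (metis ext)
qed

lemma bounded_\<sigma>2:
  assumes "g \<in> SL2" shows "bounded_wrt ip (\<sigma> (mat 1) g)"
  using assms
proof (cases rule: SL2_bruhat_cases)
  case (1 a t)
  have "\<sigma> (mat 1) g = (\<lambda>x. B.dg a (B.u t x))"
    unfolding 1(2) B.dg_def B.u_def
    using B.\<tau>_mult[OF SL2_diag2[OF 1(1)] SL2_upper_unipotent, of t] by (simp add: o_def)
  then show ?thesis using bounded_wrt_compose[OF bounded_dg2[OF 1(1)] bounded_u2] by simp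
next
  case (2 s a t)
  have "\<sigma> (mat 1) g = (\<lambda>x. B.u s (B.dg a (B.w (B.u t x))))"
    unfolding 2(2) B.dg_def B.u_def B.w_def
    using 2(1) by (simp add: B.\<tau>_mult SL2_mult SL2_diag2 SL2_upper_unipotent SL2_matw o_def)
  then show ?thesis
    using bounded_wrt_compose[OF bounded_u2 bounded_wrt_compose[OF bounded_dg2[OF 2(1)]
      bounded_wrt_compose[OF bounded_w2 bounded_u2]]] by simp
qed

end

section \<open>The kernel of \<open>N\<close> and the orthogonal complement of its image\<close>

context lefschetz_module
begin

text \<open>The orthogonal complement of the image of \<open>N\<close>, which serves as a model of
  \<open>coker N\<close> inside the space itself.\<close>

definition coprim :: "'v set" where
  "coprim = {y. \<forall>z. ip y (N z) = 0}"

text \<open>The third power of \<open>A.w\<close> is its inverse, so this is minus the conjugate of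
  \<open>N\<close> by \<open>A.w\<close>: the lowering operator of the triple that contains
  \<open>N\<close>. It is the adjoint of \<open>N\<close>, by \<open>ip_N\<close>.\<close>

definition Nadj :: "'v \<Rightarrow> 'v" where
  "Nadj y = - A.w (A.w (A.w (N (A.w y))))"

lemma ip_N: "ip (N x) y = ip x (Nadj y)"
proof -
  have "W (Nadj y) = - B.w (A.w (A.w (A.w (A.w (N (A.w y))))))"
    by (simp add: W_eq Nadj_def linear_neg[OF A.linear_w] linear_neg[OF B.linear_w] w1_w2)
  also have "\<dots> = - N (W y)" by (simp add: A.w_w_w_w W_eq N_w2 w1_w2)
  finally have "ip x (Nadj y) = - \<psi> x (N (W y))" by (simp add: ip_\<psi> \<psi>_neg)
  also have "\<dots> = ip (N x) y" by (simp add: ip_\<psi> \<psi>_N)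
  finally show ?thesis ..
qed

text \<open>A vector orthogonal to the image is orthogonal to \<open>N (Nadj y)\<close>, so
  \<open>Nadj y\<close> has norm \<open>0\<close>; and \<open>Nadj y\<close> is
  \<open>N (A.w y)\<close> up to an invertible operator. Thus \<open>A.w\<close> carries the
  complement of the image to the kernel.\<close>

lemma coprim_iff: "y \<in> coprim \<longleftrightarrow> N (A.w y) = 0"
proof
  assume "y \<in> coprim"
  then have "ip (N (Nadj y)) y = 0" by (simp add: coprim_def O.ip_sym)
  then have "Nadj y = 0" by (auto simp: ip_N dest: O.ip_eq_0)
  then have "A.w (- Nadj y) = 0" by (simp add: linear_0[OF A.linear_w])
  then show "N (A.w y) = 0" by (simp add: Nadj_def A.w_w_w_w)
next
  assume "N (A.w y) = 0"
  then have "Nadj y = 0" by (simp add: Nadj_def linear_0[OF A.linear_w])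
  then have "ip y (N z) = 0" for z
    by (metis ip_N O.ip_sym O.ip_simps(5))
  then show "y \<in> coprim" by (simp add: coprim_def)
qed

lemma subspace_coprim: "subspace coprim"
  by (auto simp: coprim_def subspace_def O.ip_simps)

lemma N_coprim: "N z \<in> coprim \<Longrightarrow> N z = 0"
  using O.ip_eq_0[of "N z"] by (simp add: coprim_def)

text \<open>For lack of completeness the projection is taken in the span \<open>M\<close> of the
  orbit of \<open>x\<close>, which has finite dimension and is stable under the first factor, hence
  under \<open>N\<close> and its adjoint.\<close>

lemma coprim_decomposition: "\<exists>z. x - N z \<in> coprim"
proof -
  obtain B where B: "finite B" "\<And>g. g \<in> SL2 \<Longrightarrow> \<sigma> g (mat 1) x \<in> span B"
    using A.finite_dimensional_orbit[of x] by blast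
  define M where "M = span ((\<lambda>g. \<sigma> g (mat 1) x) ` SL2)"
  have inv: "\<sigma> h (mat 1) y \<in> M" if h: "h \<in> SL2" and y: "y \<in> M" for h y
    using y unfolding M_def
  proof (induction rule: span_induct_alt)
    case base
    then show ?case by (simp add: linear_0[OF linear_A[OF h]] span_zero)
  next
    case (step c z y)
    then obtain g where g: "g \<in> SL2" "z = \<sigma> g (mat 1) x" by blast
    have "\<sigma> h (mat 1) z = \<sigma> (h ** g) (mat 1) x"
      using A.\<tau>_mult[OF h g(1)] g(2) by simp
    then have "\<sigma> h (mat 1) z \<in> (\<lambda>g. \<sigma> g (mat 1) x) ` SL2"
      using SL2_mult[OF h g(1)] by blast
    then show ?case
      using step(2) unfolding linear_add[OF linear_A[OF h]] linear_scale[OF linear_A[OF h]]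
      by (intro span_add span_scale) (simp_all add: span_base)
  qed
  have sub: "subspace M" by (simp add: M_def)
  have NM: "N y \<in> M" if "y \<in> M" for y
    using inv that by (intro A.N_in_subspace[OF sub]) (simp add: A.u_def SL2_upper_unipotent)
  have wM: "A.w y \<in> M" if "y \<in> M" for y
    using inv[OF SL2_matw that] by (simp add: A.w_def)
  have FM: "Nadj y \<in> M" if "y \<in> M" for y
    using that by (simp add: Nadj_def subspace_neg[OF sub] wM NM)
  obtain B' where B': "B' \<subseteq> M" "independent B'" "span B' = M"
    using basis_exists[of M] sub by (metis span_subspace)
  have "M \<subseteq> span B"
    unfolding M_def using B(2) by (intro span_minimal) auto
  then have "finite B'" using B' B(1) independent_span_bound[of B B'] by auto
  then have fin: "finite (N ` B')" by simp
  have NB: "span (N ` B') = N ` M"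
    using linear_span_image[OF A.linear_N, of B'] B'(3) by simp
  obtain y where y: "y \<in> N ` M" "\<forall>b\<in>N ` M. ip (x - y) b = 0"
    using orthogonal_decomposition[OF inner_product fin, of x] unfolding NB by blast
  then obtain z where z: "z \<in> M" "y = N z" by blast
  have "\<sigma> (mat 1) (mat 1) x \<in> M" unfolding M_def using mat1 by (blast intro: span_base)
  then have xM: "x \<in> M" by (simp add: \<sigma>_1)
  then have FyM: "Nadj (x - N z) \<in> M" using NM z sub by (intro FM) (simp add: subspace_diff)
  \<comment> \<open>Orthogonality to the image of \<open>M\<close> implies orthogonality to the
    whole image of \<open>N\<close>: as \<open>Nadj (x - N z)\<close> lies in \<open>M\<close>, its
    squared norm is a product of \<open>x - N z\<close> with an element of the image of
    \<open>M\<close>.\<close>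
  have "ip (Nadj (x - N z)) (Nadj (x - N z)) = ip (x - N z) (N (Nadj (x - N z)))"
    using ip_N[of "Nadj (x - N z)" "x - N z"] by (simp add: O.ip_sym)
  also have "\<dots> = 0" using y(2) FyM z(2) by blast
  finally have F0: "Nadj (x - N z) = 0" by (rule O.ip_eq_0)
  have "ip (x - N z) (N v) = 0" for v
    by (metis ip_N F0 O.ip_sym O.ip_simps(5))
  then show ?thesis by (auto simp: coprim_def)
qed

lemma ker_pr: "N x = 0 \<Longrightarrow> N (pr (i, j) x) = 0"
  using pr_N[of "i + 2" j x] by (simp add: pr_0)

lemma ker_pr_negative: "N x = 0 \<Longrightarrow> i < 0 \<Longrightarrow> pr (i, j) x = 0"
  by (rule A.primitive_weight_neg[of i]) (simp_all add: ker_pr coarsen_pr)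

lemma coprim_pr: "y \<in> coprim \<Longrightarrow> pr (i, j) y \<in> coprim"
  using ker_pr[of "A.w y" "- i" j] by (simp add: coprim_iff pr_w1)

lemma coprim_pr_positive:
  assumes "y \<in> coprim" "i > 0" shows "pr (i, j) y = 0"
proof -
  have "A.w (pr (i, j) y) = 0"
    using ker_pr_negative[of "A.w y" "- i" j] assms by (simp add: coprim_iff pr_w1)
  then show ?thesis using A.w_w_w_w[of "pr (i, j) y"] by (simp add: linear_0[OF A.linear_w])
qed

lemma dmap_ker: "N x = 0 \<Longrightarrow> N (dmap c x) = 0"
  unfolding dmap_def
  by (simp add: linear_sum[OF A.linear_N] linear_scale[OF A.linear_N] ker_pr split_paired_all)

lemma \<sigma>2_ker: "g \<in> SL2 \<Longrightarrow> N x = 0 \<Longrightarrow> N (\<sigma> (mat 1) g x) = 0"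
  by (simp add: N_\<sigma>2 linear_0[OF linear_B])

lemma \<sigma>2_coprim: "g \<in> SL2 \<Longrightarrow> x \<in> coprim \<Longrightarrow> \<sigma> (mat 1) g x \<in> coprim"
  by (simp add: coprim_iff w1_\<sigma>2 \<sigma>2_ker)

definition phi :: "'v \<Rightarrow> 'v" where
  "phi = dmap (\<lambda>(i, j). of_int (1 + j - i) / 2)"

lemma bounded_phi_commutator:
  assumes g: "g \<in> SL2"
  shows "bounded_wrt ip (\<lambda>x. phi (\<sigma> (mat 1) g x) - \<sigma> (mat 1) g (phi x))"
proof -
  define H where "H = dmap (\<lambda>(i, j). of_int (1 + j) / 2)"
  define I where "I = A.dmap (\<lambda>i. of_int i / 2)"
  have phi: "phi x = H x - I x" for x
  proof -
    have I_dmap: "I x = dmap (\<lambda>(i, j). of_int i / 2) x"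
      unfolding I_def
    proof (rule dmap_eqI[OF A.linear_dmap])
      fix p x assume "pr p x = x"
      then have "coarsen fst (fst p) x = x" by (metis coarsen_pr)
      from A.dmap_homogeneous[OF this]
      show "A.dmap (\<lambda>i. real_of_int i / 2) x = (case p of (i, j) \<Rightarrow> real_of_int i / 2) *\<^sub>R x"
        by (simp add: case_prod_unfold)
    qed
    show ?thesis
      unfolding I_dmap by (rule pr_eqI) (simp add: phi_def H_def pr_dmap linear_diff[OF linear_pr] diff_divide_distrib
        case_prod_unfold flip: scaleR_diff_left)
  qed
  have I: "I (\<sigma> (mat 1) g x) = \<sigma> (mat 1) g (I x)" for x
    unfolding I_def
    by (rule A.pr_eqI) (simp add: A.pr_dmap weight_A_\<sigma>2[OF g] linear_scale[OF linear_B[OF g]])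
  have bH: "bounded_wrt ip H"
    unfolding H_def
  proof (rule O.bounded_dmap)
    fix p x assume "pr p x \<noteq> 0"
    then have "\<bar>snd p\<bar> \<le> 1" using weights[of "fst p" "snd p" x] by simp
    then have "0 \<le> 1 + snd p" "1 + snd p \<le> 2" by linarith+
    then have "0 \<le> real_of_int (1 + snd p)" "real_of_int (1 + snd p) \<le> 2" by linarith+
    then show "\<bar>case p of (i, j) \<Rightarrow> real_of_int (1 + j) / 2\<bar> \<le> 1" by (simp add: case_prod_unfold)
  qed
  have "bounded_wrt ip (\<lambda>x. H (\<sigma> (mat 1) g x) - \<sigma> (mat 1) g (H x))"
    by (rule bounded_wrt_diff[OF inner_product bounded_wrt_compose[OF bH bounded_\<sigma>2[OF g]]
          bounded_wrt_compose[OF bounded_\<sigma>2[OF g] bH]])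
  then show ?thesis by (simp add: phi I linear_diff[OF linear_B[OF g]])
qed

text \<open>Inverts \<open>N ^^ n\<close> on primitive vectors by an explicit multiple of
  \<open>A.w\<close>. This is the inverse isomorphism that enters \<open>\<delta>\<close>, and it
  lands in the complement of the image.\<close>

lemma primitive_lift:
  assumes "pr (int n, j) x = x" "N x = 0"
  defines "y \<equiv> ((-1) ^ n / fact n) *\<^sub>R A.w x"
  shows "(N ^^ n) y = x" "pr (- int n, j) y = y" "y \<in> coprim"
proof -
  have c: "coarsen fst (int n) x = x" using assms(1) by (metis coarsen_pr fst_conv)
  have lin: "linear (N ^^ n)" by (induction n) (auto simp: id_def o_def intro: linear_compose[OF _ A.linear_N, unfolded o_def] linear_id[unfolded id_def])
  show "(N ^^ n) y = x"
    using A.primitive_eq_N_pow[OF c assms(2)] by (simp add: y_def linear_scale[OF lin])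
  show "pr (- int n, j) y = y"
    by (simp add: y_def linear_scale[OF linear_pr] pr_w1 assms(1))
  have "A.w (A.w x) = ((-1) powi int n) *\<^sub>R x" by (rule A.w_w_weight[OF c])
  then have "N (A.w (A.w x)) = 0" by (simp add: linear_scale[OF A.linear_N] assms(2))
  then show "y \<in> coprim" by (simp add: y_def coprim_iff linear_scale[OF A.linear_w] linear_scale[OF A.linear_N])
qed

end


section \<open>Operators on a Hilbert completion\<close>

lemma continuous_eq_on_dense:
  fixes f g :: "'a::topological_space \<Rightarrow> 'b::t2_space"
  assumes "closure S = UNIV" "continuous_on UNIV f" "continuous_on UNIV g" "\<And>x. x \<in> S \<Longrightarrow> f x = g x"
  shows "f x = g x"
proof -
  have "closed {x. f x = g x}" using assms(2,3) by (rule closed_Collect_eq)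
  then have "closure S \<subseteq> {x. f x = g x}" using assms(4) by (intro closure_minimal) auto
  then show ?thesis using assms(1) by blast
qed

lemma subspace_closure:
  fixes S :: "'a::real_normed_vector set"
  assumes S: "subspace S" shows "subspace (closure S)"
proof (rule subspaceI)
  show "0 \<in> closure S" using subspace_0[OF S] closure_subset by blast
  fix x y assume xy: "x \<in> closure S" "y \<in> closure S"
  obtain f g where f: "\<And>n::nat. f n \<in> S" "f \<longlonglongrightarrow> x" and g: "\<And>n::nat. g n \<in> S" "g \<longlonglongrightarrow> y"
    using xy unfolding closure_sequential by blast
  have "(\<lambda>n. f n + g n) \<longlonglongrightarrow> x + y" "\<And>n. f n + g n \<in> S"
    using f g subspace_add[OF S] by (auto intro: tendsto_add)
  then show "x + y \<in> closure S" unfolding closure_sequential by (intro exI[of _ "\<lambda>n. f n + g n"]) simp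
  fix r
  have "(\<lambda>n. r *\<^sub>R f n) \<longlonglongrightarrow> r *\<^sub>R x" "\<And>n. r *\<^sub>R f n \<in> S"
    using f subspace_scale[OF S] by (auto intro: tendsto_intros)
  then show "r *\<^sub>R x \<in> closure S" unfolding closure_sequential by (intro exI[of _ "\<lambda>n. r *\<^sub>R f n"]) simp
qed

section \<open>Extension by continuity and closed graphs\<close>

locale completion =
  fixes ip :: "'v::real_vector \<Rightarrow> 'v \<Rightarrow> real" and \<iota> :: "'v \<Rightarrow> 'h::{real_inner, complete_space}"
  assumes ip: "inner_product_on ip" and completion: "hilbert_completion ip \<iota>"
begin

lemma linear_\<iota>: "linear \<iota>" and \<iota>_inner: "\<iota> x \<bullet> \<iota> y = ip x y" and dense: "closure (range \<iota>) = UNIV"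
  using completion by (auto simp: hilbert_completion_def)

lemma \<iota>_norm: "(norm (\<iota> x))\<^sup>2 = ip x x"
  by (simp add: power2_norm_eq_inner \<iota>_inner)

lemma \<iota>_eq_iff: "\<iota> x = \<iota> y \<longleftrightarrow> x = y"
proof
  assume "\<iota> x = \<iota> y"
  then have "ip (x - y) (x - y) = 0"
    using \<iota>_norm[of "x - y"] by (simp add: linear_diff[OF linear_\<iota>])
  then show "x = y" using inner_product_onD(3)[OF ip, of "x - y"] by force
qed simp

lemma dense_eq:
  assumes "continuous_on UNIV f" "continuous_on UNIV g" "\<And>x. f (\<iota> x) = g (\<iota> x)"
  shows "f v = (g v :: 'c::t2_space)"
  by (rule continuous_eq_on_dense[OF dense assms(1,2)]) (use assms(3) in auto)

lemma dense_approx: "e > 0 \<Longrightarrow> \<exists>x. norm (\<iota> x - v) < e"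
  using closure_approachable[of v "range \<iota>"] dense by (auto simp: dist_norm)

lemma extension_exists:
  assumes "bounded_wrt ip f"
  shows "\<exists>R. bounded_linear R \<and> (\<forall>x. R (\<iota> x) = \<iota> (f x))"
proof -
  obtain C where C: "C \<ge> 0" "\<And>x. ip (f x) (f x) \<le> C * ip x x" and f: "linear f"
    using assms unfolding bounded_wrt_def by blast
  define g where "g v = \<iota> (f (inv_into UNIV \<iota> v))" for v
  have inj: "inj \<iota>" by (rule injI) (simp add: \<iota>_eq_iff)
  have g: "g (\<iota> x) = \<iota> (f x)" for x by (simp add: g_def inj)
  have nf: "norm (\<iota> (f x)) \<le> sqrt C * norm (\<iota> x)" for x
  proof (rule power2_le_imp_le)
    show "(norm (\<iota> (f x)))\<^sup>2 \<le> (sqrt C * norm (\<iota> x))\<^sup>2"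
      using C(2)[of x] C(1) by (simp add: \<iota>_norm power_mult_distrib)
  qed (use C in simp)
  have lip: "dist (g (\<iota> x)) (g (\<iota> y)) \<le> sqrt C * dist (\<iota> x) (\<iota> y)" for x y
    using nf[of "x - y"] by (simp add: g dist_norm linear_diff[OF linear_\<iota>] linear_diff[OF f])
  have "uniformly_continuous_on (range \<iota>) g"
    unfolding uniformly_continuous_on_def
  proof (intro allI impI)
    fix e :: real assume e: "e > 0"
    show "\<exists>d>0. \<forall>x\<in>range \<iota>. \<forall>x'\<in>range \<iota>. dist x' x < d \<longrightarrow> dist (g x') (g x) < e"
    \<comment> \<open>The summand \<open>1\<close> keeps the denominator positive when
      \<open>C = 0\<close>.\<close>
    proof (intro exI[of _ "e / (sqrt C + 1)"] conjI ballI impI)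
      show "e / (sqrt C + 1) > 0" using e C(1) by (simp add: add_nonneg_pos)
      fix v v' assume "v \<in> range \<iota>" "v' \<in> range \<iota>" and d: "dist v' v < e / (sqrt C + 1)"
      then have "dist (g v') (g v) \<le> sqrt C * dist v' v" using lip by auto
      also have "\<dots> \<le> (sqrt C + 1) * dist v' v" by (simp add: mult_right_mono)
      also have "\<dots> < e" using d C(1) pos_less_divide_eq[of "sqrt C + 1" "dist v' v" e]
          by (simp add: add_nonneg_pos mult.commute)
      finally show "dist (g v') (g v) < e" .
    qed
  qed
  then obtain G where G: "uniformly_continuous_on (closure (range \<iota>)) G" "\<And>v. v \<in> range \<iota> \<Longrightarrow> g v = G v"
    by (rule uniformly_continuous_on_extension_on_closure) blast
  have cont: "continuous_on UNIV G" using G(1) uniformly_continuous_imp_continuous by (simp add: dense)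
  have cG: "continuous_on UNIV (\<lambda>v. G (h v))" if "continuous_on UNIV h" for h :: "'h \<Rightarrow> 'h"
    using continuous_on_compose2[OF cont that] by simp
  have G\<iota>: "G (\<iota> x) = \<iota> (f x)" for x using G(2)[of "\<iota> x"] g by simp
  \<comment> \<open>Density is used in one argument at a time: the second vector stays in the range
    of \<open>\<iota>\<close> here and becomes arbitrary in the next step.\<close>
  have add1: "G (v + \<iota> y) = G v + G (\<iota> y)" for v y
    by (rule dense_eq[of "\<lambda>v. G (v + \<iota> y)" "\<lambda>v. G v + G (\<iota> y)"])
      (auto intro!: continuous_intros cG simp: cont G\<iota> linear_add[OF f] linear_add[OF linear_\<iota>]
        simp flip: linear_add[OF linear_\<iota>])
  have add: "G (v + w) = G v + G w" for v w
    by (rule dense_eq[of "\<lambda>w. G (v + w)" "\<lambda>w. G v + G w"])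
      (auto intro!: continuous_intros cG simp: cont add1)
  have scale: "G (r *\<^sub>R v) = r *\<^sub>R G v" for r v
    by (rule dense_eq[of "\<lambda>v. G (r *\<^sub>R v)" "\<lambda>v. r *\<^sub>R G v"])
      (auto intro!: continuous_intros cG simp: cont G\<iota> linear_scale[OF f]
        linear_scale[OF linear_\<iota>] simp flip: linear_scale[OF linear_\<iota>])
  have bound: "norm (G v) \<le> norm v * sqrt C" for v
  proof -
    have "closed {v. norm (G v) \<le> norm v * sqrt C}"
      by (intro closed_Collect_le continuous_intros cont)
    moreover have "range \<iota> \<subseteq> {v. norm (G v) \<le> norm v * sqrt C}"
      using nf by (auto simp: G\<iota> mult.commute)
    ultimately have "closure (range \<iota>) \<subseteq> {v. norm (G v) \<le> norm v * sqrt C}"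
      by (rule closure_minimal[rotated])
    then show ?thesis using dense by blast
  qed
  have "bounded_linear G" by (rule bounded_linear_intro[OF add scale bound])
  then show ?thesis using G\<iota> by blast
qed

definition ext :: "('v \<Rightarrow> 'v) \<Rightarrow> 'h \<Rightarrow> 'h" where
  "ext f = (SOME R. bounded_linear R \<and> (\<forall>x. R (\<iota> x) = \<iota> (f x)))"

lemma ext:
  assumes "bounded_wrt ip f"
  shows "bounded_linear (ext f)" "ext f (\<iota> x) = \<iota> (f x)"
  using someI_ex[OF extension_exists[OF assms]] by (auto simp: ext_def)

lemma continuous_ext: "bounded_wrt ip f \<Longrightarrow> continuous_on UNIV (ext f)"
  using ext(1) linear_continuous_on by blast

lemma graph_mem: "(\<iota> x, \<iota> (\<Phi> x)) \<in> op_closure \<iota> \<Phi>"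
  unfolding op_closure_def by (rule subsetD[OF closure_subset]) blast

lemma subspace_op_closure:
  assumes "linear \<Phi>" shows "subspace (op_closure \<iota> \<Phi>)"
proof -
  have "subspace (range (\<lambda>x. (\<iota> x, \<iota> (\<Phi> x))))"
    by (auto simp: subspace_def image_iff linear_0[OF linear_\<iota>] linear_0[OF assms] zero_prod_def
      intro: exI[of _ 0])
      (metis linear_add[OF linear_\<iota>] linear_add[OF assms], metis linear_scale[OF linear_\<iota>] linear_scale[OF assms])
  then show ?thesis unfolding op_closure_def by (rule subspace_closure)
qed

text \<open>The map sending \<open>(x, w)\<close> to \<open>(a x, a w + B x)\<close> is continuous
  on the product and takes the graph of \<open>\<Phi>\<close> to itself, hence also its closure. In
  particular \<open>a\<close> preserves the domain of the closed operator.\<close>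

lemma commutator_closure:
  assumes "bounded_linear a" "bounded_linear B"
    "\<And>x. a (\<iota> x) = \<iota> (f x)" "\<And>x. B (\<iota> x) = \<iota> (\<Phi> (f x)) - \<iota> (f (\<Phi> x))"
    and xw: "(x, w) \<in> op_closure \<iota> \<Phi>"
  shows "(a x, a w + B x) \<in> op_closure \<iota> \<Phi>"
proof -
  define h where "h = (\<lambda>(x, w). (a x, a w + B x))"
  have "continuous_on UNIV h"
    unfolding h_def case_prod_unfold
    by (intro continuous_intros bounded_linear.continuous_on[OF assms(1)] bounded_linear.continuous_on[OF assms(2)])
  then have "h ` closure (range (\<lambda>x. (\<iota> x, \<iota> (\<Phi> x)))) \<subseteq> closure (h ` range (\<lambda>x. (\<iota> x, \<iota> (\<Phi> x))))"
    by (intro image_closure_subset closed_closure closure_subset) (auto intro: continuous_on_subset)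
  also have "\<dots> \<subseteq> closure (range (\<lambda>x. (\<iota> x, \<iota> (\<Phi> x))))"
    by (intro closure_mono) (auto simp: h_def assms)
  finally show ?thesis using xw unfolding op_closure_def h_def by fast
qed

text \<open>Serves both parts of the theorem. Commutator bounds for single group elements are
  enough: the closed graph is a subspace, so finite combinations of pairs in it stay in it.\<close>

lemma hilbert_action:
  fixes \<rho> :: "complex^2^2 \<Rightarrow> 'v \<Rightarrow> 'v"
  assumes one: "mat 1 \<in> G" "\<rho> (mat 1) = id"
    and bdd: "\<And>\<gamma>. \<gamma> \<in> G \<Longrightarrow> bounded_wrt ip (\<rho> \<gamma>)"
    and mult: "\<And>\<gamma> \<gamma>'. \<gamma> \<in> G \<Longrightarrow> \<gamma>' \<in> G \<Longrightarrow> \<rho> (\<gamma> ** \<gamma>') = \<rho> \<gamma> \<circ> \<rho> \<gamma>'"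
    and comm: "\<And>\<gamma>. \<gamma> \<in> G \<Longrightarrow> bounded_wrt ip (\<lambda>x. \<Phi> (\<rho> \<gamma> x) - \<rho> \<gamma> (\<Phi> x))"
    and \<Phi>: "linear \<Phi>"
  shows "\<exists>R. bounded_action G \<rho> \<iota> R \<and>
    (\<forall>a\<in>group_ring_image G R. bounded_commutator (op_closure \<iota> \<Phi>) a)"
proof -
  define R where "R \<gamma> = ext (\<rho> \<gamma>)" for \<gamma>
  have R: "bounded_linear (R \<gamma>)" "R \<gamma> (\<iota> x) = \<iota> (\<rho> \<gamma> x)" if "\<gamma> \<in> G" for \<gamma> x
    using ext[OF bdd[OF that]] by (auto simp: R_def)
  have R1: "R (mat 1) v = id v" for v
    by (rule dense_eq[of "R (mat 1)" id])
      (simp_all add: R[OF one(1)] one(2) id_def linear_continuous_on[OF R(1)[OF one(1)]])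
  have R2: "R (\<gamma> ** \<gamma>') v = (R \<gamma> \<circ> R \<gamma>') v" if g: "\<gamma> \<in> G" "\<gamma>' \<in> G" for \<gamma> \<gamma>' v
  proof (rule dense_eq[of "R (\<gamma> ** \<gamma>')" "R \<gamma> \<circ> R \<gamma>'"])
    have b: "bounded_wrt ip (\<rho> (\<gamma> ** \<gamma>'))"
      using bounded_wrt_compose[OF bdd[OF g(1)] bdd[OF g(2)]] unfolding mult[OF g] o_def .
    show "continuous_on UNIV (R (\<gamma> ** \<gamma>'))" unfolding R_def by (rule continuous_ext[OF b])
    show "continuous_on UNIV (R \<gamma> \<circ> R \<gamma>')"
      unfolding o_def
      by (rule bounded_linear.continuous_on[OF R(1)[OF g(1)] bounded_linear.continuous_on[OF R(1)[OF g(2)] continuous_on_id]])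
    show "R (\<gamma> ** \<gamma>') (\<iota> x) = (R \<gamma> \<circ> R \<gamma>') (\<iota> x)" for x
      using ext(2)[OF b, of x] unfolding R_def[of "\<gamma> ** \<gamma>'"] o_def R(2)[OF g(2)] R(2)[OF g(1)] mult[OF g] .
  qed
  have act: "bounded_action G \<rho> \<iota> R"
    unfolding bounded_action_def
  proof (intro conjI ballI allI)
    show "R (mat 1) = id" by (rule HOL.ext) (rule R1)
    show "R (\<gamma> ** \<gamma>') = R \<gamma> \<circ> R \<gamma>'" if "\<gamma> \<in> G" "\<gamma>' \<in> G" for \<gamma> \<gamma>'
      by (rule HOL.ext) (rule R2[OF that])
  qed (simp_all add: R)
  have "bounded_commutator (op_closure \<iota> \<Phi>) a" if a: "a \<in> group_ring_image G R" for a
  proof -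
  obtain f where f: "f \<in> group_ring G" and a: "a = (\<lambda>x. \<Sum>\<gamma>\<in>{\<gamma>. f \<gamma> \<noteq> 0}. f \<gamma> *\<^sub>R R \<gamma> x)"
    using a by (auto simp: group_ring_image_def)
  let ?S = "{\<gamma>. f \<gamma> \<noteq> 0}"
  have S: "?S \<subseteq> G" using f by (simp add: group_ring_def)
  define B where "B \<gamma> = ext (\<lambda>x. \<Phi> (\<rho> \<gamma> x) - \<rho> \<gamma> (\<Phi> x))" for \<gamma>
  have B: "bounded_linear (B \<gamma>)" "B \<gamma> (\<iota> x) = \<iota> (\<Phi> (\<rho> \<gamma> x)) - \<iota> (\<rho> \<gamma> (\<Phi> x))" if "\<gamma> \<in> G" for \<gamma> x
    using ext[OF comm[OF that]] by (auto simp: B_def linear_diff[OF linear_\<iota>])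
  define b where "b x = (\<Sum>\<gamma>\<in>?S. f \<gamma> *\<^sub>R B \<gamma> x)" for x
  have la: "bounded_linear a"
    unfolding a using R(1) S by (intro bounded_linear_sum bounded_linear_const_scaleR) auto
  have lb: "bounded_linear b"
    unfolding b_def using B(1) S by (intro bounded_linear_sum bounded_linear_const_scaleR) auto
  have "(a x, a w + b x) \<in> op_closure \<iota> \<Phi>" if xw: "(x, w) \<in> op_closure \<iota> \<Phi>" for x w
  proof -
    have e: "(a x, a w + b x) = (\<Sum>\<gamma>\<in>?S. f \<gamma> *\<^sub>R (R \<gamma> x, R \<gamma> w + B \<gamma> x))"
      by (simp add: a b_def prod_eq_iff fst_sum snd_sum scaleR_add_right sum.distrib)
    show ?thesis
      unfolding e
    proof (intro subspace_sum[OF subspace_op_closure[OF \<Phi>]] subspace_scale[OF subspace_op_closure[OF \<Phi>]])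
      fix \<gamma> assume "\<gamma> \<in> ?S"
      then have g: "\<gamma> \<in> G" using S by blast
      show "(R \<gamma> x, R \<gamma> w + B \<gamma> x) \<in> op_closure \<iota> \<Phi>"
        by (rule commutator_closure[OF R(1)[OF g] B(1)[OF g] R(2)[OF g] B(2)[OF g] xw])
    qed
  qed
  then show ?thesis
    unfolding bounded_commutator_def using la lb by blast
  qed
  then show ?thesis using act by blast
qed

end

section \<open>Orthonormal systems and their enumeration\<close>

lemma orthonormal_basis:
  assumes ip: "inner_product_on ip" and "finite B"
  shows "\<exists>E. finite E \<and> card E \<le> card B \<and> span E = span B \<and>
    (\<forall>e\<in>E. \<forall>e'\<in>E. ip e e' = (if e = e' then 1 else 0))"
  using assms(2)
proof (induction B rule: finite_induct)
  case empty
  show ?case by (intro exI[of _ "{}"]) simp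
next
  case (insert b B)
  note ip' = inner_product_onD[OF ip]
  obtain E where E: "finite E" "card E \<le> card B" "span E = span B"
    "\<And>e e'. e \<in> E \<Longrightarrow> e' \<in> E \<Longrightarrow> ip e e' = (if e = e' then 1 else 0)"
    using insert.IH by blast
  obtain p where p: "p \<in> span B" "\<And>c. c \<in> span B \<Longrightarrow> ip (b - p) c = 0"
    using orthogonal_decomposition[OF ip insert.hyps(1), of b] by blast
  show ?case
  proof (cases "b = p")
    case True
    then have "span (insert b B) = span B" using p(1) by (simp add: span_redundant)
    then show ?thesis using E insert.hyps by (intro exI[of _ E]) auto
  next
    case False
    define r where "r = 1 / sqrt (ip (b - p) (b - p))"
    define e where "e = r *\<^sub>R (b - p)"
    have pos: "ip (b - p) (b - p) > 0" using ip'(3)[of "b - p"] False by simp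
    then have r: "r \<noteq> 0" by (simp add: r_def)
    have ee: "ip e e = 1" using pos by (simp add: e_def ip'(7,8) r_def)
    have eE: "ip e c = 0" "ip c e = 0" if "c \<in> E" for c
    proof -
      have "c \<in> span B" using span_base[OF that] E(3) by simp
      then show "ip e c = 0" using p(2) by (simp add: e_def ip'(8))
      then show "ip c e = 0" using ip'(2) by simp
    qed
    have "e \<notin> E" using eE(1)[of e] ee by auto
    have be: "b = p + inverse r *\<^sub>R e" using r by (simp add: e_def)
    have "span (insert e E) = span (insert b B)"
    proof
      have "e \<in> span (insert b B)"
        unfolding e_def using p(1) span_mono[of B "insert b B"]
        by (intro span_scale span_diff) (auto intro: span_base)
      moreover have "E \<subseteq> span (insert b B)"
        using span_superset[of E] E(3) span_mono[of B "insert b B"] by blast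
      ultimately show "span (insert e E) \<subseteq> span (insert b B)" by (intro span_minimal) auto
      have "p \<in> span (insert e E)" using p(1) E(3) span_mono[of E "insert e E"] by blast
      then have "b \<in> span (insert e E)"
        unfolding be by (intro span_add span_scale) (auto intro: span_base)
      moreover have "B \<subseteq> span (insert e E)"
        using span_superset[of B] E(3) span_mono[of E "insert e E"] by blast
      ultimately show "span (insert b B) \<subseteq> span (insert e E)" by (intro span_minimal) auto
    qed
    moreover have "card (insert e E) \<le> card (insert b B)"
      using E(1,2) insert.hyps \<open>e \<notin> E\<close> by simp
    ultimately show ?thesis
      using E(1,4) ee eE \<open>e \<notin> E\<close> by (intro exI[of _ "insert e E"]) auto
  qed
qed

lemma orthonormal_expansion:
  assumes ip: "inner_product_on ip" and E: "finite E" "\<forall>e\<in>E. \<forall>e'\<in>E. ip e e' = (if e = e' then 1 else 0)"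
    and x: "x \<in> span E"
  shows "x = (\<Sum>e\<in>E. ip x e *\<^sub>R e)"
proof -
  note ip' = inner_product_onD[OF ip]
  obtain c where c: "x = (\<Sum>e\<in>E. c e *\<^sub>R e)" using x span_finite[OF E(1)] by auto
  have "ip x e = c e" if "e \<in> E" for e
  proof -
    have "ip x e = (\<Sum>e'\<in>E. c e' * ip e' e)" unfolding c by (simp add: ip'(16) ip'(8))
    also have "\<dots> = (\<Sum>e'\<in>E. if e' = e then c e else 0)" using E(2) that by (intro sum.cong) auto
    also have "\<dots> = c e" using E(1) that by simp
    finally show ?thesis .
  qed
  then show ?thesis using c by simp
qed

text \<open>Number each level set of \<open>f\<close> by numbers below \<open>D\<close> and encode
  \<open>s\<close> as \<open>D * f s\<close> plus its number. The code is injective and division by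
  \<open>D\<close> recovers \<open>f\<close>, so listing the codes in increasing order makes
  \<open>f\<close> monotone. The \<open>k\<close>-th code is at least \<open>k\<close>, whence the
  last estimate.\<close>

lemma monotone_enumeration:
  fixes f :: "'s \<Rightarrow> nat"
  assumes lev: "\<And>m. finite {s \<in> S. f s = m}" "\<And>m. card {s \<in> S. f s = m} \<le> D"
  shows "\<exists>I e. (I = UNIV \<or> (\<exists>n. I = {..<n::nat})) \<and> bij_betw e I S \<and>
    (\<forall>k\<in>I. \<forall>l\<in>I. k \<le> l \<longrightarrow> f (e k) \<le> f (e l)) \<and> (\<forall>k\<in>I. Suc k \<le> D * Suc (f (e k)))"
proof -
  have "\<exists>h. inj_on h {s \<in> S. f s = m} \<and> h ` {s \<in> S. f s = m} \<subseteq> {..<D}" for m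
  proof -
    obtain h where h: "bij_betw h {s \<in> S. f s = m} {0..<card {s \<in> S. f s = m}}"
      using ex_bij_betw_finite_nat[OF lev(1)] by blast
    then have "inj_on h {s \<in> S. f s = m}" "h ` {s \<in> S. f s = m} \<subseteq> {..<D}"
      using lev(2)[of m] by (auto simp: bij_betw_def)
    then show ?thesis by blast
  qed
  then obtain h where h: "\<And>m. inj_on (h m) {s \<in> S. f s = m}" "\<And>m. h m ` {s \<in> S. f s = m} \<subseteq> {..<D}"
    by metis
  define code where "code s = D * f s + h (f s) s" for s
  have hD: "h (f s) s < D" if "s \<in> S" for s using h(2)[of "f s"] that by blast
  have fdiv: "code s div D = f s" if "s \<in> S" for s
    using hD[OF that] by (simp add: code_def)
  have inj: "inj_on code S"
  proof (rule inj_onI)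
    fix s t assume st: "s \<in> S" "t \<in> S" "code s = code t"
    then have "f s = f t" using fdiv by metis
    then have "h (f s) s = h (f s) t" using st(3) by (simp add: code_def)
    then show "s = t" using h(1)[of "f s"] st \<open>f s = f t\<close> by (auto dest: inj_onD)
  qed
  define M where "M = code ` S"
  \<comment> \<open>\<open>enumerate\<close> is a bijection onto a finite set only from an initial
    segment of length \<open>card M\<close>.\<close>
  define I where "I = (if finite M then {..<card M} else UNIV)"
  have bM: "bij_betw (enumerate M) I M"
    unfolding I_def using finite_bij_enumerate[of M] bij_enumerate[of M] by simp
  define e where "e k = inv_into S code (enumerate M k)" for k
  have be: "bij_betw e I S"
  proof -
    have "bij_betw code S M" using inj by (simp add: M_def bij_betw_def)
    from bij_betw_trans[OF bM bij_betw_inv_into[OF this]] show ?thesis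
      by (simp add: e_def[abs_def] o_def)
  qed
  have enM: "enumerate M k \<in> M" if "k \<in> I" for k using bM that by (auto simp: bij_betw_def)
  have ce: "code (e k) = enumerate M k" if "k \<in> I" for k
    unfolding e_def using enM[OF that] unfolding M_def by (rule f_inv_into_f)
  have eS: "e k \<in> S" if "k \<in> I" for k using be that by (auto simp: bij_betw_def)
  have mono: "f (e k) \<le> f (e l)" if kl: "k \<in> I" "l \<in> I" "k \<le> l" for k l
  proof -
    have "enumerate M k \<le> enumerate M l"
    proof (cases "k = l")
      case False
      then have "k < l" using kl by simp
      then have "enumerate M k < enumerate M l"
        using kl finite_enumerate_mono[of k l M] enumerate_mono[of k l M] by (auto simp: I_def split: if_splits)
      then show ?thesis by simp
    qed simp
    then have "code (e k) div D \<le> code (e l) div D" using ce kl by (simp add: div_le_mono)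
    then show ?thesis using fdiv eS kl by simp
  qed
  have bound: "Suc k \<le> D * Suc (f (e k))" if k: "k \<in> I" for k
  proof -
    have "k \<le> enumerate M k"
      using k finite_le_enumerate[of M k] le_enumerate[of M k] by (auto simp: I_def split: if_splits)
    also have "\<dots> = D * f (e k) + h (f (e k)) (e k)" using ce[OF k] by (simp add: code_def)
    finally show ?thesis using hD[OF eS[OF k]] by simp
  qed
  have "I = UNIV \<or> (\<exists>n. I = {..<n})" by (auto simp: I_def)
  then show ?thesis using be mono bound by (intro exI[of _ I] exI[of _ e] conjI ballI impI)
qed

text \<open>Compactness in a finite-dimensional subspace of a normed space that may be
  infinite-dimensional: each new vector contributes the continuous image of a product with a compact
  interval.\<close>

lemma compact_combinations:
  fixes F :: "'h::real_normed_vector set"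
  assumes "finite F"
  shows "compact {\<Sum>e\<in>F. a e *\<^sub>R e | a. \<forall>e\<in>F. \<bar>a e\<bar> \<le> C}"
  using assms
proof (induction F rule: finite_induct)
  case empty
  have "{\<Sum>e\<in>{}. a e *\<^sub>R e | a. \<forall>e\<in>{}. \<bar>a e\<bar> \<le> C} = {0::'h}" by auto
  then show ?case by (metis compact_sing)
next
  case (insert f F)
  let ?K = "{\<Sum>e\<in>F. a e *\<^sub>R e | a. \<forall>e\<in>F. \<bar>a e\<bar> \<le> C}"
  have "{\<Sum>e\<in>insert f F. a e *\<^sub>R e | a. \<forall>e\<in>insert f F. \<bar>a e\<bar> \<le> C}
      = (\<lambda>(t, y). t *\<^sub>R f + y) ` ({-C..C} \<times> ?K)"
  proof (intro equalityI subsetI)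
    fix v assume "v \<in> {\<Sum>e\<in>insert f F. a e *\<^sub>R e | a. \<forall>e\<in>insert f F. \<bar>a e\<bar> \<le> C}"
    then obtain a where a: "v = (\<Sum>e\<in>insert f F. a e *\<^sub>R e)" "\<forall>e\<in>insert f F. \<bar>a e\<bar> \<le> C" by blast
    then have "v = (\<lambda>(t, y). t *\<^sub>R f + y) (a f, \<Sum>e\<in>F. a e *\<^sub>R e)"
      using insert.hyps by simp
    moreover have "(a f, \<Sum>e\<in>F. a e *\<^sub>R e) \<in> {-C..C} \<times> ?K"
      using a(2) by (auto simp: abs_le_iff)
    ultimately show "v \<in> (\<lambda>(t, y). t *\<^sub>R f + y) ` ({-C..C} \<times> ?K)" by (rule image_eqI)
  next
    fix v assume "v \<in> (\<lambda>(t, y). t *\<^sub>R f + y) ` ({-C..C} \<times> ?K)"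
    then obtain t a where a: "v = t *\<^sub>R f + (\<Sum>e\<in>F. a e *\<^sub>R e)" "t \<in> {-C..C}" "\<forall>e\<in>F. \<bar>a e\<bar> \<le> C"
      by auto
    let ?a = "a(f := t)"
    have "(\<Sum>e\<in>F. ?a e *\<^sub>R e) = (\<Sum>e\<in>F. a e *\<^sub>R e)"
      using insert.hyps by (intro sum.cong) auto
    then have "v = (\<Sum>e\<in>insert f F. ?a e *\<^sub>R e)" using insert.hyps a(1) by simp
    moreover have "\<forall>e\<in>insert f F. \<bar>?a e\<bar> \<le> C" using a by (auto simp: abs_le_iff)
    ultimately show "v \<in> {\<Sum>e\<in>insert f F. a e *\<^sub>R e | a. \<forall>e\<in>insert f F. \<bar>a e\<bar> \<le> C}" by blast
  qed
  moreover have "compact ((\<lambda>(t, y). t *\<^sub>R f + y) ` ({-C..C} \<times> ?K))"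
    by (intro compact_continuous_image compact_Times insert.IH)
      (auto simp: case_prod_unfold intro!: continuous_intros)
  ultimately show ?case by simp
qed

section \<open>Diagonal operators with integral eigenvalues of bounded multiplicity\<close>

text \<open>The bound \<open>D\<close> is the same for all \<open>n\<close>; it becomes a factor of
  the constant in the decay of the eigenvalues.\<close>

locale diagonal_completion = orthogonal_grading pr ip + completion ip \<iota>
  for pr :: "int \<Rightarrow> 'v::real_vector \<Rightarrow> 'v" and ip and \<iota> :: "'v \<Rightarrow> 'h::{real_inner, complete_space}" +
  fixes D :: nat
  assumes finite_dimensional: "\<exists>B. finite B \<and> card B \<le> D \<and> range (pr n) \<subseteq> span B"
begin

definition \<Phi> :: "'v \<Rightarrow> 'v" where "\<Phi> = dmap of_int"

text \<open>For bounded \<open>c\<close> this is the functional calculus: \<open>c\<close> applied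
  to the closure of \<open>\<Phi>\<close>. Spectral projections, resolvents and the inverse of the
  absolute value are all of this form.\<close>

definition X :: "(int \<Rightarrow> real) \<Rightarrow> 'h \<Rightarrow> 'h" where "X c = ext (dmap c)"

definition \<delta> :: "int \<Rightarrow> int \<Rightarrow> real" where "\<delta> n m = (if m = n then 1 else 0)"

definition P :: "int \<Rightarrow> 'h \<Rightarrow> 'h" where "P n = X (\<delta> n)"

definition bdd :: "(int \<Rightarrow> real) \<Rightarrow> bool" where "bdd c \<longleftrightarrow> (\<exists>C. \<forall>n. \<bar>c n\<bar> \<le> C)"

lemma bounded_dmap_bdd: "bdd c \<Longrightarrow> bounded_wrt ip (dmap c)"
  unfolding bdd_def using bounded_dmap by blast

lemma X_bounded_linear: "bdd c \<Longrightarrow> bounded_linear (X c)" and X_\<iota>: "bdd c \<Longrightarrow> X c (\<iota> x) = \<iota> (dmap c x)"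
  using ext[OF bounded_dmap_bdd] by (simp_all add: X_def)

lemma bdd_\<delta>: "bdd (\<delta> n)"
  unfolding bdd_def by (intro exI[of _ 1]) (auto simp: \<delta>_def)

lemma P_bounded_linear: "bounded_linear (P n)"
  unfolding P_def by (rule X_bounded_linear[OF bdd_\<delta>])

lemma dmap_\<delta>: "dmap (\<delta> n) x = pr n x"
  by (rule pr_eqI) (simp add: pr_dmap pr_pr \<delta>_def)

lemma P_\<iota>: "P n (\<iota> x) = \<iota> (pr n x)"
  unfolding P_def by (simp add: X_\<iota> bdd_\<delta> dmap_\<delta>)

lemma continuous_X: "bdd c \<Longrightarrow> continuous_on S f \<Longrightarrow> continuous_on S (\<lambda>v. X c (f v))"
  by (rule bounded_linear.continuous_on[OF X_bounded_linear])

lemma continuous_P: "continuous_on S f \<Longrightarrow> continuous_on S (\<lambda>v. P n (f v))"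
  by (rule bounded_linear.continuous_on[OF P_bounded_linear])

lemma bdd_mult: "bdd c \<Longrightarrow> bdd c' \<Longrightarrow> bdd (\<lambda>n. c n * c' n)"
proof -
  assume "bdd c" "bdd c'"
  then obtain C C' where C: "\<And>n. \<bar>c n\<bar> \<le> C" "\<And>n. \<bar>c' n\<bar> \<le> C'" unfolding bdd_def by blast
  have "\<bar>c n * c' n\<bar> \<le> C * C'" for n
    using mult_mono[OF C(1)[of n] C(2)[of n]] C(1)[of n] by (simp add: abs_mult)
  then show ?thesis unfolding bdd_def by blast
qed

lemma X_X:
  assumes "bdd c" "bdd c'"
  shows "X c (X c' v) = X (\<lambda>n. c n * c' n) v"
  by (rule dense_eq[of "\<lambda>v. X c (X c' v)" "X (\<lambda>n. c n * c' n)"])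
    (simp_all add: X_\<iota> assms bdd_mult dmap_dmap continuous_X linear_continuous_on X_bounded_linear)

lemma P_X: "bdd c \<Longrightarrow> P n (X c v) = c n *\<^sub>R P n v"
  by (rule dense_eq[of "\<lambda>v. P n (X c v)" "\<lambda>v. c n *\<^sub>R P n v"])
    (simp_all add: X_\<iota> P_\<iota> pr_dmap linear_scale[OF linear_\<iota>] continuous_X continuous_P
      linear_continuous_on X_bounded_linear P_bounded_linear continuous_on_scaleR)

lemma X_symmetric:
  assumes "bdd c" shows "X c v \<bullet> v' = v \<bullet> X c v'"
proof (rule dense_eq[of "\<lambda>v. X c v \<bullet> v'" "\<lambda>v. v \<bullet> X c v'"])
  fix x
  show "X c (\<iota> x) \<bullet> v' = \<iota> x \<bullet> X c v'"
    by (rule dense_eq[of "\<lambda>v'. X c (\<iota> x) \<bullet> v'" "\<lambda>v'. \<iota> x \<bullet> X c v'"])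
      (auto simp: X_\<iota> assms \<iota>_inner ip_dmap intro!: continuous_intros continuous_X)
qed (auto intro!: continuous_intros continuous_X simp: assms)

lemma P_symmetric: "P n v \<bullet> v' = v \<bullet> P n v'"
  unfolding P_def by (rule X_symmetric[OF bdd_\<delta>])

lemma P_P: "P n (P m v) = (if n = m then P n v else 0)"
  unfolding P_def[of m] P_X[OF bdd_\<delta>] by (simp add: \<delta>_def)

lemmas P_linear = bounded_linear.linear[OF P_bounded_linear]

lemma P_total:
  assumes "\<And>n. P n v = 0" shows "v = 0"
proof -
  have "v \<bullet> \<iota> x = 0" for x
  proof -
    have "v \<bullet> \<iota> x = v \<bullet> \<iota> (\<Sum>n | pr n x \<noteq> 0. pr n x)" by (simp only: sum_pr)
    also have "\<dots> = (\<Sum>n | pr n x \<noteq> 0. P n v \<bullet> \<iota> x)"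
      by (simp add: linear_sum[OF linear_\<iota>] inner_sum_right P_symmetric P_\<iota>)
    finally show ?thesis by (simp add: assms)
  qed
  then have "v \<bullet> v = 0"
    by (rule dense_eq[of "\<lambda>w. v \<bullet> w" "\<lambda>w. 0", rotated 2]) (auto intro!: continuous_intros)
  then show ?thesis by simp
qed

lemma P_eqI: "(\<And>n. P n v = P n w) \<Longrightarrow> v = w"
  using P_total[of "v - w"] by (simp add: linear_diff[OF P_linear])

definition E :: "int \<Rightarrow> 'v set" where
  "E n = (SOME E. finite E \<and> card E \<le> D \<and> span E = range (pr n) \<and>
     (\<forall>e\<in>E. \<forall>e'\<in>E. ip e e' = (if e = e' then 1 else 0)))"

lemma E: "finite (E n)" "card (E n) \<le> D" "span (E n) = range (pr n)"
  "e \<in> E n \<Longrightarrow> e' \<in> E n \<Longrightarrow> ip e e' = (if e = e' then 1 else 0)"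
proof -
  obtain B where B: "finite B" "card B \<le> D" "range (pr n) \<subseteq> span B" using finite_dimensional by blast
  have sub: "subspace (range (pr n))" by (rule linear_subspace_image[OF linear_pr subspace_UNIV])
  obtain B' where B': "B' \<subseteq> range (pr n)" "independent B'" "span B' = range (pr n)"
    using basis_exists[of "range (pr n)"] sub by (metis span_subspace)
  have "B' \<subseteq> span B" using B' B by blast
  then have "finite B'" "card B' \<le> D"
    using independent_span_bound[OF B(1) B'(2)] B(2) by auto
  then have "\<exists>E. finite E \<and> card E \<le> D \<and> span E = range (pr n) \<and>
     (\<forall>e\<in>E. \<forall>e'\<in>E. ip e e' = (if e = e' then 1 else 0))"
    using orthonormal_basis[OF ip, of B'] unfolding B'(3) by (meson order_trans)
  from someI_ex[OF this]
  show "finite (E n)" "card (E n) \<le> D" "span (E n) = range (pr n)"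
    "e \<in> E n \<Longrightarrow> e' \<in> E n \<Longrightarrow> ip e e' = (if e = e' then 1 else 0)"
    unfolding E_def[symmetric] by blast+
qed

lemma pr_E: "e \<in> E n \<Longrightarrow> pr n e = e"
  using E(3)[of n] span_base[of e "E n"] by (auto simp: pr_pr)

lemma P_E: "e \<in> E n \<Longrightarrow> P m (\<iota> e) = (if m = n then \<iota> e else 0)"
  using pr_E[of e n] pr_eq[of n e m] by (auto simp: P_\<iota> linear_0[OF linear_\<iota>])

lemma P_expansion: "P n v = (\<Sum>e\<in>E n. (v \<bullet> \<iota> e) *\<^sub>R \<iota> e)"
proof (rule dense_eq[of "P n" "\<lambda>v. \<Sum>e\<in>E n. (v \<bullet> \<iota> e) *\<^sub>R \<iota> e"])
  fix x
  have "pr n x = (\<Sum>e\<in>E n. ip (pr n x) e *\<^sub>R e)"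
    using E by (intro orthonormal_expansion[OF ip]) auto
  also have "\<dots> = (\<Sum>e\<in>E n. ip x e *\<^sub>R e)"
    by (intro sum.cong) (simp_all add: ip_pr_swap pr_E)
  finally have "\<iota> (pr n x) = \<iota> (\<Sum>e\<in>E n. ip x e *\<^sub>R e)" by simp
  then show "P n (\<iota> x) = (\<Sum>e\<in>E n. (\<iota> x \<bullet> \<iota> e) *\<^sub>R \<iota> e)"
    by (simp add: P_\<iota> \<iota>_inner linear_sum[OF linear_\<iota>] linear_scale[OF linear_\<iota>])
qed (auto intro!: continuous_intros simp: linear_continuous_on P_bounded_linear)

definition S :: "nat \<Rightarrow> 'h \<Rightarrow> 'h" where "S m v = (\<Sum>n\<in>{- int m..int m}. P n v)"

lemma S_eq_X: "S m v = X (\<lambda>n. if \<bar>n\<bar> \<le> int m then 1 else 0) v"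
proof (rule P_eqI)
  fix k
  have "bdd (\<lambda>n. if \<bar>n\<bar> \<le> int m then 1 else 0)" unfolding bdd_def by (intro exI[of _ 1]) auto
  moreover have "P k (S m v) = (\<Sum>n\<in>{- int m..int m}. if k = n then P k v else 0)"
    unfolding S_def linear_sum[OF P_linear] by (simp add: P_P)
  ultimately show "P k (S m v) = P k (X (\<lambda>n. if \<bar>n\<bar> \<le> int m then 1 else 0) v)"
    by (auto simp: P_X)
qed

lemma X_norm:
  assumes c: "\<And>n. \<bar>c n\<bar> \<le> C" and "C \<ge> 0"
  shows "norm (X c v) \<le> C * norm v"
proof -
  have b: "bdd c" using c unfolding bdd_def by blast
  have "closed {v. norm (X c v) \<le> C * norm v}"
    by (intro closed_Collect_le continuous_intros continuous_X b)
  moreover have "range \<iota> \<subseteq> {v. norm (X c v) \<le> C * norm v}"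
  proof safe
    fix x
    have "(norm (X c (\<iota> x)))\<^sup>2 = (\<Sum>i | pr i x \<noteq> 0. (c i)\<^sup>2 * ip (pr i x) (pr i x))"
      unfolding X_\<iota>[OF b] \<iota>_norm
      by (subst ip_expand[OF finite_pr[of x]])
        (auto simp: pr_dmap ip_simps power2_eq_square mult.assoc)
    also have "\<dots> \<le> (\<Sum>i | pr i x \<noteq> 0. C\<^sup>2 * ip (pr i x) (pr i x))"
    proof (rule sum_mono)
      fix i
      have "(c i)\<^sup>2 \<le> C\<^sup>2" using c[of i] abs_le_square_iff[of "c i" C] assms(2) by simp
      then show "(c i)\<^sup>2 * ip (pr i x) (pr i x) \<le> C\<^sup>2 * ip (pr i x) (pr i x)"
        by (rule mult_right_mono[OF _ ip_nonneg])
    qed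
    also have "\<dots> = (C * norm (\<iota> x))\<^sup>2"
      by (simp add: power_mult_distrib \<iota>_norm ip_expand[OF finite_pr[of x], of x] sum_distrib_left)
    finally show "norm (X c (\<iota> x)) \<le> C * norm (\<iota> x)"
      by (rule power2_le_imp_le) (use assms(2) in simp)
  qed
  ultimately have "closure (range \<iota>) \<subseteq> {v. norm (X c v) \<le> C * norm v}"
    by (rule closure_minimal[rotated])
  then show ?thesis using dense by blast
qed

lemma S_norm: "norm (S m v) \<le> norm v"
  unfolding S_eq_X using X_norm[of _ 1] by simp

text \<open>The truncations are contractions, and on the dense range of \<open>\<iota>\<close> they
  are eventually the identity.\<close>

lemma S_tendsto: "(\<lambda>m. S m v) \<longlonglongrightarrow> v"
proof (rule LIMSEQ_I)
  fix r :: real assume "r > 0"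
  then obtain x where x: "norm (\<iota> x - v) < r / 2" using dense_approx[of "r / 2" v] by auto
  obtain m0 :: nat where m0: "\<forall>n\<in>{n. pr n x \<noteq> 0}. \<bar>n\<bar> \<le> int m0"
  proof
    show "\<forall>n\<in>{n. pr n x \<noteq> 0}. \<bar>n\<bar> \<le> int (nat (\<Sum>n | pr n x \<noteq> 0. \<bar>n\<bar>))"
    proof
      fix n assume n: "n \<in> {n. pr n x \<noteq> 0}"
      have "\<bar>n\<bar> \<le> (\<Sum>n | pr n x \<noteq> 0. \<bar>n\<bar>)"
        by (rule member_le_sum[OF n]) (auto simp: finite_pr)
      then show "\<bar>n\<bar> \<le> int (nat (\<Sum>n | pr n x \<noteq> 0. \<bar>n\<bar>))" by simp
    qed
  qed
  have "norm (S m v - v) < r" if "m \<ge> m0" for m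
  proof -
    have "{n. pr n x \<noteq> 0} \<subseteq> {- int m..int m}" using m0 that by fastforce
    then have "S m (\<iota> x) = \<iota> x"
      unfolding S_def P_\<iota> linear_sum[OF linear_\<iota>, symmetric] by (simp add: sum_pr_superset)
    then have "S m v - v = S m (v - \<iota> x) + (\<iota> x - v)"
      by (simp add: S_def linear_diff[OF P_linear] sum_subtractf)
    also have "norm \<dots> \<le> norm (S m (v - \<iota> x)) + norm (\<iota> x - v)" by (rule norm_triangle_ineq)
    also have "\<dots> \<le> norm (v - \<iota> x) + norm (\<iota> x - v)" using S_norm by simp
    also have "\<dots> < r" using x by (simp add: norm_minus_commute)
    finally show ?thesis .
  qed
  then show "\<exists>no. \<forall>n\<ge>no. norm (S n v - v) < r" by blast
qed

abbreviation "T \<equiv> op_closure \<iota> \<Phi>"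

text \<open>The closure is the maximal diagonal operator. For the converse, the eigenspaces are
  finite-dimensional, so \<open>P n v\<close> lies in the range of \<open>\<iota>\<close>; hence the
  truncations of \<open>(v, w)\<close> lie on the graph itself, and they converge to
  \<open>(v, w)\<close>.\<close>

lemma T_iff: "(v, w) \<in> T \<longleftrightarrow> (\<forall>n. P n w = of_int n *\<^sub>R P n v)"
proof
  assume T: "(v, w) \<in> T"
  show "\<forall>n. P n w = of_int n *\<^sub>R P n v"
  proof
    fix n
    have "closed {p. P n (snd p) = of_int n *\<^sub>R P n (fst p)}"
      by (intro closed_Collect_eq continuous_intros continuous_P)
    moreover have "range (\<lambda>x. (\<iota> x, \<iota> (\<Phi> x))) \<subseteq> {p. P n (snd p) = of_int n *\<^sub>R P n (fst p)}"
      by (auto simp: P_\<iota> \<Phi>_def pr_dmap linear_scale[OF linear_\<iota>])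
    ultimately have "T \<subseteq> {p. P n (snd p) = of_int n *\<^sub>R P n (fst p)}"
      unfolding op_closure_def by (rule closure_minimal[rotated])
    then show "P n w = of_int n *\<^sub>R P n v" using T by auto
  qed
next
  assume P: "\<forall>n. P n w = of_int n *\<^sub>R P n v"
  have "(S m v, S m w) \<in> range (\<lambda>x. (\<iota> x, \<iota> (\<Phi> x)))" for m
  proof
    define y where "y n = (\<Sum>e\<in>E n. (v \<bullet> \<iota> e) *\<^sub>R e)" for n
    have y: "P n v = \<iota> (y n)" for n
      by (simp add: y_def P_expansion linear_sum[OF linear_\<iota>] linear_scale[OF linear_\<iota>])
    have "pr n (y n) = y n" for n
      by (simp add: y_def pr_sum linear_scale[OF linear_pr] pr_E)
    then have \<Phi>y: "\<Phi> (y n) = of_int n *\<^sub>R y n" for n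
      unfolding \<Phi>_def by (rule dmap_homogeneous)
    show "(S m v, S m w) = (\<iota> (\<Sum>n\<in>{- int m..int m}. y n), \<iota> (\<Phi> (\<Sum>n\<in>{- int m..int m}. y n)))"
      using P linear_dmap[of of_int]
      by (simp add: S_def y linear_sum[OF linear_\<iota>] linear_scale[OF linear_\<iota>] \<Phi>y
          linear_sum[OF linear_dmap[of of_int], folded \<Phi>_def])
  qed simp
  moreover have "(\<lambda>m. (S m v, S m w)) \<longlonglongrightarrow> (v, w)" by (intro tendsto_Pair S_tendsto)
  ultimately show "(v, w) \<in> T"
    unfolding op_closure_def closure_sequential by (intro exI[of _ "\<lambda>m. (S m v, S m w)"]) simp
qed

lemma self_adjoint: "self_adjoint_op T"
  unfolding self_adjoint_op_def
proof
  have "range \<iota> \<subseteq> Domain T" using graph_mem by blast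
  then show "closure (Domain T) = UNIV" using closure_mono[of "range \<iota>"] dense by blast
  show "T = {(y, z). \<forall>(x, w)\<in>T. w \<bullet> y = x \<bullet> z}"
  proof (intro equalityI subsetI)
    fix p assume "p \<in> T"
    moreover obtain y z where p: "p = (y, z)" by fastforce
    ultimately have yz: "P n z = of_int n *\<^sub>R P n y" for n using T_iff by blast
    have "w \<bullet> y = x \<bullet> z" if "(x, w) \<in> T" for x w
    proof -
      have xw: "P n w = of_int n *\<^sub>R P n x" for n using that T_iff by blast
      have "S m w \<bullet> y = S m x \<bullet> z" for m
        unfolding S_def inner_sum_left
      proof (rule sum.cong[OF refl])
        fix n
        have "P n w \<bullet> y = P n x \<bullet> (of_int n *\<^sub>R P n y)"
          using P_symmetric[of n "P n x" y] P_P[of n n x] by (simp add: xw)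
        then show "P n w \<bullet> y = P n x \<bullet> z"
          using P_symmetric[of n "P n x" z] P_P[of n n x] by (simp add: yz)
      qed
      moreover have "(\<lambda>m. S m w \<bullet> y) \<longlonglongrightarrow> w \<bullet> y" "(\<lambda>m. S m x \<bullet> z) \<longlonglongrightarrow> x \<bullet> z"
        by (intro tendsto_intros S_tendsto)+
      ultimately show ?thesis using LIMSEQ_unique by simp
    qed
    then show "p \<in> {(y, z). \<forall>(x, w)\<in>T. w \<bullet> y = x \<bullet> z}" by (auto simp: p)
  next
    fix p assume "p \<in> {(y, z). \<forall>(x, w)\<in>T. w \<bullet> y = x \<bullet> z}"
    then obtain y z where p: "p = (y, z)" and yz: "\<And>x w. (x, w) \<in> T \<Longrightarrow> w \<bullet> y = x \<bullet> z" by blast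
    have "P n z = of_int n *\<^sub>R P n y" for n
    proof (rule vector_eq_ldot[THEN iffD1], rule allI)
      fix v
      \<comment> \<open>Testing on eigenvectors already determines each spectral component of
        \<open>z\<close>.\<close>
      have "(P n v, of_int n *\<^sub>R P n v) \<in> T" by (simp add: T_iff P_P linear_scale[OF P_linear])
      from yz[OF this] show "v \<bullet> P n z = v \<bullet> (of_int n *\<^sub>R P n y)"
        by (simp add: P_symmetric)
    qed
    then show "p \<in> T" by (simp add: p T_iff)
  qed
qed

text \<open>\<open>S m\<close> after \<open>X c\<close> has finite rank, and its distance from
  \<open>X c\<close> in norm is at most the supremum of \<open>\<bar>c n\<bar>\<close> over
  \<open>\<bar>n\<bar> > int m\<close>. So the image of the unit ball is totally bounded.\<close>

lemma compact_X:
  assumes lim: "\<And>\<epsilon>. \<epsilon> > 0 \<Longrightarrow> \<exists>m. \<forall>n. \<bar>n\<bar> > int m \<longrightarrow> \<bar>c n\<bar> \<le> \<epsilon>" and b: "bdd c"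
  shows "compact (closure (X c ` cball 0 1))"
proof -
  have "\<exists>k. finite k \<and> closure (X c ` cball 0 1) \<subseteq> (\<Union>x\<in>k. ball x \<epsilon>)" if \<epsilon>: "\<epsilon> > 0" for \<epsilon>
  proof -
    obtain m where m: "\<And>n. \<bar>n\<bar> > int m \<Longrightarrow> \<bar>c n\<bar> \<le> \<epsilon> / 4" using lim[of "\<epsilon> / 4"] \<epsilon> by auto
    obtain C where C: "\<And>n. \<bar>c n\<bar> \<le> C" using b unfolding bdd_def by blast
    define F where "F = (\<Union>n\<in>{- int m..int m}. \<iota> ` E n)"
    have finF: "finite F" by (simp add: F_def E)
    define K where "K = {\<Sum>e\<in>F. a e *\<^sub>R e | a. \<forall>e\<in>F. \<bar>a e\<bar> \<le> C}"
    have K: "compact K" unfolding K_def by (rule compact_combinations[OF finF])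
    have SF: "S m (X c v) \<in> K" if v: "norm v \<le> 1" for v
    proof -
      have disj: "\<iota> ` E n \<inter> \<iota> ` E n' = {}" if "n \<noteq> n'" for n n'
      proof -
        have "e \<noteq> e'" if "e \<in> E n" "e' \<in> E n'" for e e'
          using pr_E[OF that(1)] pr_E[OF that(2)] pr_eq[of n e n'] E(4)[OF that(1) that(1)] \<open>n \<noteq> n'\<close>
          by (auto simp: ip_simps)
        then show ?thesis by (auto simp: \<iota>_eq_iff)
      qed
      have "S m (X c v) = (\<Sum>n\<in>{- int m..int m}. \<Sum>e\<in>\<iota> ` E n. (X c v \<bullet> e) *\<^sub>R e)"
        unfolding S_def P_expansion
        by (intro sum.cong refl) (subst sum.reindex, auto simp: inj_on_def \<iota>_eq_iff)
      also have "\<dots> = (\<Sum>e\<in>F. (X c v \<bullet> e) *\<^sub>R e)"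
        unfolding F_def using disj E(1) by (intro sum.UNION_disjoint[symmetric]) auto
      finally have eq: "S m (X c v) = (\<Sum>e\<in>F. (X c v \<bullet> e) *\<^sub>R e)" .
      have "\<bar>X c v \<bullet> e\<bar> \<le> C" if eF: "e \<in> F" for e
      proof -
        obtain n e0 where e: "e = \<iota> e0" "e0 \<in> E n" using eF by (auto simp: F_def)
        have "(norm e)\<^sup>2 = 1" using E(4)[OF e(2) e(2)] by (simp add: e(1) \<iota>_norm)
        then have ne: "norm e = 1" by (simp add: power2_eq_1_iff) (smt (verit) norm_ge_zero)
        have C0: "C \<ge> 0" using C[of 0] by linarith
        have "\<bar>X c v \<bullet> e\<bar> \<le> norm (X c v) * norm e" by (rule Cauchy_Schwarz_ineq2)
        also have "\<dots> \<le> C * norm v" using X_norm[of c C v] C C0 ne by simp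
        also have "\<dots> \<le> C" using v C0 by (simp add: mult_left_le)
        finally show ?thesis .
      qed
      then show ?thesis unfolding K_def eq by blast
    qed
    have close: "dist (S m (X c v)) (X c v) \<le> \<epsilon> / 4" if v: "norm v \<le> 1" for v
    proof -
      define r where "r n = (if \<bar>n\<bar> \<le> int m then 0 else - c n)" for n
      have r: "\<bar>r n\<bar> \<le> \<epsilon> / 4" for n using m[of n] \<epsilon> by (auto simp: r_def)
      have br: "bdd r" unfolding bdd_def using r by blast
      have "S m (X c v) - X c v = X r v"
      proof (rule P_eqI)
        fix k
        have "bdd (\<lambda>n. if \<bar>n\<bar> \<le> int m then 1 else 0)" unfolding bdd_def by (intro exI[of _ 1]) auto
        then show "P k (S m (X c v) - X c v) = P k (X r v)"
          by (simp add: S_eq_X P_X b br linear_diff[OF P_linear] r_def)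
      qed
      then have "dist (S m (X c v)) (X c v) \<le> \<epsilon> / 4 * norm v"
        using X_norm[of r "\<epsilon> / 4" v] r \<epsilon> by (simp add: dist_norm)
      also have "\<dots> \<le> \<epsilon> / 4" using v \<epsilon> by (simp add: mult_left_le)
      finally show ?thesis .
    qed
    obtain k where k: "finite k" "K \<subseteq> (\<Union>x\<in>k. ball x (\<epsilon> / 4))"
      using K \<epsilon> unfolding compact_eq_totally_bounded by (metis divide_pos_pos zero_less_numeral)
    \<comment> \<open>Closed balls are used because their finite union is closed and so absorbs the
      closure. The radius \<open>\<epsilon> / 2\<close> consists of \<open>\<epsilon> / 4\<close>
      for the tail of \<open>c\<close> and \<open>\<epsilon> / 4\<close> for the finite net.\<close>
    have "closure (X c ` cball 0 1) \<subseteq> (\<Union>x\<in>k. cball x (\<epsilon> / 2))"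
    proof (rule closure_minimal)
      show "closed (\<Union>x\<in>k. cball x (\<epsilon> / 2))" using k(1) by (intro closed_UN) auto
      show "X c ` cball 0 1 \<subseteq> (\<Union>x\<in>k. cball x (\<epsilon> / 2))"
      proof (rule image_subsetI)
        fix v :: 'h assume "v \<in> cball 0 1"
        then have v: "norm v \<le> 1" by simp
        have "S m (X c v) \<in> (\<Union>x\<in>k. ball x (\<epsilon> / 4))" using SF[OF v] k(2) by blast
        then obtain x where x: "x \<in> k" "dist x (S m (X c v)) < \<epsilon> / 4" by auto
        have "dist x (X c v) \<le> dist x (S m (X c v)) + dist (S m (X c v)) (X c v)"
          by (rule dist_triangle)
        then have "dist x (X c v) \<le> \<epsilon> / 2" using x(2) close[OF v] by linarith
        then show "X c v \<in> (\<Union>x\<in>k. cball x (\<epsilon> / 2))" using x(1) by auto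
      qed
    qed
    also have "\<dots> \<subseteq> (\<Union>x\<in>k. ball x \<epsilon>)" using \<epsilon> by fastforce
    finally show ?thesis using k(1) by blast
  qed
  moreover have "complete (closure (X c ` cball 0 1))"
    by (rule complete_eq_closed[THEN iffD2]) simp
  ultimately show ?thesis unfolding compact_eq_totally_bounded by blast
qed

end

context diagonal_completion
begin

lemma compact_op_X:
  assumes lim: "\<And>\<epsilon>. \<epsilon> > 0 \<Longrightarrow> \<exists>m. \<forall>n. \<bar>n\<bar> > int m \<longrightarrow> \<bar>c n\<bar> \<le> \<epsilon>"
  shows "bdd c" "compact (closure (X c ` cball 0 1))"
proof -
  obtain m where m: "\<And>n. \<bar>n\<bar> > int m \<Longrightarrow> \<bar>c n\<bar> \<le> 1" using lim[of 1] by auto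
  have "\<bar>c n\<bar> \<le> 1 + (\<Sum>n\<in>{- int m..int m}. \<bar>c n\<bar>)" for n
  proof (cases "\<bar>n\<bar> \<le> int m")
    case True
    then have "\<bar>c n\<bar> \<le> (\<Sum>n\<in>{- int m..int m}. \<bar>c n\<bar>)"
      by (intro member_le_sum[of n _ "\<lambda>n. \<bar>c n\<bar>"]) auto
    then show ?thesis by simp
  next
    case False
    then have "\<bar>c n\<bar> \<le> 1" using m[of n] by simp
    moreover have "0 \<le> (\<Sum>n\<in>{- int m..int m}. \<bar>c n\<bar>)" by (intro sum_nonneg) simp
    ultimately show ?thesis by linarith
  qed
  then show b: "bdd c" unfolding bdd_def by blast
  show "compact (closure (X c ` cball 0 1))" by (rule compact_X[OF lim b])
qed

text \<open>The first two identities are the real and the imaginary part of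
  \<open>(of_int n - \<zeta>) * r n = 1\<close>; a nonreal \<open>\<zeta>\<close> is never an
  eigenvalue. The decay of \<open>r n\<close> is what makes the resolvent compact.\<close>

lemma resolvent_coefficients:
  assumes "\<zeta> \<notin> \<real>"
  defines "r n \<equiv> inverse (of_int n - \<zeta>)"
  shows "(of_int n - Re \<zeta>) * Re (r n) + Im \<zeta> * Im (r n) = 1"
    "(of_int n - Re \<zeta>) * Im (r n) - Im \<zeta> * Re (r n) = 0"
    "\<epsilon> > 0 \<Longrightarrow> \<exists>m. \<forall>n. \<bar>n\<bar> > int m \<longrightarrow> \<bar>Re (r n)\<bar> \<le> \<epsilon>"
    "\<epsilon> > 0 \<Longrightarrow> \<exists>m. \<forall>n. \<bar>n\<bar> > int m \<longrightarrow> \<bar>Im (r n)\<bar> \<le> \<epsilon>"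
proof -
  have "of_int n \<noteq> \<zeta>" using assms by (metis Reals_of_int)
  then have "(of_int n - \<zeta>) * r n = 1" by (simp add: r_def)
  then have "Re ((of_int n - \<zeta>) * r n) = 1" "Im ((of_int n - \<zeta>) * r n) = 0" by simp_all
  then show "(of_int n - Re \<zeta>) * Re (r n) + Im \<zeta> * Im (r n) = 1"
    "(of_int n - Re \<zeta>) * Im (r n) - Im \<zeta> * Re (r n) = 0" by simp_all
  have *: "\<exists>m. \<forall>n. \<bar>n\<bar> > int m \<longrightarrow> norm (r n) \<le> \<epsilon>" if e: "\<epsilon> > 0" for \<epsilon>
  proof (intro exI allI impI)
    fix n :: int assume "\<bar>n\<bar> > int (nat \<lceil>norm \<zeta> + 1 / \<epsilon>\<rceil>)"
    then have "real_of_int \<bar>n\<bar> > norm \<zeta> + 1 / \<epsilon>" by linarith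
    moreover have "norm (of_int n :: complex) \<le> norm (of_int n - \<zeta>) + norm \<zeta>"
      using norm_triangle_ineq[of "of_int n - \<zeta>" \<zeta>] by simp
    ultimately have l: "norm (of_int n - \<zeta>) \<ge> 1 / \<epsilon>" by simp
    have "norm (r n) = inverse (norm (of_int n - \<zeta>))" by (simp add: r_def norm_inverse)
    also have "\<dots> \<le> inverse (1 / \<epsilon>)" using l e by (intro le_imp_inverse_le) auto
    finally show "norm (r n) \<le> \<epsilon>" by simp
  qed
  show "\<epsilon> > 0 \<Longrightarrow> \<exists>m. \<forall>n. \<bar>n\<bar> > int m \<longrightarrow> \<bar>Re (r n)\<bar> \<le> \<epsilon>"
    "\<epsilon> > 0 \<Longrightarrow> \<exists>m. \<forall>n. \<bar>n\<bar> > int m \<longrightarrow> \<bar>Im (r n)\<bar> \<le> \<epsilon>"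
    using *[of \<epsilon>] abs_Re_le_cmod abs_Im_le_cmod order_trans by meson+
qed

lemma compact_resolvent: "compact_resolvent T"
  unfolding compact_resolvent_def
proof (intro allI impI)
  fix \<zeta> :: complex assume \<zeta>: "\<zeta> \<notin> \<real>"
  define c where "c n = Re (inverse (of_int n - \<zeta>))" for n
  define d where "d n = Im (inverse (of_int n - \<zeta>))" for n
  have cd1: "(of_int n - Re \<zeta>) * c n + Im \<zeta> * d n = 1" for n
    unfolding c_def d_def by (rule resolvent_coefficients[OF \<zeta>])
  have cd2: "(of_int n - Re \<zeta>) * d n - Im \<zeta> * c n = 0" for n
    unfolding c_def d_def by (rule resolvent_coefficients[OF \<zeta>])
  have limc: "\<And>\<epsilon>. \<epsilon> > 0 \<Longrightarrow> \<exists>m. \<forall>n. \<bar>n\<bar> > int m \<longrightarrow> \<bar>c n\<bar> \<le> \<epsilon>"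
    and limd: "\<And>\<epsilon>. \<epsilon> > 0 \<Longrightarrow> \<exists>m. \<forall>n. \<bar>n\<bar> > int m \<longrightarrow> \<bar>d n\<bar> \<le> \<epsilon>"
    unfolding c_def d_def by (rule resolvent_coefficients[OF \<zeta>], assumption)+
  note c = compact_op_X[OF limc] and d = compact_op_X[OF limd]
  note lc = X_bounded_linear[OF c(1)] and ld = X_bounded_linear[OF d(1)]
  \<comment> \<open>Multiplication by the complex numbers \<open>c n + \<i> * d n\<close>, the
    inverses of \<open>of_int n - \<zeta>\<close>, written on pairs of real vectors.\<close>
  define R where "R v = (X c (fst v) - X d (snd v), X d (fst v) + X c (snd v))" for v
  have bl: "bounded_linear R"
    unfolding R_def
    by (intro bounded_linear_Pair bounded_linear_add bounded_linear_sub
      bounded_linear_compose[OF lc] bounded_linear_compose[OF ld] bounded_linear_fst bounded_linear_snd)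
  have "compact (closure (R ` cball 0 1))"
  proof -
    let ?C = "closure (X c ` cball 0 1)" and ?D = "closure (X d ` cball 0 1)"
    define h where "h = (\<lambda>p::('h \<times> 'h) \<times> ('h \<times> 'h).
      (fst (fst p) - snd (snd p), fst (snd p) + snd (fst p)))"
    have K: "compact (h ` ((?C \<times> ?C) \<times> (?D \<times> ?D)))"
      by (intro compact_continuous_image compact_Times c d) (auto simp: h_def intro!: continuous_intros)
    have "R ` cball 0 1 \<subseteq> h ` ((?C \<times> ?C) \<times> (?D \<times> ?D))"
    proof (rule image_subsetI)
      fix v :: "'h \<times> 'h" assume v: "v \<in> cball 0 1"
      have n: "norm (fst v) \<le> 1" "norm (snd v) \<le> 1"
        using v norm_fst_le[of "fst v" "snd v"] norm_snd_le[of "snd v" "fst v"] by auto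
      have mem: "X c (fst v) \<in> ?C" "X c (snd v) \<in> ?C" "X d (fst v) \<in> ?D" "X d (snd v) \<in> ?D"
        using n by (auto intro!: subsetD[OF closure_subset] imageI)
      show "R v \<in> h ` ((?C \<times> ?C) \<times> (?D \<times> ?D))"
        by (rule image_eqI[of _ _ "((X c (fst v), X c (snd v)), (X d (fst v), X d (snd v)))"])
          (simp_all add: h_def R_def mem)
    qed
    then have "closure (R ` cball 0 1) \<subseteq> h ` ((?C \<times> ?C) \<times> (?D \<times> ?D))"
      by (rule closure_minimal[OF _ compact_imp_closed[OF K]])
    then show ?thesis using compact_Int_closed[OF K, of "closure (R ` cball 0 1)"] by (simp add: inf.absorb2)
  qed
  moreover have "complex_shift T \<zeta> = range (\<lambda>v. (R v, v))"
  proof (intro equalityI subsetI)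
    fix q assume "q \<in> complex_shift T \<zeta>"
    then obtain x y x' y' where q: "q = ((x, y), (x' - Re \<zeta> *\<^sub>R x + Im \<zeta> *\<^sub>R y, y' - Re \<zeta> *\<^sub>R y - Im \<zeta> *\<^sub>R x))"
      and T: "(x, x') \<in> T" "(y, y') \<in> T"
      unfolding complex_shift_def by blast
    define a where "a = x' - Re \<zeta> *\<^sub>R x + Im \<zeta> *\<^sub>R y"
    define b where "b = y' - Re \<zeta> *\<^sub>R y - Im \<zeta> *\<^sub>R x"
    have Pa: "P n a = (of_int n - Re \<zeta>) *\<^sub>R P n x + Im \<zeta> *\<^sub>R P n y" for n
      using T unfolding a_def T_iff
      by (simp add: linear_add[OF P_linear] linear_diff[OF P_linear] linear_scale[OF P_linear] scaleR_diff_left)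
    have Pb: "P n b = (of_int n - Re \<zeta>) *\<^sub>R P n y - Im \<zeta> *\<^sub>R P n x" for n
      using T unfolding b_def T_iff
      by (simp add: linear_add[OF P_linear] linear_diff[OF P_linear] linear_scale[OF P_linear] scaleR_diff_left)
    have "X c a - X d b = x"
    proof (rule P_eqI)
      fix n
      have "P n (X c a - X d b) = ((of_int n - Re \<zeta>) * c n + Im \<zeta> * d n) *\<^sub>R P n x
          - ((of_int n - Re \<zeta>) * d n - Im \<zeta> * c n) *\<^sub>R P n y"
        by (simp add: linear_diff[OF P_linear] P_X c d Pa Pb algebra_simps)
      then show "P n (X c a - X d b) = P n x" by (simp add: cd1 cd2)
    qed
    moreover have "X d a + X c b = y"
    proof (rule P_eqI)
      fix n
      have "P n (X d a + X c b) = ((of_int n - Re \<zeta>) * c n + Im \<zeta> * d n) *\<^sub>R P n y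
          + ((of_int n - Re \<zeta>) * d n - Im \<zeta> * c n) *\<^sub>R P n x"
        by (simp add: linear_add[OF P_linear] P_X c d Pa Pb algebra_simps)
      then show "P n (X d a + X c b) = P n y" by (simp add: cd1 cd2)
    qed
    ultimately have "q = (R (a, b), (a, b))" by (simp add: q R_def a_def b_def)
    then show "q \<in> range (\<lambda>v. (R v, v))" by blast
  next
    fix q assume "q \<in> range (\<lambda>v. (R v, v))"
    then obtain a b where q: "q = (R (a, b), (a, b))" by auto
    define x where "x = X c a - X d b"
    define y where "y = X d a + X c b"
    define x' where "x' = a + Re \<zeta> *\<^sub>R x - Im \<zeta> *\<^sub>R y"
    define y' where "y' = b + Re \<zeta> *\<^sub>R y + Im \<zeta> *\<^sub>R x"
    have Px: "P n x = c n *\<^sub>R P n a - d n *\<^sub>R P n b" for n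
      by (simp add: x_def linear_diff[OF P_linear] P_X c d)
    have Py: "P n y = d n *\<^sub>R P n a + c n *\<^sub>R P n b" for n
      by (simp add: y_def linear_add[OF P_linear] P_X c d)
    have "(x, x') \<in> T"
      unfolding T_iff
    proof
      fix n
      have "P n x' - of_int n *\<^sub>R P n x = (1 - ((of_int n - Re \<zeta>) * c n + Im \<zeta> * d n)) *\<^sub>R P n a
          + ((of_int n - Re \<zeta>) * d n - Im \<zeta> * c n) *\<^sub>R P n b"
        by (simp add: x'_def linear_add[OF P_linear] linear_diff[OF P_linear] linear_scale[OF P_linear]
            Px Py algebra_simps)
      then show "P n x' = of_int n *\<^sub>R P n x" by (simp add: cd1 cd2)
    qed
    moreover have "(y, y') \<in> T"
      unfolding T_iff
    proof
      fix n
      have "P n y' - of_int n *\<^sub>R P n y = (1 - ((of_int n - Re \<zeta>) * c n + Im \<zeta> * d n)) *\<^sub>R P n b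
          - ((of_int n - Re \<zeta>) * d n - Im \<zeta> * c n) *\<^sub>R P n a"
        by (simp add: y'_def linear_add[OF P_linear] linear_diff[OF P_linear] linear_scale[OF P_linear]
            Px Py algebra_simps)
      then show "P n y' = of_int n *\<^sub>R P n y" by (simp add: cd1 cd2)
    qed
    moreover have "q = ((x, y), (x' - Re \<zeta> *\<^sub>R x + Im \<zeta> *\<^sub>R y, y' - Re \<zeta> *\<^sub>R y - Im \<zeta> *\<^sub>R x))"
      by (simp add: q R_def x'_def y'_def flip: x_def y_def)
    ultimately show "q \<in> complex_shift T \<zeta>" unfolding complex_shift_def by blast
  qed
  ultimately show "\<exists>R. compact_op R \<and> complex_shift T \<zeta> = range (\<lambda>v. (R v, v))"
    unfolding compact_op_def using bl by blast
qed

lemma op_kernel_iff: "x \<in> op_kernel T \<longleftrightarrow> (\<forall>n. n \<noteq> 0 \<longrightarrow> P n x = 0)"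
  by (auto simp: op_kernel_def T_iff linear_0[OF P_linear])

lemma kernel_complement_iff: "x \<in> (op_kernel T)\<^sup>\<bottom> \<longleftrightarrow> P 0 x = 0"
proof
  assume x: "x \<in> (op_kernel T)\<^sup>\<bottom>"
  have "P 0 x \<in> op_kernel T" by (simp add: op_kernel_iff P_P)
  then have "P 0 x \<bullet> x = 0" using x by (auto simp: orthogonal_comp_def orthogonal_def)
  then have "P 0 x \<bullet> P 0 x = 0" using P_symmetric[of 0 "P 0 x" x] P_P[of 0 0 x] by simp
  then show "P 0 x = 0" by simp
next
  assume x: "P 0 x = 0"
  have "y \<bullet> x = 0" if y: "y \<in> op_kernel T" for y
  proof -
    have "y = P 0 y"
      by (rule P_eqI) (use y in \<open>auto simp: P_P op_kernel_iff\<close>)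
    then have "y \<bullet> x = y \<bullet> P 0 x" by (metis P_symmetric)
    then show ?thesis using x by simp
  qed
  then show "x \<in> (op_kernel T)\<^sup>\<bottom>" by (auto simp: orthogonal_comp_def orthogonal_def)
qed

text \<open>The convention \<open>inverse 0 = 0\<close> makes this operator vanish on the zero
  modes.\<close>

definition Pinv :: "'h \<Rightarrow> 'h" where "Pinv = X (\<lambda>n. inverse \<bar>of_int n\<bar>)"

lemma inverse_abs_int: "\<bar>inverse \<bar>of_int n :: real\<bar>\<bar> \<le> 1"
  by (cases "n = 0") (auto simp: inverse_le_1_iff)

lemma bdd_inv: "bdd (\<lambda>n. inverse \<bar>of_int n\<bar>)"
  unfolding bdd_def using inverse_abs_int by blast

lemma P_Pinv: "P n (Pinv v) = inverse \<bar>of_int n\<bar> *\<^sub>R P n v"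
  unfolding Pinv_def by (rule P_X[OF bdd_inv])

lemma abs_inverse_Pinv: "abs_inverse T Pinv"
  unfolding abs_inverse_def
proof (intro conjI allI ballI)
  show "bounded_linear Pinv" unfolding Pinv_def by (rule X_bounded_linear[OF bdd_inv])
  show "Pinv x \<bullet> y = x \<bullet> Pinv y" for x y unfolding Pinv_def by (rule X_symmetric[OF bdd_inv])
  show "x \<bullet> Pinv x \<ge> 0" for x
  proof -
    \<comment> \<open>Positivity is obtained by writing \<open>Pinv\<close> as the square of a
      symmetric operator.\<close>
    define s where "s n = sqrt (inverse \<bar>of_int n\<bar>)" for n :: int
    have s: "bdd s"
      unfolding bdd_def s_def using inverse_abs_int by (intro exI[of _ 1]) (auto simp: real_sqrt_le_1_iff)
    have "Pinv x = X s (X s x)"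
      unfolding X_X[OF s s] Pinv_def s_def by simp
    then have "x \<bullet> Pinv x = X s x \<bullet> X s x" using X_symmetric[OF s, of x "X s x"] by simp
    then show ?thesis by simp
  qed
  show "Pinv x = 0" if "x \<in> op_kernel T" for x
  proof (rule P_total)
    fix n show "P n (Pinv x) = 0"
      using that by (cases "n = 0") (simp_all add: P_Pinv op_kernel_iff)
  qed
  show "\<exists>y. (Pinv (Pinv x), y) \<in> T \<and> (y, x) \<in> T" if x: "x \<in> (op_kernel T)\<^sup>\<bottom>" for x
  proof -
    have b: "bdd (\<lambda>n. inverse (of_int n))"
      unfolding bdd_def using inverse_abs_int by (intro exI[of _ 1]) auto
    \<comment> \<open>The inverse of the operator with its sign, halfway between
      \<open>Pinv (Pinv x)\<close> and \<open>x\<close>.\<close>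
    define y where "y = X (\<lambda>n. inverse (of_int n)) x"
    have y: "P n y = inverse (of_int n) *\<^sub>R P n x" for n unfolding y_def by (rule P_X[OF b])
    have "(Pinv (Pinv x), y) \<in> T"
      unfolding T_iff
    proof
      fix n
      have "inverse (real_of_int n) = of_int n * (inverse \<bar>of_int n\<bar> * inverse \<bar>of_int n\<bar>)"
        by (cases "n = 0") (auto simp: field_simps abs_if)
      then show "P n y = of_int n *\<^sub>R P n (Pinv (Pinv x))" by (simp add: y P_Pinv)
    qed
    moreover have "(y, x) \<in> T"
      unfolding T_iff
    proof
      fix n show "P n x = of_int n *\<^sub>R P n y"
        using x by (cases "n = 0") (simp_all add: y kernel_complement_iff)
    qed
    ultimately show ?thesis by blast
  qed
qed

lemma one_summable: "one_summable T"
proof -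
  define Q where "Q = (SIGMA n:-{0}. E n)"
  define f where "f q = nat \<bar>fst q\<bar>" for q :: "int \<times> 'v"
  have lev: "{q \<in> Q. f q = m} \<subseteq> Sigma {- int m, int m} E" for m
    by (auto simp: Q_def f_def)
  have fin: "finite (Sigma {- int m, int m} E)" for m using E(1) by (intro finite_SigmaI) auto
  \<comment> \<open>The absolute value \<open>m\<close> is shared by the eigenvalues
    \<open>m\<close> and \<open>- m\<close>.\<close>
  have "card (Sigma {- int m, int m} E) \<le> 2 * D" for m
  proof -
    have "card (Sigma {- int m, int m} E) = (\<Sum>n\<in>{- int m, int m}. card (E n))"
      by (rule card_SigmaI) (simp_all add: E)
    also have "\<dots> \<le> (\<Sum>n\<in>{- int m, int m}. D)" by (intro sum_mono E)
    also have "\<dots> \<le> 2 * D" by (simp add: card_insert_if)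
    finally show ?thesis .
  qed
  then have card: "card {q \<in> Q. f q = m} \<le> 2 * D" for m
    using card_mono[OF fin lev] order_trans by blast
  have finl: "finite {q \<in> Q. f q = m}" for m by (rule finite_subset[OF lev fin])
  obtain I :: "nat set" and q where I: "I = UNIV \<or> (\<exists>n. I = {..<n})" and q: "bij_betw q I Q"
    and mono: "\<forall>k\<in>I. \<forall>l\<in>I. k \<le> l \<longrightarrow> f (q k) \<le> f (q l)"
    and bound: "\<forall>k\<in>I. Suc k \<le> 2 * D * Suc (f (q k))"
    using monotone_enumeration[of Q f "2 * D", OF finl card] by blast
  define e where "e k = \<iota> (snd (q k))" for k
  define ev where "ev k = 1 / real (f (q k))" for k
  have qQ: "q k \<in> Q" if "k \<in> I" for k using q that by (auto simp: bij_betw_def)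
  have snd: "snd (q k) \<in> E (fst (q k))" "fst (q k) \<noteq> 0" if "k \<in> I" for k
    using qQ[OF that] by (auto simp: Q_def)
  have fpos: "f (q k) \<ge> 1" if "k \<in> I" for k using snd(2)[OF that] by (simp add: f_def)
  have "abs_inverse T Pinv" by (rule abs_inverse_Pinv)
  moreover have "\<forall>k\<in>I. \<forall>l\<in>I. e k \<bullet> e l = (if k = l then 1 else 0)"
  proof (intro ballI)
    fix k l assume kl: "k \<in> I" "l \<in> I"
    show "e k \<bullet> e l = (if k = l then 1 else 0)"
    proof (cases "fst (q k) = fst (q l)")
      case True
      then have "e k \<bullet> e l = (if snd (q k) = snd (q l) then 1 else 0)"
        using E(4) snd(1)[OF kl(1)] snd(1)[OF kl(2)] by (simp add: e_def \<iota>_inner)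
      moreover have "snd (q k) = snd (q l) \<longleftrightarrow> k = l"
        using True q kl by (metis bij_betw_def inj_onD prod_eqI)
      ultimately show ?thesis by simp
    next
      case False
      have "ip (snd (q k)) (snd (q l)) = ip (pr (fst (q k)) (snd (q k))) (pr (fst (q l)) (snd (q l)))"
        using pr_E[OF snd(1)[OF kl(1)]] pr_E[OF snd(1)[OF kl(2)]] by simp
      also have "\<dots> = 0" by (rule pr_orthogonal[OF False])
      finally show ?thesis using False by (auto simp: e_def \<iota>_inner)
    qed
  qed
  moreover have "closure (span (e ` I)) = (op_kernel T)\<^sup>\<bottom>"
  proof
    have "closed ((op_kernel T)\<^sup>\<bottom>)"
    proof -
      have "closed {x. P 0 x = 0}" by (intro closed_Collect_eq continuous_intros continuous_P)
      then show ?thesis by (simp add: kernel_complement_iff[symmetric])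
    qed
    moreover have "e ` I \<subseteq> (op_kernel T)\<^sup>\<bottom>"
    proof safe
      fix k assume "k \<in> I"
      then show "e k \<in> (op_kernel T)\<^sup>\<bottom>"
        using snd[of k] P_E[of "snd (q k)" "fst (q k)" 0] by (simp add: kernel_complement_iff e_def)
    qed
    ultimately show "closure (span (e ` I)) \<subseteq> (op_kernel T)\<^sup>\<bottom>"
      by (intro closure_minimal span_minimal subspace_orthogonal_comp)
    show "(op_kernel T)\<^sup>\<bottom> \<subseteq> closure (span (e ` I))"
    proof
      fix v assume "v \<in> (op_kernel T)\<^sup>\<bottom>"
      then have v: "P 0 v = 0" by (simp add: kernel_complement_iff)
      have Pn: "P n v \<in> span (e ` I)" for n
      proof (cases "n = 0")
        case True
        then show ?thesis using v by (simp add: span_zero)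
      next
        case False
        have "\<iota> x \<in> e ` I" if x: "x \<in> E n" for x
        proof -
          have "(n, x) \<in> Q" using False x by (simp add: Q_def)
          then obtain k where "k \<in> I" "q k = (n, x)" using q by (auto simp: bij_betw_def)
          then show ?thesis by (auto simp: e_def intro!: image_eqI[of _ _ k])
        qed
        then show ?thesis unfolding P_expansion by (intro span_sum span_scale span_base)
      qed
      have "S m v \<in> span (e ` I)" for m unfolding S_def by (intro span_sum Pn)
      then show "v \<in> closure (span (e ` I))"
        unfolding closure_sequential using S_tendsto by (intro exI[of _ "\<lambda>m. S m v"]) simp
    qed
  qed
  moreover have "\<forall>k\<in>I. Pinv (e k) = ev k *\<^sub>R e k"
  proof
    fix k assume k: "k \<in> I"
    show "Pinv (e k) = ev k *\<^sub>R e k"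
    proof (rule P_eqI)
      fix n
      have fe: "inverse \<bar>real_of_int (fst (q k))\<bar> = ev k" by (simp add: ev_def f_def inverse_eq_divide)
      show "P n (Pinv (e k)) = P n (ev k *\<^sub>R e k)"
        using P_E[OF snd(1)[OF k], of n] fe by (auto simp: P_Pinv linear_scale[OF P_linear] e_def)
    qed
  qed
  moreover have "\<forall>k\<in>I. \<forall>l\<in>I. k \<le> l \<longrightarrow> ev l \<le> ev k"
  proof (intro ballI impI)
    fix k l assume kl: "k \<in> I" "l \<in> I" "k \<le> l"
    have "real (f (q k)) \<le> real (f (q l))" "real (f (q k)) > 0"
      using mono kl fpos[OF kl(1)] by auto
    then show "ev l \<le> ev k" unfolding ev_def by (intro divide_left_mono) auto
  qed
  moreover have "\<forall>k\<in>I. ev k \<le> real (4 * D) / real (Suc k)"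
  proof
    fix k assume k: "k \<in> I"
    have "Suc k \<le> 2 * D * Suc (f (q k))" using bound k by blast
    \<comment> \<open>As \<open>f (q k) \<ge> 1\<close>, replacing \<open>Suc (f (q k))\<close> by a
      multiple of \<open>f (q k)\<close> costs a factor \<open>2\<close>; this is the origin of the
      constant \<open>4 * D\<close>.\<close>
    also have "\<dots> \<le> 2 * D * (2 * f (q k))" using fpos[OF k] by (intro mult_left_mono) auto
    finally have "real (Suc k) \<le> real (4 * D) * real (f (q k))"
      unfolding of_nat_mult[symmetric] of_nat_le_iff by simp
    then show "ev k \<le> real (4 * D) / real (Suc k)"
      using fpos[OF k] by (simp add: ev_def field_simps)
  qed
  ultimately show ?thesis
    unfolding one_summable_def
    using I by (intro exI[of _ Pinv] exI[of _ I] exI[of _ e] exI[of _ ev] conjI)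
      (assumption | rule exI[of _ "real (4 * D)"])+
qed

end


section \<open>Smooth forms on a surface\<close>

lemma frechet_derivative_eqI: "(f has_derivative D) (at z) \<Longrightarrow> frechet_derivative f (at z) = D"
  using frechet_derivative_at by metis

lemma differentiable_atD:
  "open S \<Longrightarrow> z \<in> S \<Longrightarrow> f differentiable_on S \<Longrightarrow> f differentiable (at z)"
  by (metis at_within_open differentiable_on_def)

lemma ck_on_SucD:
  assumes "ck_on (Suc n) S f" "open S" "z \<in> S"
  shows "(f has_derivative frechet_derivative f (at z)) (at z)"
  using assms differentiable_atD[of S z f] frechet_derivative_works[of f "at z"] by simp

lemma ck_on_cong:
  assumes "open S" "\<And>z. z \<in> S \<Longrightarrow> f z = g z" "ck_on n S f"
  shows "ck_on n S g"
  using assms(2,3)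
proof (induction n arbitrary: f g)
  case 0
  then show ?case using continuous_on_cong by (metis ck_on.simps(1))
next
  case (Suc n)
  have d: "(g has_derivative frechet_derivative f (at z)) (at z)" if "z \<in> S" for z
    using has_derivative_transform_within_open[OF ck_on_SucD[OF Suc.prems(2) assms(1) that] assms(1) that Suc.prems(1)]
    by blast
  then have e: "frechet_derivative g (at z) = frechet_derivative f (at z)" if "z \<in> S" for z
    using frechet_derivative_eqI that by blast
  have "g differentiable_on S"
    unfolding differentiable_on_def using d by (meson differentiableI has_derivative_at_withinI)
  moreover have "ck_on n S (\<lambda>z. frechet_derivative g (at z) v)" for v
    by (rule Suc.IH[of "\<lambda>z. frechet_derivative f (at z) v"]) (use e Suc.prems(2) in auto)
  ultimately show ?case by simp
qed

lemma ck_on_SucI: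
  assumes S: "open S" and d: "\<And>z. z \<in> S \<Longrightarrow> (f has_derivative D z) (at z)"
    and ck: "\<And>v. ck_on n S (\<lambda>z. D z v)"
  shows "ck_on (Suc n) S f"
proof -
  have "f differentiable_on S"
    unfolding differentiable_on_def using d by (meson differentiableI has_derivative_at_withinI)
  moreover have "ck_on n S (\<lambda>z. frechet_derivative f (at z) v)" for v
    by (rule ck_on_cong[OF S _ ck[of v]]) (simp add: frechet_derivative_eqI[OF d])
  ultimately show ?thesis by simp
qed

lemma ck_on_Suc_imp: "open S \<Longrightarrow> ck_on (Suc n) S f \<Longrightarrow> ck_on n S f"
proof (induction n arbitrary: f)
  case 0
  then show ?case using differentiable_imp_continuous_on by auto
next
  case (Suc n)
  then show ?case by simp
qed

lemma ck_on_const: "open S \<Longrightarrow> ck_on n S (\<lambda>z. u)"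
proof (induction n arbitrary: u)
  case (Suc n)
  show ?case by (rule ck_on_SucI[where D = "\<lambda>z v. 0"]) (use Suc in auto)
qed simp

lemma ck_on_add: "open S \<Longrightarrow> ck_on n S f \<Longrightarrow> ck_on n S g \<Longrightarrow> ck_on n S (\<lambda>z. f z + g z)"
proof (induction n arbitrary: f g)
  case (Suc n)
  show ?case
  proof (rule ck_on_SucI[OF Suc.prems(1)])
    show "((\<lambda>z. f z + g z) has_derivative
      (\<lambda>v. frechet_derivative f (at z) v + frechet_derivative g (at z) v)) (at z)" if "z \<in> S" for z
      using that Suc.prems by (intro has_derivative_add ck_on_SucD)
    show "ck_on n S (\<lambda>z. frechet_derivative f (at z) v + frechet_derivative g (at z) v)" for v
      using Suc.prems by (intro Suc.IH) auto
  qed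
qed (auto intro: continuous_on_add)

lemma ck_on_mult: "open S \<Longrightarrow> ck_on n S f \<Longrightarrow> ck_on n S g \<Longrightarrow> ck_on n S (\<lambda>z. f z * g z)"
proof (induction n arbitrary: f g)
  case (Suc n)
  show ?case
  proof (rule ck_on_SucI[OF Suc.prems(1)])
    show "((\<lambda>z. f z * g z) has_derivative
      (\<lambda>v. f z * frechet_derivative g (at z) v + frechet_derivative f (at z) v * g z)) (at z)" if "z \<in> S" for z
      using that Suc.prems by (intro has_derivative_mult ck_on_SucD)
    show "ck_on n S (\<lambda>z. f z * frechet_derivative g (at z) v + frechet_derivative f (at z) v * g z)" for v
      using Suc.prems ck_on_Suc_imp[OF Suc.prems(1,2)] ck_on_Suc_imp[OF Suc.prems(1,3)]
      by (intro ck_on_add Suc.IH) auto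
  qed
qed (auto intro: continuous_on_mult)

lemma smooth_on_cong: "open S \<Longrightarrow> (\<And>z. z \<in> S \<Longrightarrow> f z = g z) \<Longrightarrow> smooth_on S f \<Longrightarrow> smooth_on S g"
  unfolding smooth_on_def using ck_on_cong by blast

lemma smooth_on_const: "open S \<Longrightarrow> smooth_on S (\<lambda>z. u)"
  and smooth_on_add: "open S \<Longrightarrow> smooth_on S f \<Longrightarrow> smooth_on S g \<Longrightarrow> smooth_on S (\<lambda>z. f z + g z)"
  and smooth_on_mult: "open S \<Longrightarrow> smooth_on S f \<Longrightarrow> smooth_on S g \<Longrightarrow> smooth_on S (\<lambda>z. f z * g z)"
  by (simp_all add: smooth_on_def ck_on_const ck_on_add ck_on_mult)

lemma smooth_on_derivative:
  assumes "smooth_on S f"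
  shows "smooth_on S (\<lambda>z. frechet_derivative f (at z) v)"
  unfolding smooth_on_def
proof
  fix n
  have "ck_on (Suc n) S f" using assms unfolding smooth_on_def by blast
  then show "ck_on n S (\<lambda>z. frechet_derivative f (at z) v)" by simp
qed

lemma smooth_onI:
  assumes S: "open S" and d: "\<And>z. z \<in> S \<Longrightarrow> (f has_derivative D z) (at z)"
    and sm: "\<And>v. smooth_on S (\<lambda>z. D z v)"
  shows "smooth_on S f"
  unfolding smooth_on_def
proof
  fix n
  have "ck_on (Suc n) S f"
    by (rule ck_on_SucI[OF S d]) (use sm in \<open>auto simp: smooth_on_def\<close>)
  then show "ck_on n S f" by (rule ck_on_Suc_imp[OF S])
qed

lemma smooth_on_has_derivative:
  "smooth_on S f \<Longrightarrow> open S \<Longrightarrow> z \<in> S \<Longrightarrow> (f has_derivative frechet_derivative f (at z)) (at z)"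
  unfolding smooth_on_def using ck_on_SucD by blast

text \<open>A real linear map of the complex plane has exactly one expression
  \<open>p * v + q * cnj v\<close>, and the Wirtinger derivatives are its coefficients. The rules
  for sums, conjugates and compositions are read off from this form through
  \<open>wirt_eqI\<close>.\<close>

lemma wirt_decomposition:
  assumes "(f has_derivative D) (at z)"
  shows "D v = wirt f z * v + wirt_bar f z * cnj v"
proof -
  have lin: "linear D" using assms has_derivative_linear by blast
  have "v = Re v *\<^sub>R 1 + Im v *\<^sub>R \<i>" by (simp add: complex_eq_iff)
  then have "D v = Re v *\<^sub>R D 1 + Im v *\<^sub>R D \<i>"
    using linear_add[OF lin, of "Re v *\<^sub>R 1" "Im v *\<^sub>R \<i>"] by (simp add: linear_scale[OF lin])
  then show ?thesis
    unfolding wirt_def wirt_bar_def frechet_derivative_eqI[OF assms]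
    by (simp add: complex_eq_iff field_simps)
qed

lemma wirt_eqI:
  assumes "(f has_derivative (\<lambda>v. p * v + q * cnj v)) (at z)"
  shows "wirt f z = p" "wirt_bar f z = q"
  unfolding wirt_def wirt_bar_def frechet_derivative_eqI[OF assms]
  by (simp_all add: algebra_simps)

lemma has_derivative_wirt:
  assumes "(f has_derivative D) (at z)"
  shows "(f has_derivative (\<lambda>v. wirt f z * v + wirt_bar f z * cnj v)) (at z)"
proof -
  have "D = (\<lambda>v. wirt f z * v + wirt_bar f z * cnj v)"
    by (rule ext) (rule wirt_decomposition[OF assms])
  then show ?thesis using assms by simp
qed

lemma smooth_on_wirt:
  assumes "open S" "smooth_on S f"
  shows "smooth_on S (wirt f)" "smooth_on S (wirt_bar f)"
proof -
  have w: "wirt f = (\<lambda>z. (1/2) * (frechet_derivative f (at z) 1 + (- \<i>) * frechet_derivative f (at z) \<i>))"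
    "wirt_bar f = (\<lambda>z. (1/2) * (frechet_derivative f (at z) 1 + \<i> * frechet_derivative f (at z) \<i>))"
    by (auto simp: wirt_def wirt_bar_def)
  show "smooth_on S (wirt f)" "smooth_on S (wirt_bar f)"
    unfolding w
    by (intro smooth_on_mult smooth_on_add smooth_on_const smooth_on_derivative assms)+
qed

lemma wirt_add:
  assumes "(f has_derivative D) (at z)" "(g has_derivative E) (at z)"
  shows "wirt (\<lambda>z. f z + g z) z = wirt f z + wirt g z"
    "wirt_bar (\<lambda>z. f z + g z) z = wirt_bar f z + wirt_bar g z"
proof -
  have "((\<lambda>z. f z + g z) has_derivative
      (\<lambda>v. (wirt f z + wirt g z) * v + (wirt_bar f z + wirt_bar g z) * cnj v)) (at z)"
    using has_derivative_add[OF has_derivative_wirt[OF assms(1)] has_derivative_wirt[OF assms(2)]]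
    by (simp add: algebra_simps)
  then show "wirt (\<lambda>z. f z + g z) z = wirt f z + wirt g z"
    "wirt_bar (\<lambda>z. f z + g z) z = wirt_bar f z + wirt_bar g z" by (rule wirt_eqI)+
qed

lemma wirt_cmult:
  assumes "(f has_derivative D) (at z)"
  shows "wirt (\<lambda>z. u * f z) z = u * wirt f z" "wirt_bar (\<lambda>z. u * f z) z = u * wirt_bar f z"
proof -
  have "((\<lambda>z. u * f z) has_derivative
      (\<lambda>v. (u * wirt f z) * v + (u * wirt_bar f z) * cnj v)) (at z)"
    using has_derivative_mult_right[OF has_derivative_wirt[OF assms], of u]
    by (simp add: algebra_simps)
  then show "wirt (\<lambda>z. u * f z) z = u * wirt f z" "wirt_bar (\<lambda>z. u * f z) z = u * wirt_bar f z"
    by (rule wirt_eqI)+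
qed

lemma wirt_const: "wirt (\<lambda>z. u) z = 0" "wirt_bar (\<lambda>z. u) z = 0"
  by (rule wirt_eqI[where p = 0 and q = 0], simp)+

lemma wirt_cnj:
  assumes "(f has_derivative D) (at z)"
  shows "wirt (\<lambda>z. cnj (f z)) z = cnj (wirt_bar f z)" "wirt_bar (\<lambda>z. cnj (f z)) z = cnj (wirt f z)"
proof -
  have "((\<lambda>z. cnj (f z)) has_derivative
      (\<lambda>v. cnj (wirt_bar f z) * v + cnj (wirt f z) * cnj v)) (at z)"
    using has_derivative_cnj[OF has_derivative_wirt[OF assms]]
    by (simp add: add.commute)
  then show "wirt (\<lambda>z. cnj (f z)) z = cnj (wirt_bar f z)" "wirt_bar (\<lambda>z. cnj (f z)) z = cnj (wirt f z)"
    by (rule wirt_eqI)+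
qed

lemma wirt_compose_holomorphic:
  assumes "(f has_derivative D) (at (h z))" "(h has_field_derivative h') (at z)"
  shows "wirt (\<lambda>z. f (h z)) z = wirt f (h z) * h'" "wirt_bar (\<lambda>z. f (h z)) z = wirt_bar f (h z) * cnj h'"
proof -
  have "(h has_derivative (\<lambda>v. h' * v)) (at z)" using assms(2) by (simp add: has_field_derivative_def)
  from has_derivative_compose[OF this has_derivative_wirt[OF assms(1)]]
  have "((\<lambda>z. f (h z)) has_derivative (\<lambda>v. (wirt f (h z) * h') * v + (wirt_bar f (h z) * cnj h') * cnj v)) (at z)"
    by (simp add: mult.assoc)
  then show "wirt (\<lambda>z. f (h z)) z = wirt f (h z) * h'" "wirt_bar (\<lambda>z. f (h z)) z = wirt_bar f (h z) * cnj h'"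
    by (rule wirt_eqI)+
qed

lemma wirt_cong_open:
  assumes "open S" "z \<in> S" "\<And>z. z \<in> S \<Longrightarrow> f z = g z" "(f has_derivative D) (at z)"
  shows "wirt g z = wirt f z" "wirt_bar g z = wirt_bar f z"
  using frechet_derivative_eqI[OF has_derivative_transform_within_open[OF assms(4,1,2,3)]]
    frechet_derivative_eqI[OF assms(4)] by (simp_all add: wirt_def wirt_bar_def)

section \<open>Charts and forms on a Riemann surface\<close>

locale riemann =
  fixes X :: "'x topology" and A :: "'x chart set"
  assumes riemann: "riemann_surface X A"
begin

lemma chart:
  assumes "c \<in> A"
  shows "openin X (fst c)" "open (snd c ` fst c)"
    "homeomorphic_map (subtopology X (fst c)) (top_of_set (snd c ` fst c)) (snd c)"
    "fst c \<subseteq> topspace X" "inj_on (snd c) (fst c)"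
proof -
  show o: "openin X (fst c)" and "open (snd c ` fst c)"
    and h: "homeomorphic_map (subtopology X (fst c)) (top_of_set (snd c ` fst c)) (snd c)"
    using riemann assms unfolding riemann_surface_def by blast+
  show s: "fst c \<subseteq> topspace X" using o by (rule openin_subset)
  show "inj_on (snd c) (fst c)"
    using h homeomorphic_imp_injective_map[OF h] s by (simp add: topspace_subtopology inf.absorb2)
qed

lemma covers: "x \<in> topspace X \<Longrightarrow> \<exists>c\<in>A. x \<in> fst c"
  using riemann unfolding riemann_surface_def by blast

lemma cinv: "c \<in> A \<Longrightarrow> x \<in> fst c \<Longrightarrow> cinv c (snd c x) = x"
  by (simp add: chart(5))

lemma cinv_mem: "z \<in> snd c ` fst c \<Longrightarrow> cinv c z \<in> fst c" "z \<in> snd c ` fst c \<Longrightarrow> snd c (cinv c z) = z"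
  by (simp_all add: inv_into_into f_inv_into_f)

lemma open_chart_image:
  assumes "c \<in> A" "openin X W" "W \<subseteq> fst c"
  shows "open (snd c ` W)"
proof -
  have "openin (subtopology X (fst c)) W"
    using assms by (metis openin_subtopology inf.absorb1)
  moreover have "open_map (subtopology X (fst c)) (top_of_set (snd c ` fst c)) (snd c)"
    using chart(3)[OF assms(1)] homeomorphic_imp_open_map by blast
  ultimately have "openin (top_of_set (snd c ` fst c)) (snd c ` W)" by (simp add: open_map_def)
  then show ?thesis using openin_open_trans chart(2)[OF assms(1)] by blast
qed

lemma open_overlap: "c \<in> A \<Longrightarrow> c' \<in> A \<Longrightarrow> open (snd c ` (fst c \<inter> fst c'))"
  by (intro open_chart_image openin_Int chart(1)) auto

lemma transition:
  assumes "c \<in> A" "c' \<in> A" "z \<in> snd c ` (fst c \<inter> fst c')"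
  shows "((snd c' \<circ> cinv c) has_field_derivative deriv (snd c' \<circ> cinv c) z) (at z)"
proof -
  have "(snd c' \<circ> cinv c) holomorphic_on snd c ` (fst c \<inter> fst c')"
    using riemann assms unfolding riemann_surface_def by blast
  then show ?thesis using open_overlap[OF assms(1,2)] assms(3) by (rule holomorphic_derivI)
qed

lemma form_smooth: "\<eta> \<in> forms A \<Longrightarrow> c \<in> A \<Longrightarrow> smooth_on (snd c ` fst c) (\<lambda>z. \<eta> a b c (cinv c z))"
  and form_zero: "\<eta> \<in> forms A \<Longrightarrow> \<not> (a \<le> 1 \<and> b \<le> 1 \<and> c \<in> A \<and> x \<in> fst c) \<Longrightarrow> \<eta> a b c x = 0"
  and form_transform: "\<eta> \<in> forms A \<Longrightarrow> c \<in> A \<Longrightarrow> c' \<in> A \<Longrightarrow> x \<in> fst c \<Longrightarrow> x \<in> fst c' \<Longrightarrow>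
    \<eta> a b c x = \<eta> a b c' x * deriv (snd c' \<circ> cinv c) (snd c x) ^ a * cnj (deriv (snd c' \<circ> cinv c) (snd c x)) ^ b"
  unfolding forms_def by blast+

lemma form_derivative:
  assumes "\<eta> \<in> forms A" "c \<in> A" "x \<in> fst c"
  shows "((\<lambda>z. \<eta> a b c (cinv c z)) has_derivative frechet_derivative (\<lambda>z. \<eta> a b c (cinv c z)) (at (snd c x))) (at (snd c x))"
  using form_smooth[OF assms(1,2)] chart(2)[OF assms(2)] assms(3)
  by (intro smooth_on_has_derivative) auto

lemma formI:
  assumes "\<And>a b c x. \<not> (a \<le> 1 \<and> b \<le> 1 \<and> c \<in> A \<and> x \<in> fst c) \<Longrightarrow> \<eta> a b c x = 0"
    and "\<And>a b c. c \<in> A \<Longrightarrow> smooth_on (snd c ` fst c) (\<lambda>z. \<eta> a b c (cinv c z))"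
    and "\<And>a b c c' x. c \<in> A \<Longrightarrow> c' \<in> A \<Longrightarrow> x \<in> fst c \<Longrightarrow> x \<in> fst c' \<Longrightarrow>
      \<eta> a b c x = \<eta> a b c' x * deriv (snd c' \<circ> cinv c) (snd c x) ^ a * cnj (deriv (snd c' \<circ> cinv c) (snd c x)) ^ b"
  shows "\<eta> \<in> forms A"
  unfolding forms_def using assms by blast

lemma zero_form: "0 \<in> forms A"
  by (rule formI) (simp_all add: chart(2) smooth_on_const)

lemma add_form:
  assumes "\<eta> \<in> forms A" "\<theta> \<in> forms A" shows "\<eta> + \<theta> \<in> forms A"
proof (rule formI)
  show "(\<eta> + \<theta>) a b c x = 0" if "\<not> (a \<le> 1 \<and> b \<le> 1 \<and> c \<in> A \<and> x \<in> fst c)" for a b c x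
    using form_zero[OF assms(1) that] form_zero[OF assms(2) that] by simp
  show "smooth_on (snd c ` fst c) (\<lambda>z. (\<eta> + \<theta>) a b c (cinv c z))" if "c \<in> A" for a b c
    using smooth_on_add[OF chart(2) form_smooth form_smooth, OF that assms(1) that assms(2) that] by simp
  show "(\<eta> + \<theta>) a b c x = (\<eta> + \<theta>) a b c' x * deriv (snd c' \<circ> cinv c) (snd c x) ^ a * cnj (deriv (snd c' \<circ> cinv c) (snd c x)) ^ b"
    if "c \<in> A" "c' \<in> A" "x \<in> fst c" "x \<in> fst c'" for a b c c' x
    unfolding plus_fun_apply
    by (subst form_transform[OF assms(1) that], subst form_transform[OF assms(2) that]) (simp add: distrib_right)
qed

lemma cscale_form:
  assumes "\<eta> \<in> forms A" shows "cscale u \<eta> \<in> forms A"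
proof (rule formI)
  show "cscale u \<eta> a b c x = 0" if "\<not> (a \<le> 1 \<and> b \<le> 1 \<and> c \<in> A \<and> x \<in> fst c)" for a b c x
    using form_zero[OF assms that] by (simp add: cscale_def)
  show "smooth_on (snd c ` fst c) (\<lambda>z. cscale u \<eta> a b c (cinv c z))" if "c \<in> A" for a b c
    unfolding cscale_def
    by (intro smooth_on_mult smooth_on_const chart(2)[OF that] form_smooth[OF assms that])
  show "cscale u \<eta> a b c x = cscale u \<eta> a b c' x * deriv (snd c' \<circ> cinv c) (snd c x) ^ a * cnj (deriv (snd c' \<circ> cinv c) (snd c x)) ^ b"
    if "c \<in> A" "c' \<in> A" "x \<in> fst c" "x \<in> fst c'" for a b c c' x
    unfolding cscale_def by (subst form_transform[OF assms that]) (simp add: mult.assoc)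
qed

lemma del_0: "del 0 = 0" and delbar_0: "delbar 0 = 0"
  by (auto simp: del_def delbar_def wirt_const fun_eq_iff)

lemma del_add:
  assumes "\<eta> \<in> forms A" "\<theta> \<in> forms A"
  shows "del (\<eta> + \<theta>) = del \<eta> + del \<theta>" "delbar (\<eta> + \<theta>) = delbar \<eta> + delbar \<theta>"
proof -
  have *: "wirt (\<lambda>z. (\<eta> + \<theta>) a b c (cinv c z)) (snd c x)
        = wirt (\<lambda>z. \<eta> a b c (cinv c z)) (snd c x) + wirt (\<lambda>z. \<theta> a b c (cinv c z)) (snd c x)"
      "wirt_bar (\<lambda>z. (\<eta> + \<theta>) a b c (cinv c z)) (snd c x)
        = wirt_bar (\<lambda>z. \<eta> a b c (cinv c z)) (snd c x) + wirt_bar (\<lambda>z. \<theta> a b c (cinv c z)) (snd c x)"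
    if x: "x \<in> fst c" for a b c x
  proof (atomize (full), cases "c \<in> A")
    case True
    show "wirt (\<lambda>z. (\<eta> + \<theta>) a b c (cinv c z)) (snd c x)
        = wirt (\<lambda>z. \<eta> a b c (cinv c z)) (snd c x) + wirt (\<lambda>z. \<theta> a b c (cinv c z)) (snd c x) \<and>
      wirt_bar (\<lambda>z. (\<eta> + \<theta>) a b c (cinv c z)) (snd c x)
        = wirt_bar (\<lambda>z. \<eta> a b c (cinv c z)) (snd c x) + wirt_bar (\<lambda>z. \<theta> a b c (cinv c z)) (snd c x)"
      using wirt_add[OF form_derivative[OF assms(1) True x] form_derivative[OF assms(2) True x]] by simp
  next
    case False
    then have "\<eta> a b c = (\<lambda>x. 0)" "\<theta> a b c = (\<lambda>x. 0)"
      using form_zero[OF assms(1)] form_zero[OF assms(2)] by (auto simp: fun_eq_iff)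
    then show "wirt (\<lambda>z. (\<eta> + \<theta>) a b c (cinv c z)) (snd c x)
        = wirt (\<lambda>z. \<eta> a b c (cinv c z)) (snd c x) + wirt (\<lambda>z. \<theta> a b c (cinv c z)) (snd c x) \<and>
      wirt_bar (\<lambda>z. (\<eta> + \<theta>) a b c (cinv c z)) (snd c x)
        = wirt_bar (\<lambda>z. \<eta> a b c (cinv c z)) (snd c x) + wirt_bar (\<lambda>z. \<theta> a b c (cinv c z)) (snd c x)"
      by (simp add: wirt_const)
  qed
  show "del (\<eta> + \<theta>) = del \<eta> + del \<theta>" "delbar (\<eta> + \<theta>) = delbar \<eta> + delbar \<theta>"
    by (intro ext, simp add: del_def delbar_def *[unfolded plus_fun_apply] distrib_left)+
qed

lemma del_cscale:
  assumes "\<eta> \<in> forms A"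
  shows "del (cscale u \<eta>) = cscale u (del \<eta>)" "delbar (cscale u \<eta>) = cscale u (delbar \<eta>)"
proof -
  have *: "wirt (\<lambda>z. u * \<eta> a b c (cinv c z)) (snd c x) = u * wirt (\<lambda>z. \<eta> a b c (cinv c z)) (snd c x) \<and>
      wirt_bar (\<lambda>z. u * \<eta> a b c (cinv c z)) (snd c x) = u * wirt_bar (\<lambda>z. \<eta> a b c (cinv c z)) (snd c x)"
    if x: "x \<in> fst c" for a b c x
  proof (cases "c \<in> A")
    case True
    then show ?thesis using wirt_cmult[OF form_derivative[OF assms True x]] by simp
  next
    case False
    then have "\<eta> a b c = (\<lambda>x. 0)" using form_zero[OF assms] by (auto simp: fun_eq_iff)
    then show ?thesis by (simp add: wirt_const)
  qed
  show "del (cscale u \<eta>) = cscale u (del \<eta>)" "delbar (cscale u \<eta>) = cscale u (delbar \<eta>)"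
    by (intro ext, simp add: del_def delbar_def cscale_def *)+
qed

definition is_function :: "'x form \<Rightarrow> bool" where
  "is_function \<eta> \<longleftrightarrow> \<eta> \<in> forms A \<and> (\<forall>a b. (a, b) \<noteq> (0, 0) \<longrightarrow> \<eta> a b = 0)"

text \<open>The chain rule for a holomorphic transition map keeps the two Wirtinger derivatives
  apart; it yields the transformation laws in types (1,0) and (0,1).\<close>

lemma function_transition:
  assumes "is_function \<eta>" "c \<in> A" "c' \<in> A" "x \<in> fst c" "x \<in> fst c'"
  defines "w e \<equiv> wirt (\<lambda>z. \<eta> 0 0 e (cinv e z)) (snd e x)"
    and "w' e \<equiv> wirt_bar (\<lambda>z. \<eta> 0 0 e (cinv e z)) (snd e x)"
    and "d \<equiv> deriv (snd c' \<circ> cinv c) (snd c x)"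
  shows "w c = w c' * d" "w' c = w' c' * cnj d"
proof -
  have f: "\<eta> \<in> forms A" using assms(1) by (simp add: is_function_def)
  have x: "snd c x \<in> snd c ` (fst c \<inter> fst c')" using assms by blast
  let ?h = "snd c' \<circ> cinv c"
  have hx: "?h (snd c x) = snd c' x" using cinv[OF assms(2,4)] by simp
  have "((\<lambda>z. \<eta> 0 0 c' (cinv c' z)) has_derivative
      frechet_derivative (\<lambda>z. \<eta> 0 0 c' (cinv c' z)) (at (snd c' x))) (at (?h (snd c x)))"
    unfolding hx by (rule form_derivative[OF f assms(3,5)])
  note comp = wirt_compose_holomorphic[OF this transition[OF assms(2,3) x]]
  have eq: "\<eta> 0 0 c' (cinv c' (?h z)) = \<eta> 0 0 c (cinv c z)" if z: "z \<in> snd c ` (fst c \<inter> fst c')" for z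
  proof -
    obtain y where y: "z = snd c y" "y \<in> fst c" "y \<in> fst c'" using z by blast
    then show ?thesis
      using form_transform[OF f assms(2,3) y(2,3), of 0 0] cinv[OF assms(2) y(2)] cinv[OF assms(3) y(3)] by simp
  qed
  note tr = wirt_cong_open[OF open_overlap[OF assms(2,3)] x eq[symmetric] form_derivative[OF f assms(2,4)]]
  show "w c = w c' * d" "w' c = w' c' * cnj d"
    using comp tr hx by (simp_all add: w_def w'_def d_def)
qed

lemma function_del_form:
  assumes "is_function \<eta>"
  shows "del \<eta> \<in> forms A" "delbar \<eta> \<in> forms A"
proof -
  have f: "\<eta> \<in> forms A" and z: "\<And>a b. (a, b) \<noteq> (0, 0) \<Longrightarrow> \<eta> a b = 0" using assms by (auto simp: is_function_def)
  have z1: "\<eta> a b c = (\<lambda>x. 0)" if "(a, b) \<noteq> (0, 0)" for a b c by (rule ext) (simp add: z[OF that])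
  have z2: "\<eta> a b c = (\<lambda>x. 0)" if "c \<notin> A" for a b c using form_zero[OF f] that by (auto simp: fun_eq_iff)
  have del: "del \<eta> a b c x = (if (a, b) = (1, 0) \<and> c \<in> A \<and> x \<in> fst c then wirt (\<lambda>z. \<eta> 0 0 c (cinv c z)) (snd c x) else 0)" for a b c x
    by (cases "b = 0"; cases "c \<in> A") (simp_all add: del_def z1 z2 wirt_const)
  have delbar: "delbar \<eta> a b c x = (if (a, b) = (0, 1) \<and> c \<in> A \<and> x \<in> fst c then wirt_bar (\<lambda>z. \<eta> 0 0 c (cinv c z)) (snd c x) else 0)" for a b c x
    by (cases "a = 0"; cases "c \<in> A") (simp_all add: delbar_def z1 z2 wirt_const)
  have sm: "smooth_on (snd c ` fst c) (\<lambda>z. wirt (\<lambda>z. \<eta> 0 0 c (cinv c z)) z)"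
    "smooth_on (snd c ` fst c) (\<lambda>z. wirt_bar (\<lambda>z. \<eta> 0 0 c (cinv c z)) z)" if c: "c \<in> A" for c
    using smooth_on_wirt[OF chart(2)[OF c] form_smooth[OF f c]] by simp_all
  show "del \<eta> \<in> forms A"
  proof (rule formI)
    show "del \<eta> a b c x = 0" if "\<not> (a \<le> 1 \<and> b \<le> 1 \<and> c \<in> A \<and> x \<in> fst c)" for a b c x
      using that by (auto simp: del)
    show "smooth_on (snd c ` fst c) (\<lambda>z. del \<eta> a b c (cinv c z))" if c: "c \<in> A" for a b c
    proof (cases "(a, b) = (1, 0)")
      case True
      show ?thesis
        by (rule smooth_on_cong[OF chart(2)[OF c] _ sm(1)[OF c]]) (use True c in \<open>simp add: del cinv_mem\<close>)
    next
      case False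
      then show ?thesis using smooth_on_const[OF chart(2)[OF c], of 0] by (auto simp: del)
    qed
    show "del \<eta> a b c x = del \<eta> a b c' x * deriv (snd c' \<circ> cinv c) (snd c x) ^ a * cnj (deriv (snd c' \<circ> cinv c) (snd c x)) ^ b"
      if "c \<in> A" "c' \<in> A" "x \<in> fst c" "x \<in> fst c'" for a b c c' x
      using function_transition(1)[OF assms that] that by (simp add: del)
  qed
  show "delbar \<eta> \<in> forms A"
  proof (rule formI)
    show "delbar \<eta> a b c x = 0" if "\<not> (a \<le> 1 \<and> b \<le> 1 \<and> c \<in> A \<and> x \<in> fst c)" for a b c x
      using that by (auto simp: delbar)
    show "smooth_on (snd c ` fst c) (\<lambda>z. delbar \<eta> a b c (cinv c z))" if c: "c \<in> A" for a b c
    proof (cases "(a, b) = (0, 1)")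
      case True
      show ?thesis
        by (rule smooth_on_cong[OF chart(2)[OF c] _ sm(2)[OF c]]) (use True c in \<open>simp add: delbar cinv_mem\<close>)
    next
      case False
      then show ?thesis using smooth_on_const[OF chart(2)[OF c], of 0] by (auto simp: delbar)
    qed
    show "delbar \<eta> a b c x = delbar \<eta> a b c' x * deriv (snd c' \<circ> cinv c) (snd c x) ^ a * cnj (deriv (snd c' \<circ> cinv c) (snd c x)) ^ b"
      if "c \<in> A" "c' \<in> A" "x \<in> fst c" "x \<in> fst c'" for a b c c' x
      using function_transition(2)[OF assms that] that by (simp add: delbar)
  qed
qed

lemma form_cnj_del:
  assumes "is_function \<eta>"
  shows "form_cnj (del \<eta>) = delbar (form_cnj \<eta>)" "form_cnj (delbar \<eta>) = del (form_cnj \<eta>)"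
proof -
  have f: "\<eta> \<in> forms A" and z: "\<And>a b. (a, b) \<noteq> (0, 0) \<Longrightarrow> \<eta> a b = 0" using assms by (auto simp: is_function_def)
  have z1: "\<eta> a b c = (\<lambda>x. 0)" if "(a, b) \<noteq> (0, 0)" for a b c by (rule ext) (simp add: z[OF that])
  have *: "wirt (\<lambda>z. cnj (\<eta> a b c (cinv c z))) (snd c x) = cnj (wirt_bar (\<lambda>z. \<eta> a b c (cinv c z)) (snd c x)) \<and>
      wirt_bar (\<lambda>z. cnj (\<eta> a b c (cinv c z))) (snd c x) = cnj (wirt (\<lambda>z. \<eta> a b c (cinv c z)) (snd c x))"
    if x: "x \<in> fst c" for a b c x
  proof (cases "c \<in> A")
    case True
    then show ?thesis using wirt_cnj[OF form_derivative[OF f True x]] by simp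
  next
    case False
    then have "\<eta> a b c = (\<lambda>x. 0)" using form_zero[OF f] by (auto simp: fun_eq_iff)
    then show ?thesis by (simp add: wirt_const)
  qed
  show "form_cnj (del \<eta>) = delbar (form_cnj \<eta>)"
  proof (intro ext)
    fix a b c x
    show "form_cnj (del \<eta>) a b c x = delbar (form_cnj \<eta>) a b c x"
      by (cases "a = 0") (simp_all add: form_cnj_def del_def delbar_def * z1 wirt_const)
  qed
  show "form_cnj (delbar \<eta>) = del (form_cnj \<eta>)"
  proof (intro ext)
    fix a b c x
    show "form_cnj (delbar \<eta>) a b c x = del (form_cnj \<eta>) a b c x"
      by (cases "b = 0") (simp_all add: form_cnj_def del_def delbar_def * z1 wirt_const)
  qed
qed

end

section \<open>Degrees, reality and truncation in the complex \<open>K\<close>\<close>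

lemma cscale_0: "cscale u 0 = 0"
  and cscale_cscale: "cscale u (cscale v \<eta>) = cscale (u * v) \<eta>"
  and cscale_1: "cscale 1 \<eta> = \<eta>"
  and cscale_add: "cscale u (\<eta> + \<theta>) = cscale u \<eta> + cscale u \<theta>"
  and cscale_diff: "cscale u (\<eta> - \<theta>) = cscale u \<eta> - cscale u \<theta>"
  and scaleR_eq_cscale: "r *\<^sub>R \<eta> = cscale (of_real r) \<eta>"
  and form_cnj_0: "form_cnj 0 = 0"
  and form_cnj_add: "form_cnj (\<eta> + \<theta>) = form_cnj \<eta> + form_cnj \<theta>"
  and form_cnj_cscale: "form_cnj (cscale u \<eta>) = cscale (cnj u) (form_cnj \<eta>)"
  by (auto simp: cscale_def form_cnj_def scaleR_fun_def scaleR_conv_of_real fun_eq_iff algebra_simps)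

lemma cscale_eq_0_iff: "cscale u \<eta> = 0 \<longleftrightarrow> u = 0 \<or> \<eta> = 0"
  by (auto simp: cscale_def fun_eq_iff)

lemma tpi_nonzero: "tpi \<noteq> 0" and cnj_tpi: "cnj tpi = - tpi"
  by (auto simp: tpi_def)

text \<open>Total degree \<open>j + 1\<close>, with types beyond \<open>1\<close> excluded as well,
  so that nothing is left for \<open>\<bar>j\<bar> > 1\<close>.\<close>

definition graded :: "int \<Rightarrow> 'x form \<Rightarrow> bool" where
  "graded j \<eta> \<longleftrightarrow> (\<forall>a b. \<not> (a \<le> 1 \<and> b \<le> 1 \<and> int a + int b = j + 1) \<longrightarrow> \<eta> a b = 0)"

lemma graded_0: "graded j 0"
  and graded_add: "graded j \<eta> \<Longrightarrow> graded j \<theta> \<Longrightarrow> graded j (\<eta> + \<theta>)"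
  and graded_diff: "graded j \<eta> \<Longrightarrow> graded j \<theta> \<Longrightarrow> graded j (\<eta> - \<theta>)"
  by (auto simp: graded_def)

lemma graded_cscale: "graded j \<eta> \<Longrightarrow> graded j (cscale u \<eta>)"
  by (auto simp: graded_def cscale_def fun_eq_iff)

lemma graded_del:
  assumes "graded j \<eta>" shows "graded (j + 1) (del \<eta>)" "graded (j + 1) (delbar \<eta>)"
proof -
  have z: "\<eta> a b c = (\<lambda>x. 0)" if "\<not> (a \<le> 1 \<and> b \<le> 1 \<and> int a + int b = j + 1)" for a b c
    by (rule ext) (use assms that in \<open>simp add: graded_def\<close>)
  show "graded (j + 1) (del \<eta>)"
    unfolding graded_def
  proof (intro allI impI ext)
    fix a b c x assume ab: "\<not> (a \<le> 1 \<and> b \<le> 1 \<and> int a + int b = j + 1 + 1)"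
    show "del \<eta> a b c x = 0 c x"
    proof (cases "a = 1")
      case True
      then have "\<eta> 0 b c = (\<lambda>x. 0)" for c using ab by (intro z) auto
      then show ?thesis using True by (simp add: del_def wirt_const)
    qed (simp add: del_def)
  qed
  show "graded (j + 1) (delbar \<eta>)"
    unfolding graded_def
  proof (intro allI impI ext)
    fix a b c x assume ab: "\<not> (a \<le> 1 \<and> b \<le> 1 \<and> int a + int b = j + 1 + 1)"
    show "delbar \<eta> a b c x = 0 c x"
    proof (cases "b = 1")
      case True
      then have "\<eta> a 0 c = (\<lambda>x. 0)" for c using ab by (intro z) auto
      then show ?thesis using True by (simp add: delbar_def wirt_const)
    qed (simp add: delbar_def)
  qed
qed

lemma graded_zero: "graded j \<eta> \<Longrightarrow> j < -1 \<or> j > 1 \<Longrightarrow> \<eta> = 0"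
proof -
  assume g: "graded j \<eta>" and j: "j < -1 \<or> j > 1"
  have "\<eta> a b = 0" for a b
    using g j unfolding graded_def by (cases "a \<le> 1 \<and> b \<le> 1 \<and> int a + int b = j + 1") auto
  then show ?thesis by (simp add: fun_eq_iff)
qed

text \<open>On a surface the bound on \<open>\<bar>a - b\<bar>\<close> in the definition of \<open>K\<close> holds automatically.\<close>

lemma K_typeI:
  assumes "K_ok i j k" "a \<le> 1" "b \<le> 1" "int a + int b = j + 1"
  shows "K_type i j k a b"
proof -
  have "2 * k \<ge> i" "even (1 + j - i)" using assms(1) by (auto simp: K_ok_def)
  moreover have "(a = 0 \<or> a = 1) \<and> (b = 0 \<or> b = 1)" using assms(2,3) by auto
  ultimately show ?thesis
    using assms(4) unfolding K_type_def by (elim conjE disjE) (auto, presburger+)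
qed

lemma K_proj_graded: "graded j \<eta> \<Longrightarrow> K_proj i j k \<eta> = (if K_ok i j k then \<eta> else 0)"
proof (intro ext)
  fix a b c x assume g: "graded j \<eta>"
  show "K_proj i j k \<eta> a b c x = (if K_ok i j k then \<eta> else 0) a b c x"
  proof (cases "a \<le> 1 \<and> b \<le> 1 \<and> int a + int b = j + 1")
    case True
    then show ?thesis using K_typeI[of i j k a b] by (simp add: K_proj_def)
  next
    case False
    then have "\<eta> a b = 0" using g by (simp add: graded_def)
    then show ?thesis by (simp add: K_proj_def)
  qed
qed

text \<open>\<open>d1\<close> and \<open>d2\<close> are the two parts of the differential before
  projection. On graded forms the projection is either the identity or zero, according to
  \<open>K_ok\<close>.\<close>

definition d1 :: "'x form \<Rightarrow> 'x form" where "d1 \<eta> = del \<eta> + delbar \<eta>"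
definition d2 :: "'x form \<Rightarrow> 'x form" where "d2 \<eta> = cscale \<i> (delbar \<eta> - del \<eta>)"

lemma graded_d: "graded j \<eta> \<Longrightarrow> graded (j + 1) (d1 \<eta>)" "graded j \<eta> \<Longrightarrow> graded (j + 1) (d2 \<eta>)"
  unfolding d1_def d2_def by (intro graded_add graded_cscale graded_diff graded_del; assumption)+

definition gradedK :: "'x kfam \<Rightarrow> bool" where
  "gradedK x \<longleftrightarrow> (\<forall>i j k. graded j (x (i, j, k)))"

lemma KN_graded:
  "gradedK x \<Longrightarrow> KN x (i, j, k) = (if K_ok i j k then cscale (inverse tpi) (x (i - 2, j, k - 1)) else 0)"
  unfolding KN_def by (simp add: K_proj_graded graded_cscale gradedK_def)

lemma Kd_graded:
  assumes "gradedK x"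
  shows "Kd x (i, j, k) = d1 (x (i - 1, j - 1, k - 1)) + (if K_ok i j k then d2 (x (i - 1, j - 1, k)) else 0)"
proof -
  have "graded (j - 1) (x (i - 1, j - 1, k))" using assms by (simp add: gradedK_def)
  from graded_d(2)[OF this] have "graded j (d2 (x (i - 1, j - 1, k)))" by simp
  then show ?thesis unfolding Kd_def d1_def by (simp add: K_proj_graded flip: d2_def)
qed

lemma gradedK_Kd: "gradedK x \<Longrightarrow> gradedK (Kd x)"
proof -
  assume x: "gradedK x"
  have "graded j (Kd x (i, j, k))" for i j k
  proof -
    have g: "graded (j - 1) (x (i - 1, j - 1, k))" for i k using x by (simp add: gradedK_def)
    have "graded j (d1 (x (i - 1, j - 1, k)))" "graded j (d2 (x (i - 1, j - 1, k)))" for i k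
      using graded_d[OF g] by simp_all
    then show ?thesis unfolding Kd_graded[OF x] by (intro graded_add) (auto simp: graded_0)
  qed
  then show ?thesis by (simp add: gradedK_def)
qed

context riemann
begin

lemma form_graded: "\<eta> \<in> forms A \<Longrightarrow> (\<And>a b. int a + int b \<noteq> j + 1 \<Longrightarrow> \<eta> a b = 0) \<Longrightarrow> graded j \<eta>"
proof -
  assume f: "\<eta> \<in> forms A" and d: "\<And>a b. int a + int b \<noteq> j + 1 \<Longrightarrow> \<eta> a b = 0"
  have "\<eta> a b = 0" if "\<not> (a \<le> 1 \<and> b \<le> 1)" for a b
    by (intro ext) (use form_zero[OF f] that in auto)
  then show ?thesis using d by (auto simp: graded_def)
qed

definition twist :: "int \<Rightarrow> int \<Rightarrow> complex" where "twist i j = (-1) powi ((1 + j - i) div 2)"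

text \<open>As \<open>tpi\<close> is imaginary, a form is \<open>tpi powi n\<close> times a real
  form exactly if conjugation multiplies it by \<open>(-1) powi n\<close>. The sign
  \<open>twist\<close> thus replaces the explicit factor in the definition of
  \<open>K\<close>.\<close>

definition K_form :: "int \<Rightarrow> int \<Rightarrow> 'x form \<Rightarrow> bool" where
  "K_form i j \<eta> \<longleftrightarrow> \<eta> \<in> forms A \<and> form_cnj \<eta> = cscale (twist i j) \<eta> \<and> graded j \<eta>"

lemma cnj_tpi_powi: "cnj tpi powi ((1 + j - i) div 2) = twist i j * tpi powi ((1 + j - i) div 2)"
proof -
  have "cnj tpi powi m = (-1) powi m * tpi powi m" for m
    using power_int_mult_distrib[of "-1" tpi m] by (simp add: cnj_tpi)
  then show ?thesis by (simp only: twist_def)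
qed

text \<open>By \<open>K_typeI\<close> the restriction on types follows from the degree, so
  \<open>k\<close> enters only through \<open>K_ok\<close>.\<close>

lemma K3_eq: "K3 A i j k = (if K_ok i j k then {\<eta>. K_form i j \<eta>} else {0})"
proof (cases "K_ok i j k")
  case True
  define n where "n = (1 + j - i) div 2"
  have tw: "cnj tpi powi n = twist i j * tpi powi n" unfolding n_def by (rule cnj_tpi_powi)
  have nz: "tpi powi n \<noteq> 0" using tpi_nonzero by simp
  have "\<eta> \<in> K3 A i j k \<longleftrightarrow> K_form i j \<eta>" for \<eta>
  proof
    assume "\<eta> \<in> K3 A i j k"
    then obtain \<theta> where \<theta>: "\<eta> = cscale (tpi powi n) \<theta>" "\<theta> \<in> forms A" "form_cnj \<theta> = \<theta>"
      "\<And>a b. \<not> K_type i j k a b \<Longrightarrow> \<theta> a b = 0"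
      using True unfolding K3_def n_def by auto
    have "graded j \<theta>" using \<theta> by (intro form_graded) (auto simp: K_type_def)
    then show "K_form i j \<eta>"
      using \<theta> by (simp add: K_form_def cscale_form graded_cscale form_cnj_cscale tw cscale_cscale)
  next
    assume K: "K_form i j \<eta>"
    define \<theta> where "\<theta> = cscale (inverse (tpi powi n)) \<eta>"
    have \<eta>: "\<eta> = cscale (tpi powi n) \<theta>" using nz by (simp add: \<theta>_def cscale_cscale cscale_1)
    have "twist i j \<noteq> 0" by (simp add: twist_def)
    then have "form_cnj \<theta> = \<theta>"
      using K nz by (simp add: \<theta>_def form_cnj_cscale K_form_def cscale_cscale tw field_simps)
    moreover have "\<theta> \<in> forms A" using K by (simp add: \<theta>_def K_form_def cscale_form)
    moreover have "\<theta> a b = 0" if t: "\<not> K_type i j k a b" for a b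
    proof -
      have "graded j \<theta>" using K by (simp add: \<theta>_def K_form_def graded_cscale)
      then show ?thesis using K_typeI[OF True, of a b] t unfolding graded_def by blast
    qed
    ultimately show "\<eta> \<in> K3 A i j k" using True \<eta> unfolding K3_def n_def by auto
  qed
  then show ?thesis using True by auto
next
  case False
  then show ?thesis by (simp add: K3_def)
qed

lemma K_form_0: "K_form i j 0"
  by (simp add: K_form_def zero_form graded_0 form_cnj_0 cscale_0)

lemma KtotD:
  assumes "x \<in> Ktot A"
  shows "K_form i j (x (i, j, k))" "x (i, j, k) \<noteq> 0 \<Longrightarrow> K_ok i j k" "finite {t. x t \<noteq> 0}"
    "x (i, j, k) \<in> forms A" "graded j (x (i, j, k))" "gradedK x"
proof -
  have K: "x (i, j, k) \<in> K3 A i j k" for i j k using assms by (simp add: Ktot_def)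
  show f: "K_form i j (x (i, j, k))" for i j k
    using K[of i j k] K_form_0 by (simp add: K3_eq split: if_splits)
  show "x (i, j, k) \<noteq> 0 \<Longrightarrow> K_ok i j k" using K[of i j k] by (simp add: K3_eq split: if_splits)
  show "finite {t. x t \<noteq> 0}" using assms by (simp add: Ktot_def)
  show "x (i, j, k) \<in> forms A" "graded j (x (i, j, k))" using f by (simp_all add: K_form_def)
  show "gradedK x" using f by (simp add: gradedK_def K_form_def)
qed

lemma KtotI:
  assumes "finite {t. x t \<noteq> 0}" "\<And>i j k. K_ok i j k \<Longrightarrow> K_form i j (x (i, j, k))"
    "\<And>i j k. x (i, j, k) \<noteq> 0 \<Longrightarrow> K_ok i j k"
  shows "x \<in> Ktot A"
  using assms unfolding Ktot_def K3_eq by simp blast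

lemma Ktot_weights:
  assumes "x \<in> Ktot A" "x (i, j, k) \<noteq> 0" shows "\<bar>j\<bar> \<le> 1" "odd (i + j)"
proof -
  show "\<bar>j\<bar> \<le> 1" using graded_zero[OF KtotD(5)[OF assms(1), of j i k]] assms(2) by linarith
  show "odd (i + j)" using KtotD(2)[OF assms] by (simp add: K_ok_def)
qed

lemma K_form_add: "K_form i j \<eta> \<Longrightarrow> K_form i j \<theta> \<Longrightarrow> K_form i j (\<eta> + \<theta>)"
  by (simp add: K_form_def add_form graded_add form_cnj_add cscale_add)

lemma K_form_scaleR: "K_form i j \<eta> \<Longrightarrow> K_form i j (cscale (of_real r) \<eta>)"
  by (simp add: K_form_def cscale_form graded_cscale form_cnj_cscale cscale_cscale mult.commute)

lemma subspace_Ktot: "subspace (Ktot A)"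
proof (rule subspaceI)
  show "0 \<in> Ktot A" by (rule KtotI) (simp_all add: K_form_0)
  show "x + y \<in> Ktot A" if x: "x \<in> Ktot A" and y: "y \<in> Ktot A" for x y
  proof (rule KtotI)
    have "{t. (x + y) t \<noteq> 0} \<subseteq> {t. x t \<noteq> 0} \<union> {t. y t \<noteq> 0}" by auto
    then show "finite {t. (x + y) t \<noteq> 0}" using KtotD(3)[OF x] KtotD(3)[OF y] by (metis finite_UnI finite_subset)
    show "K_form i j ((x + y) (i, j, k))" for i j k
      using K_form_add KtotD(1)[OF x] KtotD(1)[OF y] by simp
    show "K_ok i j k" if nz: "(x + y) (i, j, k) \<noteq> 0" for i j k
    proof (cases "x (i, j, k) = 0")
      case True
      then show ?thesis using nz KtotD(2)[OF y] by simp
    next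
      case False
      then show ?thesis using KtotD(2)[OF x] by simp
    qed
  qed
  show "r *\<^sub>R x \<in> Ktot A" if x: "x \<in> Ktot A" for r x
  proof (rule KtotI)
    have e: "(r *\<^sub>R x) t = cscale (of_real r) (x t)" for t by (simp add: scaleR_fun_def[of r x] scaleR_eq_cscale)
    show "finite {t. (r *\<^sub>R x) t \<noteq> 0}"
      by (rule finite_subset[OF _ KtotD(3)[OF x]]) (auto simp: e cscale_eq_0_iff)
    show "K_form i j ((r *\<^sub>R x) (i, j, k))" for i j k
      unfolding e by (rule K_form_scaleR[OF KtotD(1)[OF x]])
    show "K_ok i j k" if nz: "(r *\<^sub>R x) (i, j, k) \<noteq> 0" for i j k
      using nz KtotD(2)[OF x] unfolding e by (auto simp: cscale_eq_0_iff)
  qed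
qed

lemma scaleR_kfam: "(r *\<^sub>R (x :: 'x kfam)) t = cscale (of_real r) (x t)"
  by (simp add: scaleR_fun_def[of r x] scaleR_eq_cscale)

lemma d_0: "d1 0 = 0" "d2 0 = 0"
  by (simp_all add: d1_def d2_def del_0 delbar_0 cscale_0)

lemma d_add:
  assumes "\<eta> \<in> forms A" "\<theta> \<in> forms A"
  shows "d1 (\<eta> + \<theta>) = d1 \<eta> + d1 \<theta>" "d2 (\<eta> + \<theta>) = d2 \<eta> + d2 \<theta>"
  by (simp_all add: d1_def d2_def del_add[OF assms] cscale_add cscale_diff algebra_simps)

lemma d_cscale:
  assumes "\<eta> \<in> forms A"
  shows "d1 (cscale u \<eta>) = cscale u (d1 \<eta>)" "d2 (cscale u \<eta>) = cscale u (d2 \<eta>)"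
  by (simp_all add: d1_def d2_def del_cscale[OF assms] cscale_add cscale_diff cscale_cscale mult.commute)

lemma Kd_eq:
  "x \<in> Ktot A \<Longrightarrow> Kd x (i, j, k) = d1 (x (i - 1, j - 1, k - 1)) + (if K_ok i j k then d2 (x (i - 1, j - 1, k)) else 0)"
  by (rule Kd_graded[OF KtotD(6)])

lemma KN_eq:
  "x \<in> Ktot A \<Longrightarrow> KN x (i, j, k) = (if K_ok i j k then cscale (inverse tpi) (x (i - 2, j, k - 1)) else 0)"
  by (rule KN_graded[OF KtotD(6)])

lemma Kd_add:
  assumes "x \<in> Ktot A" "y \<in> Ktot A" shows "Kd (x + y) = Kd x + Kd y"
proof
  fix t :: "int \<times> int \<times> int"
  obtain i j k where t: "t = (i, j, k)" using prod_cases3 by blast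
  have "x + y \<in> Ktot A" using assms subspace_add[OF subspace_Ktot] by blast
  then show "Kd (x + y) t = (Kd x + Kd y) t"
    using assms by (simp add: t Kd_eq d_add KtotD(4))
qed

lemma Kd_scaleR:
  assumes "x \<in> Ktot A" shows "Kd (r *\<^sub>R x) = r *\<^sub>R Kd x"
proof
  fix t :: "int \<times> int \<times> int"
  obtain i j k where t: "t = (i, j, k)" using prod_cases3 by blast
  have "r *\<^sub>R x \<in> Ktot A" using assms subspace_scale[OF subspace_Ktot] by blast
  then show "Kd (r *\<^sub>R x) t = (r *\<^sub>R Kd x) t"
    using assms by (simp add: t Kd_eq scaleR_kfam d_cscale KtotD(4) cscale_add cscale_0)
qed

lemma Kd_0: "Kd (0 :: 'x kfam) = 0"
  using Kd_scaleR[OF subspace_0[OF subspace_Ktot], of 0] by (simp only: scaleR_zero_left)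

lemma KN_add:
  assumes "x \<in> Ktot A" "y \<in> Ktot A" shows "KN (x + y) = KN x + KN y"
proof
  fix t :: "int \<times> int \<times> int"
  obtain i j k where t: "t = (i, j, k)" using prod_cases3 by blast
  have "x + y \<in> Ktot A" using assms subspace_add[OF subspace_Ktot] by blast
  then show "KN (x + y) t = (KN x + KN y) t"
    using assms by (simp add: t KN_eq cscale_add)
qed

lemma KN_scaleR:
  assumes "x \<in> Ktot A" shows "KN (r *\<^sub>R x) = r *\<^sub>R KN x"
proof
  fix t :: "int \<times> int \<times> int"
  obtain i j k where t: "t = (i, j, k)" using prod_cases3 by blast
  have "r *\<^sub>R x \<in> Ktot A" using assms subspace_scale[OF subspace_Ktot] by blast
  then show "KN (r *\<^sub>R x) t = (r *\<^sub>R KN x) t"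
    using assms by (simp add: t KN_eq scaleR_kfam cscale_cscale mult.commute cscale_0)
qed

lemma twist_shift: "even (1 + j - i) \<Longrightarrow> twist (i + 2) j = - twist i j"
proof -
  assume "even (1 + j - i)"
  then have "(1 + j - (i + 2)) div 2 = (1 + j - i) div 2 - 1" by presburger
  then show ?thesis by (simp add: twist_def power_int_diff)
qed

lemma KN_Ktot:
  assumes x: "x \<in> Ktot A" shows "KN x \<in> Ktot A"
proof (rule KtotI)
  have "{t. KN x t \<noteq> 0} \<subseteq> (\<lambda>(i, j, k). (i + 2, j, k + 1)) ` {t. x t \<noteq> 0}"
  proof
    fix t assume t: "t \<in> {t. KN x t \<noteq> 0}"
    obtain i j k where ijk: "t = (i, j, k)" using prod_cases3 by blast
    have "x (i - 2, j, k - 1) \<noteq> 0" using t by (auto simp: ijk KN_eq[OF x] cscale_0 split: if_splits)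
    then show "t \<in> (\<lambda>(i, j, k). (i + 2, j, k + 1)) ` {t. x t \<noteq> 0}"
      by (intro image_eqI[of _ _ "(i - 2, j, k - 1)"]) (auto simp: ijk)
  qed
  then show "finite {t. KN x t \<noteq> 0}" using KtotD(3)[OF x] by (metis finite_imageI finite_subset)
  show "K_form i j (KN x (i, j, k))" if ok: "K_ok i j k" for i j k
  proof -
    have K: "K_form (i - 2) j (x (i - 2, j, k - 1))" by (rule KtotD(1)[OF x])
    have "even (1 + j - (i - 2))" using ok by (auto simp: K_ok_def)
    from twist_shift[OF this] have tw: "twist i j = - twist (i - 2) j" by simp
    show ?thesis
      using K ok unfolding K_form_def KN_eq[OF x]
      by (simp add: cscale_form graded_cscale form_cnj_cscale cscale_cscale tw cnj_tpi mult.commute)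
  qed
  show "K_ok i j k" if "KN x (i, j, k) \<noteq> 0" for i j k
    using that by (simp add: KN_eq[OF x] split: if_splits)
qed

text \<open>Apart from truncation, a scalar is exchanged with a linear operator. As for truncation,
  wherever the forms involved are nonzero the conditions \<open>K_ok\<close> on the two sides
  agree.\<close>

lemma KN_Kd:
  assumes x: "x \<in> Ktot A" shows "KN (Kd x) = Kd (KN x)"
proof
  fix t :: "int \<times> int \<times> int"
  obtain i j k where t: "t = (i, j, k)" using prod_cases3 by blast
  define p where "p = x (i - 3, j - 1, k - 2)"
  define q where "q = x (i - 3, j - 1, k - 1)"
  have f: "p \<in> forms A" "q \<in> forms A" by (simp_all add: p_def q_def KtotD(4)[OF x])
  have kp: "p \<noteq> 0 \<Longrightarrow> K_ok (i - 3) (j - 1) (k - 2)" and kq: "q \<noteq> 0 \<Longrightarrow> K_ok (i - 3) (j - 1) (k - 1)"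
    by (auto simp: p_def q_def KtotD(2)[OF x])
  have "KN (Kd x) t = (if K_ok i j k then cscale (inverse tpi)
      (d1 p + (if K_ok (i - 2) j (k - 1) then d2 q else 0)) else 0)"
    by (simp add: t KN_graded[OF gradedK_Kd[OF KtotD(6)[OF x]]] Kd_eq[OF x] p_def q_def)
  moreover have "Kd (KN x) t = d1 (if K_ok (i - 1) (j - 1) (k - 1) then cscale (inverse tpi) p else 0)
      + (if K_ok i j k then d2 (if K_ok (i - 1) (j - 1) k then cscale (inverse tpi) q else 0) else 0)"
    by (simp add: t Kd_eq[OF KN_Ktot[OF x]] KN_eq[OF x] p_def q_def)
  moreover have "p = 0 \<or> K_ok i j k \<and> K_ok (i - 1) (j - 1) (k - 1) \<or> \<not> K_ok i j k \<and> \<not> K_ok (i - 1) (j - 1) (k - 1)"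
    using kp by (cases "p = 0") (auto simp: K_ok_def)
  moreover have "q = 0 \<or> \<not> K_ok i j k \<or> K_ok (i - 2) j (k - 1) \<and> K_ok (i - 1) (j - 1) k"
    using kq by (cases "q = 0") (auto simp: K_ok_def)
  ultimately show "KN (Kd x) t = Kd (KN x) t"
    by (auto simp: d_0 d_cscale[OF f(1)] d_cscale[OF f(2)] cscale_add cscale_0)
qed

section \<open>Bihomogeneous components of families\<close>

definition comp :: "int \<times> int \<Rightarrow> 'x kfam \<Rightarrow> 'x kfam" where
  "comp p x = (\<lambda>(i, j, k). if (i, j) = p then x (i, j, k) else 0)"

lemma comp_apply: "comp p x (i, j, k) = (if (i, j) = p then x (i, j, k) else 0)"
  by (simp add: comp_def)

lemma comp_Ktot: "x \<in> Ktot A \<Longrightarrow> comp p x \<in> Ktot A"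
proof (rule KtotI)
  assume x: "x \<in> Ktot A"
  show "finite {t. comp p x t \<noteq> 0}"
    by (rule finite_subset[OF _ KtotD(3)[OF x]]) (auto simp: comp_def split: if_splits)
  show "K_form i j (comp p x (i, j, k))" for i j k
    using KtotD(1)[OF x] by (simp add: comp_apply K_form_0)
  show "K_ok i j k" if "comp p x (i, j, k) \<noteq> 0" for i j k
    using KtotD(2)[OF x] that by (simp add: comp_apply split: if_splits)
qed

lemma comp_K2: "x \<in> Ktot A \<Longrightarrow> comp (i, j) x \<in> K2 A i j"
  by (auto simp: K2_def comp_Ktot comp_apply)

lemma K2_comp: "x \<in> K2 A i j \<Longrightarrow> comp (i, j) x = x"
  by (auto simp: K2_def comp_def fun_eq_iff)

lemma comp_add: "comp p (x + y) = comp p x + comp p y"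
  and comp_0: "comp p 0 = 0"
  and comp_comp: "comp p (comp q x) = (if p = q then comp p x else 0)"
  by (auto simp: comp_def fun_eq_iff)

lemma comp_scaleR: "comp p (r *\<^sub>R x) = r *\<^sub>R comp p x"
  by (rule ext) (auto simp: comp_def scaleR_kfam cscale_0 split: prod.splits)

lemma comp_Kd:
  assumes x: "x \<in> Ktot A" shows "comp (i, j) (Kd x) = Kd (comp (i - 1, j - 1) x)"
proof
  fix t :: "int \<times> int \<times> int"
  obtain a b k where t: "t = (a, b, k)" using prod_cases3 by blast
  show "comp (i, j) (Kd x) t = Kd (comp (i - 1, j - 1) x) t"
    by (auto simp: t comp_apply Kd_eq[OF x] Kd_eq[OF comp_Ktot[OF x]] d_0)
qed

lemma comp_KN:
  assumes x: "x \<in> Ktot A" shows "comp (i, j) (KN x) = KN (comp (i - 2, j) x)"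
proof
  fix t :: "int \<times> int \<times> int"
  obtain a b k where t: "t = (a, b, k)" using prod_cases3 by blast
  show "comp (i, j) (KN x) t = KN (comp (i - 2, j) x) t"
    by (auto simp: t comp_apply KN_eq[OF x] KN_eq[OF comp_Ktot[OF x]] cscale_0)
qed

lemma sum_kfam_apply: "(\<Sum>q\<in>I. (f q :: 'x kfam)) t = (\<Sum>q\<in>I. f q t)"
  by (induction I rule: infinite_finite_induct) (simp_all only: sum.infinite sum.empty sum.insert zero_fun_apply plus_fun_apply not_False_eq_True)

lemma sum_comp:
  assumes "finite I" "\<And>i j k. x (i, j, k) \<noteq> 0 \<Longrightarrow> (i, j) \<in> I"
  shows "(\<Sum>p\<in>I. comp p x) = x"
proof
  fix t :: "int \<times> int \<times> int"
  obtain i j k where t: "t = (i, j, k)" using prod_cases3 by blast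
  have "(\<Sum>p\<in>I. comp p x) t = (\<Sum>p\<in>I. if p = (i, j) then x t else 0)"
    unfolding t sum_kfam_apply by (intro sum.cong) (auto simp: comp_apply)
  then show "(\<Sum>p\<in>I. comp p x) t = x t"
    using assms by (auto simp: t)
qed

lemma subspace_cocycles: "subspace (cocycles A)"
  using subspace_Ktot Kd_add Kd_scaleR Kd_0 unfolding cocycles_def subspace_def by auto

lemma comp_cocycles: "x \<in> cocycles A \<Longrightarrow> comp p x \<in> cocycles A"
proof -
  assume x: "x \<in> cocycles A"
  obtain i j where p: "p = (i, j)" by fastforce
  have "Kd (comp p x) = comp (i + 1, j + 1) (Kd x)"
    using comp_Kd[of x "i + 1" "j + 1"] x by (simp add: p cocycles_def)
  then show ?thesis using x by (simp add: cocycles_def comp_Ktot comp_0)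
qed

lemma KN_0: "KN (0 :: 'x kfam) = 0"
  using KN_scaleR[OF subspace_0[OF subspace_Ktot], of 0] by (simp only: scaleR_zero_left)

lemma KN_cocycles: "x \<in> cocycles A \<Longrightarrow> KN x \<in> cocycles A"
  using KN_Ktot[of x] KN_Kd[of x] KN_0 by (simp add: cocycles_def)

end

section \<open>The polarization form on cochains\<close>

lemma surface_integral_cong: "\<eta> 1 1 = \<theta> 1 1 \<Longrightarrow> surface_integral X A \<eta> = surface_integral X A \<theta>"
  unfolding surface_integral_def by simp

lemma surface_integral_cscale: "surface_integral X A (cscale u \<eta>) = u * surface_integral X A \<eta>"
proof -
  have "integral S (\<lambda>z. - 2 * \<i> * (u * f z)) = u * integral S (\<lambda>z. - 2 * \<i> * f z)" for S and f :: "complex \<Rightarrow> complex"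
    using integral_mult_right[of S u "\<lambda>z. - 2 * \<i> * f z"] by (simp add: mult.left_commute mult.assoc)
  then show ?thesis unfolding surface_integral_def cscale_def by (simp add: sum_distrib_left Let_def mult.left_commute)
qed

lemma surface_integral_0: "surface_integral X A 0 = 0"
  using surface_integral_cscale[of X A 0 0] by (simp add: cscale_0)

lemma wedge_11: "wedge \<eta> \<theta> 1 1 c x =
    \<eta> 0 0 c x * \<theta> 1 1 c x - \<eta> 0 1 c x * \<theta> 1 0 c x + \<eta> 1 0 c x * \<theta> 0 1 c x + \<eta> 1 1 c x * \<theta> 0 0 c x"
  by (simp add: wedge_def atMost_Suc)

lemma wedge_cscale: "wedge (cscale u \<eta>) \<theta> = cscale u (wedge \<eta> \<theta>)"
    "wedge \<eta> (cscale u \<theta>) = cscale u (wedge \<eta> \<theta>)"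
  by (auto simp: wedge_def cscale_def fun_eq_iff sum_distrib_left intro!: sum.cong)

lemma weil_cscale: "weil (cscale u \<eta>) = cscale u (weil \<eta>)"
  by (auto simp: weil_def cscale_def fun_eq_iff)

lemma wedge_0: "wedge 0 \<theta> = 0" "wedge \<eta> (weil 0) = 0"
  by (auto simp: wedge_def weil_def fun_eq_iff)

lemma div_2_add: "p = q + 2 * r \<Longrightarrow> p div 2 = q div 2 + (r :: int)"
  by simp

text \<open>The exponents \<open>m * (m + 1) div 2\<close> at \<open>1 - j\<close> and
  \<open>- 1 - j\<close> differ by the odd number \<open>1 - 2 * j\<close>.\<close>

lemma eps_shift: "eps (1 - j) = - eps (- 1 - j)"
proof -
  have "(1 - j) * (1 - j + 1) = (- 1 - j) * (- 1 - j + 1) + 2 * (1 - 2 * j)" by (simp add: algebra_simps)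
  from div_2_add[OF this]
  have "(1 - j) * (1 - j + 1) div 2 = (- 1 - j) * (- 1 - j + 1) div 2 + (1 - 2 * j)" .
  then show ?thesis unfolding eps_def by (simp add: power_int_add power_int_minus_left)
qed

text \<open>The two exponents differ by \<open>3 * j\<close>, which has the parity of
  \<open>j\<close>.\<close>

lemma eps_reflect: "eps (1 + j) = (-1) powi j * eps (1 - j)"
proof -
  have "(1 + j) * (1 + j + 1) = (1 - j) * (1 - j + 1) + 2 * (3 * j)" by (simp add: algebra_simps)
  from div_2_add[OF this]
  have "(1 + j) * (1 + j + 1) div 2 = (1 - j) * (1 - j + 1) div 2 + 3 * j" .
  then show ?thesis unfolding eps_def by (simp add: power_int_add power_int_minus_left)
qed

text \<open>The summand of \<open>Kpsi\<close>, defined for all indices, so that sums over the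
  supports of different families can be compared.\<close>

definition kterm :: "'x topology \<Rightarrow> 'x chart set \<Rightarrow> 'x kfam \<Rightarrow> 'x kfam \<Rightarrow> int \<times> int \<times> int \<Rightarrow> complex" where
  "kterm X A x y = (\<lambda>(i, j, k). inverse tpi * eps (1 - j) * (-1) powi k *
       surface_integral X A (wedge (x (- i, - j, k)) (weil (y (i, j, k + i)))))"

lemma kterm_0: "x (- i, - j, k) = 0 \<or> y (i, j, k + i) = 0 \<Longrightarrow> kterm X A x y (i, j, k) = 0"
  by (auto simp: kterm_def wedge_0 surface_integral_0)

lemma Kpsi_eq:
  assumes "finite F" "\<And>p. p \<notin> F \<Longrightarrow> kterm X A x y p = 0" "finite {t. x t \<noteq> 0}"
  shows "Kpsi X A x y = Re (\<Sum>p\<in>F. kterm X A x y p)"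
proof -
  let ?S = "{(i, j, k). x (- i, - j, k) \<noteq> 0}"
  have "?S \<subseteq> (\<lambda>(i, j, k). (- i, - j, k)) ` {t. x t \<noteq> 0}"
  proof
    fix p assume p: "p \<in> ?S"
    obtain i j k where ijk: "p = (i, j, k)" using prod_cases3 by blast
    show "p \<in> (\<lambda>(i, j, k). (- i, - j, k)) ` {t. x t \<noteq> 0}"
      using p by (intro image_eqI[of _ _ "(- i, - j, k)"]) (auto simp: ijk)
  qed
  then have fin: "finite ?S" using assms(3) by (metis finite_imageI finite_subset)
  have "(\<Sum>p\<in>?S. kterm X A x y p) = (\<Sum>p\<in>?S \<union> F. kterm X A x y p)"
  proof (rule sum.mono_neutral_left)
    show "\<forall>p\<in>(?S \<union> F) - ?S. kterm X A x y p = 0"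
    proof
      fix p assume p: "p \<in> (?S \<union> F) - ?S"
      obtain i j k where ijk: "p = (i, j, k)" using prod_cases3 by blast
      have "x (- i, - j, k) = 0" using p by (simp add: ijk)
      then show "kterm X A x y p = 0" unfolding ijk by (intro kterm_0) simp
    qed
  qed (use fin assms(1) in auto)
  also have "\<dots> = (\<Sum>p\<in>F. kterm X A x y p)"
    by (rule sum.mono_neutral_right) (use fin assms(1,2) in auto)
  finally show ?thesis
    unfolding Kpsi_def kterm_def by (simp add: case_prod_unfold)
qed

lemma Kpsi_finite_support:
  assumes "finite {t. x t \<noteq> 0}"
  obtains F where "finite F" "\<And>p. p \<notin> F \<Longrightarrow> kterm X A x y p = 0"
proof
  show "finite ((\<lambda>(i, j, k). (- i, - j, k)) ` {t. x t \<noteq> 0})" using assms by simp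
  show "kterm X A x y p = 0" if p: "p \<notin> (\<lambda>(i, j, k). (- i, - j, k)) ` {t. x t \<noteq> 0}" for p
  proof -
    obtain i j k where ijk: "p = (i, j, k)" using prod_cases3 by blast
    have "x (- i, - j, k) = 0"
    proof (rule ccontr)
      assume "x (- i, - j, k) \<noteq> 0"
      then have "p \<in> (\<lambda>(i, j, k). (- i, - j, k)) ` {t. x t \<noteq> 0}"
        by (intro image_eqI[of _ _ "(- i, - j, k)"]) (auto simp: ijk)
      then show False using p by blast
    qed
    then show ?thesis unfolding ijk by (intro kterm_0) simp
  qed
qed

text \<open>\<open>Kpsi\<close> sums over the support of its first argument, and the symmetries
  change that argument. A bijection of all indices that reverses the sign of each term avoids any
  comparison of supports.\<close>

lemma Kpsi_reindex:
  assumes fx: "finite {t. x t \<noteq> 0}" and fx': "finite {t. x' t \<noteq> 0}"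
    and h: "bij h" "\<And>p. kterm X A x y p = - kterm X A x' y' (h p)"
  shows "Kpsi X A x y = - Kpsi X A x' y'"
proof -
  obtain F where F: "finite F" "\<And>p. p \<notin> F \<Longrightarrow> kterm X A x y p = 0" using Kpsi_finite_support[OF fx] by blast
  have "Kpsi X A x' y' = Re (\<Sum>p\<in>h ` F. kterm X A x' y' p)"
  proof (rule Kpsi_eq[OF _ _ fx'])
    show "finite (h ` F)" using F(1) by simp
    show "kterm X A x' y' p = 0" if p: "p \<notin> h ` F" for p
    proof -
      obtain q where q: "p = h q" using h(1) by (metis bij_pointE)
      then have "q \<notin> F" using p by blast
      then show ?thesis using F(2) h(2)[of q] q by simp
    qed
  qed
  also have "(\<Sum>p\<in>h ` F. kterm X A x' y' p) = (\<Sum>p\<in>F. kterm X A x' y' (h p))"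
    using h(1) by (intro sum.reindex_cong[of h]) (auto simp: bij_def inj_on_def)
  also have "\<dots> = - (\<Sum>p\<in>F. kterm X A x y p)"
    unfolding sum_negf[symmetric] by (rule sum.cong) (simp_all add: h(2))
  finally show ?thesis using Kpsi_eq[OF F fx] by simp
qed

context riemann
begin

text \<open>Both sides carry one further factor \<open>inverse tpi\<close>; the sign comes from
  \<open>(-1) powi k\<close>, since \<open>N\<close> raises \<open>k\<close> by \<open>1\<close>. If
  both forms are nonzero, then neither target is truncated.\<close>

lemma Kpsi_KN:
  assumes x: "x \<in> Ktot A" and y: "y \<in> Ktot A"
  shows "Kpsi X A (KN x) y = - Kpsi X A x (KN y)"
proof (rule Kpsi_reindex[OF KtotD(3)[OF KN_Ktot[OF x]] KtotD(3)[OF x]])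
  let ?h = "\<lambda>(i, j, k). (i + 2 :: int, j :: int, k - 1 :: int)"
  show "bij ?h"
    by (rule o_bij[of "\<lambda>(i, j, k). (i - 2, j, k + 1)"]) auto
  fix p :: "int \<times> int \<times> int"
  obtain i j k where p: "p = (i, j, k)" using prod_cases3 by blast
  define a where "a = x (- i - 2, - j, k - 1)"
  define b where "b = y (i, j, k + i)"
  have l: "kterm X A (KN x) y p = inverse tpi * eps (1 - j) * (-1) powi k *
      surface_integral X A (wedge (if K_ok (- i) (- j) k then cscale (inverse tpi) a else 0) (weil b))"
    by (simp add: p kterm_def KN_eq[OF x] a_def b_def)
  have r: "kterm X A x (KN y) (?h p) = inverse tpi * eps (1 - j) * (-1) powi (k - 1) *
      surface_integral X A (wedge a (weil (if K_ok (i + 2) j (k + i + 1) then cscale (inverse tpi) b else 0)))"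
    by (simp add: p kterm_def KN_eq[OF y] a_def b_def algebra_simps)
  show "kterm X A (KN x) y p = - kterm X A x (KN y) (?h p)"
  proof (cases "a = 0 \<or> b = 0")
    case True
    then show ?thesis unfolding l r by (auto simp: wedge_0 surface_integral_0 cscale_0)
  next
    case False
    have "K_ok (- i - 2) (- j) (k - 1)" "K_ok i j (k + i)"
      using False KtotD(2)[OF x, of "- i - 2" "- j" "k - 1"] KtotD(2)[OF y, of i j "k + i"]
      by (auto simp: a_def b_def)
    then have "K_ok (- i) (- j) k" "K_ok (i + 2) j (k + i + 1)" by (auto simp: K_ok_def)
    then show ?thesis unfolding l r
      by (simp add: wedge_cscale weil_cscale surface_integral_cscale power_int_diff)
  qed
qed

text \<open>The integrand is symmetric in the two forms once the Weil operator is applied to the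
  second. The exchange produces \<open>(-1) powi j\<close> from \<open>eps\<close> and
  \<open>(-1) powi i\<close> from the shift of \<open>k\<close>; as \<open>i + j\<close> is odd,
  their product is \<open>-1\<close>.\<close>

lemma Kpsi_antisym:
  assumes x: "x \<in> Ktot A" and y: "y \<in> Ktot A"
  shows "Kpsi X A y x = - Kpsi X A x y"
proof (rule Kpsi_reindex[OF KtotD(3)[OF y] KtotD(3)[OF x]])
  let ?h = "\<lambda>(i, j, k). (- i :: int, - j :: int, k + i :: int)"
  show "bij ?h"
    by (rule o_bij[of ?h]) auto
  fix p :: "int \<times> int \<times> int"
  obtain i j k where p: "p = (i, j, k)" using prod_cases3 by blast
  define a where "a = y (- i, - j, k)"
  define b where "b = x (i, j, k + i)"
  have l: "kterm X A y x p = inverse tpi * eps (1 - j) * (-1) powi k * surface_integral X A (wedge a (weil b))"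
    by (simp add: p kterm_def a_def b_def)
  have r: "kterm X A x y (?h p) = inverse tpi * eps (1 + j) * (-1) powi (k + i) * surface_integral X A (wedge b (weil a))"
    by (simp add: p kterm_def a_def b_def)
  have s: "surface_integral X A (wedge b (weil a)) = surface_integral X A (wedge a (weil b))"
  proof (rule surface_integral_cong, intro ext)
    fix c z
    show "wedge b (weil a) 1 1 c z = wedge a (weil b) 1 1 c z"
      unfolding wedge_11 by (simp add: weil_def power_int_minus field_simps)
  qed
  show "kterm X A y x p = - kterm X A x y (?h p)"
  proof (cases "a = 0")
    case True
    then show ?thesis unfolding l r s by (simp add: wedge_0 surface_integral_0)
  next
    case False
    then have "odd (- i + - j)" using Ktot_weights(2)[OF y, of "- i" "- j" k] by (simp add: a_def)
    then have "odd (i + j)" by simp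
    then have "(-1) powi j * (-1) powi i = (-1 :: complex)"
      by (simp add: power_int_minus_left)
    then show ?thesis unfolding l r s eps_reflect by (auto simp: power_int_add power_int_minus_left split: if_splits)
  qed
qed

lemma Kpsi_degree:
  assumes x: "x \<in> Ktot A" and "(i', j') \<noteq> (- i, - j)"
  shows "Kpsi X A (comp (i, j) x) (comp (i', j') y) = 0"
proof -
  have "Kpsi X A (comp (i, j) x) (comp (i', j') y) = Re (\<Sum>p\<in>{}. kterm X A (comp (i, j) x) (comp (i', j') y) p)"
  proof (rule Kpsi_eq[OF _ _ KtotD(3)[OF comp_Ktot[OF x]]])
    fix p :: "int \<times> int \<times> int"
    obtain a b k where p: "p = (a, b, k)" using prod_cases3 by blast
    show "kterm X A (comp (i, j) x) (comp (i', j') y) p = 0"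
      unfolding p by (rule kterm_0) (use assms(2) in \<open>auto simp: comp_apply\<close>)
  qed simp
  then show ?thesis by simp
qed

end

section \<open>Multiplication by the Kaehler form\<close>

locale kaehler_surface = riemann X A for X :: "'x topology" and A +
  fixes \<omega> :: "'x form"
  assumes kaehler: "kaehler_form A \<omega>"
begin

lemma \<omega>: "\<omega> \<in> forms A" "form_cnj \<omega> = \<omega>" "(a, b) \<noteq> (1, 1) \<Longrightarrow> \<omega> a b c x = 0"
proof -
  show "\<omega> \<in> forms A" "form_cnj \<omega> = \<omega>" using kaehler by (auto simp: kaehler_form_def)
  assume "(a, b) \<noteq> (1, 1)"
  then have "\<omega> a b = 0" using kaehler unfolding kaehler_form_def by blast
  then show "\<omega> a b c x = 0" by simp
qed

lemma \<omega>_zero: "\<omega> 0 0 c x = 0" "\<omega> 0 (Suc 0) c x = 0" "\<omega> (Suc 0) 0 c x = 0"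
  by (rule \<omega>(3), simp)+

lemma cnj_\<omega>: "cnj (\<omega> (Suc 0) (Suc 0) c x) = - \<omega> (Suc 0) (Suc 0) c x"
proof -
  have "form_cnj \<omega> 1 1 c x = \<omega> 1 1 c x" by (simp only: \<omega>(2))
  then show ?thesis by (simp add: form_cnj_def minus_equation_iff)
qed

lemma wedge_\<omega>: "wedge \<eta> \<omega> a b c x = (if (a, b) = (1, 1) then \<eta> 0 0 c x * \<omega> 1 1 c x else 0)"
proof (cases "(a, b) = (1, 1)")
  case True
  then show ?thesis using wedge_11[of \<eta> \<omega> c x] by (simp add: \<omega>_zero)
next
  case False
  have z: "(\<Sum>a'\<le>a. \<Sum>b'\<le>b. (-1) ^ (b' * (a - a')) * \<eta> a' b' c x * \<omega> (a - a') (b - b') c x) = 0"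
    if "a \<le> 1" "b \<le> 1"
  proof (intro sum.neutral ballI)
    fix a' b'
    have "(a - a', b - b') \<noteq> (1, 1)" using False that by auto
    from \<omega>(3)[OF this] show "(-1) ^ (b' * (a - a')) * \<eta> a' b' c x * \<omega> (a - a') (b - b') c x = 0" by simp
  qed
  have "wedge \<eta> \<omega> a b c x = 0"
  proof (cases "a \<le> 1 \<and> b \<le> 1")
    case True
    then show ?thesis unfolding wedge_def
      using z[OF conjunct1[OF True] conjunct2[OF True]] by (simp only: True if_True simp_thms)
  next
    case False
    then show ?thesis unfolding wedge_def by (simp only: if_False)
  qed
  then show ?thesis using False by auto
qed

lemma Kell_eq: "Kell \<omega> x (i, j, k) = cscale tpi (wedge (x (i, j - 2, k)) \<omega>)"
  by (simp add: Kell_def)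

lemma K_form_wedge:
  assumes "K_form i (j - 2) \<eta>" "even (1 + j - i)"
  shows "K_form i j (cscale tpi (wedge \<eta> \<omega>))"
proof -
  have f: "\<eta> \<in> forms A" and re: "form_cnj \<eta> = cscale (twist i (j - 2)) \<eta>" and g: "graded (j - 2) \<eta>"
    using assms(1) by (auto simp: K_form_def)
  have "wedge \<eta> \<omega> \<in> forms A"
  proof (rule formI)
    show "wedge \<eta> \<omega> a b c x = 0" if "\<not> (a \<le> 1 \<and> b \<le> 1 \<and> c \<in> A \<and> x \<in> fst c)" for a b c x
      using that form_zero[OF f, of 0 0 c x] by (auto simp: wedge_\<omega>)
    show "smooth_on (snd c ` fst c) (\<lambda>z. wedge \<eta> \<omega> a b c (cinv c z))" if "c \<in> A" for a b c
    proof (cases "(a, b) = (1, 1)")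
      case True
      then show ?thesis
        using smooth_on_mult[OF chart(2) form_smooth form_smooth, OF that f that \<omega>(1) that] by (simp add: wedge_\<omega>)
    next
      case False
      then show ?thesis using smooth_on_const[OF chart(2)[OF that], of 0] by (auto simp: wedge_\<omega>)
    qed
    show "wedge \<eta> \<omega> a b c x = wedge \<eta> \<omega> a b c' x * deriv (snd c' \<circ> cinv c) (snd c x) ^ a * cnj (deriv (snd c' \<circ> cinv c) (snd c x)) ^ b"
      if "c \<in> A" "c' \<in> A" "x \<in> fst c" "x \<in> fst c'" for a b c c' x
      using form_transform[OF f that, of 0 0] form_transform[OF \<omega>(1) that, of 1 1] by (auto simp: wedge_\<omega>)
  qed
  moreover have "graded j (wedge \<eta> \<omega>)"
    unfolding graded_def
  proof (intro allI impI ext)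
    fix a b c x assume ab: "\<not> (a \<le> 1 \<and> b \<le> 1 \<and> int a + int b = j + 1)"
    show "wedge \<eta> \<omega> a b c x = 0 c x"
    proof (cases "(a, b) = (1, 1)")
      case True
      then have "\<eta> 0 0 = 0" using ab g by (auto simp: graded_def)
      then show ?thesis by (simp add: wedge_\<omega>)
    qed (auto simp: wedge_\<omega>)
  qed
  moreover have "form_cnj (wedge \<eta> \<omega>) = cscale (twist i (j - 2)) (wedge \<eta> \<omega>)"
  proof (intro ext)
    fix a b c x
    have "form_cnj \<eta> 0 0 c x = twist i (j - 2) * \<eta> 0 0 c x" unfolding re by (simp add: cscale_def)
    then show "form_cnj (wedge \<eta> \<omega>) a b c x = cscale (twist i (j - 2)) (wedge \<eta> \<omega>) a b c x"
      by (auto simp: form_cnj_def cscale_def wedge_\<omega> cnj_\<omega>)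
  qed
  moreover have "twist i (j - 2) = - twist i j"
  proof -
    have "(1 + (j - 2) - i) div 2 = (1 + j - i) div 2 - 1" using assms(2) by presburger
    then show ?thesis by (simp add: twist_def power_int_diff)
  qed
  ultimately show ?thesis
    by (simp add: K_form_def cscale_form graded_cscale form_cnj_cscale cscale_cscale cnj_tpi mult.commute)
qed

lemma Kell_Ktot:
  assumes x: "x \<in> Ktot A" shows "Kell \<omega> x \<in> Ktot A"
proof (rule KtotI)
  have nz: "x (i, j - 2, k) \<noteq> 0" if "Kell \<omega> x (i, j, k) \<noteq> 0" for i j k
    using that by (auto simp: Kell_eq wedge_0 cscale_0)
  have "{t. Kell \<omega> x t \<noteq> 0} \<subseteq> (\<lambda>(i, j, k). (i, j + 2, k)) ` {t. x t \<noteq> 0}"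
  proof
    fix t assume t: "t \<in> {t. Kell \<omega> x t \<noteq> 0}"
    obtain i j k where ijk: "t = (i, j, k)" using prod_cases3 by blast
    show "t \<in> (\<lambda>(i, j, k). (i, j + 2, k)) ` {t. x t \<noteq> 0}"
      using nz[of i j k] t by (intro image_eqI[of _ _ "(i, j - 2, k)"]) (auto simp: ijk)
  qed
  then show "finite {t. Kell \<omega> x t \<noteq> 0}" using KtotD(3)[OF x] by (metis finite_imageI finite_subset)
  show "K_form i j (Kell \<omega> x (i, j, k))" if "K_ok i j k" for i j k
    unfolding Kell_eq using that by (intro K_form_wedge KtotD(1)[OF x]) (simp add: K_ok_def)
  show "K_ok i j k" if "Kell \<omega> x (i, j, k) \<noteq> 0" for i j k
    using KtotD(2)[OF x nz[OF that]] by (auto simp: K_ok_def)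
qed

lemma Kell_zero:
  assumes "x (i, j - 2, k) 0 0 = 0" shows "Kell \<omega> x (i, j, k) = 0"
  using assms by (auto simp: Kell_eq cscale_def wedge_\<omega> fun_eq_iff)

text \<open>The values of \<open>Kell\<close> are forms of top degree, whose differentials vanish
  for reasons of degree.\<close>

lemma Kell_cocycle:
  assumes x: "x \<in> Ktot A" shows "Kell \<omega> x \<in> cocycles A"
proof -
  have e: "Kell \<omega> x \<in> Ktot A" by (rule Kell_Ktot[OF x])
  have z: "d1 (Kell \<omega> x (i, j, k)) = 0 \<and> d2 (Kell \<omega> x (i, j, k)) = 0" for i j k
  proof (cases "j = 1")
    case True
    have "graded 1 (Kell \<omega> x (i, 1, k))" by (rule KtotD(5)[OF e])
    from graded_d[OF this] have "graded 2 (d1 (Kell \<omega> x (i, 1, k)))" "graded 2 (d2 (Kell \<omega> x (i, 1, k)))" by simp_all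
    then show ?thesis using True graded_zero by (metis less_numeral_extra(4) one_less_numeral_iff semiring_norm(76))
  next
    case False
    have "x (i, j - 2, k) 0 0 = 0" using KtotD(5)[OF x, of "j - 2" i k] False by (auto simp: graded_def)
    then show ?thesis by (simp add: Kell_zero d_0)
  qed
  have "Kd (Kell \<omega> x) t = 0" for t
  proof -
    obtain i j k where ijk: "t = (i, j, k)" using prod_cases3 by blast
    show ?thesis unfolding ijk Kd_eq[OF e] using z by auto
  qed
  then show ?thesis using e by (simp add: cocycles_def fun_eq_iff)
qed

text \<open>\<open>Kell\<close> depends only on the function part, and the function part of a
  differential is zero because there is no lower degree.\<close>

lemma Kell_Kd:
  assumes y: "y \<in> Ktot A" shows "Kell \<omega> (Kd y) = 0"
proof
  fix t :: "int \<times> int \<times> int"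
  obtain i j k where ijk: "t = (i, j, k)" using prod_cases3 by blast
  have "Kd y (i, j - 2, k) 0 0 = 0"
  proof (cases "j = 1")
    case True
    have "y (a, - 2, b) = 0" for a b using graded_zero[OF KtotD(5)[OF y, of "- 2" a b]] by simp
    then show ?thesis using True by (simp add: Kd_eq[OF y] d_0)
  next
    case False
    have "graded (j - 2) (Kd y (i, j - 2, k))"
      using gradedK_Kd[OF KtotD(6)[OF y]] by (simp add: gradedK_def)
    then show ?thesis using False by (auto simp: graded_def)
  qed
  then show "Kell \<omega> (Kd y) t = 0 t" unfolding ijk by (simp add: Kell_zero)
qed

lemma Kell_add: "Kell \<omega> (x + y) = Kell \<omega> x + Kell \<omega> y"
  by (auto simp: fun_eq_iff Kell_eq cscale_def wedge_\<omega> distrib_right distrib_left)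

lemma Kell_scaleR: "Kell \<omega> (r *\<^sub>R x) = r *\<^sub>R Kell \<omega> x"
  by (rule ext) (auto simp: fun_eq_iff Kell_eq scaleR_kfam cscale_def wedge_\<omega> split: prod.splits)

text \<open>Both integrands are the product of the two functions with \<open>\<omega>\<close>; the
  sign is that of \<open>eps\<close> under the shift of \<open>j\<close> by
  \<open>2\<close>.\<close>

lemma Kpsi_Kell:
  assumes x: "x \<in> Ktot A" and y: "y \<in> Ktot A"
  shows "Kpsi X A (Kell \<omega> x) y = - Kpsi X A x (Kell \<omega> y)"
proof (rule Kpsi_reindex[OF KtotD(3)[OF Kell_Ktot[OF x]] KtotD(3)[OF x]])
  let ?h = "\<lambda>(i, j, k). (i :: int, j + 2 :: int, k :: int)"
  show "bij ?h"
    by (rule o_bij[of "\<lambda>(i, j, k). (i, j - 2, k)"]) auto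
  fix p :: "int \<times> int \<times> int"
  obtain i j k where p: "p = (i, j, k)" using prod_cases3 by blast
  define a where "a = x (- i, - j - 2, k)"
  define b where "b = y (i, j, k + i)"
  have l: "kterm X A (Kell \<omega> x) y p = inverse tpi * eps (1 - j) * (-1) powi k *
      surface_integral X A (wedge (cscale tpi (wedge a \<omega>)) (weil b))"
    by (simp add: p kterm_def Kell_eq a_def b_def)
  have "1 - (j + 2) = - 1 - j" "- (j + 2) = - j - 2" "j + 2 - 2 = j" by simp_all
  then have r: "kterm X A x (Kell \<omega> y) (?h p) = inverse tpi * eps (- 1 - j) * (-1) powi k *
      surface_integral X A (wedge a (weil (cscale tpi (wedge b \<omega>))))"
    unfolding p kterm_def prod.case Kell_eq a_def b_def by simp
  have s: "surface_integral X A (wedge (wedge a \<omega>) (weil b)) = surface_integral X A (wedge a (weil (wedge b \<omega>)))"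
  proof (rule surface_integral_cong, intro ext)
    fix c z
    show "wedge (wedge a \<omega>) (weil b) 1 1 c z = wedge a (weil (wedge b \<omega>)) 1 1 c z"
      unfolding wedge_11 by (simp add: weil_def wedge_\<omega> \<omega>_zero)
  qed
  show "kterm X A (Kell \<omega> x) y p = - kterm X A x (Kell \<omega> y) (?h p)"
    unfolding l r by (simp add: wedge_cscale weil_cscale surface_integral_cscale s eps_shift)
qed

end

section \<open>Maps induced on a quotient\<close>

lemma quotient_byD:
  assumes "quotient_by Z B cls"
  shows "x \<in> Z \<Longrightarrow> y \<in> Z \<Longrightarrow> cls (x + y) = cls x + cls y" "x \<in> Z \<Longrightarrow> cls (r *\<^sub>R x) = r *\<^sub>R cls x"
    "\<exists>x\<in>Z. cls x = v" "x \<in> Z \<Longrightarrow> cls x = 0 \<longleftrightarrow> x \<in> B"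
proof -
  have "v \<in> cls ` Z" using assms by (simp add: quotient_by_def)
  then show "\<exists>x\<in>Z. cls x = v" by blast
qed (use assms in \<open>auto simp: quotient_by_def\<close>)

text \<open>\<open>induced\<close> evaluates at a representative chosen by \<open>inv_into\<close>.
  Two representatives differ by an element of \<open>B\<close>, on which \<open>f\<close>
  vanishes.\<close>

lemma quotient_by_induced:
  assumes q: "quotient_by Z B cls" and Z: "subspace Z"
    and add: "\<And>x y. x \<in> Z \<Longrightarrow> y \<in> Z \<Longrightarrow> f (x + y) = f x + f y"
    and scale: "\<And>r x. x \<in> Z \<Longrightarrow> f (r *\<^sub>R x) = r *\<^sub>R f x"
    and zero: "\<And>x. x \<in> Z \<Longrightarrow> x \<in> B \<Longrightarrow> f x = 0"
  shows "\<And>z. z \<in> Z \<Longrightarrow> induced Z cls f (cls z) = f z" "linear (induced Z cls f)"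
proof -
  show e: "induced Z cls f (cls z) = f z" if z: "z \<in> Z" for z
  proof -
    define y where "y = inv_into Z cls (cls z)"
    have y: "y \<in> Z" "cls y = cls z" using z by (simp_all add: y_def inv_into_into f_inv_into_f)
    have ny: "(-1) *\<^sub>R y \<in> Z" using subspace_scale[OF Z] y by blast
    have "cls (z + (-1) *\<^sub>R y) = 0"
      using quotient_byD(1)[OF q z ny] quotient_byD(2)[OF q y(1), of "-1"] y(2) by simp
    then have "f (z + (-1) *\<^sub>R y) = 0"
      using quotient_byD(4)[OF q subspace_add[OF Z z ny]] zero[OF subspace_add[OF Z z ny]] by blast
    then have "f z + (-1) *\<^sub>R f y = 0" by (simp only: add[OF z ny] scale[OF y(1)])
    then show ?thesis by (simp add: induced_def flip: y_def)
  qed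
  show "linear (induced Z cls f)"
  proof (rule linearI)
    fix u v r
    obtain x y where xy: "x \<in> Z" "cls x = u" "y \<in> Z" "cls y = v" using quotient_byD(3)[OF q] by metis
    have "u + v = cls (x + y)" "r *\<^sub>R u = cls (r *\<^sub>R x)"
      using xy quotient_byD(1,2)[OF q] by simp_all
    then show "induced Z cls f (u + v) = induced Z cls f u + induced Z cls f v"
      "induced Z cls f (r *\<^sub>R u) = r *\<^sub>R induced Z cls f u"
      using xy e add scale subspace_add[OF Z] subspace_scale[OF Z] by metis+
  qed
qed


section \<open>The Lefschetz module on the cohomology of \<open>K\<close>\<close>

locale surface_module = kaehler_surface X A \<omega>
  for X :: "'x topology" and A and \<omega> :: "'x form" +
  fixes cls :: "'x kfam \<Rightarrow> 'v::real_vector" and \<sigma> :: "real^2^2 \<Rightarrow> real^2^2 \<Rightarrow> 'v \<Rightarrow> 'v"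
    and \<psi> :: "'v \<Rightarrow> 'v \<Rightarrow> real"
  assumes module: "polarized_lefschetz_cohomology X A \<omega> cls \<sigma> \<psi>"
begin

lemma quotient: "quotient_by (cocycles A) (Kd ` Ktot A) cls"
  using module by (simp add: polarized_lefschetz_cohomology_def cohomology_def)

lemmas cls_add = quotient_byD(1)[OF quotient]
  and cls_scale = quotient_byD(2)[OF quotient]
  and cls_surj = quotient_byD(3)[OF quotient]
  and cls_eq_0 = quotient_byD(4)[OF quotient]

lemma cocycles_Ktot: "x \<in> cocycles A \<Longrightarrow> x \<in> Ktot A" and cocycles_Kd: "x \<in> cocycles A \<Longrightarrow> Kd x = 0"
  by (auto simp: cocycles_def)

lemma cls_0: "cls 0 = 0"
  using cls_scale[OF subspace_0[OF subspace_cocycles], of 0] by (simp only: scaleR_zero_left)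

lemma cls_sum: "(\<And>p. p \<in> I \<Longrightarrow> f p \<in> cocycles A) \<Longrightarrow> cls (\<Sum>p\<in>I. f p) = (\<Sum>p\<in>I. cls (f p))"
proof (induction I rule: infinite_finite_induct)
  case (insert p I)
  have "(\<Sum>p\<in>I. f p) \<in> cocycles A" using insert by (intro subspace_sum[OF subspace_cocycles]) auto
  then have "cls (f p + (\<Sum>p\<in>I. f p)) = cls (f p) + (\<Sum>p\<in>I. cls (f p))"
    using insert cls_add by simp
  then show ?case by (simp only: sum.insert[OF insert.hyps])
qed (simp_all only: sum.infinite sum.empty cls_0 not_False_eq_True)

definition pr :: "int \<times> int \<Rightarrow> 'v \<Rightarrow> 'v" where
  "pr p = induced (cocycles A) cls (\<lambda>x. cls (comp p x))"

lemma pr_cls: "z \<in> cocycles A \<Longrightarrow> pr p (cls z) = cls (comp p z)"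
  and linear_pr_cls: "linear (pr p)"
proof -
  have zero: "cls (comp p x) = 0" if "x \<in> cocycles A" "x \<in> Kd ` Ktot A" for x
  proof -
    obtain i j where p: "p = (i, j)" by fastforce
    obtain y where y: "y \<in> Ktot A" "x = Kd y" using \<open>x \<in> Kd ` Ktot A\<close> by blast
    have "comp p x = Kd (comp (i - 1, j - 1) y)" using comp_Kd[OF y(1)] y(2) p by simp
    then have "comp p x \<in> Kd ` Ktot A" using comp_Ktot[OF y(1)] by blast
    then show ?thesis using cls_eq_0[OF comp_cocycles[OF \<open>x \<in> cocycles A\<close>]] by blast
  qed
  have "cls (comp p (x + y)) = cls (comp p x) + cls (comp p y)" if "x \<in> cocycles A" "y \<in> cocycles A" for x y
    unfolding comp_add using cls_add comp_cocycles that by blast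
  moreover have "cls (comp p (r *\<^sub>R x)) = r *\<^sub>R cls (comp p x)" if "x \<in> cocycles A" for r x
    unfolding comp_scaleR using cls_scale comp_cocycles that by blast
  ultimately show "z \<in> cocycles A \<Longrightarrow> pr p (cls z) = cls (comp p z)" "linear (pr p)"
    unfolding pr_def using quotient_by_induced[OF quotient subspace_cocycles, of "\<lambda>x. cls (comp p x)"] zero by blast+
qed

lemma HN_cls: "z \<in> cocycles A \<Longrightarrow> HN A cls (cls z) = cls (KN z)"
proof -
  have zero: "cls (KN x) = 0" if "x \<in> cocycles A" "x \<in> Kd ` Ktot A" for x
  proof -
    obtain y where y: "y \<in> Ktot A" "x = Kd y" using \<open>x \<in> Kd ` Ktot A\<close> by blast
    then have "KN x \<in> Kd ` Ktot A" using KN_Kd[OF y(1)] KN_Ktot[OF y(1)] by blast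
    then show ?thesis using cls_eq_0[OF KN_cocycles[OF \<open>x \<in> cocycles A\<close>]] by blast
  qed
  have "cls (KN (x + y)) = cls (KN x) + cls (KN y)" if "x \<in> cocycles A" "y \<in> cocycles A" for x y
    unfolding KN_add[OF cocycles_Ktot[OF that(1)] cocycles_Ktot[OF that(2)]] using cls_add KN_cocycles that by blast
  moreover have "cls (KN (r *\<^sub>R x)) = r *\<^sub>R cls (KN x)" if "x \<in> cocycles A" for r x
    unfolding KN_scaleR[OF cocycles_Ktot[OF that]] using cls_scale KN_cocycles that by blast
  ultimately show "z \<in> cocycles A \<Longrightarrow> HN A cls (cls z) = cls (KN z)"
    unfolding HN_def using quotient_by_induced(1)[OF quotient subspace_cocycles, of "\<lambda>x. cls (KN x)"] zero by blast
qed

lemma Hell_cls: "z \<in> cocycles A \<Longrightarrow> Hell A \<omega> cls (cls z) = cls (Kell \<omega> z)"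
proof -
  have zero: "cls (Kell \<omega> x) = 0" if "x \<in> Kd ` Ktot A" for x
    using that Kell_Kd cls_0 by auto
  have "cls (Kell \<omega> (x + y)) = cls (Kell \<omega> x) + cls (Kell \<omega> y)" if "x \<in> cocycles A" "y \<in> cocycles A" for x y
    unfolding Kell_add using cls_add Kell_cocycle cocycles_Ktot that by blast
  moreover have "cls (Kell \<omega> (r *\<^sub>R x)) = r *\<^sub>R cls (Kell \<omega> x)" if "x \<in> cocycles A" for r x
    unfolding Kell_scaleR using cls_scale Kell_cocycle cocycles_Ktot that by blast
  ultimately show "z \<in> cocycles A \<Longrightarrow> Hell A \<omega> cls (cls z) = cls (Kell \<omega> z)"
    unfolding Hell_def using quotient_by_induced(1)[OF quotient subspace_cocycles, of "\<lambda>x. cls (Kell \<omega> x)"] zero by blast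
qed

definition support :: "'x kfam \<Rightarrow> (int \<times> int) set" where
  "support x = (\<lambda>(i, j, k). (i, j)) ` {t. x t \<noteq> 0}"

lemma finite_support: "x \<in> Ktot A \<Longrightarrow> finite (support x)"
  using KtotD(3) by (simp add: support_def)

lemma supportI: "x (i, j, k) \<noteq> 0 \<Longrightarrow> (i, j) \<in> support x"
  unfolding support_def by (rule image_eqI[of _ _ "(i, j, k)"]) auto

lemma comp_support: "p \<notin> support x \<Longrightarrow> comp p x = 0"
proof
  fix t :: "int \<times> int \<times> int" assume p: "p \<notin> support x"
  obtain i j k where t: "t = (i, j, k)" using prod_cases3 by blast
  show "comp p x t = 0 t" using p supportI[of x i j k] by (auto simp: t comp_apply)
qed

lemma support_sum: "x \<in> Ktot A \<Longrightarrow> (\<Sum>p\<in>support x. comp p x) = x"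
  by (rule sum_comp[OF finite_support supportI])

lemma grading_pr: "grading pr"
proof (rule grading.intro)
  show "linear (pr p)" for p by (rule linear_pr_cls)
  show "pr p (pr p' v) = (if p = p' then pr p v else 0)" for p p' v
  proof -
    obtain z where z: "z \<in> cocycles A" "cls z = v" using cls_surj by blast
    then have "pr p (pr p' v) = cls (comp p (comp p' z))" using pr_cls comp_cocycles by metis
    also have "\<dots> = (if p = p' then pr p v else 0)"
      using z(2) pr_cls[OF z(1), of p] cls_0 unfolding comp_comp by (cases "p = p'") (simp_all only: if_True if_False simp_thms)
    finally show ?thesis .
  qed
  have sub: "{p. pr p (cls z) \<noteq> 0} \<subseteq> support z" if z: "z \<in> cocycles A" for z
  proof (rule subsetI, rule ccontr)
    fix p assume p: "p \<in> {p. pr p (cls z) \<noteq> 0}" "p \<notin> support z"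
    have "pr p (cls z) = 0" unfolding pr_cls[OF z] comp_support[OF p(2)] by (rule cls_0)
    then show False using p(1) by blast
  qed
  show fin: "finite {p. pr p v \<noteq> 0}" for v
  proof -
    obtain z where z: "z \<in> cocycles A" "cls z = v" using cls_surj by blast
    then show ?thesis using finite_subset[OF sub[OF z(1)] finite_support[OF cocycles_Ktot[OF z(1)]]] by simp
  qed
  show "(\<Sum>p | pr p v \<noteq> 0. pr p v) = v" for v
  proof -
    obtain z where z: "z \<in> cocycles A" "cls z = v" using cls_surj by blast
    have "(\<Sum>p | pr p (cls z) \<noteq> 0. pr p (cls z)) = (\<Sum>p\<in>support z. pr p (cls z))"
      by (rule sum.mono_neutral_left[OF finite_support[OF cocycles_Ktot[OF z(1)]] sub[OF z(1)]]) auto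
    also have "\<dots> = cls (\<Sum>p\<in>support z. comp p z)"
      by (subst cls_sum) (use comp_cocycles[OF z(1)] pr_cls[OF z(1)] in auto)
    also have "\<dots> = cls z" by (simp only: support_sum[OF cocycles_Ktot[OF z(1)]])
    finally show ?thesis using z(2) by simp
  qed
qed

lemma H2_eq: "H2 A cls i j = {v. pr (i, j) v = v}"
proof (intro equalityI subsetI)
  fix v assume "v \<in> H2 A cls i j"
  then obtain z where "z \<in> cocycles A" "z \<in> K2 A i j" "v = cls z" by (auto simp: H2_def)
  then show "v \<in> {v. pr (i, j) v = v}" by (simp add: pr_cls K2_comp)
next
  fix v assume "v \<in> {v. pr (i, j) v = v}"
  then have v: "pr (i, j) v = v" by simp
  obtain z where z: "z \<in> cocycles A" "cls z = v" using cls_surj by blast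
  then have "v = cls (comp (i, j) z)" using v pr_cls by metis
  then show "v \<in> H2 A cls i j"
    unfolding H2_def using comp_cocycles[OF z(1)] comp_K2[OF cocycles_Ktot[OF z(1)]] by blast
qed

lemma lefschetz: "lefschetz_rep (H2 A cls) (HN A cls) (Hell A \<omega> cls) \<sigma>"
  and \<psi>_cls: "x \<in> cocycles A \<Longrightarrow> y \<in> cocycles A \<Longrightarrow> \<psi> (cls x) (cls y) = Kpsi X A x y"
  and inner_product_polarization: "inner_product_on (polarization_ip \<psi> \<sigma>)"
  using module by (auto simp: polarized_lefschetz_cohomology_def)

text \<open>The identities for \<open>\<psi>\<close> descend from those for \<open>Kpsi\<close> on
  cocycles, and the restrictions on the weights from those on the support of a
  representative.\<close>

lemma lefschetz_module_cohomology: "lefschetz_module pr \<sigma> (HN A cls) (Hell A \<omega> cls) \<psi>"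
proof (intro lefschetz_module.intro[OF grading_pr] lefschetz_module_axioms.intro)
  note L = lefschetz[unfolded lefschetz_rep_def]
  show "linear (\<sigma> g h)" if "g \<in> SL2" "h \<in> SL2" for g h using L that by blast
  show "\<sigma> (mat 1) (mat 1) = id" using L by blast
  show "\<sigma> (g ** g') (h ** h') = \<sigma> g h \<circ> \<sigma> g' h'"
    if "g \<in> SL2" "h \<in> SL2" "g' \<in> SL2" "h' \<in> SL2" for g h g' h' using L that by blast
  show "\<sigma> (diag2 a (inverse a)) (diag2 b (inverse b)) (pr (i, j) x) = (a powi i * b powi j) *\<^sub>R pr (i, j) x"
    if "a \<noteq> 0" "b \<noteq> 0" for a b i j x
  proof -
    have "pr (i, j) x \<in> H2 A cls i j" using grading.pr_pr[OF grading_pr] by (simp add: H2_eq)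
    then show ?thesis using L that by blast
  qed
  show "((\<lambda>t. f (\<sigma> (mat 1 + t *\<^sub>R matE) (mat 1) x)) has_real_derivative f (HN A cls x)) (at 0)"
    "((\<lambda>t. f (\<sigma> (mat 1) (mat 1 + t *\<^sub>R matE) x)) has_real_derivative f (Hell A \<omega> cls x)) (at 0)"
    if "linear f" for f x using L that by blast+
  show "\<bar>j\<bar> \<le> 1 \<and> odd (i + j)" if nz: "pr (i, j) x \<noteq> 0" for i j x
  proof -
    obtain z where z: "z \<in> cocycles A" "cls z = x" using cls_surj by blast
    then have "comp (i, j) z \<noteq> 0" using nz pr_cls[OF z(1)] cls_0 by metis
    then have "(i, j) \<in> support z" using comp_support by blast
    then obtain k where "z (i, j, k) \<noteq> 0" by (auto simp: support_def)
    then show ?thesis using Ktot_weights[OF cocycles_Ktot[OF z(1)]] by blast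
  qed
  show "\<psi> (HN A cls x) y = - \<psi> x (HN A cls y)" for x y
  proof -
    obtain a b where "a \<in> cocycles A" "cls a = x" "b \<in> cocycles A" "cls b = y" using cls_surj by metis
    then show ?thesis using HN_cls \<psi>_cls KN_cocycles Kpsi_KN cocycles_Ktot by metis
  qed
  show "\<psi> (Hell A \<omega> cls x) y = - \<psi> x (Hell A \<omega> cls y)" for x y
  proof -
    obtain a b where "a \<in> cocycles A" "cls a = x" "b \<in> cocycles A" "cls b = y" using cls_surj by metis
    then show ?thesis using Hell_cls \<psi>_cls Kell_cocycle Kpsi_Kell cocycles_Ktot by metis
  qed
  show "\<psi> y x = - \<psi> x y" for x y
  proof -
    obtain a b where "a \<in> cocycles A" "cls a = x" "b \<in> cocycles A" "cls b = y" using cls_surj by metis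
    then show ?thesis using \<psi>_cls Kpsi_antisym cocycles_Ktot by metis
  qed
  show "\<psi> (pr (i, j) x) (pr (i', j') y) = 0" if d: "(i', j') \<noteq> (- i, - j)" for i j i' j' x y
  proof -
    obtain a b where ab: "a \<in> cocycles A" "cls a = x" "b \<in> cocycles A" "cls b = y" using cls_surj by metis
    have "\<psi> (pr (i, j) x) (pr (i', j') y) = Kpsi X A (comp (i, j) a) (comp (i', j') b)"
      using ab pr_cls \<psi>_cls comp_cocycles by metis
    then show ?thesis using Kpsi_degree[OF cocycles_Ktot[OF ab(1)] d] by simp
  qed
  show "inner_product_on (polarization_ip \<psi> \<sigma>)" by (rule inner_product_polarization)
qed

sublocale L: lefschetz_module pr \<sigma> "HN A cls" "Hell A \<omega> cls" \<psi>
  by (rule lefschetz_module_cohomology)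

lemma PhiTilde_eq: "PhiTilde A cls x = L.phi x"
proof -
  define c :: "int \<times> int \<Rightarrow> real" where "c = (\<lambda>(i, j). of_int (1 + j - i) / 2)"
  define G where "G x = (\<lambda>(i, j, k). c (i, j) *\<^sub>R x (i, j, k))" for x :: "'x kfam"
  have G: "G x (i, j, k) = cscale (of_real (c (i, j))) (x (i, j, k))" for x i j k
    by (simp add: G_def scaleR_eq_cscale)
  have GK: "G x \<in> Ktot A" if x: "x \<in> Ktot A" for x
  proof (rule KtotI)
    show "finite {t. G x t \<noteq> 0}"
      by (rule finite_subset[OF _ KtotD(3)[OF x]]) (auto simp: G_def)
    show "K_form i j (G x (i, j, k))" for i j k unfolding G by (rule K_form_scaleR[OF KtotD(1)[OF x]])
    show "K_ok i j k" if "G x (i, j, k) \<noteq> 0" for i j k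
      using that KtotD(2)[OF x, of i j k] by (auto simp: G cscale_eq_0_iff)
  qed
  have GKd: "Kd (G x) = G (Kd x)" if x: "x \<in> Ktot A" for x
  proof
    fix t :: "int \<times> int \<times> int"
    obtain i j k where t: "t = (i, j, k)" using prod_cases3 by blast
    \<comment> \<open>The differential raises \<open>i\<close> and \<open>j\<close> together and
      leaves \<open>1 + j - i\<close> unchanged, so \<open>G\<close> is a map of complexes.\<close>
    have "c (i - 1, j - 1) = c (i, j)" by (simp add: c_def)
    then show "Kd (G x) t = G (Kd x) t"
      by (simp add: t Kd_eq[OF GK[OF x]] Kd_eq[OF x] G d_cscale KtotD(4)[OF x] cscale_add cscale_0)
  qed
  have G0: "G 0 = 0" by (auto simp: G_def fun_eq_iff)
  have Gc: "G x \<in> cocycles A" if "x \<in> cocycles A" for x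
    using that GK GKd G0 by (simp add: cocycles_def)
  have Gadd: "G (x + y) = G x + G y" for x y by (auto simp: G_def fun_eq_iff scaleR_add_right)
  have Gscale: "G (r *\<^sub>R x) = r *\<^sub>R G x" for r x
    by (rule ext) (auto simp: G scaleR_kfam cscale_cscale mult.commute split: prod.splits)
  have zero: "cls (G x) = 0" if "x \<in> cocycles A" "x \<in> Kd ` Ktot A" for x
  proof -
    obtain y where y: "y \<in> Ktot A" "x = Kd y" using \<open>x \<in> Kd ` Ktot A\<close> by blast
    then have "G x \<in> Kd ` Ktot A" using GKd[OF y(1)] GK[OF y(1)] by (metis image_eqI)
    then show ?thesis using cls_eq_0[OF Gc[OF \<open>x \<in> cocycles A\<close>]] by blast
  qed
  have PT: "PhiTilde A cls = induced (cocycles A) cls (\<lambda>x. cls (G x))"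
    by (simp add: PhiTilde_def G_def c_def)
  have a: "cls (G (x + y)) = cls (G x) + cls (G y)" if "x \<in> cocycles A" "y \<in> cocycles A" for x y
    unfolding Gadd using cls_add Gc that by blast
  have b: "cls (G (r *\<^sub>R x)) = r *\<^sub>R cls (G x)" if "x \<in> cocycles A" for r x
    unfolding Gscale using cls_scale Gc that by blast
  have ind: "induced (cocycles A) cls (\<lambda>x. cls (G x)) (cls z) = cls (G z)" if "z \<in> cocycles A" for z
    using quotient_by_induced(1)[OF quotient subspace_cocycles, of "\<lambda>x. cls (G x)"] a b zero that by blast
  have lin: "linear (induced (cocycles A) cls (\<lambda>x. cls (G x)))"
    using quotient_by_induced(2)[OF quotient subspace_cocycles, of "\<lambda>x. cls (G x)"] a b zero by blast
  have "PhiTilde A cls x = L.dmap c x"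
  proof (rule L.dmap_eqI)
    show "linear (PhiTilde A cls)" unfolding PT by (rule lin)
    fix p x assume px: "pr p x = x"
    obtain z where z: "z \<in> cocycles A" "cls z = x" using cls_surj by blast
    have x: "x = cls (comp p z)" using px z pr_cls by metis
    have "G (comp p z) = c p *\<^sub>R comp p z"
      by (rule ext) (auto simp: G scaleR_kfam comp_apply cscale_0 split: prod.splits)
    then show "PhiTilde A cls x = c p *\<^sub>R x"
      unfolding PT x ind[OF comp_cocycles[OF z(1)]] using cls_scale[OF comp_cocycles[OF z(1)]] by simp
  qed
  then show ?thesis by (simp add: L.phi_def c_def)
qed

end


section \<open>De Rham cohomology in degree one\<close>

text \<open>The primitive is the integral along the segment from the centre. Differentiation under
  the integral sign and closedness turn the integrand into a total derivative in \<open>t\<close>,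
  whose integral is the value at the endpoint.\<close>

lemma poincare_ball:
  fixes p q :: "complex \<Rightarrow> complex"
  assumes p: "smooth_on (ball z0 r) p" and q: "smooth_on (ball z0 r) q"
    and closed: "\<And>z. z \<in> ball z0 r \<Longrightarrow> wirt_bar p z = wirt q z"
    and z: "z \<in> ball z0 r"
  shows "((\<lambda>z. integral {0..1} (\<lambda>t. p (z0 + t *\<^sub>R (z - z0)) * (z - z0) + q (z0 + t *\<^sub>R (z - z0)) * cnj (z - z0)))
    has_derivative (\<lambda>v. p z * v + q z * cnj v)) (at z)"
proof -
  let ?B = "ball z0 r"
  define m where "m t z = z0 + t *\<^sub>R (z - z0)" for t :: real and z :: complex
  have mB: "m t z \<in> ?B" if "z \<in> ?B" "t \<in> {0..1}" for t z
  proof -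
    have "dist z0 (m t z) = t * dist z0 z" using that by (simp add: m_def dist_norm norm_minus_commute)
    also have "\<dots> \<le> 1 * dist z0 z" using that by (intro mult_right_mono) auto
    finally show ?thesis using that by simp
  qed
  have cm: "continuous_on (?B \<times> {0..1}) (\<lambda>(z, t). m t z)"
    unfolding m_def case_prod_unfold by (intro continuous_intros)
  have cont: "continuous_on (?B \<times> {0..1}) (\<lambda>(z, t). g (m t z))" if g: "smooth_on ?B g" for g
  proof -
    have "ck_on 0 ?B g" using g unfolding smooth_on_def by blast
    then have "continuous_on ?B g" by simp
    moreover have "(\<lambda>(z, t). m t z) ` (?B \<times> {0..1}) \<subseteq> ?B"
      using mB by (intro image_subsetI) (simp only: case_prod_unfold mem_Times_iff)
    ultimately show ?thesis
      using continuous_on_compose2[OF _ cm, of ?B g] by (simp add: case_prod_unfold)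
  qed
  have dp: "(p has_derivative (\<lambda>v. wirt p z * v + wirt_bar p z * cnj v)) (at z)"
    and dq: "(q has_derivative (\<lambda>v. wirt q z * v + wirt_bar q z * cnj v)) (at z)" if "z \<in> ?B" for z
    using has_derivative_wirt smooth_on_has_derivative[OF p open_ball that]
      smooth_on_has_derivative[OF q open_ball that] by blast+
  \<comment> \<open>\<open>\<alpha>\<close> and \<open>\<beta>\<close> are the coefficients of
    \<open>v\<close> and \<open>cnj v\<close> in the derivative of the integrand with respect to
    \<open>z\<close>; in \<open>\<beta>\<close>, closedness has replaced \<open>wirt_bar p\<close>
    by \<open>wirt q\<close>.\<close>
  define \<alpha> where "\<alpha> z t = p (m t z) + t *\<^sub>R (wirt p (m t z) * (z - z0) + wirt q (m t z) * cnj (z - z0))" for z t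
  define \<beta> where "\<beta> z t = q (m t z) + t *\<^sub>R (wirt q (m t z) * (z - z0) + wirt_bar q (m t z) * cnj (z - z0))" for z t
  \<comment> \<open>\<open>leibniz_rule\<close> takes the derivative as a family of bounded linear
    maps that is continuous in that type; conjugation is only real linear and has to be wrapped
    separately.\<close>
  define C :: "complex \<Rightarrow>\<^sub>L complex" where "C = Blinfun cnj"
  have C: "blinfun_apply C v = cnj v" for v
    unfolding C_def by (simp add: bounded_linear_Blinfun_apply bounded_linear_cnj)
  define L where "L z t = blinfun_mult_right (\<alpha> z t) + (blinfun_mult_right (\<beta> z t) o\<^sub>L C)" for z t
  have L: "blinfun_apply (L z t) v = \<alpha> z t * v + \<beta> z t * cnj v" for z t v
    unfolding L_def by (simp add: plus_blinfun.rep_eq C)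
  let ?F = "\<lambda>z t. p (m t z) * (z - z0) + q (m t z) * cnj (z - z0)"
  have c\<alpha>: "continuous_on (?B \<times> {0..1}) (\<lambda>(z, t). \<alpha> z t)"
    unfolding \<alpha>_def case_prod_unfold
    using cont[OF p] cont[OF smooth_on_wirt(1)[OF open_ball p]] cont[OF smooth_on_wirt(1)[OF open_ball q]]
    by (intro continuous_intros) (auto simp: case_prod_unfold)
  have c\<beta>: "continuous_on (?B \<times> {0..1}) (\<lambda>(z, t). \<beta> z t)"
    unfolding \<beta>_def case_prod_unfold
    using cont[OF q] cont[OF smooth_on_wirt(1)[OF open_ball q]] cont[OF smooth_on_wirt(2)[OF open_ball q]]
    by (intro continuous_intros) (auto simp: case_prod_unfold)
  have cL: "continuous_on (?B \<times> cbox 0 1) (\<lambda>(z, t). L z t)"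
    unfolding L_def case_prod_unfold
    using c\<alpha> c\<beta> by (intro continuous_intros bounded_linear.continuous_on[OF bounded_linear_blinfun_mult_right])
      (auto simp: case_prod_unfold)
  have dF: "((\<lambda>z. ?F z t) has_derivative blinfun_apply (L z t)) (at z within ?B)"
    if z: "z \<in> ?B" and t: "t \<in> cbox 0 1" for z t
  proof -
    have t': "t \<in> {0..1}" using t by simp
    have dm: "((\<lambda>z. m t z) has_derivative (\<lambda>v. t *\<^sub>R v)) (at z)"
      unfolding m_def by (auto intro!: derivative_eq_intros)
    note pm = has_derivative_compose[OF dm dp[OF mB[OF z t']]]
    note qm = has_derivative_compose[OF dm dq[OF mB[OF z t']]]
    have dz: "((\<lambda>z. z - z0) has_derivative (\<lambda>v. v)) (at z)" by (auto intro!: derivative_eq_intros)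
    have dzc: "((\<lambda>z. cnj (z - z0)) has_derivative (\<lambda>v. cnj v)) (at z)"
      by (rule has_derivative_cnj[OF dz])
    have "((\<lambda>z. ?F z t) has_derivative
      (\<lambda>v. (p (m t z) * v + (wirt p (m t z) * (t *\<^sub>R v) + wirt_bar p (m t z) * cnj (t *\<^sub>R v)) * (z - z0))
         + (q (m t z) * cnj v + (wirt q (m t z) * (t *\<^sub>R v) + wirt_bar q (m t z) * cnj (t *\<^sub>R v)) * cnj (z - z0)))) (at z)"
      by (rule has_derivative_add[OF has_derivative_mult[OF pm dz] has_derivative_mult[OF qm dzc]])
    moreover have "(p (m t z) * v + (wirt p (m t z) * (t *\<^sub>R v) + wirt_bar p (m t z) * cnj (t *\<^sub>R v)) * (z - z0))
         + (q (m t z) * cnj v + (wirt q (m t z) * (t *\<^sub>R v) + wirt_bar q (m t z) * cnj (t *\<^sub>R v)) * cnj (z - z0))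
        = blinfun_apply (L z t) v" for v
      unfolding L \<alpha>_def \<beta>_def closed[OF mB[OF z t']]
      by (simp add: scaleR_conv_of_real algebra_simps)
    ultimately show ?thesis by (simp add: has_derivative_at_withinI)
  qed
  have intF: "?F z integrable_on cbox 0 1" if "z \<in> ?B" for z
  proof (rule integrable_continuous)
    have mz: "continuous_on (cbox 0 1) (\<lambda>t. (z, t :: real))" by (intro continuous_intros)
    have "continuous_on (cbox 0 1) (\<lambda>t. p (m t z))" "continuous_on (cbox 0 1) (\<lambda>t. q (m t z))"
      using continuous_on_compose2[OF cont[OF p] mz] continuous_on_compose2[OF cont[OF q] mz]
        image_subsetI[of "cbox 0 1" "\<lambda>t. (z, t :: real)" "?B \<times> {0..1}"] that by simp_all
    then show "continuous_on (cbox 0 1) (?F z)" by (intro continuous_intros)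
  qed
  from leibniz_rule[of ?B 0 1 ?F L, OF dF intF cL z convex_ball]
  have "((\<lambda>z. integral (cbox 0 1) (?F z)) has_derivative blinfun_apply (integral (cbox 0 1) (L z))) (at z within ?B)" .
  then have D: "((\<lambda>z. integral {0..1} (?F z)) has_derivative blinfun_apply (integral (cbox 0 1) (L z))) (at z)"
    by (simp only: at_within_open[OF z open_ball] box_real)
  have "blinfun_apply (integral (cbox 0 1) (L z)) v = p z * v + q z * cnj v" for v
  proof -
    have "continuous_on (cbox 0 1) (L z)"
      using continuous_on_compose2[OF cL, of "cbox 0 1" "\<lambda>t. (z, t)"] z
        image_subsetI[of "cbox 0 1" "\<lambda>t. (z, t :: real)" "?B \<times> cbox 0 1"]
      by (simp add: continuous_on_Pair)
    then have "L z integrable_on cbox 0 1" by (rule integrable_continuous)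
    from integral_linear[OF this blinfun.bounded_linear_left, of v]
    have e: "blinfun_apply (integral (cbox 0 1) (L z)) v = integral (cbox 0 1) (\<lambda>t. \<alpha> z t * v + \<beta> z t * cnj v)"
      by (simp add: o_def L)
    \<comment> \<open>By closedness once more, the integrand is the derivative of \<open>t\<close>
      times the value of the form at \<open>m t z\<close>.\<close>
    have "((\<lambda>t. \<alpha> z t * v + \<beta> z t * cnj v) has_integral
        (1 *\<^sub>R (p (m 1 z) * v + q (m 1 z) * cnj v) - 0 *\<^sub>R (p (m 0 z) * v + q (m 0 z) * cnj v))) {0..1}"
    proof (rule fundamental_theorem_of_calculus)
      fix t :: real assume t: "t \<in> {0..1}"
      have dm: "((\<lambda>t. m t z) has_derivative (\<lambda>s. s *\<^sub>R (z - z0))) (at t within {0..1})"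
        unfolding m_def by (auto intro!: derivative_eq_intros)
      note pm = has_derivative_compose[OF dm dp[OF mB[OF z t]]]
      note qm = has_derivative_compose[OF dm dq[OF mB[OF z t]]]
      have "((\<lambda>t. t *\<^sub>R (p (m t z) * v + q (m t z) * cnj v)) has_derivative
         (\<lambda>s. t *\<^sub>R ((wirt p (m t z) * (s *\<^sub>R (z - z0)) + wirt_bar p (m t z) * cnj (s *\<^sub>R (z - z0))) * v
              + (wirt q (m t z) * (s *\<^sub>R (z - z0)) + wirt_bar q (m t z) * cnj (s *\<^sub>R (z - z0))) * cnj v)
            + s *\<^sub>R (p (m t z) * v + q (m t z) * cnj v))) (at t within {0..1})"
        by (rule has_derivative_scaleR[OF has_derivative_ident has_derivative_add[OF
            has_derivative_mult_left[OF pm] has_derivative_mult_left[OF qm]]])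
      then show "((\<lambda>t. t *\<^sub>R (p (m t z) * v + q (m t z) * cnj v)) has_vector_derivative
          \<alpha> z t * v + \<beta> z t * cnj v) (at t within {0..1})"
        unfolding has_vector_derivative_def closed[OF mB[OF z t]]
        by (rule has_derivative_eq_rhs)
          (auto simp: \<alpha>_def \<beta>_def scaleR_conv_of_real algebra_simps)
    qed simp
    then show ?thesis unfolding e by (simp add: integral_unique m_def)
  qed
  then have "blinfun_apply (integral (cbox 0 1) (L z)) = (\<lambda>v. p z * v + q z * cnj v)" by (rule ext)
  then show ?thesis using D by (simp add: m_def)
qed

text \<open>\<open>E\<close> factors through the values of the functionals in \<open>I\<close>, so
  its image has dimension at most \<open>card I\<close>. The induction splits off one functional at
  a time by passing to its kernel in \<open>Z\<close>.\<close>

lemma finite_rank_image: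
  fixes E :: "'a::real_vector \<Rightarrow> 'v::real_vector" and lam :: "'k \<Rightarrow> 'a \<Rightarrow> real"
  assumes "finite I" "subspace Z"
    and lam_add: "\<And>i x y. i \<in> I \<Longrightarrow> x \<in> Z \<Longrightarrow> y \<in> Z \<Longrightarrow> lam i (x + y) = lam i x + lam i y"
    and lam_scale: "\<And>i x r. i \<in> I \<Longrightarrow> x \<in> Z \<Longrightarrow> lam i (r *\<^sub>R x) = r * lam i x"
    and E_add: "\<And>x y. x \<in> Z \<Longrightarrow> y \<in> Z \<Longrightarrow> E (x + y) = E x + E y"
    and E_scale: "\<And>x r. x \<in> Z \<Longrightarrow> E (r *\<^sub>R x) = r *\<^sub>R E x"
    and kernel: "\<And>x. x \<in> Z \<Longrightarrow> (\<And>i. i \<in> I \<Longrightarrow> lam i x = 0) \<Longrightarrow> E x = 0"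
  shows "\<exists>S. finite S \<and> card S \<le> card I \<and> E ` Z \<subseteq> span S"
  using assms
proof (induction I arbitrary: Z rule: finite_induct)
  case empty
  then have "E ` Z \<subseteq> span {}" by auto
  then show ?case by (metis finite.emptyI le_refl card.empty)
next
  case (insert j I)
  define Z' where "Z' = {x \<in> Z. lam j x = 0}"
  have l0: "lam j 0 = 0" using insert.prems(3)[of j 0 0] subspace_0[OF insert.prems(1)] by simp
  have Z': "subspace Z'" "Z' \<subseteq> Z"
    using insert.prems(1-3) l0 unfolding subspace_def Z'_def by auto
  have "\<exists>S. finite S \<and> card S \<le> card I \<and> E ` Z' \<subseteq> span S"
  proof (rule insert.IH[OF Z'(1)])
    show "lam i (x + y) = lam i x + lam i y" if "i \<in> I" "x \<in> Z'" "y \<in> Z'" for i x y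
      by (rule insert.prems(2)) (use that Z'(2) in auto)
    show "lam i (r *\<^sub>R x) = r * lam i x" if "i \<in> I" "x \<in> Z'" for i x r
      by (rule insert.prems(3)) (use that Z'(2) in auto)
    show "E (x + y) = E x + E y" if "x \<in> Z'" "y \<in> Z'" for x y
      by (rule insert.prems(4)) (use that Z'(2) in auto)
    show "E (r *\<^sub>R x) = r *\<^sub>R E x" if "x \<in> Z'" for x r
      by (rule insert.prems(5)) (use that Z'(2) in auto)
    fix x assume x: "x \<in> Z'" and *: "\<And>i. i \<in> I \<Longrightarrow> lam i x = 0"
    show "E x = 0" by (rule insert.prems(6)) (use x * in \<open>auto simp: Z'_def\<close>)
  qed
  then obtain S where S: "finite S" "card S \<le> card I" "E ` Z' \<subseteq> span S" by blast
  show ?case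
  proof (cases "Z' = Z")
    case True
    then show ?thesis using S insert.hyps by (intro exI[of _ S]) auto
  next
    case False
    then obtain z where z: "z \<in> Z" "lam j z \<noteq> 0" using Z' by (auto simp: Z'_def)
    have "E x \<in> span (insert (E z) S)" if x: "x \<in> Z" for x
    proof -
      define r where "r = lam j x / lam j z"
      have mem: "(- r) *\<^sub>R z \<in> Z" using subspace_scale[OF insert.prems(1) z(1)] .
      have "lam j (x + (- r) *\<^sub>R z) = lam j x + (- r) * lam j z"
        using insert.prems(2)[OF insertI1 x mem] insert.prems(3)[OF insertI1 z(1), of "- r"] by simp
      then have "x + (- r) *\<^sub>R z \<in> Z'"
        using subspace_add[OF insert.prems(1) x mem] z(2) by (simp add: Z'_def r_def)
      then have "E (x + (- r) *\<^sub>R z) \<in> span (insert (E z) S)"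
        using S(3) span_mono[of S "insert (E z) S"] by blast
      moreover have "E (x + (- r) *\<^sub>R z) = E x - r *\<^sub>R E z"
        using insert.prems(4)[OF x mem] insert.prems(5)[OF z(1), of "- r"] by simp
      ultimately have "E x - r *\<^sub>R E z + r *\<^sub>R E z \<in> span (insert (E z) S)"
        by (metis insertI1 span_add span_base span_scale)
      then show ?thesis by simp
    qed
    moreover have "card (insert (E z) S) \<le> card (insert j I)"
      using S(1,2) insert.hyps card_insert_le_m1[of "card (insert j I)" S "E z"] by (simp add: card_insert_if)
    ultimately show ?thesis using S(1) by (intro exI[of _ "insert (E z) S"]) auto
  qed
qed

section \<open>Local primitives and their gluing\<close>

context riemann
begin

text \<open>Only differentiability of \<open>f\<close> is asked for. Its derivatives are the
  coefficients of \<open>\<eta>\<close>, so a primitive of a smooth form is smooth by itself;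
  \<open>as_form_primitive\<close> uses this.\<close>

definition primitive_at :: "('x \<Rightarrow> complex) \<Rightarrow> 'x form \<Rightarrow> 'x \<Rightarrow> bool" where
  "primitive_at f \<eta> x \<longleftrightarrow> (\<forall>c\<in>A. x \<in> fst c \<longrightarrow>
     ((\<lambda>z. f (cinv c z)) has_derivative (\<lambda>v. \<eta> 1 0 c x * v + \<eta> 0 1 c x * cnj v)) (at (snd c x)))"

lemma primitive_atI:
  assumes \<eta>: "\<eta> \<in> forms A" and c': "c' \<in> A" "x \<in> fst c'"
    and d: "((\<lambda>z. f (cinv c' z)) has_derivative (\<lambda>v. \<eta> 1 0 c' x * v + \<eta> 0 1 c' x * cnj v)) (at (snd c' x))"
  shows "primitive_at f \<eta> x"
  unfolding primitive_at_def
proof (intro ballI impI)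
  fix c assume c: "c \<in> A" "x \<in> fst c"
  let ?h = "snd c' \<circ> cinv c"
  let ?W = "snd c ` (fst c \<inter> fst c')"
  have x: "snd c x \<in> ?W" using c c' by blast
  have hx: "?h (snd c x) = snd c' x" using cinv[OF c] by simp
  have "(?h has_derivative (\<lambda>v. deriv ?h (snd c x) * v)) (at (snd c x))"
    using transition[OF c(1) c'(1) x] by (simp add: has_field_derivative_def)
  moreover have "((\<lambda>z. f (cinv c' z)) has_derivative (\<lambda>v. \<eta> 1 0 c' x * v + \<eta> 0 1 c' x * cnj v)) (at (?h (snd c x)))"
    unfolding hx by (rule d)
  ultimately have "((\<lambda>z. f (cinv c' (?h z))) has_derivative
      (\<lambda>v. \<eta> 1 0 c' x * (deriv ?h (snd c x) * v) + \<eta> 0 1 c' x * cnj (deriv ?h (snd c x) * v))) (at (snd c x))"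
    by (rule has_derivative_compose)
  moreover have "\<eta> 1 0 c' x * (deriv ?h (snd c x) * v) + \<eta> 0 1 c' x * cnj (deriv ?h (snd c x) * v)
      = \<eta> 1 0 c x * v + \<eta> 0 1 c x * cnj v" for v
    using form_transform[OF \<eta> c(1) c'(1) c(2) c'(2), of 1 0] form_transform[OF \<eta> c(1) c'(1) c(2) c'(2), of 0 1]
    by (simp add: mult.assoc)
  ultimately have "((\<lambda>z. f (cinv c' (?h z))) has_derivative (\<lambda>v. \<eta> 1 0 c x * v + \<eta> 0 1 c x * cnj v)) (at (snd c x))"
    by simp
  then show "((\<lambda>z. f (cinv c z)) has_derivative (\<lambda>v. \<eta> 1 0 c x * v + \<eta> 0 1 c x * cnj v)) (at (snd c x))"
  proof (rule has_derivative_transform_within_open[OF _ open_overlap[OF c(1) c'(1)] x])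
    fix z assume "z \<in> ?W"
    then obtain y where "z = snd c y" "y \<in> fst c" "y \<in> fst c'" by blast
    then show "f (cinv c' (?h z)) = f (cinv c z)" using cinv c(1) c'(1) by simp
  qed
qed

lemma primitive_at_cong:
  assumes "primitive_at f \<eta> x" "openin X W" "x \<in> W" "\<And>y. y \<in> W \<Longrightarrow> f y = g y"
  shows "primitive_at g \<eta> x"
  unfolding primitive_at_def
proof (intro ballI impI)
  fix c assume c: "c \<in> A" "x \<in> fst c"
  have d: "((\<lambda>z. f (cinv c z)) has_derivative (\<lambda>v. \<eta> 1 0 c x * v + \<eta> 0 1 c x * cnj v)) (at (snd c x))"
    using assms(1) c by (simp add: primitive_at_def)
  show "((\<lambda>z. g (cinv c z)) has_derivative (\<lambda>v. \<eta> 1 0 c x * v + \<eta> 0 1 c x * cnj v)) (at (snd c x))"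
  proof (rule has_derivative_transform_within_open[OF d])
    show "open (snd c ` (W \<inter> fst c))"
      by (intro open_chart_image[OF c(1)] openin_Int assms(2) chart(1)[OF c(1)]) auto
    show "snd c x \<in> snd c ` (W \<inter> fst c)" using assms(3) c by blast
    show "f (cinv c z) = g (cinv c z)" if z: "z \<in> snd c ` (W \<inter> fst c)" for z
    proof -
      obtain y where "z = snd c y" "y \<in> W" "y \<in> fst c" using z by blast
      then show ?thesis using cinv[OF c(1)] assms(4) by simp
    qed
  qed
qed

definition as_form :: "('x \<Rightarrow> complex) \<Rightarrow> 'x form" where
  "as_form f = (\<lambda>a b c x. if a = 0 \<and> b = 0 \<and> c \<in> A \<and> x \<in> fst c then f x else 0)"

lemma as_form_primitive:
  assumes \<eta>: "\<eta> \<in> forms A" "graded 0 \<eta>" and prim: "\<And>x. x \<in> topspace X \<Longrightarrow> primitive_at f \<eta> x"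
  shows "is_function (as_form f)" "d1 (as_form f) = \<eta>"
proof -
  have d: "((\<lambda>z. as_form f 0 0 c (cinv c z)) has_derivative (\<lambda>v. \<eta> 1 0 c x * v + \<eta> 0 1 c x * cnj v)) (at (snd c x))"
    if c: "c \<in> A" "x \<in> fst c" for c x
  proof (rule has_derivative_transform_within_open[of "\<lambda>z. f (cinv c z)"])
    have "x \<in> topspace X" using c chart(4) by blast
    then show "((\<lambda>z. f (cinv c z)) has_derivative (\<lambda>v. \<eta> 1 0 c x * v + \<eta> 0 1 c x * cnj v)) (at (snd c x))"
      using prim c by (simp add: primitive_at_def)
    show "open (snd c ` fst c)" by (rule chart(2)[OF c(1)])
    show "snd c x \<in> snd c ` fst c" using c by blast
    show "f (cinv c z) = as_form f 0 0 c (cinv c z)" if "z \<in> snd c ` fst c" for z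
      using that c by (simp add: as_form_def cinv_mem)
  qed
  have form: "as_form f \<in> forms A"
  proof (rule formI)
    show "as_form f a b c x = 0" if "\<not> (a \<le> 1 \<and> b \<le> 1 \<and> c \<in> A \<and> x \<in> fst c)" for a b c x
      using that by (auto simp: as_form_def)
    show "smooth_on (snd c ` fst c) (\<lambda>z. as_form f a b c (cinv c z))" if c: "c \<in> A" for a b c
    proof (cases "a = 0 \<and> b = 0")
      case True
      have "smooth_on (snd c ` fst c) (\<lambda>z. as_form f 0 0 c (cinv c z))"
      proof (rule smooth_onI[OF chart(2)[OF c]])
        fix z assume z: "z \<in> snd c ` fst c"
        show "((\<lambda>z. as_form f 0 0 c (cinv c z)) has_derivative
            (\<lambda>v. \<eta> 1 0 c (cinv c z) * v + \<eta> 0 1 c (cinv c z) * cnj v)) (at z)"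
          using d[OF c cinv_mem(1)[OF z]] by (simp add: cinv_mem(2)[OF z])
      next
        show "smooth_on (snd c ` fst c) (\<lambda>z. \<eta> 1 0 c (cinv c z) * v + \<eta> 0 1 c (cinv c z) * cnj v)" for v
          by (intro smooth_on_add smooth_on_mult smooth_on_const chart(2)[OF c] form_smooth[OF \<eta>(1) c])
      qed
      then show ?thesis using True by simp
    next
      case False
      then have "(\<lambda>z. as_form f a b c (cinv c z)) = (\<lambda>z. 0)" by (auto simp: as_form_def)
      then show ?thesis using smooth_on_const[OF chart(2)[OF c], of 0] by simp
    qed
    show "as_form f a b c x = as_form f a b c' x * deriv (snd c' \<circ> cinv c) (snd c x) ^ a * cnj (deriv (snd c' \<circ> cinv c) (snd c x)) ^ b"
      if "c \<in> A" "c' \<in> A" "x \<in> fst c" "x \<in> fst c'" for a b c c' x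
      using that by (simp add: as_form_def)
  qed
  have z1: "as_form f a b c = (\<lambda>x. 0)" if "\<not> (a = 0 \<and> b = 0 \<and> c \<in> A)" for a b c
    using that by (auto simp: as_form_def)
  show "is_function (as_form f)"
    unfolding is_function_def using form by (auto simp: fun_eq_iff z1)
  show "d1 (as_form f) = \<eta>"
  proof (intro ext)
    fix a b c x
    show "d1 (as_form f) a b c x = \<eta> a b c x"
    proof (cases "c \<in> A \<and> x \<in> fst c")
      case True
      then have w: "wirt (\<lambda>z. as_form f 0 0 c (cinv c z)) (snd c x) = \<eta> 1 0 c x"
        "wirt_bar (\<lambda>z. as_form f 0 0 c (cinv c z)) (snd c x) = \<eta> 0 1 c x"
        using wirt_eqI[OF d[of c x]] by simp_all
      consider "a = 1" "b = 0" | "a = 0" "b = 1" | "\<not> (a = 1 \<and> b = 0) \<and> \<not> (a = 0 \<and> b = 1)" by blast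
      then show ?thesis
      proof cases
        case 3
        then have "\<not> (a \<le> 1 \<and> b \<le> 1 \<and> int a + int b = 0 + 1)" by auto
        then have "\<eta> a b = 0" using \<eta>(2) unfolding graded_def by blast
        then have "\<eta> a b c x = 0" by simp
        then show ?thesis using 3 by (auto simp: d1_def del_def delbar_def z1 wirt_const)
      qed (use True w in \<open>simp_all add: d1_def del_def delbar_def z1 wirt_const\<close>)
    next
      case False
      then have "\<eta> a b c x = 0" using form_zero[OF \<eta>(1)] by blast
      moreover have "del (as_form f) a b c x = 0" "delbar (as_form f) a b c x = 0"
        using False by (auto simp: del_def delbar_def z1 wirt_const)
      ultimately show ?thesis by (simp add: d1_def)
    qed
  qed
qed

end

context riemann
begin

definition closed_forms :: "'x form set" where
  "closed_forms = {\<eta> \<in> forms A. graded 0 \<eta> \<and> form_cnj \<eta> = \<eta> \<and> d1 \<eta> = 0}"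

lemma closed_formD:
  assumes "\<eta> \<in> closed_forms"
  shows "\<eta> \<in> forms A" "graded 0 \<eta>" "\<eta> 0 1 c x = cnj (\<eta> 1 0 c x)"
    "c \<in> A \<Longrightarrow> x \<in> fst c \<Longrightarrow>
      wirt_bar (\<lambda>z. \<eta> 1 0 c (cinv c z)) (snd c x) = wirt (\<lambda>z. \<eta> 0 1 c (cinv c z)) (snd c x)"
proof -
  show "\<eta> \<in> forms A" "graded 0 \<eta>" using assms by (auto simp: closed_forms_def)
  have "form_cnj \<eta> 0 1 c x = \<eta> 0 1 c x" using assms by (simp add: closed_forms_def)
  then show "\<eta> 0 1 c x = cnj (\<eta> 1 0 c x)" by (simp add: form_cnj_def)
  assume c: "c \<in> A" "x \<in> fst c"
  have "d1 \<eta> 1 1 c x = 0" using assms by (simp add: closed_forms_def)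
  then show "wirt_bar (\<lambda>z. \<eta> 1 0 c (cinv c z)) (snd c x) = wirt (\<lambda>z. \<eta> 0 1 c (cinv c z)) (snd c x)"
    using c by (simp add: d1_def del_def delbar_def)
qed

definition chart_ball :: "'x chart \<Rightarrow> complex \<Rightarrow> real \<Rightarrow> 'x set" where
  "chart_ball c z r = {y \<in> fst c. snd c y \<in> ball z r}"

lemma openin_chart_vimage:
  assumes c: "c \<in> A" and S: "open S"
  shows "openin X {y \<in> fst c. snd c y \<in> S}"
proof -
  have "continuous_map (subtopology X (fst c)) (top_of_set (snd c ` fst c)) (snd c)"
    using chart(3)[OF c] homeomorphic_imp_continuous_map by blast
  then have "continuous_map (subtopology X (fst c)) euclidean (snd c)"
    by (simp add: continuous_map_in_subtopology)
  then have "openin (subtopology X (fst c)) {y \<in> topspace (subtopology X (fst c)). snd c y \<in> S}"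
    using S by (intro openin_continuous_map_preimage) auto
  moreover have "topspace (subtopology X (fst c)) = fst c" using chart(4)[OF c] by auto
  ultimately have "openin (subtopology X (fst c)) {y \<in> fst c. snd c y \<in> S}" by (simp only:)
  then show ?thesis by (simp only: openin_open_subtopology[OF chart(1)[OF c]])
qed

lemma openin_chart_ball: "c \<in> A \<Longrightarrow> openin X (chart_ball c z r)"
  unfolding chart_ball_def by (rule openin_chart_vimage) auto

lemma chart_cball_exists:
  assumes "openin X Q" "x \<in> Q"
  obtains c r where "c \<in> A" "x \<in> fst c" "r > 0" "cball (snd c x) r \<subseteq> snd c ` (Q \<inter> fst c)"
proof -
  have "x \<in> topspace X" using assms openin_subset by blast
  then obtain c where c: "c \<in> A" "x \<in> fst c" using covers by blast
  have "open (snd c ` (Q \<inter> fst c))"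
    by (intro open_chart_image[OF c(1)] openin_Int assms(1) chart(1)[OF c(1)]) auto
  moreover have "snd c x \<in> snd c ` (Q \<inter> fst c)" using c assms(2) by blast
  ultimately obtain r where "r > 0" "cball (snd c x) r \<subseteq> snd c ` (Q \<inter> fst c)"
    using open_contains_cball by blast
  then show ?thesis using that c by blast
qed

text \<open>The radial integral of \<open>poincare_ball\<close> in the coordinate of
  \<open>c\<close>. An explicit formula, unlike an arbitrary choice of primitives, is linear in the
  form.\<close>

definition local_primitive :: "'x chart \<Rightarrow> complex \<Rightarrow> 'x form \<Rightarrow> 'x \<Rightarrow> complex" where
  "local_primitive c z0 \<eta> y = integral {0..1} (\<lambda>t.
     \<eta> 1 0 c (cinv c (z0 + t *\<^sub>R (snd c y - z0))) * (snd c y - z0)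
     + \<eta> 0 1 c (cinv c (z0 + t *\<^sub>R (snd c y - z0))) * cnj (snd c y - z0))"

lemma smooth_on_subset: "smooth_on S f \<Longrightarrow> T \<subseteq> S \<Longrightarrow> smooth_on T f"
proof -
  have "ck_on n S f \<Longrightarrow> T \<subseteq> S \<Longrightarrow> ck_on n T f" for n f
    by (induction n arbitrary: f) (auto intro: continuous_on_subset differentiable_on_subset)
  then show "smooth_on S f \<Longrightarrow> T \<subseteq> S \<Longrightarrow> smooth_on T f" by (auto simp: smooth_on_def)
qed

lemma local_primitive:
  assumes \<eta>: "\<eta> \<in> closed_forms" and c: "c \<in> A" and ball: "ball z0 r \<subseteq> snd c ` fst c"
    and y: "y \<in> chart_ball c z0 r"
  shows "primitive_at (local_primitive c z0 \<eta>) \<eta> y"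
proof (rule primitive_atI[OF closed_formD(1)[OF \<eta>] c])
  have yc: "y \<in> fst c" and yb: "snd c y \<in> ball z0 r" using y by (auto simp: chart_ball_def)
  show "y \<in> fst c" by (rule yc)
  let ?p = "\<lambda>z. \<eta> 1 0 c (cinv c z)" and ?q = "\<lambda>z. \<eta> 0 1 c (cinv c z)"
  have sm: "smooth_on (ball z0 r) ?p" "smooth_on (ball z0 r) ?q"
    using form_smooth[OF closed_formD(1)[OF \<eta>] c] smooth_on_subset ball by blast+
  have cl: "wirt_bar ?p z = wirt ?q z" if z: "z \<in> ball z0 r" for z
  proof -
    obtain x where "x \<in> fst c" "z = snd c x" using z ball by blast
    then show ?thesis using closed_formD(4)[OF \<eta> c] by blast
  qed
  have "((\<lambda>z. integral {0..1} (\<lambda>t. ?p (z0 + t *\<^sub>R (z - z0)) * (z - z0) + ?q (z0 + t *\<^sub>R (z - z0)) * cnj (z - z0)))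
    has_derivative (\<lambda>v. ?p (snd c y) * v + ?q (snd c y) * cnj v)) (at (snd c y))"
    by (rule poincare_ball[OF sm cl yb])
  then have D: "((\<lambda>z. integral {0..1} (\<lambda>t. ?p (z0 + t *\<^sub>R (z - z0)) * (z - z0) + ?q (z0 + t *\<^sub>R (z - z0)) * cnj (z - z0)))
    has_derivative (\<lambda>v. \<eta> 1 0 c y * v + \<eta> 0 1 c y * cnj v)) (at (snd c y))"
    by (simp only: cinv[OF c yc])
  show "((\<lambda>z. local_primitive c z0 \<eta> (cinv c z)) has_derivative
      (\<lambda>v. \<eta> 1 0 c y * v + \<eta> 0 1 c y * cnj v)) (at (snd c y))"
  proof (rule has_derivative_transform_within_open[OF D open_ball yb])
    fix z assume "z \<in> ball z0 r"
    then have "snd c (cinv c z) = z" using ball by (intro cinv_mem(2)) blast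
    then show "integral {0..1} (\<lambda>t. ?p (z0 + t *\<^sub>R (z - z0)) * (z - z0) + ?q (z0 + t *\<^sub>R (z - z0)) * cnj (z - z0))
        = local_primitive c z0 \<eta> (cinv c z)"
      by (simp only: local_primitive_def)
  qed
qed

lemma local_primitive_integrable:
  assumes \<eta>: "\<eta> \<in> closed_forms" and c: "c \<in> A" and ball: "ball z0 r \<subseteq> snd c ` fst c"
    and y: "y \<in> chart_ball c z0 r"
  shows "(\<lambda>t. \<eta> 1 0 c (cinv c (z0 + t *\<^sub>R (snd c y - z0))) * (snd c y - z0)
     + \<eta> 0 1 c (cinv c (z0 + t *\<^sub>R (snd c y - z0))) * cnj (snd c y - z0)) integrable_on {0..1::real}"
proof -
  let ?m = "\<lambda>t::real. z0 + t *\<^sub>R (snd c y - z0)"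
  have yb: "snd c y \<in> ball z0 r" using y by (auto simp: chart_ball_def)
  have mem: "?m t \<in> snd c ` fst c" if "t \<in> {0..1}" for t
  proof -
    have "dist z0 (?m t) = t * dist z0 (snd c y)" using that by (simp add: dist_norm norm_minus_commute)
    also have "\<dots> \<le> 1 * dist z0 (snd c y)" using that by (intro mult_right_mono) auto
    finally show ?thesis using yb ball by auto
  qed
  have "continuous_on {0..1} (\<lambda>t. \<eta> a b c (cinv c (?m t)))" for a b
  proof -
    have "ck_on 0 (snd c ` fst c) (\<lambda>z. \<eta> a b c (cinv c z))"
      using form_smooth[OF closed_formD(1)[OF \<eta>] c] unfolding smooth_on_def by blast
    then have "continuous_on (snd c ` fst c) (\<lambda>z. \<eta> a b c (cinv c z))" by simp
    moreover have "continuous_on {0..1} ?m" by (intro continuous_intros)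
    ultimately show ?thesis using mem by (rule continuous_on_compose2[OF _ _ image_subsetI])
  qed
  then have "continuous_on {0..1} (\<lambda>t. \<eta> 1 0 c (cinv c (?m t)) * (snd c y - z0) + \<eta> 0 1 c (cinv c (?m t)) * cnj (snd c y - z0))"
    by (intro continuous_on_add continuous_on_mult_right)
  then show ?thesis by (rule integrable_continuous_real)
qed

lemma local_primitive_linear:
  assumes c: "c \<in> A" and ball: "ball z0 r \<subseteq> snd c ` fst c" and y: "y \<in> chart_ball c z0 r"
  shows "\<eta> \<in> closed_forms \<Longrightarrow> \<theta> \<in> closed_forms \<Longrightarrow>
      local_primitive c z0 (\<eta> + \<theta>) y = local_primitive c z0 \<eta> y + local_primitive c z0 \<theta> y"
    "local_primitive c z0 (s *\<^sub>R \<eta>) y = s *\<^sub>R local_primitive c z0 \<eta> y"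
    "\<eta> \<in> closed_forms \<Longrightarrow> cnj (local_primitive c z0 \<eta> y) = local_primitive c z0 \<eta> y"
proof -
  show "local_primitive c z0 (\<eta> + \<theta>) y = local_primitive c z0 \<eta> y + local_primitive c z0 \<theta> y"
    if \<eta>: "\<eta> \<in> closed_forms" and \<theta>: "\<theta> \<in> closed_forms"
    unfolding local_primitive_def
      integral_add[OF local_primitive_integrable[OF \<eta> assms] local_primitive_integrable[OF \<theta> assms], symmetric]
    by (simp add: algebra_simps)
  show "local_primitive c z0 (s *\<^sub>R \<eta>) y = s *\<^sub>R local_primitive c z0 \<eta> y"
    unfolding local_primitive_def integral_cmul[symmetric]
    by (simp add: scaleR_eq_cscale cscale_def scaleR_conv_of_real algebra_simps)
  show "cnj (local_primitive c z0 \<eta> y) = local_primitive c z0 \<eta> y" if \<eta>: "\<eta> \<in> closed_forms"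
    unfolding local_primitive_def integral_cnj
    using closed_formD(3)[OF \<eta>] by (simp add: add.commute)
qed

lemma primitives_differ_by_constant:
  assumes c: "c \<in> A" and ball: "ball z s \<subseteq> snd c ` fst c"
    and f: "\<And>y. y \<in> chart_ball c z s \<Longrightarrow> primitive_at f \<eta> y"
    and g: "\<And>y. y \<in> chart_ball c z s \<Longrightarrow> primitive_at g \<eta> y"
    and m: "m \<in> chart_ball c z s" and y: "y \<in> chart_ball c z s" and eq: "f m = g m"
  shows "f y = g y"
proof -
  have "\<exists>k. \<forall>w\<in>ball z s. f (cinv c w) - g (cinv c w) = k"
  proof (rule has_derivative_zero_constant[OF convex_ball])
    fix w assume w: "w \<in> ball z s"
    then have wi: "w \<in> snd c ` fst c" using ball by blast
    let ?x = "cinv c w"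
    have x: "?x \<in> fst c" "snd c ?x = w" using cinv_mem[OF wi] by auto
    then have xb: "?x \<in> chart_ball c z s" using w by (simp add: chart_ball_def)
    have "((\<lambda>w. f (cinv c w)) has_derivative (\<lambda>v. \<eta> 1 0 c ?x * v + \<eta> 0 1 c ?x * cnj v)) (at w)"
      "((\<lambda>w. g (cinv c w)) has_derivative (\<lambda>v. \<eta> 1 0 c ?x * v + \<eta> 0 1 c ?x * cnj v)) (at w)"
      using f[OF xb, unfolded primitive_at_def, rule_format, OF c x(1)]
        g[OF xb, unfolded primitive_at_def, rule_format, OF c x(1)] by (simp_all only: x(2))
    from has_derivative_diff[OF this]
    have "((\<lambda>w. f (cinv c w) - g (cinv c w)) has_derivative (\<lambda>v. 0)) (at w)" by simp
    then show "((\<lambda>w. f (cinv c w) - g (cinv c w)) has_derivative (\<lambda>v. 0)) (at w within ball z s)"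
      by (rule has_derivative_at_withinI)
  qed
  then obtain k where k: "\<And>w. w \<in> ball z s \<Longrightarrow> f (cinv c w) - g (cinv c w) = k" by blast
  have "f x - g x = k" if "x \<in> chart_ball c z s" for x
    using k[of "snd c x"] that cinv[OF c] by (auto simp: chart_ball_def)
  from this[OF m] this[OF y] eq show ?thesis by simp
qed

text \<open>The disc is closed in its chart domain, which need not be closed in \<open>X\<close>; it
  is closed in \<open>X\<close> because it is compact and \<open>X\<close> is Hausdorff.\<close>

lemma closedin_chart_cball:
  assumes c: "c \<in> A" and cball: "cball z r \<subseteq> snd c ` fst c"
  shows "closedin X {y \<in> fst c. snd c y \<in> cball z r}"
proof -
  let ?K = "{y \<in> fst c. snd c y \<in> cball z r}"
  have im: "snd c ` ?K = cball z r" using cball by blast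
  have "compactin (top_of_set (snd c ` fst c)) (snd c ` ?K)"
    unfolding im using cball by (simp add: compactin_subtopology)
  moreover have "?K \<subseteq> topspace (subtopology X (fst c))" using chart(4)[OF c] by auto
  ultimately have "compactin (subtopology X (fst c)) ?K"
    using homeomorphic_map_compactness[OF chart(3)[OF c]] by blast
  then have "compactin X ?K" by (simp add: compactin_subtopology)
  moreover have "Hausdorff_space X" using riemann by (simp add: riemann_surface_def)
  ultimately show ?thesis by (rule compactin_imp_closedin[rotated])
qed

text \<open>Local primitives on finitely many coordinate balls \<open>U\<close> glue as soon as they agree at finitely
  many points.  The overlaps of the balls may have infinitely many components; so one passes to the
  concentric balls \<open>V\<close> of half the radius and chooses the sets \<open>W\<close> such that \<open>W m \<inter> V a \<noteq> {}\<close>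
  implies \<open>W m \<subseteq> U a\<close>.\<close>

lemma de_Rham_finite:
  assumes "compact_space X"
  shows "\<exists>(I :: ('x \<times> 'x \<times> 'x) set) lam. finite I \<and>
    (\<forall>i\<in>I. \<forall>\<eta>\<in>closed_forms. \<forall>\<theta>\<in>closed_forms. lam i (\<eta> + \<theta>) = lam i \<eta> + (lam i \<theta> :: real)) \<and>
    (\<forall>i\<in>I. \<forall>\<eta>\<in>closed_forms. \<forall>r. lam i (r *\<^sub>R \<eta>) = r * lam i \<eta>) \<and>
    (\<forall>\<eta>\<in>closed_forms. (\<forall>i\<in>I. lam i \<eta> = 0) \<longrightarrow> (\<exists>f. is_function f \<and> form_cnj f = f \<and> d1 f = \<eta>))"
proof -
  have "\<forall>x\<in>topspace X. \<exists>p. fst p \<in> A \<and> x \<in> fst (fst p) \<and> snd p > 0 \<and>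
      cball (snd (fst p) x) (snd p) \<subseteq> snd (fst p) ` fst (fst p)"
  proof
    fix x assume "x \<in> topspace X"
    then obtain c r where "c \<in> A" "x \<in> fst c" "r > 0" "cball (snd c x) r \<subseteq> snd c ` (topspace X \<inter> fst c)"
      using chart_cball_exists[OF openin_topspace] by metis
    then show "\<exists>p. fst p \<in> A \<and> x \<in> fst (fst p) \<and> snd p > 0 \<and>
      cball (snd (fst p) x) (snd p) \<subseteq> snd (fst p) ` fst (fst p)"
      by (intro exI[of _ "(c, r)"]) auto
  qed
  from bchoice[OF this] obtain P where P: "\<And>x. x \<in> topspace X \<Longrightarrow> fst (P x) \<in> A \<and> x \<in> fst (fst (P x)) \<and> snd (P x) > 0 \<and>
      cball (snd (fst (P x)) x) (snd (P x)) \<subseteq> snd (fst (P x)) ` fst (fst (P x))" by blast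
  define c where "c x = fst (P x)" for x
  define z where "z x = snd (c x) x" for x
  define r where "r x = snd (P x)" for x
  have c: "c x \<in> A" "x \<in> fst (c x)" "r x > 0" "cball (z x) (r x) \<subseteq> snd (c x) ` fst (c x)"
    if "x \<in> topspace X" for x using P[OF that] by (auto simp: c_def r_def z_def)
  define U where "U x = chart_ball (c x) (z x) (r x)" for x
  define V where "V x = chart_ball (c x) (z x) (r x / 2)" for x
  \<comment> \<open>Closed discs between \<open>V\<close> and \<open>U\<close>: their complements
    are open and can be used as neighbourhoods.\<close>
  define K where "K x = {y \<in> fst (c x). snd (c x) y \<in> cball (z x) (r x / 2)}" for x
  have VK: "V x \<subseteq> K x" for x by (auto simp: V_def K_def chart_ball_def)
  have KU: "K x \<subseteq> U x" if "x \<in> topspace X" for x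
    using c(3)[OF that] by (auto simp: K_def U_def chart_ball_def)
  have oU: "openin X (U x)" and oV: "openin X (V x)" if "x \<in> topspace X" for x
    using c(1)[OF that] by (auto simp: U_def V_def openin_chart_ball)
  have cK: "closedin X (K x)" if "x \<in> topspace X" for x
    unfolding K_def using c[OF that] subset_cball[of "r x / 2" "r x" "z x"] by (intro closedin_chart_cball) auto
  have xV: "x \<in> V x" if "x \<in> topspace X" for x using c[OF that] by (auto simp: V_def chart_ball_def z_def)
  have ballU: "ball (z x) (r x) \<subseteq> snd (c x) ` fst (c x)" if "x \<in> topspace X" for x
    using c(4)[OF that] ball_subset_cball by blast
  have finite_cover: "\<exists>F. finite F \<and> F \<subseteq> topspace X \<and> topspace X \<subseteq> (\<Union>x\<in>F. W x)"
    if W: "\<And>x. x \<in> topspace X \<Longrightarrow> openin X (W x)" "\<And>x. x \<in> topspace X \<Longrightarrow> x \<in> W x" for W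
  proof -
    have cov: "\<And>S. S \<in> W ` topspace X \<Longrightarrow> openin X S" "topspace X \<subseteq> \<Union>(W ` topspace X)" using W by auto
    obtain \<F> where F: "finite \<F>" "\<F> \<subseteq> W ` topspace X" "topspace X \<subseteq> \<Union>\<F>"
      using assms cov unfolding compact_space_alt by metis
    obtain F where "finite F" "F \<subseteq> topspace X" "\<F> = W ` F" using finite_subset_image[OF F(1,2)] by blast
    then show ?thesis using F(3) by blast
  qed
  obtain F where F: "finite F" "F \<subseteq> topspace X" "topspace X \<subseteq> (\<Union>x\<in>F. V x)"
    using finite_cover[of V] oV xV by metis
  \<comment> \<open>A neighbourhood of \<open>y\<close> that, for each ball, lies inside
    \<open>U a\<close> or misses \<open>K a\<close>. A ball chosen inside \<open>Q y\<close> that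
    meets some \<open>V a\<close> is therefore contained in \<open>U a\<close>.\<close>
  define Q where "Q y = topspace X \<inter> (\<Inter>a\<in>F. if y \<in> K a then U a else topspace X - K a)" for y
  have Q: "openin X (Q y)" "y \<in> topspace X \<Longrightarrow> y \<in> Q y" for y
  proof -
    have "openin X (if y \<in> K a then U a else topspace X - K a)" if "a \<in> F" for a
      using that F(2) oU cK by (auto intro: openin_diff)
    from openin_INT[OF F(1) this] show "openin X (Q y)" by (simp only: Q_def Int_commute)
    show "y \<in> topspace X \<Longrightarrow> y \<in> Q y" using KU F(2) by (auto simp: Q_def)
  qed
  have "\<forall>y\<in>topspace X. \<exists>p. fst p \<in> A \<and> y \<in> fst (fst p) \<and> snd p > 0 \<and>
      cball (snd (fst p) y) (snd p) \<subseteq> snd (fst p) ` (Q y \<inter> fst (fst p))"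
  proof
    fix y assume "y \<in> topspace X"
    then obtain c r where "c \<in> A" "y \<in> fst c" "r > 0" "cball (snd c y) r \<subseteq> snd c ` (Q y \<inter> fst c)"
      using chart_cball_exists[OF Q(1) Q(2)] by metis
    then show "\<exists>p. fst p \<in> A \<and> y \<in> fst (fst p) \<and> snd p > 0 \<and>
      cball (snd (fst p) y) (snd p) \<subseteq> snd (fst p) ` (Q y \<inter> fst (fst p))"
      by (intro exI[of _ "(c, r)"]) auto
  qed
  from bchoice[OF this] obtain P' where P': "\<And>y. y \<in> topspace X \<Longrightarrow> fst (P' y) \<in> A \<and> y \<in> fst (fst (P' y)) \<and> snd (P' y) > 0 \<and>
      cball (snd (fst (P' y)) y) (snd (P' y)) \<subseteq> snd (fst (P' y)) ` (Q y \<inter> fst (fst (P' y)))" by blast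
  define e where "e y = fst (P' y)" for y
  define s where "s y = snd (P' y)" for y
  have e: "e y \<in> A" "y \<in> fst (e y)" "s y > 0" "cball (snd (e y) y) (s y) \<subseteq> snd (e y) ` (Q y \<inter> fst (e y))"
    if "y \<in> topspace X" for y using P'[OF that] by (auto simp: e_def s_def)
  define W where "W y = chart_ball (e y) (snd (e y) y) (s y)" for y
  have WQ: "W y \<subseteq> Q y" if y: "y \<in> topspace X" for y
  proof
    fix x assume "x \<in> W y"
    then have x: "x \<in> fst (e y)" "snd (e y) x \<in> cball (snd (e y) y) (s y)" by (auto simp: W_def chart_ball_def)
    then obtain x' where "x' \<in> Q y" "x' \<in> fst (e y)" "snd (e y) x = snd (e y) x'" using e(4)[OF y] by blast
    then show "x \<in> Q y" using x(1) chart(5)[OF e(1)[OF y]] by (metis inj_onD)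
  qed
  have ballW: "ball (snd (e y) y) (s y) \<subseteq> snd (e y) ` fst (e y)" if "y \<in> topspace X" for y
    using e(4)[OF that] ball_subset_cball by fast
  have yW: "y \<in> W y" if "y \<in> topspace X" for y using e[OF that] by (auto simp: W_def chart_ball_def)
  have oW: "openin X (W y)" if "y \<in> topspace X" for y
    using e(1)[OF that] by (auto simp: W_def openin_chart_ball)
  obtain M where M: "finite M" "M \<subseteq> topspace X" "topspace X \<subseteq> (\<Union>y\<in>M. W y)"
    using finite_cover[of W] oW yW by metis
  \<comment> \<open>One condition for each pair of balls at each centre that lies in both closed
    discs.\<close>
  define I where "I = {(a, b, m). a \<in> F \<and> b \<in> F \<and> m \<in> M \<and> m \<in> K a \<and> m \<in> K b}"
  define f where "f a \<eta> = local_primitive (c a) (z a) \<eta>" for a \<eta>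
  \<comment> \<open>The local primitives of a real form are real by \<open>f_real\<close>, so real
    parts record the whole difference.\<close>
  define lam where "lam = (\<lambda>(a, b, m) \<eta>. Re (f a \<eta> m - f b \<eta> m))"
  have "I \<subseteq> F \<times> F \<times> M" by (auto simp: I_def)
  then have finI: "finite I" using F(1) M(1) by (metis finite_SigmaI finite_subset)
  have cb: "c a \<in> A" "ball (z a) (r a) \<subseteq> snd (c a) ` fst (c a)" if "a \<in> F" for a
    using that F(2) c(1)[of a] ballU[of a] by blast+
  have f_add: "f a (\<eta> + \<theta>) m = f a \<eta> m + f a \<theta> m"
    if "a \<in> F" "m \<in> U a" "\<eta> \<in> closed_forms" "\<theta> \<in> closed_forms" for a m \<eta> \<theta>
    unfolding f_def using local_primitive_linear(1)[OF cb[OF that(1)] that(2)[unfolded U_def] that(3,4)] .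
  have f_scale: "f a (k *\<^sub>R \<eta>) m = k *\<^sub>R f a \<eta> m" if "a \<in> F" "m \<in> U a" for a m \<eta> k
    unfolding f_def using local_primitive_linear(2)[OF cb[OF that(1)] that(2)[unfolded U_def]] .
  have f_real: "cnj (f a \<eta> m) = f a \<eta> m" if "a \<in> F" "m \<in> U a" "\<eta> \<in> closed_forms" for a m \<eta>
    unfolding f_def using local_primitive_linear(3)[OF cb[OF that(1)] that(2)[unfolded U_def] that(3)] .
  have f_prim: "primitive_at (f a \<eta>) \<eta> y" if "a \<in> F" "y \<in> U a" "\<eta> \<in> closed_forms" for a y \<eta>
    unfolding f_def using local_primitive[OF that(3) cb[OF that(1)] that(2)[unfolded U_def]] .
  have IU: "a \<in> F" "b \<in> F" "m \<in> U a" "m \<in> U b" if "(a, b, m) \<in> I" for a b m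
    using that KU F(2) by (auto simp: I_def)
  have "\<exists>g. is_function g \<and> form_cnj g = g \<and> d1 g = \<eta>"
    if \<eta>: "\<eta> \<in> closed_forms" and zero: "\<forall>i\<in>I. lam i \<eta> = 0" for \<eta>
  proof -
    \<comment> \<open>The ball \<open>W m\<close> around \<open>y\<close> meets \<open>V a\<close>
      and \<open>V b\<close>, so it lies in \<open>U a\<close> and \<open>U b\<close>. Both
      primitives are defined on this connected set and agree at its centre \<open>m\<close>, hence
      at \<open>y\<close>.\<close>
    have agree: "f a \<eta> y = f b \<eta> y" if ab: "a \<in> F" "b \<in> F" and y: "y \<in> V a" "y \<in> V b" for a b y
    proof -
      have "y \<in> topspace X" using oV ab F(2) y(1) openin_subset by blast
      then obtain m where m: "m \<in> M" "y \<in> W m" using M(3) by blast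
      then have mX: "m \<in> topspace X" using M(2) by blast
      have Km: "m \<in> K d \<and> W m \<subseteq> U d" if d: "d \<in> F" "y \<in> V d" for d
      proof -
        have "m \<in> K d"
        proof (rule ccontr)
          assume "m \<notin> K d"
          then have "Q m \<subseteq> topspace X - K d" using d(1) by (auto simp: Q_def)
          then show False using WQ[OF mX] m(2) VK d(2) by blast
        qed
        then have "Q m \<subseteq> U d" using d(1) by (auto simp: Q_def)
        then show ?thesis using WQ[OF mX] \<open>m \<in> K d\<close> by blast
      qed
      have i: "(a, b, m) \<in> I" using Km ab y m(1) by (auto simp: I_def)
      have "lam (a, b, m) \<eta> = 0" using zero i by blast
      then have "Re (f a \<eta> m) = Re (f b \<eta> m)" by (simp add: lam_def)
      moreover have "Im (f a \<eta> m) = 0" "Im (f b \<eta> m) = 0"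
        using f_real[OF IU(1,3)[OF i] \<eta>] f_real[OF IU(2,4)[OF i] \<eta>] by (auto simp: complex_eq_iff)
      ultimately have "f a \<eta> m = f b \<eta> m" by (simp add: complex_eq_iff)
      moreover have "primitive_at (f d \<eta>) \<eta> x" if d: "d \<in> F" "y \<in> V d" and x: "x \<in> W m" for d x
        using f_prim[OF d(1) _ \<eta>] Km[OF d] x by blast
      ultimately show ?thesis
        using primitives_differ_by_constant[OF e(1)[OF mX] ballW[OF mX], folded W_def, of "f a \<eta>" \<eta> "f b \<eta>" m y]
          ab y yW[OF mX] m(2) by blast
    qed
    define g where "g y = f (SOME a. a \<in> F \<and> y \<in> V a) \<eta> y" for y
    have g: "g y = f a \<eta> y" if "a \<in> F" "y \<in> V a" for a y
    proof -
      have "\<exists>a. a \<in> F \<and> y \<in> V a" using that by blast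
      from someI_ex[OF this] show ?thesis unfolding g_def using agree that by blast
    qed
    have VU: "V a \<subseteq> U a" if "a \<in> F" for a using VK KU F(2) that by blast
    have "primitive_at g \<eta> y" if y: "y \<in> topspace X" for y
    proof -
      obtain a where a: "a \<in> F" "y \<in> V a" using F(3) y by blast
      show ?thesis
      proof (rule primitive_at_cong[OF _ oV a(2)])
        show "primitive_at (f a \<eta>) \<eta> y" using f_prim[OF a(1) _ \<eta>] a VU by blast
        show "a \<in> topspace X" using a F(2) by blast
        show "f a \<eta> x = g x" if "x \<in> V a" for x using g[OF a(1) that] by simp
      qed
    qed
    note h = as_form_primitive[OF closed_formD(1,2)[OF \<eta>] this]
    have "form_cnj (as_form g) = as_form g"
    proof (intro ext)
      fix a b d x
      have real: "cnj (g x) = g x" if x: "x \<in> topspace X"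
      proof -
        obtain a where a: "a \<in> F" "x \<in> V a" using F(3) x by blast
        then show ?thesis using g[OF a] f_real[OF a(1) _ \<eta>, of x] VU by auto
      qed
      have "cnj (g x) = g x" if "d \<in> A" "x \<in> fst d" using real chart(4)[OF that(1)] that(2) by blast
      then show "form_cnj (as_form g) a b d x = as_form g a b d x"
        by (auto simp: form_cnj_def as_form_def)
    qed
    then show ?thesis using h by blast
  qed
  moreover have "\<forall>i\<in>I. \<forall>\<eta>\<in>closed_forms. \<forall>\<theta>\<in>closed_forms. lam i (\<eta> + \<theta>) = lam i \<eta> + lam i \<theta>"
  proof (intro ballI)
    fix i \<eta> \<theta> assume i: "i \<in> I" and \<eta>: "\<eta> \<in> closed_forms" "\<theta> \<in> closed_forms"
    obtain a b m where abm: "i = (a, b, m)" using prod_cases3 by blast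
    show "lam i (\<eta> + \<theta>) = lam i \<eta> + lam i \<theta>"
      using IU[of a b m] i \<eta> f_add by (simp add: abm lam_def)
  qed
  moreover have "\<forall>i\<in>I. \<forall>\<eta>\<in>closed_forms. \<forall>k. lam i (k *\<^sub>R \<eta>) = k * lam i \<eta>"
  proof (intro ballI allI)
    fix i \<eta> k assume i: "i \<in> I"
    obtain a b m where abm: "i = (a, b, m)" using prod_cases3 by blast
    show "lam i (k *\<^sub>R \<eta>) = k * lam i \<eta>"
      using IU[of a b m] i f_scale by (simp add: abm lam_def right_diff_distrib)
  qed
  ultimately show ?thesis using finI by (intro exI[of _ I] exI[of _ lam]) blast
qed

end


section \<open>The kernel of \<open>N\<close>\<close>

text \<open>The mixed second difference over a parallelogram, evaluated by the mean value theorem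
  first along \<open>u\<close> and then along \<open>v\<close>.\<close>

lemma second_difference:
  fixes F :: "complex \<Rightarrow> real"
  assumes h: "h > 0" and S: "\<And>t s. 0 \<le> t \<Longrightarrow> t \<le> h \<Longrightarrow> 0 \<le> s \<Longrightarrow> s \<le> h \<Longrightarrow> z + t *\<^sub>R u + s *\<^sub>R v \<in> S"
    and F: "\<And>w. w \<in> S \<Longrightarrow> (F has_derivative F' w) (at w)"
    and F': "\<And>w. w \<in> S \<Longrightarrow> ((\<lambda>w. F' w u) has_derivative F'' w) (at w)"
  shows "\<exists>t s. 0 < t \<and> t < h \<and> 0 < s \<and> s < h \<and>
    F (z + h *\<^sub>R u + h *\<^sub>R v) - F (z + h *\<^sub>R u) - F (z + h *\<^sub>R v) + F z = h * (h * F'' (z + t *\<^sub>R u + s *\<^sub>R v) v)"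
proof -
  have line: "((\<lambda>t. G (p + t *\<^sub>R d)) has_real_derivative D d) (at t)"
    if "(G has_derivative D) (at (p + t *\<^sub>R d))" for G :: "complex \<Rightarrow> real" and D p d t
  proof -
    have "((\<lambda>t. p + t *\<^sub>R d) has_derivative (\<lambda>x. x *\<^sub>R d)) (at t)" by (auto intro!: derivative_eq_intros)
    from has_derivative_compose[OF this that]
    have "((\<lambda>t. G (p + t *\<^sub>R d)) has_derivative (\<lambda>x. D (x *\<^sub>R d))) (at t)" .
    moreover have "D (x *\<^sub>R d) = x * D d" for x
      using linear_scale[OF has_derivative_linear[OF that]] by simp
    ultimately show ?thesis by (simp add: has_field_derivative_def mult.commute[of _ "D d"] fun_eq_iff)
  qed
  let ?\<phi> = "\<lambda>t. F ((z + h *\<^sub>R v) + t *\<^sub>R u) - F (z + t *\<^sub>R u)"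
  have mem: "(z + h *\<^sub>R v) + t *\<^sub>R u \<in> S" "z + t *\<^sub>R u \<in> S" if "0 \<le> t" "t \<le> h" for t
    using S[of t h] S[of t 0] that h by (simp_all add: algebra_simps)
  have "\<exists>t>0. t < h \<and> ?\<phi> h - ?\<phi> 0 = (h - 0) * (F' ((z + h *\<^sub>R v) + t *\<^sub>R u) u - F' (z + t *\<^sub>R u) u)"
    by (rule MVT2[OF h]) (intro DERIV_diff line F mem)
  then obtain t where t: "0 < t" "t < h" "?\<phi> h - ?\<phi> 0 = h * (F' ((z + h *\<^sub>R v) + t *\<^sub>R u) u - F' (z + t *\<^sub>R u) u)" by auto
  have "\<exists>s>0. s < h \<and> F' ((z + t *\<^sub>R u) + h *\<^sub>R v) u - F' ((z + t *\<^sub>R u) + 0 *\<^sub>R v) u = (h - 0) * F'' ((z + t *\<^sub>R u) + s *\<^sub>R v) v"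
    by (rule MVT2[OF h]) (intro line F' S; use t in simp)
  then obtain s where s: "0 < s" "s < h" "F' ((z + t *\<^sub>R u) + h *\<^sub>R v) u - F' (z + t *\<^sub>R u) u = h * F'' ((z + t *\<^sub>R u) + s *\<^sub>R v) v" by auto
  have sw: "(z + h *\<^sub>R v) + t *\<^sub>R u = (z + t *\<^sub>R u) + h *\<^sub>R v" for t by (simp add: algebra_simps)
  have "F (z + h *\<^sub>R u + h *\<^sub>R v) - F (z + h *\<^sub>R u) - F (z + h *\<^sub>R v) + F z = h * (h * F'' (z + t *\<^sub>R u + s *\<^sub>R v) v)"
    using t(3) s(3) unfolding sw by simp
  then show ?thesis using t s by blast
qed

text \<open>The second difference is symmetric in \<open>u\<close> and \<open>v\<close>, and
  evaluating it in both orders equates the two second derivatives at nearby points. Continuity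
  brings these points to \<open>z\<close>.\<close>

lemma second_derivatives_commute:
  fixes F :: "complex \<Rightarrow> real"
  assumes S: "open S" "z \<in> S"
    and F: "\<And>w. w \<in> S \<Longrightarrow> (F has_derivative F' w) (at w)"
    and F': "\<And>w u. w \<in> S \<Longrightarrow> ((\<lambda>w. F' w u) has_derivative F'' u w) (at w)"
    and cont: "\<And>u v. continuous_on S (\<lambda>w. F'' u w v)"
  shows "F'' u z v = F'' v z u"
proof (rule ccontr)
  assume ne: "F'' u z v \<noteq> F'' v z u"
  \<comment> \<open>Half of the gap: each second derivative may move by less than \<open>e\<close>,
    so together they cannot close it.\<close>
  define e where "e = \<bar>F'' u z v - F'' v z u\<bar> / 2"
  have e: "e > 0" using ne by (simp add: e_def)
  have c: "isCont (\<lambda>w. F'' u w v) z" for u v using cont S continuous_on_eq_continuous_at by blast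
  have near: "\<exists>d>0. \<forall>w. dist w z < d \<longrightarrow> \<bar>F'' u w v - F'' u z v\<bar> < e" for u v
    using c[of u v] e unfolding continuous_at_eps_delta dist_real_def by blast
  obtain d1 where d1: "d1 > 0" "\<And>w. dist w z < d1 \<Longrightarrow> \<bar>F'' u w v - F'' u z v\<bar> < e" using near by blast
  obtain d2 where d2: "d2 > 0" "\<And>w. dist w z < d2 \<Longrightarrow> \<bar>F'' v w u - F'' v z u\<bar> < e" using near by blast
  obtain d3 where d3: "d3 > 0" "ball z d3 \<subseteq> S" using S open_contains_ball by blast
  define d where "d = min d1 (min d2 d3)"
  have d: "d > 0" using d1 d2 d3 by (simp add: d_def)
  \<comment> \<open>The parallelogram with sides \<open>h *\<^sub>R u\<close> and
    \<open>h *\<^sub>R v\<close> stays within \<open>h * q = d / 2\<close> of \<open>z\<close>; the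
    summand \<open>1\<close> covers the case of zero vectors.\<close>
  define q where "q = norm u + norm v + 1"
  define h where "h = d / (2 * q)"
  have pos: "q > 0" by (simp add: q_def add_nonneg_pos)
  have h: "h > 0" using d pos by (simp add: h_def)
  have near_z: "dist (z + t *\<^sub>R u + s *\<^sub>R v) z < d" if "0 \<le> t" "t \<le> h" "0 \<le> s" "s \<le> h" for t s
  proof -
    have "dist (z + t *\<^sub>R u + s *\<^sub>R v) z = norm (t *\<^sub>R u + s *\<^sub>R v)" by (simp add: dist_norm)
    also have "\<dots> \<le> t * norm u + s * norm v" using norm_triangle_ineq[of "t *\<^sub>R u" "s *\<^sub>R v"] that by simp
    also have "\<dots> \<le> h * norm u + h * norm v" using that by (intro add_mono mult_right_mono) auto
    also have "\<dots> \<le> h * q" using h by (simp add: q_def algebra_simps)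
    also have "\<dots> = d / 2" using pos by (simp add: h_def)
    also have "\<dots> < d" using d by simp
    finally show ?thesis .
  qed
  have in_S: "z + t *\<^sub>R u + s *\<^sub>R v \<in> S" if "0 \<le> t" "t \<le> h" "0 \<le> s" "s \<le> h" for t s
  proof -
    have "dist (z + t *\<^sub>R u + s *\<^sub>R v) z < d3" using near_z[OF that] by (simp add: d_def)
    then show ?thesis using d3(2) by (auto simp: dist_commute)
  qed
  have in_S': "z + t *\<^sub>R v + s *\<^sub>R u \<in> S" if "0 \<le> t" "t \<le> h" "0 \<le> s" "s \<le> h" for t s
    using in_S[of s t] that by (simp add: add.assoc add.commute[of "t *\<^sub>R v"])
  obtain t s where ts: "0 < t" "t < h" "0 < s" "s < h"
    "F (z + h *\<^sub>R u + h *\<^sub>R v) - F (z + h *\<^sub>R u) - F (z + h *\<^sub>R v) + F z = h * (h * F'' u (z + t *\<^sub>R u + s *\<^sub>R v) v)"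
    using second_difference[where F = F and F' = F' and S = S, OF h in_S F F'] by blast
  obtain t' s' where ts': "0 < t'" "t' < h" "0 < s'" "s' < h"
    "F (z + h *\<^sub>R v + h *\<^sub>R u) - F (z + h *\<^sub>R v) - F (z + h *\<^sub>R u) + F z = h * (h * F'' v (z + t' *\<^sub>R v + s' *\<^sub>R u) u)"
    using second_difference[where F = F and F' = F' and S = S, OF h in_S' F F'] by blast
  have sw: "z + h *\<^sub>R v + h *\<^sub>R u = z + h *\<^sub>R u + h *\<^sub>R v" by (simp add: algebra_simps)
  have "h * (h * F'' u (z + t *\<^sub>R u + s *\<^sub>R v) v) = h * (h * F'' v (z + t' *\<^sub>R v + s' *\<^sub>R u) u)"
    using ts(5) ts'(5) unfolding sw by linarith
  then have eq: "F'' u (z + t *\<^sub>R u + s *\<^sub>R v) v = F'' v (z + t' *\<^sub>R v + s' *\<^sub>R u) u" using h by simp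
  have "dist (z + t *\<^sub>R u + s *\<^sub>R v) z < d1" using near_z[of t s] ts by (simp add: d_def)
  from d1(2)[OF this] have 1: "\<bar>F'' u (z + t *\<^sub>R u + s *\<^sub>R v) v - F'' u z v\<bar> < e" .
  have sw': "z + t' *\<^sub>R v + s' *\<^sub>R u = z + s' *\<^sub>R u + t' *\<^sub>R v" by (simp add: algebra_simps)
  have "dist (z + t' *\<^sub>R v + s' *\<^sub>R u) z < d2" unfolding sw' using near_z[of s' t'] ts' by (simp add: d_def)
  from d2(2)[OF this] have 2: "\<bar>F'' v (z + t' *\<^sub>R v + s' *\<^sub>R u) u - F'' v z u\<bar> < e" .
  show False using 1 2 eq by (simp add: e_def abs_if split: if_splits)
qed

text \<open>Real and imaginary parts are treated separately, because the argument with second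
  differences rests on the mean value theorem for real functions.\<close>

lemma wirt_commute:
  assumes S: "open S" "z \<in> S" and f: "smooth_on S f"
  shows "wirt (wirt_bar f) z = wirt_bar (wirt f) z"
proof -
  define D where "D v w = frechet_derivative f (at w) v" for v w
  define E where "E u w v = frechet_derivative (D u) (at w) v" for u w v
  have Dsm: "smooth_on S (D v)" for v unfolding D_def by (rule smooth_on_derivative[OF f])
  have Esm: "smooth_on S (\<lambda>w. E u w v)" for u v unfolding E_def by (rule smooth_on_derivative[OF Dsm])
  have fD: "(f has_derivative (\<lambda>v. D v w)) (at w)" if "w \<in> S" for w
    using smooth_on_has_derivative[OF f S(1) that] by (simp add: D_def)
  have DE: "(D u has_derivative E u w) (at w)" if "w \<in> S" for u w
    using smooth_on_has_derivative[OF Dsm S(1) that] unfolding E_def .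
  have cont: "continuous_on S (\<lambda>w. E u w v)" for u v
    using Esm[of u v] unfolding smooth_on_def by (metis ck_on.simps(1))
  have "Re (E 1 z \<i>) = Re (E \<i> z 1)"
    by (rule second_derivatives_commute[where F = "\<lambda>w. Re (f w)" and F' = "\<lambda>w v. Re (D v w)" and
          F'' = "\<lambda>u w v. Re (E u w v)", OF S])
      (intro has_derivative_Re fD DE continuous_intros cont; assumption)+
  moreover have "Im (E 1 z \<i>) = Im (E \<i> z 1)"
    by (rule second_derivatives_commute[where F = "\<lambda>w. Im (f w)" and F' = "\<lambda>w v. Im (D v w)" and
          F'' = "\<lambda>u w v. Im (E u w v)", OF S])
      (intro has_derivative_Im fD DE continuous_intros cont; assumption)+
  ultimately have sym: "E 1 z \<i> = E \<i> z 1" by (simp add: complex_eq_iff)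
  have wb: "wirt_bar f = (\<lambda>w. (1/2) * (D 1 w + \<i> * D \<i> w))" and w: "wirt f = (\<lambda>w. (1/2) * (D 1 w + (- \<i>) * D \<i> w))"
    by (auto simp: wirt_def wirt_bar_def D_def)
  have d: "((\<lambda>w. (1/2) * (D 1 w + k * D \<i> w)) has_derivative (\<lambda>v. (1/2) * (E 1 z v + k * E \<i> z v))) (at z)" for k
    by (intro has_derivative_mult_right has_derivative_add DE S)
  have W1: "wirt (wirt_bar f) z = ((1/2) * (E 1 z 1 + \<i> * E \<i> z 1) - \<i> * ((1/2) * (E 1 z \<i> + \<i> * E \<i> z \<i>))) / 2"
    unfolding wb wirt_def[of "\<lambda>w. (1/2) * (D 1 w + \<i> * D \<i> w)"] frechet_derivative_eqI[OF d] ..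
  have W2: "wirt_bar (wirt f) z = ((1/2) * (E 1 z 1 + (- \<i>) * E \<i> z 1) + \<i> * ((1/2) * (E 1 z \<i> + (- \<i>) * E \<i> z \<i>))) / 2"
    unfolding w wirt_bar_def[of "\<lambda>w. (1/2) * (D 1 w + (- \<i>) * D \<i> w)"] frechet_derivative_eqI[OF d] ..
  show ?thesis unfolding W1 W2 sym by (simp add: field_simps)
qed

context riemann
begin

lemma del_del: "del (del \<eta>) = 0" and delbar_delbar: "delbar (delbar \<eta>) = 0"
  by (auto simp: del_def delbar_def wirt_const fun_eq_iff)

lemma del_delbar:
  assumes \<eta>: "\<eta> \<in> forms A" shows "delbar (del \<eta>) = cscale (-1) (del (delbar \<eta>))"
proof (intro ext)
  fix a b c x
  show "delbar (del \<eta>) a b c x = cscale (-1) (del (delbar \<eta>)) a b c x"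
  proof (cases "a = 1 \<and> b = 1 \<and> x \<in> fst c")
    case True
    show ?thesis
    proof (cases "c \<in> A")
      case c: True
      let ?h = "\<lambda>z. \<eta> 0 0 c (cinv c z)"
      have op: "open (snd c ` fst c)" and xc: "snd c x \<in> snd c ` fst c" using chart(2)[OF c] True by auto
      have sm: "smooth_on (snd c ` fst c) ?h" by (rule form_smooth[OF \<eta> c])
      have eq: "wirt ?h z = del \<eta> 1 0 c (cinv c z)" "wirt_bar ?h z = delbar \<eta> 0 1 c (cinv c z)"
        if "z \<in> snd c ` fst c" for z
        using cinv_mem[OF that] by (simp_all add: del_def delbar_def)
      have "wirt_bar (\<lambda>z. del \<eta> 1 0 c (cinv c z)) (snd c x) = wirt_bar (wirt ?h) (snd c x)"
        by (rule wirt_cong_open(2)[OF op xc eq(1) smooth_on_has_derivative[OF smooth_on_wirt(1)[OF op sm] op xc]])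
      moreover have "wirt (\<lambda>z. delbar \<eta> 0 1 c (cinv c z)) (snd c x) = wirt (wirt_bar ?h) (snd c x)"
        by (rule wirt_cong_open(1)[OF op xc eq(2) smooth_on_has_derivative[OF smooth_on_wirt(2)[OF op sm] op xc]])
      ultimately show ?thesis
        using True wirt_commute[OF op xc sm] by (simp add: cscale_def del_def[of "delbar \<eta>"] delbar_def[of "del \<eta>"])
    next
      case False
      then have "\<eta> a b c = (\<lambda>x. 0)" for a b using form_zero[OF \<eta>] by blast
      then show ?thesis by (simp add: cscale_def del_def delbar_def wirt_const cong: if_cong)
    qed
  next
    case False
    then show ?thesis by (auto simp: cscale_def del_def delbar_def wirt_const)
  qed
qed

end

section \<open>Closed functions, and the square of the differential\<close>

context riemann
begin

text \<open>In degree zero the coefficient does not depend on the chart, so \<open>\<theta>\<close>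
  is a function on points. It is a primitive of the zero form, hence locally constant, and
  \<open>X\<close> is connected.\<close>

lemma closed_function_constant:
  assumes \<theta>: "\<theta> \<in> forms A" "graded (-1) \<theta>" "d1 \<theta> = 0"
    and c0: "c0 \<in> A" "x0 \<in> fst c0" and c: "c \<in> A" "x \<in> fst c"
  shows "\<theta> 0 0 c x = \<theta> 0 0 c0 x0"
proof -
  define f where "f x = \<theta> 0 0 (SOME c. c \<in> A \<and> x \<in> fst c) x" for x
  have f: "f x = \<theta> 0 0 c x" if c: "c \<in> A" "x \<in> fst c" for c x
  proof -
    have "\<exists>c. c \<in> A \<and> x \<in> fst c" using c by blast
    from someI_ex[OF this] show ?thesis
      using form_transform[OF \<theta>(1) _ c(1) _ c(2), of _ 0 0] by (simp add: f_def)
  qed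
  have prim: "primitive_at f 0 y" if y: "y \<in> topspace X" for y
  proof -
    obtain c where c: "c \<in> A" "y \<in> fst c" using covers y by blast
    let ?h = "\<lambda>z. \<theta> 0 0 c (cinv c z)"
    have "del \<theta> 1 0 c y = wirt ?h (snd c y)" "delbar \<theta> 1 0 c y = 0"
      "del \<theta> 0 1 c y = 0" "delbar \<theta> 0 1 c y = wirt_bar ?h (snd c y)"
      using c by (simp_all add: del_def delbar_def)
    moreover have "d1 \<theta> 1 0 c y = 0" "d1 \<theta> 0 1 c y = 0" by (simp_all add: \<theta>(3))
    ultimately have w: "wirt ?h (snd c y) = 0" "wirt_bar ?h (snd c y) = 0" by (simp_all add: d1_def)
    have "(?h has_derivative (\<lambda>v. (0 :: 'x form) 1 0 c y * v + (0 :: 'x form) 0 1 c y * cnj v)) (at (snd c y))"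
      using has_derivative_wirt[OF form_derivative[OF \<theta>(1) c, of 0 0]] w by simp
    then have "((\<lambda>z. f (cinv c z)) has_derivative
        (\<lambda>v. (0 :: 'x form) 1 0 c y * v + (0 :: 'x form) 0 1 c y * cnj v)) (at (snd c y))"
      by (rule has_derivative_transform_within_open[OF _ chart(2)[OF c(1)]])
        (use c f[OF c(1)] in \<open>auto simp: cinv_mem\<close>)
    then show ?thesis by (rule primitive_atI[OF zero_form c])
  qed
  have local: "\<exists>W. openin X W \<and> y \<in> W \<and> (\<forall>x\<in>W. f x = f y)" if y: "y \<in> topspace X" for y
  proof -
    obtain c r where c: "c \<in> A" "y \<in> fst c" "r > 0" "cball (snd c y) r \<subseteq> snd c ` (topspace X \<inter> fst c)"
      using chart_cball_exists[OF openin_topspace y] by metis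
    then have ball: "ball (snd c y) r \<subseteq> snd c ` fst c" using ball_subset_cball by blast
    let ?W = "chart_ball c (snd c y) r"
    have W: "?W \<subseteq> topspace X" using openin_chart_ball[OF c(1)] openin_subset by blast
    have yW: "y \<in> ?W" using c by (simp add: chart_ball_def)
    have p: "primitive_at f 0 x" if "x \<in> ?W" for x using prim W that by blast
    have q: "primitive_at (\<lambda>x. f y) 0 x" if "x \<in> ?W" for x
    proof -
      have "x \<in> fst c" using that by (simp add: chart_ball_def)
      then show ?thesis by (intro primitive_atI[OF zero_form c(1)]) auto
    qed
    have "f x = f y" if "x \<in> ?W" for x
      by (rule primitives_differ_by_constant[OF c(1) ball p q yW that refl])
    then show ?thesis using openin_chart_ball[OF c(1)] yW by blast
  qed
  have op: "openin X {x \<in> topspace X. P (f x)}" for P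
  proof (subst openin_subopen, intro ballI)
    fix y assume y: "y \<in> {x \<in> topspace X. P (f x)}"
    then obtain W where W: "openin X W" "y \<in> W" "\<forall>x\<in>W. f x = f y" using local by blast
    moreover have "W \<subseteq> {x \<in> topspace X. P (f x)}"
    proof
      fix x assume "x \<in> W"
      then have "f x = f y" "x \<in> topspace X" using W(3) openin_subset[OF W(1)] by blast+
      then show "x \<in> {x \<in> topspace X. P (f x)}" using y by simp
    qed
    ultimately show "\<exists>T. openin X T \<and> y \<in> T \<and> T \<subseteq> {x \<in> topspace X. P (f x)}" by blast
  qed
  have conn: "connected_space X" using riemann by (simp add: riemann_surface_def)
  have x: "x \<in> topspace X" "x0 \<in> topspace X" using chart(4) c c0 by blast+
  have "f x = f x0"
  proof (rule ccontr)
    assume "f x \<noteq> f x0"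
    then have "{y \<in> topspace X. f y \<noteq> f x0} \<noteq> {}" "{y \<in> topspace X. f y = f x0} \<noteq> {}" using x by blast+
    moreover have "topspace X \<subseteq> {y \<in> topspace X. f y = f x0} \<union> {y \<in> topspace X. f y \<noteq> f x0}" by blast
    moreover have "{y \<in> topspace X. f y = f x0} \<inter> {y \<in> topspace X. f y \<noteq> f x0} = {}" by blast
    ultimately show False
      using conn op[of "\<lambda>v. v = f x0"] op[of "\<lambda>v. v \<noteq> f x0"] unfolding connected_space_def by blast
  qed
  then show ?thesis using f c c0 by simp
qed

lemma K_form_function:
  assumes "K_form i j \<eta>" "j \<le> -1" shows "is_function \<eta>"
proof (cases "j = -1")
  case True
  then show ?thesis using assms(1) unfolding K_form_def is_function_def graded_def by auto
next
  case False
  then have "\<eta> = 0" using graded_zero[of j \<eta>] assms by (simp add: K_form_def)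
  then show ?thesis by (simp add: is_function_def zero_form)
qed

lemma K_form_d:
  assumes "K_form i j \<eta>" "j \<le> -1"
  shows "K_form (i + 1) (j + 1) (d1 \<eta>)" "K_form (i + 1) (j + 1) (d2 \<eta>)"
proof -
  have K: "\<eta> \<in> forms A" "form_cnj \<eta> = cscale (twist i j) \<eta>" "graded j \<eta>" using assms(1) by (auto simp: K_form_def)
  have fn: "is_function \<eta>" by (rule K_form_function[OF assms])
  have "1 + (j + 1) - (i + 1) = 1 + j - i" by simp
  then have tw: "twist (i + 1) (j + 1) = twist i j" by (simp only: twist_def)
  have "form_cnj (del \<eta>) = cscale (twist i j) (delbar \<eta>)" "form_cnj (delbar \<eta>) = cscale (twist i j) (del \<eta>)"
    using form_cnj_del[OF fn] by (simp_all add: K(2) del_cscale[OF K(1)])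
  moreover have "form_cnj (\<eta> - \<theta>) = form_cnj \<eta> - form_cnj \<theta>" for \<eta> \<theta> :: "'x form"
    by (simp add: form_cnj_def fun_eq_iff algebra_simps)
  ultimately have cnj: "form_cnj (d1 \<eta>) = cscale (twist i j) (d1 \<eta>)" "form_cnj (d2 \<eta>) = cscale (twist i j) (d2 \<eta>)"
    by (simp_all add: d1_def d2_def form_cnj_add form_cnj_cscale cscale_add cscale_cscale)
      (simp_all add: cscale_def fun_eq_iff algebra_simps)
  have "cscale (-1) (del \<eta>) \<in> forms A" by (rule cscale_form[OF function_del_form(1)[OF fn]])
  from add_form[OF function_del_form(2)[OF fn] this] have "delbar \<eta> - del \<eta> \<in> forms A"
    by (simp add: cscale_def plus_fun_def fun_diff_def)
  then have "d1 \<eta> \<in> forms A" "d2 \<eta> \<in> forms A"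
    unfolding d1_def d2_def by (intro add_form cscale_form function_del_form[OF fn])+
  then show "K_form (i + 1) (j + 1) (d1 \<eta>)" "K_form (i + 1) (j + 1) (d2 \<eta>)"
    unfolding K_form_def tw using cnj graded_d[OF K(3)] by blast+
qed

text \<open>Since \<open>j \<le> -1\<close>, only functions are differentiated. If
  \<open>(i, j, k)\<close> is a truncated position, then so is \<open>(i - 1, j - 1, k - 1)\<close>,
  from which \<open>d1\<close> arrives, while \<open>d2\<close> is cut off in \<open>Kd\<close>
  itself.\<close>

lemma Kd_Ktot:
  assumes c: "c \<in> Ktot A" and j: "\<And>i j k. c (i, j, k) \<noteq> 0 \<Longrightarrow> j \<le> -1"
  shows "Kd c \<in> Ktot A"
proof (rule KtotI)
  let ?T = "{t. c t \<noteq> 0}"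
  have "Kd c t = 0" if t: "t \<notin> (\<lambda>(i, j, k). (i + 1, j + 1, k + 1)) ` ?T \<union> (\<lambda>(i, j, k). (i + 1, j + 1, k)) ` ?T" for t
  proof -
    obtain i j k where ijk: "t = (i, j, k)" using prod_cases3 by blast
    have "c (i - 1, j - 1, k - 1) = 0" "c (i - 1, j - 1, k) = 0"
      using t image_eqI[of t "\<lambda>(i, j, k). (i + 1, j + 1, k + 1)" "(i - 1, j - 1, k - 1)" ?T]
        image_eqI[of t "\<lambda>(i, j, k). (i + 1, j + 1, k)" "(i - 1, j - 1, k)" ?T] by (auto simp: ijk)
    then show ?thesis by (simp add: ijk Kd_eq[OF c] d_0)
  qed
  then have "{t. Kd c t \<noteq> 0} \<subseteq> (\<lambda>(i, j, k). (i + 1, j + 1, k + 1)) ` ?T \<union> (\<lambda>(i, j, k). (i + 1, j + 1, k)) ` ?T"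
    by blast
  then show "finite {t. Kd c t \<noteq> 0}" using KtotD(3)[OF c] by (metis finite_UnI finite_imageI finite_subset)
  have Kc: "K_form i j (d1 (c (i - 1, j - 1, k)))" "K_form i j (d2 (c (i - 1, j - 1, k)))" for i j k
  proof -
    have "K_form i j (d1 (c (i - 1, j - 1, k))) \<and> K_form i j (d2 (c (i - 1, j - 1, k)))"
    proof (cases "c (i - 1, j - 1, k) = 0")
      case True
      then show ?thesis by (simp add: d_0 K_form_0)
    next
      case False
      from K_form_d[of "i - 1" "j - 1", OF KtotD(1)[OF c] j[OF False]] show ?thesis by simp
    qed
    then show "K_form i j (d1 (c (i - 1, j - 1, k)))" "K_form i j (d2 (c (i - 1, j - 1, k)))" by auto
  qed
  show "K_form i j (Kd c (i, j, k))" for i j k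
    unfolding Kd_eq[OF c] by (intro K_form_add) (auto simp: Kc K_form_0)
  show "K_ok i j k" if nz: "Kd c (i, j, k) \<noteq> 0" for i j k
  proof (rule ccontr)
    assume no: "\<not> K_ok i j k"
    then have "\<not> K_ok (i - 1) (j - 1) (k - 1)" by (auto simp: K_ok_def)
    then have "c (i - 1, j - 1, k - 1) = 0" using KtotD(2)[OF c] by blast
    then show False using nz no by (simp add: Kd_eq[OF c] d_0)
  qed
qed

lemma d_d:
  assumes "\<eta> \<in> forms A" "del \<eta> \<in> forms A" "delbar \<eta> \<in> forms A"
  shows "d1 (d1 \<eta>) = 0" "d2 (d2 \<eta>) = 0" "d1 (d2 \<eta>) + d2 (d1 \<eta>) = 0"
proof -
  have f: "cscale (-1) (del \<eta>) \<in> forms A" by (rule cscale_form[OF assms(2)])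
  have m: "delbar \<eta> - del \<eta> = delbar \<eta> + cscale (-1) (del \<eta>)" by (simp add: cscale_def fun_eq_iff)
  note s = del_add[OF assms(2,3)] del_add[OF assms(3) f] del_cscale[OF assms(2)] del_cscale[OF assms(3)]
    del_cscale[OF add_form[OF assms(3) f]] del_del delbar_delbar del_delbar[OF assms(1)]
  show "d1 (d1 \<eta>) = 0" "d2 (d2 \<eta>) = 0" "d1 (d2 \<eta>) + d2 (d1 \<eta>) = 0"
    by (simp_all add: d1_def d2_def m s) (auto simp: cscale_def fun_eq_iff algebra_simps)
qed

text \<open>\<open>d1\<close> and \<open>d2\<close> have square zero and anticommute. The two mixed
  terms carry the conditions \<open>K_ok i j k\<close> and
  \<open>K_ok (i - 1) (j - 1) (k - 1)\<close>, which agree wherever the form at \<open>k - 1\<close>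
  is nonzero.\<close>

lemma Kd_Kd:
  assumes c: "c \<in> Ktot A" and j: "\<And>i j k. c (i, j, k) \<noteq> 0 \<Longrightarrow> j \<le> -1"
  shows "Kd (Kd c) = 0"
proof
  fix t :: "int \<times> int \<times> int"
  obtain i j k where t: "t = (i, j, k)" using prod_cases3 by blast
  define p where "p k = c (i - 2, j - 2, k)" for k
  have dp: "p k \<in> forms A" "del (p k) \<in> forms A" "delbar (p k) \<in> forms A" for k
  proof -
    have "is_function (p k)"
    proof (cases "p k = 0")
      case False
      then have "j - 2 \<le> -1" using j by (simp add: p_def)
      then show ?thesis unfolding p_def by (rule K_form_function[OF KtotD(1)[OF c]])
    qed (simp add: is_function_def zero_form)
    then show "p k \<in> forms A" "del (p k) \<in> forms A" "delbar (p k) \<in> forms A"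
      using function_del_form by (auto simp: is_function_def)
  qed
  have df: "d1 (p k) \<in> forms A" "d2 (p k) \<in> forms A" for k
  proof -
    have m: "delbar (p k) - del (p k) = delbar (p k) + cscale (-1) (del (p k))" by (simp add: cscale_def fun_eq_iff)
    show "d1 (p k) \<in> forms A" "d2 (p k) \<in> forms A"
      unfolding d1_def d2_def m by (intro add_form cscale_form dp)+
  qed
  have K1: "Kd c (i - 1, j - 1, k) = d1 (p (k - 1)) + (if K_ok (i - 1) (j - 1) k then d2 (p k) else 0)" for k
    unfolding Kd_eq[OF c] p_def by simp
  have 1: "d1 (Kd c (i - 1, j - 1, k - 1)) = (if K_ok (i - 1) (j - 1) (k - 1) then d1 (d2 (p (k - 1))) else 0)"
    unfolding K1 using d_add(1)[OF df] d_d(1)[OF dp] by (simp add: d_0)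
  have 2: "d2 (Kd c (i - 1, j - 1, k)) = d2 (d1 (p (k - 1)))"
    unfolding K1 using d_add(2)[OF df] d_d(2)[OF dp] by (simp add: d_0)
  have 3: "K_ok i j k \<longleftrightarrow> K_ok (i - 1) (j - 1) (k - 1)" if "p (k - 1) \<noteq> 0"
    using KtotD(2)[OF c, of "i - 2" "j - 2" "k - 1"] that by (auto simp: p_def K_ok_def)
  show "Kd (Kd c) t = 0 t"
    using 3 d_d(3)[OF dp, of "k - 1"]
    by (cases "p (k - 1) = 0") (auto simp: t Kd_eq[OF Kd_Ktot[OF c j]] 1 2 d_0)
qed

definition single :: "int \<Rightarrow> int \<Rightarrow> int \<Rightarrow> 'x form \<Rightarrow> 'x kfam" where
  "single i j k \<eta> = (\<lambda>t. if t = (i, j, k) then \<eta> else 0)"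

lemma single_Ktot: "K_ok i j k \<Longrightarrow> K_form i j \<eta> \<Longrightarrow> single i j k \<eta> \<in> Ktot A"
  by (rule KtotI) (auto simp: single_def K_form_0 split: if_splits intro: finite_subset[of _ "{(i, j, k)}"])

lemma single_add: "single i j k (\<eta> + \<theta>) = single i j k \<eta> + single i j k \<theta>"
  by (simp add: single_def fun_eq_iff)

lemma single_scaleR: "single i j k (r *\<^sub>R \<eta>) = r *\<^sub>R single i j k \<eta>"
  by (rule ext) (simp add: single_def scaleR_kfam scaleR_eq_cscale cscale_0)

text \<open>At the lowest position \<open>k = i\<close> the component \<open>d2\<close> would land
  in \<open>(i + 1, j + 1, i)\<close>, where \<open>K\<close> is zero, so only \<open>d1\<close>
  survives.\<close>

lemma Kd_single:
  assumes "K_ok i j i" "K_form i j \<eta>" "i \<ge> 0"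
  shows "Kd (single i j i \<eta>) = single (i + 1) (j + 1) (i + 1) (d1 \<eta>)"
proof
  fix t :: "int \<times> int \<times> int"
  obtain a b k where t: "t = (a, b, k)" using prod_cases3 by blast
  have "\<not> (a - 1 = i \<and> b - 1 = j \<and> k = i \<and> K_ok a b k)" by (auto simp: K_ok_def)
  then have "(if K_ok a b k then d2 (single i j i \<eta> (a - 1, b - 1, k)) else 0) = 0"
    by (auto simp: single_def d_0)
  moreover have "d1 (single i j i \<eta> (a - 1, b - 1, k - 1)) = single (i + 1) (j + 1) (i + 1) (d1 \<eta>) (a, b, k)"
    by (auto simp: single_def d_0)
  ultimately show "Kd (single i j i \<eta>) t = single (i + 1) (j + 1) (i + 1) (d1 \<eta>) t"
    by (simp add: t Kd_eq[OF single_Ktot[OF assms(1,2)]])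
qed

text \<open>For \<open>k > i\<close> the target of \<open>N\<close> is not truncated, and
  \<open>N\<close> is then multiplication by a nonzero scalar. Positions with \<open>k < i\<close>
  are empty, which leaves \<open>k = i\<close>.\<close>

lemma KN_zero_single:
  assumes x: "x \<in> K2 A i j" and N: "KN x = 0" and i: "i \<ge> 0"
  shows "x = single i j i (x (i, j, i))"
proof
  fix t :: "int \<times> int \<times> int"
  have xK: "x \<in> Ktot A" and supp: "\<And>a b k. (a, b) \<noteq> (i, j) \<Longrightarrow> x (a, b, k) = 0" using x by (auto simp: K2_def)
  obtain a b k where t: "t = (a, b, k)" using prod_cases3 by blast
  have "x (i, j, k) = 0" if k: "k \<noteq> i"
  proof (rule ccontr)
    assume nz: "x (i, j, k) \<noteq> 0"
    then have ok: "K_ok i j k" by (rule KtotD(2)[OF xK])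
    then have "K_ok (i + 2) j (k + 1)" using k i by (auto simp: K_ok_def)
    moreover have "KN x (i + 2, j, k + 1) = 0" by (simp add: N)
    ultimately have "cscale (inverse tpi) (x (i, j, k)) = 0" by (simp add: KN_eq[OF xK])
    then show False using nz tpi_nonzero by (simp add: cscale_eq_0_iff)
  qed
  then show "x t = single i j i (x (i, j, i)) t"
    using supp by (cases "(a, b) = (i, j)") (auto simp: t single_def)
qed

end


section \<open>Classes in the kernel of \<open>N\<close> and bounds for their dimension\<close>

context surface_module
begin

lemma cocycle_diff: "x \<in> cocycles A \<Longrightarrow> y \<in> cocycles A \<Longrightarrow> x - y \<in> cocycles A"
  by (rule subspace_diff[OF subspace_cocycles])

lemma cls_diff: "x \<in> cocycles A \<Longrightarrow> y \<in> cocycles A \<Longrightarrow> cls (x - y) = cls x - cls y"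
  using cls_add[of "x - y" y] cocycle_diff[of x y] by simp

text \<open>A class in \<open>ker N\<close> has a representative \<open>a\<close> with \<open>N a = 0\<close>: if \<open>N a = d b\<close>, then \<open>b = N c\<close> and one
  passes to \<open>a - d c\<close>.\<close>

lemma kernel_representative:
  assumes px: "pr (i, j) x = x" and N: "HN A cls x = 0" and i: "i \<ge> 0" and j: "j \<le> 0"
  shows "\<exists>\<eta>. K_form i j \<eta> \<and> (\<eta> \<noteq> 0 \<longrightarrow> K_ok i j i) \<and> d1 \<eta> = 0 \<and> single i j i \<eta> \<in> cocycles A \<and> x = cls (single i j i \<eta>)"
proof -
  obtain a where a: "a \<in> cocycles A" "a \<in> K2 A i j" "x = cls a"
    using px H2_eq[of i j] by (auto simp: H2_def)
  have aK: "a \<in> Ktot A" by (rule cocycles_Ktot[OF a(1)])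
  have "cls (KN a) = 0" using N HN_cls[OF a(1)] a(3) by simp
  then obtain y where y: "y \<in> Ktot A" "KN a = Kd y" using cls_eq_0[OF KN_cocycles[OF a(1)]] by blast
  define b where "b = comp (i + 1, j - 1) y"
  have bK: "b \<in> Ktot A" unfolding b_def by (rule comp_Ktot[OF y(1)])
  have "KN a = comp (i + 2, j) (KN a)" using comp_KN[OF aK, of "i + 2" j] K2_comp[OF a(2)] by simp
  also have "\<dots> = Kd b" unfolding y(2) b_def using comp_Kd[OF y(1), of "i + 2" j] by (simp add: algebra_simps)
  finally have Nab: "KN a = Kd b" .
  \<comment> \<open>The preimage of \<open>b\<close> under \<open>N\<close>. A nonzero component of
    \<open>b\<close> has first degree \<open>i + 1\<close> and third index at least
    \<open>i + 1\<close>; after the shift the third index is still at least \<open>i\<close>, hence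
    nonnegative, and the target is not truncated.\<close>
  define c where "c = (\<lambda>(i, j, k). cscale tpi (b (i + 2, j, k + 1)))"
  have c: "c (i', j', k) = cscale tpi (b (i' + 2, j', k + 1))" for i' j' k by (simp add: c_def)
  have c_ok: "K_ok i' j' k \<and> i' = i - 1 \<and> j' = j - 1" if nz: "c (i', j', k) \<noteq> 0" for i' j' k
  proof -
    have "b (i' + 2, j', k + 1) \<noteq> 0" using nz by (auto simp: c cscale_0)
    moreover from this have "i' = i - 1" "j' = j - 1" by (auto simp: b_def comp_apply split: if_splits)
    moreover have "K_ok (i' + 2) j' (k + 1)" by (rule KtotD(2)[OF bK]) fact
    ultimately show ?thesis using i by (auto simp: K_ok_def)
  qed
  have cK: "c \<in> Ktot A"
  proof (rule KtotI)
    have "{t. c t \<noteq> 0} \<subseteq> (\<lambda>(i, j, k). (i - 2, j, k - 1)) ` {t. b t \<noteq> 0}"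
    proof
      fix t assume t: "t \<in> {t. c t \<noteq> 0}"
      obtain i' j' k where ijk: "t = (i', j', k)" using prod_cases3 by blast
      have "b (i' + 2, j', k + 1) \<noteq> 0" using t by (auto simp: ijk c cscale_0)
      then show "t \<in> (\<lambda>(i, j, k). (i - 2, j, k - 1)) ` {t. b t \<noteq> 0}"
        by (intro image_eqI[of _ _ "(i' + 2, j', k + 1)"]) (auto simp: ijk)
    qed
    then show "finite {t. c t \<noteq> 0}" using KtotD(3)[OF bK] by (metis finite_imageI finite_subset)
    show "K_form i' j' (c (i', j', k))" if ok: "K_ok i' j' k" for i' j' k
    proof -
      have K: "K_form (i' + 2) j' (b (i' + 2, j', k + 1))" by (rule KtotD(1)[OF bK])
      have tw: "twist (i' + 2) j' = - twist i' j'" using ok by (intro twist_shift) (simp add: K_ok_def)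
      show ?thesis
        using K unfolding K_form_def c
        by (simp add: cscale_form graded_cscale form_cnj_cscale cscale_cscale tw cnj_tpi mult.commute)
    qed
    show "K_ok i' j' k" if "c (i', j', k) \<noteq> 0" for i' j' k using c_ok[OF that] by blast
  qed
  have Nc: "KN c = b"
  proof
    fix t :: "int \<times> int \<times> int"
    obtain i' j' k where t: "t = (i', j', k)" using prod_cases3 by blast
    show "KN c t = b t"
      using KtotD(2)[OF bK, of i' j' k] tpi_nonzero
      by (cases "b (i', j', k) = 0") (auto simp: t KN_eq[OF cK] c cscale_cscale cscale_0 cscale_1)
  qed
  have c_j: "j' \<le> -1" if "c (i', j', k) \<noteq> 0" for i' j' k using c_ok[OF that] j by simp
  have dcK: "Kd c \<in> Ktot A" by (rule Kd_Ktot[OF cK c_j])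
  define a' where "a' = a - Kd c"
  have "Kd (Kd c) = 0" by (rule Kd_Kd[OF cK c_j])
  then have dc: "Kd c \<in> cocycles A" using dcK by (simp add: cocycles_def)
  have a'c: "a' \<in> cocycles A" unfolding a'_def by (rule cocycle_diff[OF a(1) dc])
  have "KN (- 1 *\<^sub>R Kd c) = - 1 *\<^sub>R KN (Kd c)" by (rule KN_scaleR[OF dcK])
  moreover have "- 1 *\<^sub>R Kd c \<in> Ktot A" by (rule subspace_scale[OF subspace_Ktot dcK])
  ultimately have "KN (a + - 1 *\<^sub>R Kd c) = KN a + - 1 *\<^sub>R KN (Kd c)" using KN_add[OF aK] by metis
  then have Na': "KN a' = 0" by (simp add: a'_def KN_Kd[OF cK] Nc Nab)
  have "comp (i, j) (Kd c) t = Kd c t" for t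
  proof -
    obtain i' j' k where t: "t = (i', j', k)" using prod_cases3 by blast
    have "c (i' - 1, j' - 1, l) = 0" if "(i', j') \<noteq> (i, j)" for l
      using c_ok[of "i' - 1" "j' - 1" l] that by auto
    then show ?thesis
      by (cases "(i', j') = (i, j)") (auto simp: t comp_apply Kd_eq[OF cK] d_0)
  qed
  then have "comp (i, j) (Kd c) = Kd c" by blast
  then have "Kd c \<in> K2 A i j" using comp_K2[OF dcK] by metis
  then have a'2: "a' \<in> K2 A i j"
    using a(2) cocycles_Ktot[OF a'c] by (auto simp: K2_def a'_def)
  define \<eta> where "\<eta> = a' (i, j, i)"
  have a'_eq: "a' = single i j i \<eta>" unfolding \<eta>_def by (rule KN_zero_single[OF a'2 Na' i])
  have K: "K_form i j \<eta>" and ok: "\<eta> \<noteq> 0 \<longrightarrow> K_ok i j i"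
    using KtotD(1,2)[OF cocycles_Ktot[OF a'c]] by (auto simp: \<eta>_def)
  have d: "d1 \<eta> = 0"
  proof (cases "\<eta> = 0")
    case False
    then have "K_ok i j i" using ok by blast
    then have "Kd a' (i + 1, j + 1, i + 1) = d1 \<eta>"
      using Kd_single[OF _ K i] a'_eq by (simp add: single_def[of "i + 1"])
    then show ?thesis using cocycles_Kd[OF a'c] by simp
  qed (simp add: d_0)
  have "cls (Kd c) = 0" using cls_eq_0[OF dc] cK by blast
  then have "x = cls a'" using a(3) cls_diff[OF a(1) dc] by (simp add: a'_def)
  then show ?thesis using K ok d a'c unfolding a'_eq by blast
qed

text \<open>Once the factor \<open>tpi powi n\<close> is split off, representatives run through a
  space \<open>Z\<close> of closed real forms that depends on \<open>j\<close> alone. This makes the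
  bound uniform in \<open>i\<close>.\<close>

lemma kernel_finite_nonneg:
  assumes compact: "compact_space X"
  shows "\<exists>D. \<forall>i j. i \<ge> 0 \<longrightarrow> j \<le> 0 \<longrightarrow>
    (\<exists>S. finite S \<and> card S \<le> D \<and> {x. HN A cls x = 0 \<and> pr (i, j) x = x} \<subseteq> span S)"
proof -
  obtain I :: "('x \<times> 'x \<times> 'x) set" and lam where I: "finite I"
    and lam_add: "\<forall>i\<in>I. \<forall>\<eta>\<in>closed_forms. \<forall>\<theta>\<in>closed_forms. lam i (\<eta> + \<theta>) = lam i \<eta> + (lam i \<theta> :: real)"
    and lam_scale: "\<forall>i\<in>I. \<forall>\<eta>\<in>closed_forms. \<forall>r. lam i (r *\<^sub>R \<eta>) = r * lam i \<eta>"
    and exact: "\<forall>\<eta>\<in>closed_forms. (\<forall>i\<in>I. lam i \<eta> = 0) \<longrightarrow> (\<exists>f. is_function f \<and> form_cnj f = f \<and> d1 f = \<eta>)"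
    using de_Rham_finite[OF compact] by (elim exE conjE) (rule that)
  have "topspace X \<noteq> {}" using riemann by (simp add: riemann_surface_def)
  then obtain x0 c0 where c0: "c0 \<in> A" "x0 \<in> fst c0" using covers by blast
  \<comment> \<open>The \<open>1\<close> accounts for constant functions in degree
    \<open>j = -1\<close>, and \<open>card I\<close> for classes of closed 1-forms in degree
    \<open>j = 0\<close>.\<close>
  have main: "\<exists>S. finite S \<and> card S \<le> max 1 (card I) \<and> {x. HN A cls x = 0 \<and> pr (i, j) x = x} \<subseteq> span S"
    if i: "i \<ge> 0" and j: "j \<le> 0" for i j
  proof (cases "K_ok i j i \<and> j \<ge> -1")
    case False
    have "x = 0" if Nx: "HN A cls x = 0" and px: "pr (i, j) x = x" for x
    proof -
      obtain \<eta> where \<eta>: "K_form i j \<eta>" "\<eta> \<noteq> 0 \<longrightarrow> K_ok i j i" "x = cls (single i j i \<eta>)"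
        using kernel_representative[OF px Nx i j] by blast
      have "\<eta> = 0" using \<eta>(1,2) False graded_zero[of j \<eta>] by (auto simp: K_form_def)
      then have "single i j i \<eta> = 0" by (simp add: single_def fun_eq_iff)
      then show ?thesis using \<eta>(3) cls_0 by simp
    qed
    then have "{x. HN A cls x = 0 \<and> pr (i, j) x = x} \<subseteq> span {}" by auto
    then show ?thesis by (intro exI[of _ "{}"]) simp
  next
    case True
    then have ok: "K_ok i j i" and j': "j = -1 \<or> j = 0" using j by auto
    define n where "n = (1 + j - i) div 2"
    define Z where "Z = {\<theta> \<in> forms A. graded j \<theta> \<and> form_cnj \<theta> = \<theta> \<and> d1 \<theta> = 0}"
    define E where "E \<theta> = cls (single i j i (cscale (tpi powi n) \<theta>))" for \<theta>
    have nz: "tpi powi n \<noteq> 0" using tpi_nonzero by simp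
    have tw: "cnj tpi powi n = twist i j * tpi powi n" unfolding n_def by (rule cnj_tpi_powi)
    have subZ: "subspace Z"
      unfolding subspace_def Z_def
      by (auto simp: zero_form add_form graded_0 graded_add form_cnj_0 form_cnj_add d_0 d_add scaleR_eq_cscale
          cscale_form graded_cscale form_cnj_cscale d_cscale cscale_0)
    have KZ: "K_form i j (cscale (tpi powi n) \<theta>)" if "form_cnj \<theta> = \<theta>" "\<theta> \<in> forms A" "graded j \<theta>" for \<theta>
      using that by (simp add: K_form_def cscale_form graded_cscale form_cnj_cscale tw cscale_cscale)
    have cocycle: "single i j i (cscale (tpi powi n) \<theta>) \<in> cocycles A" if \<theta>: "\<theta> \<in> Z" for \<theta>
    proof -
      have K: "K_form i j (cscale (tpi powi n) \<theta>)" using \<theta> by (intro KZ) (auto simp: Z_def)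
      have "d1 (cscale (tpi powi n) \<theta>) = 0" using \<theta> by (simp add: Z_def d_cscale cscale_0)
      then have "Kd (single i j i (cscale (tpi powi n) \<theta>)) = 0"
        unfolding Kd_single[OF ok K i] by (simp add: single_def fun_eq_iff)
      then show ?thesis using single_Ktot[OF ok K] by (simp add: cocycles_def)
    qed
    have E_add: "E (\<theta> + \<theta>') = E \<theta> + E \<theta>'" if "\<theta> \<in> Z" "\<theta>' \<in> Z" for \<theta> \<theta>'
      unfolding E_def cscale_add single_add by (rule cls_add[OF cocycle cocycle]) (use that in auto)
    have E_scale: "E (r *\<^sub>R \<theta>) = r *\<^sub>R E \<theta>" if "\<theta> \<in> Z" for \<theta> r
    proof -
      have "cscale (tpi powi n) (r *\<^sub>R \<theta>) = r *\<^sub>R cscale (tpi powi n) \<theta>"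
        by (simp add: scaleR_eq_cscale cscale_cscale mult.commute)
      then show ?thesis using cls_scale[OF cocycle[OF that]] by (simp add: E_def single_scaleR)
    qed
    have "{x. HN A cls x = 0 \<and> pr (i, j) x = x} \<subseteq> E ` Z"
    proof
      fix x assume x: "x \<in> {x. HN A cls x = 0 \<and> pr (i, j) x = x}"
      then obtain \<eta> where \<eta>: "K_form i j \<eta>" "d1 \<eta> = 0" "x = cls (single i j i \<eta>)"
        using kernel_representative[of i j x] i j by blast
      define \<theta> where "\<theta> = cscale (inverse (tpi powi n)) \<eta>"
      have "\<eta> = cscale (tpi powi n) \<theta>" using nz by (simp add: \<theta>_def cscale_cscale cscale_1)
      then have "x = E \<theta>" using \<eta>(3) by (simp add: E_def)
      moreover have "twist i j \<noteq> 0" by (simp add: twist_def)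
      then have "form_cnj \<theta> = \<theta>"
        using \<eta>(1) nz tw by (simp add: \<theta>_def form_cnj_cscale K_form_def cscale_cscale field_simps)
      then have "\<theta> \<in> Z" using \<eta> by (simp add: Z_def \<theta>_def K_form_def cscale_form graded_cscale d_cscale cscale_0)
      ultimately show "x \<in> E ` Z" by blast
    qed
    moreover have "\<exists>S. finite S \<and> card S \<le> max 1 (card I) \<and> E ` Z \<subseteq> span S"
    proof (cases "j = 0")
      case True
      have Zc: "Z = closed_forms" by (simp add: Z_def closed_forms_def True)
      have "\<exists>S. finite S \<and> card S \<le> card I \<and> E ` Z \<subseteq> span S"
      proof (rule finite_rank_image[OF I subZ])
        show "lam k (x + y) = lam k x + lam k y" if "k \<in> I" "x \<in> Z" "y \<in> Z" for k x y
          using lam_add that unfolding Zc by blast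
        show "lam k (r *\<^sub>R x) = r * lam k x" if "k \<in> I" "x \<in> Z" for k x r
          using lam_scale that unfolding Zc by blast
        show "E (x + y) = E x + E y" if "x \<in> Z" "y \<in> Z" for x y by (rule E_add[OF that])
        show "E (r *\<^sub>R x) = r *\<^sub>R E x" if "x \<in> Z" for x r by (rule E_scale[OF that])
        fix \<theta> assume \<theta>: "\<theta> \<in> Z" and zero: "\<And>k. k \<in> I \<Longrightarrow> lam k \<theta> = 0"
        obtain f where f: "is_function f" "form_cnj f = f" "d1 f = \<theta>"
          using exact \<theta> zero unfolding Zc by blast
        have fz: "f a b = 0" if "(a, b) \<noteq> (0, 0)" for a b using f(1) that unfolding is_function_def by blast
        have f': "f \<in> forms A" using f(1) by (simp add: is_function_def)
        moreover have "graded (-1) f" unfolding graded_def by (intro allI impI fz) auto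
        ultimately have f': "f \<in> forms A" "graded (-1) f" by auto
        have "odd i" using ok True by (simp add: K_ok_def)
        \<comment> \<open>For \<open>j = 0\<close> the number \<open>i\<close> is odd, hence
          positive. A primitive then sits at the lowest position of degree
          \<open>(i - 1, -1)\<close>, where \<open>Kd_single\<close> applies.\<close>
        then have i1: "i - 1 \<ge> 0" using i by (cases "i = 0") auto
        have ok': "K_ok (i - 1) (-1) (i - 1)" using \<open>odd i\<close> i1 by (simp add: K_ok_def)
        have "1 + - 1 - (i - 1) = 1 + j - i" using True by simp
        then have tw': "twist (i - 1) (-1) = twist i j" by (simp only: twist_def)
        have K: "K_form (i - 1) (-1) (cscale (tpi powi n) f)"
          using f' f(2) by (simp add: K_form_def cscale_form graded_cscale form_cnj_cscale tw tw' cscale_cscale)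
        have "Kd (single (i - 1) (-1) (i - 1) (cscale (tpi powi n) f)) = single i j i (cscale (tpi powi n) \<theta>)"
          unfolding Kd_single[OF ok' K i1] using True by (simp add: d_cscale[OF f'(1)] f(3))
        then have "single i j i (cscale (tpi powi n) \<theta>) \<in> Kd ` Ktot A" using single_Ktot[OF ok' K] by (metis image_eqI)
        then show "E \<theta> = 0" using cls_eq_0[OF cocycle[OF \<theta>]] by (simp add: E_def)
      qed
      then obtain S where "finite S" "card S \<le> card I" "E ` Z \<subseteq> span S" by blast
      then show ?thesis by (intro exI[of _ S]) auto
    next
      case False
      then have jm: "j = -1" using j' by simp
      have "\<exists>S. finite S \<and> card S \<le> card {x0} \<and> E ` Z \<subseteq> span S"
      proof (rule finite_rank_image[where lam = "\<lambda>_ \<theta>. Re (\<theta> 0 0 c0 x0)", OF _ subZ])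
        show "E (x + y) = E x + E y" if "x \<in> Z" "y \<in> Z" for x y by (rule E_add[OF that])
        show "E (r *\<^sub>R x) = r *\<^sub>R E x" if "x \<in> Z" for x r by (rule E_scale[OF that])
        show "Re ((r *\<^sub>R \<theta>) 0 0 c0 x0) = r * Re (\<theta> 0 0 c0 x0)" for r and \<theta> :: "'x form"
          by (simp add: scaleR_eq_cscale cscale_def)
        fix \<theta> assume \<theta>: "\<theta> \<in> Z" and zero: "\<And>k. k \<in> {x0} \<Longrightarrow> Re (\<theta> 0 0 c0 x0) = 0"
        have Z: "\<theta> \<in> forms A" "graded (-1) \<theta>" "d1 \<theta> = 0" "form_cnj \<theta> = \<theta>" using \<theta> jm by (auto simp: Z_def)
        have "form_cnj \<theta> 0 0 c0 x0 = \<theta> 0 0 c0 x0" by (simp add: Z(4))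
        then have "cnj (\<theta> 0 0 c0 x0) = \<theta> 0 0 c0 x0" by (simp add: form_cnj_def)
        then have z0: "\<theta> 0 0 c0 x0 = 0" using zero by (simp add: complex_eq_iff)
        have "\<theta> a b c x = 0" for a b c x
        proof (cases "a = 0 \<and> b = 0 \<and> c \<in> A \<and> x \<in> fst c")
          case True
          then show ?thesis using closed_function_constant[OF Z(1-3) c0, of c x] z0 by simp
        next
          case False
          then show ?thesis using form_zero[OF Z(1)] Z(2) unfolding graded_def by (cases "a = 0 \<and> b = 0") auto
        qed
        then have "\<theta> = 0" by (simp add: fun_eq_iff)
        then have "single i j i (cscale (tpi powi n) \<theta>) = 0" by (intro ext) (simp add: single_def cscale_0)
        then show "E \<theta> = 0" by (simp add: E_def cls_0)
      qed auto
      then obtain S where "finite S" "card S \<le> card {x0}" "E ` Z \<subseteq> span S" by blast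
      then show ?thesis by (intro exI[of _ S]) auto
    qed
    ultimately show ?thesis by (elim exE conjE) (intro exI conjI, assumption+, rule order_trans)
  qed
  then show ?thesis by blast
qed

text \<open>\<open>B.w\<close> commutes with \<open>N\<close> and exchanges \<open>j\<close> with
  \<open>- j\<close>, which reduces positive \<open>j\<close> to negative \<open>j\<close>; for
  negative \<open>i\<close> there are no nonzero kernel elements.\<close>

lemma kernel_finite:
  assumes "compact_space X"
  shows "\<exists>D. \<forall>i j. \<exists>S. finite S \<and> card S \<le> D \<and> {x. HN A cls x = 0 \<and> pr (i, j) x = x} \<subseteq> span S"
proof -
  obtain D where D: "\<And>i j. i \<ge> 0 \<Longrightarrow> j \<le> 0 \<Longrightarrow>
      \<exists>S. finite S \<and> card S \<le> D \<and> {x. HN A cls x = 0 \<and> pr (i, j) x = x} \<subseteq> span S"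
    using kernel_finite_nonneg[OF assms] by blast
  have "\<exists>S. finite S \<and> card S \<le> D \<and> {x. HN A cls x = 0 \<and> pr (i, j) x = x} \<subseteq> span S" for i j
  proof (cases "i \<ge> 0")
    case False
    have "x = 0" if "HN A cls x = 0" "pr (i, j) x = x" for x
      using L.ker_pr_negative[of x i j] that False by simp
    then have "{x. HN A cls x = 0 \<and> pr (i, j) x = x} \<subseteq> span {}" by auto
    then show ?thesis by (intro exI[of _ "{}"]) simp
  next
    case i: True
    show ?thesis
    proof (cases "j \<le> 0")
      case True
      then show ?thesis using D[OF i] by blast
    next
      case False
      obtain S where S: "finite S" "card S \<le> D" "{x. HN A cls x = 0 \<and> pr (i, - j) x = x} \<subseteq> span S"
        using D[OF i, of "- j"] False by auto
      have "x \<in> span (L.B.w ` S)" if x: "HN A cls x = 0" "pr (i, j) x = x" for x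
      proof -
        define y where "y = L.B.w (L.B.w (L.B.w x))"
        have "HN A cls y = 0" "pr (i, - j) y = y"
          using x by (simp_all add: y_def L.N_w2 L.pr_w2 linear_0[OF L.B.linear_w])
        then have "y \<in> span S" using S(3) by blast
        moreover have "x = L.B.w y" by (simp add: y_def L.B.w_w_w_w)
        ultimately show ?thesis using linear_span_image[OF L.B.linear_w, of S] by blast
      qed
      then have "{x. HN A cls x = 0 \<and> pr (i, j) x = x} \<subseteq> span (L.B.w ` S)" by blast
      then show ?thesis using S(1,2) card_image_le[of S L.B.w] by (intro exI[of _ "L.B.w ` S"]) auto
    qed
  qed
  then show ?thesis by blast
qed

end


section \<open>The cohomology of the cone\<close>

lemma (in orthogonal_grading) orthogonal_coarsen:
  fixes f :: "'i \<Rightarrow> 'k"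
  shows "orthogonal_grading (coarsen f) ip"
proof (intro orthogonal_grading.intro orthogonal_grading_axioms.intro)
  show "grading (coarsen f)" by (rule coarsen_grading)
  show "inner_product_on ip" by (rule ip)
  fix k k' x y assume "k \<noteq> (k' :: 'k)"
  then have "coarsen f k (coarsen f k' y) = 0" using grading.pr_pr[OF coarsen_grading[of f]] by simp
  moreover have "ip (coarsen f k x) (coarsen f k' y) = ip x (coarsen f k (coarsen f k' y))"
    unfolding coarsen_def by (rule ip_dmap)
  ultimately show "ip (coarsen f k x) (coarsen f k' y) = 0" by (simp add: ip_simps)
qed

section \<open>The exact sequence of the mapping cone\<close>

locale cone_module = surface_module X A \<omega> cls \<sigma> \<psi>
  for X :: "'x topology" and A and \<omega> :: "'x form" and cls :: "'x kfam \<Rightarrow> 'v::real_vector" and \<sigma> \<psi> +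
  fixes ccls :: "'x kfam \<times> 'x kfam \<Rightarrow> 'u::real_vector"
  assumes cone: "cone_cohomology A ccls"
begin

abbreviation "N \<equiv> HN A cls"
abbreviation "ip \<equiv> polarization_ip \<psi> \<sigma>"

lemma cone_cocycle_iff: "(a, b) \<in> cone_cocycles A \<longleftrightarrow> a \<in> cocycles A \<and> b \<in> Ktot A \<and> KN a + Kd b = 0"
  by (auto simp: cone_cocycles_def cone_D_def cocycles_def zero_prod_def)

lemma cone_quotient: "quotient_by (cone_cocycles A) (cone_D ` (Ktot A \<times> Ktot A)) ccls"
  using cone by (simp add: cone_cohomology_def)

lemmas ccls_add = quotient_byD(1)[OF cone_quotient]
  and ccls_scale = quotient_byD(2)[OF cone_quotient]
  and ccls_surj = quotient_byD(3)[OF cone_quotient]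
  and ccls_eq_0 = quotient_byD(4)[OF cone_quotient]

lemma subspace_cone_cocycles: "subspace (cone_cocycles A)"
proof (rule subspaceI)
  show "0 \<in> cone_cocycles A"
    using subspace_0[OF subspace_Ktot] subspace_0[OF subspace_cocycles]
    by (simp add: zero_prod_def cone_cocycle_iff KN_0 Kd_0)
  show "x + y \<in> cone_cocycles A" if "x \<in> cone_cocycles A" "y \<in> cone_cocycles A" for x y
  proof -
    obtain a b a' b' where xy: "x = (a, b)" "y = (a', b')" by fastforce
    have "a \<in> cocycles A" "b \<in> Ktot A" "KN a + Kd b = 0" "a' \<in> cocycles A" "b' \<in> Ktot A" "KN a' + Kd b' = 0"
      using that by (auto simp: xy cone_cocycle_iff)
    moreover from this have "KN (a + a') + Kd (b + b') = (KN a + Kd b) + (KN a' + Kd b')"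
      using KN_add[of a a'] Kd_add[of b b'] cocycles_Ktot by (simp add: algebra_simps)
    ultimately show ?thesis
      using subspace_add[OF subspace_cocycles] subspace_add[OF subspace_Ktot] by (simp add: xy cone_cocycle_iff)
  qed
  show "r *\<^sub>R x \<in> cone_cocycles A" if "x \<in> cone_cocycles A" for r x
  proof -
    obtain a b where x: "x = (a, b)" by fastforce
    have ab: "a \<in> cocycles A" "b \<in> Ktot A" "KN a + Kd b = 0" using that by (auto simp: x cone_cocycle_iff)
    have "KN (r *\<^sub>R a) + Kd (r *\<^sub>R b) = r *\<^sub>R (KN a + Kd b)"
      using KN_scaleR[OF cocycles_Ktot[OF ab(1)]] Kd_scaleR[OF ab(2)] by (simp only: scaleR_add_right)
    then show ?thesis
      using ab subspace_scale[OF subspace_cocycles] subspace_scale[OF subspace_Ktot] by (simp add: x cone_cocycle_iff)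
  qed
qed

lemma ccls_0: "ccls 0 = 0"
  using ccls_scale[OF subspace_0[OF subspace_cone_cocycles], of 0] by (simp only: scaleR_zero_left)

lemma ccls_00: "ccls (0, 0) = 0"
  using ccls_0 by (simp add: zero_prod_def)

abbreviation "T \<equiv> to_ker A cls ccls"
abbreviation "\<kappa> \<equiv> from_coker A cls ccls"

lemma T_ccls: "(a, b) \<in> cone_cocycles A \<Longrightarrow> T (ccls (a, b)) = cls a" and linear_T: "linear T"
proof -
  have fst: "fst z \<in> cocycles A" if "z \<in> cone_cocycles A" for z
    using that cone_cocycle_iff[of "fst z" "snd z"] by simp
  have zero: "cls (fst z) = 0" if z: "z \<in> cone_cocycles A" "z \<in> cone_D ` (Ktot A \<times> Ktot A)" for z
  proof -
    obtain y where y: "y \<in> Ktot A" "fst z = - Kd y" using z(2) by (auto simp: cone_D_def)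
    have "fst z = Kd (-1 *\<^sub>R y)" using Kd_scaleR[OF y(1), of "-1"] y(2) by simp
    then have "fst z \<in> Kd ` Ktot A" using subspace_scale[OF subspace_Ktot y(1)] by blast
    then show ?thesis using cls_eq_0[OF fst[OF z(1)]] by blast
  qed
  have a: "cls (fst (x + y)) = cls (fst x) + cls (fst y)" if "x \<in> cone_cocycles A" "y \<in> cone_cocycles A" for x y
    using cls_add[OF fst fst] that by simp
  have s: "cls (fst (r *\<^sub>R x)) = r *\<^sub>R cls (fst x)" if "x \<in> cone_cocycles A" for r x
    using cls_scale[OF fst[OF that]] by simp
  note q = quotient_by_induced[OF cone_quotient subspace_cone_cocycles, of "\<lambda>z. cls (fst z)", OF a s zero]
  show "linear T" unfolding to_ker_def by (rule q(2))
  show "(a, b) \<in> cone_cocycles A \<Longrightarrow> T (ccls (a, b)) = cls a" unfolding to_ker_def using q(1)[of "(a, b)"] by simp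
qed

lemma zero_cone_cocycle: "b \<in> cocycles A \<Longrightarrow> (0, b) \<in> cone_cocycles A"
  using subspace_0[OF subspace_cocycles] by (simp add: cone_cocycle_iff KN_0 cocycles_def)

lemma \<kappa>_cls: "b \<in> cocycles A \<Longrightarrow> \<kappa> (cls b) = ccls (0, b)" and linear_\<kappa>: "linear \<kappa>"
proof -
  have zero: "ccls (0, b) = 0" if b: "b \<in> cocycles A" "b \<in> Kd ` Ktot A" for b
  proof -
    obtain y where y: "y \<in> Ktot A" "b = Kd y" using b(2) by blast
    have "(0, b) = cone_D (0, y)" by (simp add: cone_D_def KN_0 Kd_0 y(2))
    then have "(0, b) \<in> cone_D ` (Ktot A \<times> Ktot A)" using y(1) subspace_0[OF subspace_Ktot] by blast
    then show ?thesis using ccls_eq_0[OF zero_cone_cocycle[OF b(1)]] by blast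
  qed
  have a: "ccls (0, x + y) = ccls (0, x) + ccls (0, y)" if "x \<in> cocycles A" "y \<in> cocycles A" for x y
    using ccls_add[OF zero_cone_cocycle[OF that(1)] zero_cone_cocycle[OF that(2)]] by simp
  have s: "ccls (0, r *\<^sub>R x) = r *\<^sub>R ccls (0, x)" if "x \<in> cocycles A" for r x
    using ccls_scale[OF zero_cone_cocycle[OF that], of r] by simp
  note q = quotient_by_induced[OF quotient subspace_cocycles, of "\<lambda>b. ccls (0, b)", OF a s zero]
  show "linear \<kappa>" unfolding from_coker_def by (rule q(2))
  show "b \<in> cocycles A \<Longrightarrow> \<kappa> (cls b) = ccls (0, b)" unfolding from_coker_def by (rule q(1))
qed

lemma cone_cases: obtains a b where "a \<in> cocycles A" "b \<in> Ktot A" "KN a + Kd b = 0" "u = ccls (a, b)"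
proof -
  obtain z where z: "z \<in> cone_cocycles A" "ccls z = u" using ccls_surj by blast
  obtain a b where "z = (a, b)" by fastforce
  then show ?thesis using that[of a b] z cone_cocycle_iff by blast
qed

text \<open>This lemma and those up to \<open>\<kappa>_eq_0\<close> are the exactness statements for
  \<open>N\<close>, \<open>\<kappa>\<close> and \<open>T\<close>: the cohomology of the cone is an
  extension of \<open>ker N\<close> by \<open>coker N\<close>.\<close>

lemma N_T: "N (T u) = 0"
proof -
  obtain a b where u: "a \<in> cocycles A" "b \<in> Ktot A" "KN a + Kd b = 0" "u = ccls (a, b)" by (rule cone_cases)
  have "KN a = - Kd b" using u(3) by (simp add: eq_neg_iff_add_eq_0)
  then have "KN a = Kd (-1 *\<^sub>R b)" using Kd_scaleR[OF u(2), of "-1"] by simp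
  then have "KN a \<in> Kd ` Ktot A" using subspace_scale[OF subspace_Ktot u(2)] by blast
  then show ?thesis using cls_eq_0[OF KN_cocycles[OF u(1)]] u T_ccls cone_cocycle_iff by (simp add: HN_cls)
qed

lemma T_surj: assumes "N x = 0" shows "\<exists>u. T u = x"
proof -
  obtain a where a: "a \<in> cocycles A" "cls a = x" using cls_surj by blast
  then have "cls (KN a) = 0" using assms HN_cls by metis
  then obtain y where y: "y \<in> Ktot A" "KN a = Kd y" using cls_eq_0[OF KN_cocycles[OF a(1)]] by blast
  have "KN a + Kd (-1 *\<^sub>R y) = 0" using Kd_scaleR[OF y(1), of "-1"] y(2) by simp
  then have "(a, -1 *\<^sub>R y) \<in> cone_cocycles A"
    using a(1) subspace_scale[OF subspace_Ktot y(1)] cone_cocycle_iff by blast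
  then show ?thesis using T_ccls a(2) by blast
qed

lemma T_\<kappa>: "T (\<kappa> y) = 0"
proof -
  obtain b where "b \<in> cocycles A" "cls b = y" using cls_surj by blast
  then show ?thesis using T_ccls[OF zero_cone_cocycle] \<kappa>_cls cls_0 by metis
qed

lemma T_eq_0: assumes "T u = 0" shows "\<exists>y. u = \<kappa> y"
proof -
  obtain a b where u: "a \<in> cocycles A" "b \<in> Ktot A" "KN a + Kd b = 0" "u = ccls (a, b)" by (rule cone_cases)
  have z: "(a, b) \<in> cone_cocycles A" using u cone_cocycle_iff by blast
  have "cls a = 0" using assms T_ccls[OF z] u(4) by simp
  then obtain y where y: "y \<in> Ktot A" "a = Kd y" using cls_eq_0[OF u(1)] by blast
  \<comment> \<open>Adding the coboundary \<open>cone_D (y, 0)\<close> removes the first component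
    of \<open>(a, b)\<close>.\<close>
  define b' where "b' = b + KN y"
  have b'K: "b' \<in> Ktot A" unfolding b'_def by (rule subspace_add[OF subspace_Ktot u(2) KN_Ktot[OF y(1)]])
  have "Kd b' = Kd b + KN a" unfolding b'_def Kd_add[OF u(2) KN_Ktot[OF y(1)]] y(2) KN_Kd[OF y(1)] ..
  then have b': "b' \<in> cocycles A" using u(3) b'K by (simp add: cocycles_def add.commute)
  have D: "cone_D (y, 0) = (- a, KN y)" by (simp add: cone_D_def y(2) Kd_0)
  have eq: "(0, b') = (a, b) + cone_D (y, 0)" unfolding D b'_def by simp
  then have "cone_D (y, 0) = (0, b') + (-1) *\<^sub>R (a, b)" by (simp add: zero_prod_def algebra_simps)
  then have c: "cone_D (y, 0) \<in> cone_cocycles A"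
    using subspace_add[OF subspace_cone_cocycles zero_cone_cocycle[OF b'] subspace_scale[OF subspace_cone_cocycles z]] by metis
  have "cone_D (y, 0) \<in> cone_D ` (Ktot A \<times> Ktot A)" using y(1) subspace_0[OF subspace_Ktot] by blast
  then have "ccls (cone_D (y, 0)) = 0" using ccls_eq_0[OF c] by blast
  then have "u = ccls (0, b')" unfolding eq ccls_add[OF z c] using u(4) by simp
  then show ?thesis using \<kappa>_cls[OF b'] by metis
qed

lemma \<kappa>_N: "\<kappa> (N z) = 0"
proof -
  obtain a where a: "a \<in> cocycles A" "cls a = z" using cls_surj by blast
  have "(0, KN a) = cone_D (a, 0)" by (simp add: cone_D_def cocycles_Kd[OF a(1)] Kd_0)
  then have "(0, KN a) \<in> cone_D ` (Ktot A \<times> Ktot A)"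
    using cocycles_Ktot[OF a(1)] subspace_0[OF subspace_Ktot] by blast
  then have "ccls (0, KN a) = 0" using ccls_eq_0[OF zero_cone_cocycle[OF KN_cocycles[OF a(1)]]] by blast
  then show ?thesis using HN_cls[OF a(1)] \<kappa>_cls[OF KN_cocycles[OF a(1)]] a(2) by simp
qed

lemma \<kappa>_eq_0: assumes "\<kappa> y = 0" shows "\<exists>z. y = N z"
proof -
  obtain b where b: "b \<in> cocycles A" "cls b = y" using cls_surj by blast
  then have "ccls (0, b) = 0" using assms \<kappa>_cls by metis
  then obtain a c where ac: "a \<in> Ktot A" "c \<in> Ktot A" "(0, b) = cone_D (a, c)"
    using ccls_eq_0[OF zero_cone_cocycle[OF b(1)]] by blast
  then have a: "a \<in> cocycles A" and bc: "b = KN a + Kd c" by (simp_all add: cone_D_def cocycles_def)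
  have "Kd c = b - KN a" using bc by simp
  then have c: "Kd c \<in> cocycles A" using cocycle_diff[OF b(1) KN_cocycles[OF a]] by simp
  have "cls (Kd c) = 0" using cls_eq_0[OF c] ac(2) by blast
  then have "y = N (cls a)" using b(2) cls_add[OF KN_cocycles[OF a] c] HN_cls[OF a] by (simp add: bc)
  then show ?thesis by blast
qed

section \<open>The bigrading on the cohomology of the cone\<close>

text \<open>Indexed by the degree of the first component. The second component of a pair lives in
  the degree shifted by \<open>(1, -1)\<close>, as in the definition of \<open>grX\<close>.\<close>

definition pU :: "int \<times> int \<Rightarrow> 'u \<Rightarrow> 'u" where
  "pU p = induced (cone_cocycles A) ccls (\<lambda>z. ccls (comp p (fst z), comp (fst p + 1, snd p - 1) (snd z)))"

lemma comp_cone_cocycle: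
  assumes "(a, b) \<in> cone_cocycles A" shows "(comp (i, j) a, comp (i + 1, j - 1) b) \<in> cone_cocycles A"
proof -
  have ab: "a \<in> cocycles A" "b \<in> Ktot A" "KN a + Kd b = 0" using assms by (auto simp: cone_cocycle_iff)
  have "KN (comp (i, j) a) + Kd (comp (i + 1, j - 1) b) = comp (i + 2, j) (KN a + Kd b)"
    using comp_KN[OF cocycles_Ktot[OF ab(1)], of "i + 2" j] comp_Kd[OF ab(2), of "i + 2" j]
    by (simp add: comp_add algebra_simps)
  then show ?thesis using ab comp_cocycles comp_Ktot by (simp add: cone_cocycle_iff comp_0)
qed

lemma pU_ccls: "(a, b) \<in> cone_cocycles A \<Longrightarrow> pU (i, j) (ccls (a, b)) = ccls (comp (i, j) a, comp (i + 1, j - 1) b)"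
  and linear_pU: "linear (pU p)"
proof -
  define F where "F p z = (comp p (fst z), comp (fst p + 1, snd p - 1) (snd z))"
    for p and z :: "'x kfam \<times> 'x kfam"
  have F_add: "F p (x + y) = F p x + F p y" for p x y by (simp add: F_def comp_add)
  have F_scale: "F p (r *\<^sub>R x) = r *\<^sub>R F p x" for p r x by (simp add: F_def comp_scaleR)
  have Fc: "F p z \<in> cone_cocycles A" if "z \<in> cone_cocycles A" for p z
    using comp_cone_cocycle[of "fst z" "snd z" "fst p" "snd p"] that by (simp add: F_def)
  have zero: "ccls (F p z) = 0" if z: "z \<in> cone_cocycles A" "z \<in> cone_D ` (Ktot A \<times> Ktot A)" for p z
  proof -
    obtain a b where ab: "a \<in> Ktot A" "b \<in> Ktot A" "z = cone_D (a, b)" using z(2) by blast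
    obtain i j where p: "p = (i, j)" by fastforce
    have m: "comp q (- x) = - comp q x" for q x using comp_scaleR[of q "-1" x] by simp
    have "F p z = cone_D (comp (i - 1, j - 1) a, comp (i, j - 2) b)"
      using comp_Kd[OF ab(1), of i j] comp_KN[OF ab(1), of "i + 1" "j - 1"] comp_Kd[OF ab(2), of "i + 1" "j - 1"]
      by (simp add: F_def p ab(3) cone_D_def comp_add m)
    then have "F p z \<in> cone_D ` (Ktot A \<times> Ktot A)" using comp_Ktot[OF ab(1)] comp_Ktot[OF ab(2)] by blast
    then show ?thesis using ccls_eq_0[OF Fc[OF z(1)]] by blast
  qed
  have a: "ccls (F p (x + y)) = ccls (F p x) + ccls (F p y)" if "x \<in> cone_cocycles A" "y \<in> cone_cocycles A" for p x y
    unfolding F_add by (rule ccls_add[OF Fc[OF that(1)] Fc[OF that(2)]])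
  have s: "ccls (F p (r *\<^sub>R x)) = r *\<^sub>R ccls (F p x)" if "x \<in> cone_cocycles A" for p r x
    unfolding F_scale by (rule ccls_scale[OF Fc[OF that]])
  have pU: "pU p = induced (cone_cocycles A) ccls (\<lambda>z. ccls (F p z))" for p by (simp add: pU_def F_def)
  note q = quotient_by_induced[OF cone_quotient subspace_cone_cocycles, of "\<lambda>z. ccls (F p z)" for p, OF a s zero]
  show "linear (pU p)" unfolding pU by (rule q(2))
  show "(a, b) \<in> cone_cocycles A \<Longrightarrow> pU (i, j) (ccls (a, b)) = ccls (comp (i, j) a, comp (i + 1, j - 1) b)"
    unfolding pU using q(1)[of "(a, b)" "(i, j)"] by (simp add: F_def)
qed

lemma T_pU: "T (pU p u) = pr p (T u)"
proof -
  obtain a b where u: "a \<in> cocycles A" "b \<in> Ktot A" "KN a + Kd b = 0" "u = ccls (a, b)" by (rule cone_cases)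
  have z: "(a, b) \<in> cone_cocycles A" using u cone_cocycle_iff by blast
  obtain i j where p: "p = (i, j)" by fastforce
  show ?thesis using u z by (simp add: p pU_ccls T_ccls comp_cone_cocycle pr_cls)
qed

lemma pU_\<kappa>: "pU (i, j) (\<kappa> y) = \<kappa> (pr (i + 1, j - 1) y)"
proof -
  obtain b where b: "b \<in> cocycles A" "cls b = y" using cls_surj by blast
  then show ?thesis
    using pU_ccls[OF zero_cone_cocycle[OF b(1)]] pr_cls[OF b(1)] \<kappa>_cls[OF b(1)] \<kappa>_cls[OF comp_cocycles[OF b(1)]]
    by (simp add: comp_0 flip: b(2))
qed

lemma grading_pU: "grading pU"
proof (rule grading.intro)
  show "linear (pU p)" for p by (rule linear_pU)
  show "pU p (pU p' u) = (if p = p' then pU p u else 0)" for p p' u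
  proof -
    obtain a b where u: "a \<in> cocycles A" "b \<in> Ktot A" "KN a + Kd b = 0" "u = ccls (a, b)" by (rule cone_cases)
    have z: "(a, b) \<in> cone_cocycles A" using u cone_cocycle_iff by blast
    obtain i j i' j' where p: "p = (i, j)" "p' = (i', j')" by fastforce
    show ?thesis
      using z by (simp add: ccls_00 p u(4) pU_ccls comp_cone_cocycle comp_comp)
  qed
  have ex: "\<exists>I. finite I \<and> {p. pU p u \<noteq> 0} \<subseteq> I \<and> (\<Sum>p\<in>I. pU p u) = u" for u
  proof -
    obtain a b where u: "a \<in> cocycles A" "b \<in> Ktot A" "KN a + Kd b = 0" "u = ccls (a, b)" by (rule cone_cases)
    have z: "(a, b) \<in> cone_cocycles A" using u cone_cocycle_iff by blast
    \<comment> \<open>\<open>s\<close> leads from the degree of the first component to that of the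
      second; \<open>t\<close> undoes it, so that the supports of \<open>a\<close> and
      \<open>b\<close> are indexed alike.\<close>
    define s where "s = (\<lambda>(i, j). (i + 1, j - 1 :: int) :: int \<times> int)"
    define t where "t = (\<lambda>(i, j). (i - 1, j + 1 :: int) :: int \<times> int)"
    have ts: "t (s p) = p" "s (t p) = p" for p by (auto simp: s_def t_def split: prod.splits)
    define I where "I = support a \<union> t ` support b"
    have fin: "finite I" using finite_support[OF cocycles_Ktot[OF u(1)]] finite_support[OF u(2)] by (simp add: I_def)
    have pU: "pU p u = ccls (comp p a, comp (s p) b)" for p
      using pU_ccls[OF z, of "fst p" "snd p"] by (simp add: s_def u(4) case_prod_unfold)
    have "(\<Sum>p\<in>I. comp p a) = a" using fin supportI[of a] by (intro sum_comp) (auto simp: I_def)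
    moreover have "(\<Sum>p\<in>I. comp (s p) b) = b"
    proof -
      have "(\<Sum>p\<in>I. comp (s p) b) = (\<Sum>q\<in>s ` I. comp q b)"
        by (subst sum.reindex) (auto intro: inj_on_inverseI[of _ t] simp: ts)
      also have "\<dots> = b"
        using fin supportI[of b] by (intro sum_comp) (auto simp: I_def image_iff intro!: bexI[of _ "t _"] simp: ts)
      finally show ?thesis .
    qed
    moreover have "ccls (\<Sum>p\<in>J. (comp p a, comp (s p) b)) = (\<Sum>p\<in>J. ccls (comp p a, comp (s p) b)) \<and>
        (\<Sum>p\<in>J. (comp p a, comp (s p) b)) \<in> cone_cocycles A" if "finite J" for J
      using that
    proof (induction J)
      case empty
      show ?case using subspace_0[OF subspace_cone_cocycles] by (simp add: ccls_0)
    next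
      case (insert p J)
      have "(comp p a, comp (s p) b) \<in> cone_cocycles A"
        using comp_cone_cocycle[OF z, of "fst p" "snd p"] by (simp add: s_def case_prod_unfold)
      then show ?case
        using insert ccls_add subspace_add[OF subspace_cone_cocycles] by (simp only: sum.insert[OF insert.hyps])
    qed
    note this[OF fin]
    ultimately have "(\<Sum>p\<in>I. pU p u) = u"
      unfolding pU by (simp add: sum_prod flip: u(4))
    moreover have "{p. pU p u \<noteq> 0} \<subseteq> I"
    proof (rule subsetI, rule ccontr)
      fix p assume p: "p \<in> {p. pU p u \<noteq> 0}" "p \<notin> I"
      then have "p \<notin> support a" "s p \<notin> support b" using ts(1)[of p] by (auto simp: I_def image_iff)
      then have "pU p u = ccls 0" unfolding pU using comp_support by (simp add: zero_prod_def)
      also have "\<dots> = 0" by (rule ccls_0)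
      finally show False using p(1) by blast
    qed
    ultimately show ?thesis using fin by blast
  qed
  show "finite {p. pU p u \<noteq> 0}" for u using ex[of u] finite_subset by blast
  show "(\<Sum>p | pU p u \<noteq> 0. pU p u) = u" for u
  proof -
    obtain I where I: "finite I" "{p. pU p u \<noteq> 0} \<subseteq> I" "(\<Sum>p\<in>I. pU p u) = u" using ex by blast
    have "(\<Sum>p | pU p u \<noteq> 0. pU p u) = (\<Sum>p\<in>I. pU p u)"
      by (rule sum.mono_neutral_left[OF I(1,2)]) auto
    then show ?thesis using I(3) by simp
  qed
qed

sublocale U: grading pU by (rule grading_pU)

lemma pU_odd: "pU (i, j) u \<noteq> 0 \<Longrightarrow> odd (i + j)"
proof (rule ccontr)
  assume nz: "pU (i, j) u \<noteq> 0" and ev: "\<not> odd (i + j)"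
  obtain a b where u: "a \<in> cocycles A" "b \<in> Ktot A" "KN a + Kd b = 0" "u = ccls (a, b)" by (rule cone_cases)
  have z: "(a, b) \<in> cone_cocycles A" using u cone_cocycle_iff by blast
  have "comp (i', j') x = 0" if x: "x \<in> Ktot A" and ev: "even (i' + j')" for i' j' x
  proof (rule comp_support)
    show "(i', j') \<notin> support x" using Ktot_weights(2)[OF x] ev by (auto simp: support_def)
  qed
  then have "comp (i, j) a = 0" "comp (i + 1, j - 1) b = 0" using u cocycles_Ktot ev by auto
  then have "pU (i, j) u = ccls 0" using pU_ccls[OF z] u(4) by (simp add: zero_prod_def)
  also have "\<dots> = 0" by (rule ccls_0)
  finally show False using nz by blast
qed

lemma grX_eq: "grX A ccls p q = {u. pU (q - 2 * p, q - 1) u = u}"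
proof (intro equalityI subsetI)
  fix u assume "u \<in> grX A ccls p q"
  then obtain a b where ab: "(a, b) \<in> cone_cocycles A" "a \<in> K2 A (q - 2 * p) (q - 1)"
    "b \<in> K2 A (q - 2 * p + 1) (q - 2)" "u = ccls (a, b)" by (auto simp: grX_def)
  have "comp (q - 2 * p + 1, q - 1 - 1) b = b" using K2_comp[OF ab(3)] by simp
  then show "u \<in> {u. pU (q - 2 * p, q - 1) u = u}" using ab by (simp add: pU_ccls K2_comp)
next
  fix u assume u: "u \<in> {u. pU (q - 2 * p, q - 1) u = u}"
  obtain a b where ab: "a \<in> cocycles A" "b \<in> Ktot A" "KN a + Kd b = 0" "u = ccls (a, b)" by (rule cone_cases)
  have z: "(a, b) \<in> cone_cocycles A" using ab cone_cocycle_iff by blast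
  have "u = ccls (comp (q - 2 * p, q - 1) a, comp (q - 2 * p + 1, q - 2) b)"
    using u pU_ccls[OF z, of "q - 2 * p" "q - 1"] ab(4) by simp
  moreover have "(comp (q - 2 * p, q - 1) a, comp (q - 2 * p + 1, q - 2) b) \<in> cone_cocycles A"
    using comp_cone_cocycle[OF z, of "q - 2 * p" "q - 1"] by simp
  ultimately show "u \<in> grX A ccls p q"
    unfolding grX_def using comp_K2[OF cocycles_Ktot[OF ab(1)]] comp_K2[OF ab(2)] by blast
qed

end

lemma finite_dimensional_preimage:
  assumes f: "linear f" and W: "subspace W" and inj: "\<And>x. x \<in> W \<Longrightarrow> f x = 0 \<Longrightarrow> x = 0"
    and S: "finite S" "f ` W \<subseteq> span S"
  shows "\<exists>B. finite B \<and> card B \<le> card S \<and> W \<subseteq> span B"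
proof -
  obtain B where B: "B \<subseteq> W" "independent B" "W \<subseteq> span B" using basis_exists[of W] by metis
  have sp: "span B = W" using span_minimal[OF B(1) W] B(3) by blast
  have "inj_on f (span B)"
    unfolding linear_inj_on_iff_eq_0[OF f subspace_span] unfolding sp using inj by auto
  then have "independent (f ` B)" "card (f ` B) = card B" "inj_on f B"
    using linear_independent_injective_image[OF f B(2)] card_image inj_on_subset span_superset by metis+
  moreover have "f ` B \<subseteq> span S" using B(1) S(2) by blast
  ultimately show ?thesis
    using independent_span_bound[OF S(1), of "f ` B"] B(3) finite_image_iff by metis
qed

section \<open>The splitting into \<open>ker N\<close> and the complement of the image\<close>

context cone_module
begin

text \<open>Modulo the image of \<open>N\<close>, which \<open>\<kappa>\<close> kills,
  \<open>y\<close> may be taken in \<open>L.coprim\<close>, and there components with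
  \<open>i > 0\<close> vanish.\<close>

lemma \<kappa>_pr_positive: assumes "i > 0" shows "\<kappa> (pr (i, j) y) = 0"
proof -
  obtain z where z: "y - N z \<in> L.coprim" using L.coprim_decomposition by blast
  have "pr (i, j) (y - N z) = 0" by (rule L.coprim_pr_positive[OF z assms])
  then have "pr (i, j) y = N (pr (i - 2, j) z)" by (simp add: linear_diff[OF L.linear_pr] L.pr_N)
  then show ?thesis by (simp add: \<kappa>_N)
qed

text \<open>\<open>\<kappa>\<close> lowers the first index by \<open>1\<close>, so
  \<open>coker N\<close>, in degrees \<open>i \<le> 0\<close>, lands in \<open>i < 0\<close>, while
  \<open>ker N\<close> has degrees \<open>i \<ge> 0\<close>. The sign of \<open>i\<close> therefore
  separates the two parts, and this is the projection onto the first.\<close>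

definition neg :: "'u \<Rightarrow> 'u" where "neg = U.dmap (\<lambda>(i, j). if i < 0 then 1 else 0)"

lemma pU_neg: "pU (i, j) (neg u) = (if i < 0 then pU (i, j) u else 0)"
  by (simp add: neg_def U.pr_dmap)

lemma neg_pU: "neg (pU (i, j) u) = (if i < 0 then pU (i, j) u else 0)"
  by (simp add: neg_def U.dmap_pr)

lemma linear_neg: "linear neg"
  unfolding neg_def by (rule U.linear_dmap)

lemma T_neg: "T (neg u) = 0"
proof (rule L.pr_all_zero)
  fix p :: "int \<times> int"
  obtain i j where p: "p = (i, j)" by fastforce
  have "pr p (T (neg u)) = T (pU p (neg u))" by (simp add: T_pU)
  also have "\<dots> = (if i < 0 then pr p (T u) else 0)"
    by (simp add: p pU_neg T_pU linear_0[OF linear_T])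
  also have "\<dots> = 0" using L.ker_pr_negative[OF N_T] by (simp add: p)
  finally show "pr p (T (neg u)) = 0" .
qed

lemma neg_\<kappa>: "neg (\<kappa> y) = \<kappa> y"
proof (rule U.pr_eqI)
  fix p :: "int \<times> int"
  obtain i j where p: "p = (i, j)" by fastforce
  show "pU p (neg (\<kappa> y)) = pU p (\<kappa> y)"
    using \<kappa>_pr_positive[of "i + 1" "j - 1" y] by (simp add: p pU_neg pU_\<kappa>)
qed

lemma \<kappa>_coprim_inj:
  assumes "y \<in> L.coprim" "y' \<in> L.coprim" "\<kappa> y = \<kappa> y'" shows "y = y'"
proof -
  have "\<kappa> (y - y') = 0" using assms(3) by (simp add: linear_diff[OF linear_\<kappa>])
  then obtain z where z: "y - y' = N z" using \<kappa>_eq_0 by blast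
  then have "N z \<in> L.coprim" using subspace_diff[OF L.subspace_coprim assms(1,2)] by simp
  then have "y - y' = 0" unfolding z by (rule L.N_coprim)
  then show ?thesis by simp
qed

text \<open>The component of a class in \<open>coker N\<close>, realized in the orthogonal complement of the image of \<open>N\<close>.\<close>

definition S :: "'u \<Rightarrow> 'v" where "S u = (THE y. y \<in> L.coprim \<and> \<kappa> y = neg u)"

lemma S: "S u \<in> L.coprim" "\<kappa> (S u) = neg u"
  and S_eqI: "y \<in> L.coprim \<Longrightarrow> \<kappa> y = neg u \<Longrightarrow> S u = y"
proof -
  obtain y where y: "neg u = \<kappa> y" using T_eq_0[OF T_neg] by blast
  obtain z where z: "y - N z \<in> L.coprim" using L.coprim_decomposition by blast
  have "\<kappa> (y - N z) = neg u" by (simp add: y linear_diff[OF linear_\<kappa>] \<kappa>_N)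
  with z have "\<exists>!y. y \<in> L.coprim \<and> \<kappa> y = neg u" using \<kappa>_coprim_inj by (intro ex1I[of _ "y - N z"]) auto
  from theI'[OF this] show S: "S u \<in> L.coprim" "\<kappa> (S u) = neg u" by (auto simp: S_def)
  show "y \<in> L.coprim \<Longrightarrow> \<kappa> y = neg u \<Longrightarrow> S u = y" for y
    using \<kappa>_coprim_inj[OF S(1), of y] S(2) by simp
qed

lemma linear_S: "linear S"
proof (rule linearI)
  show "S (u + v) = S u + S v" for u v
    by (rule S_eqI) (simp_all add: S subspace_add[OF L.subspace_coprim] linear_add[OF linear_\<kappa>] linear_add[OF linear_neg])
  show "S (r *\<^sub>R u) = r *\<^sub>R S u" for r u
    by (rule S_eqI) (simp_all add: S subspace_scale[OF L.subspace_coprim] linear_scale[OF linear_\<kappa>] linear_scale[OF linear_neg])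
qed

lemma S_\<kappa>: "y \<in> L.coprim \<Longrightarrow> S (\<kappa> y) = y"
  by (rule S_eqI) (simp_all add: neg_\<kappa>)

text \<open>Together with \<open>TS_surj\<close> this makes \<open>(T, S)\<close> an isomorphism
  onto the direct sum of \<open>ker N\<close> and \<open>L.coprim\<close>. Inner product, action and
  Dirac operator are all handled through it.\<close>

lemma TS_0: assumes "T u = 0" "S u = 0" shows "u = 0"
proof (rule U.pr_all_zero)
  fix p :: "int \<times> int"
  obtain i j where p: "p = (i, j)" by fastforce
  obtain y where y: "u = \<kappa> y" using T_eq_0[OF assms(1)] by blast
  have "neg u = 0" using S(2)[of u] by (simp add: assms(2) linear_0[OF linear_\<kappa>])
  then have "u = 0" by (simp add: y neg_\<kappa>)
  then show "pU p u = 0" by (simp add: U.pr_0)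
qed

lemma TS_eqI: assumes "T u = T v" "S u = S v" shows "u = v"
  using TS_0[of "u - v"] assms by (simp add: linear_diff[OF linear_T] linear_diff[OF linear_S])

lemma TS_surj: assumes "N x = 0" "y \<in> L.coprim" shows "\<exists>u. T u = x \<and> S u = y"
proof -
  obtain u where u: "T u = x" using T_surj[OF assms(1)] by blast
  have "neg (neg u) = neg u" using neg_\<kappa>[of "S u"] by (simp add: S)
  then have "S (neg u) = S u" by (intro S_eqI) (simp_all add: S)
  \<comment> \<open>The part of \<open>u\<close> in negative degrees is exchanged for
    \<open>\<kappa> y\<close>; \<open>T\<close> vanishes on both.\<close>
  then have "T (u - neg u + \<kappa> y) = x" "S (u - neg u + \<kappa> y) = y"
    by (simp_all add: u T_neg T_\<kappa> S_\<kappa>[OF assms(2)] linear_add[OF linear_T] linear_diff[OF linear_T]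
        linear_add[OF linear_S] linear_diff[OF linear_S])
  then show ?thesis by blast
qed

lemma S_pU: "S (pU (i, j) u) = pr (i + 1, j - 1) (S u)"
  by (rule S_eqI[OF L.coprim_pr[OF S(1)]]) (simp add: S pU_neg neg_pU flip: pU_\<kappa>)

lemma ker_part_iff: "u \<in> ker_part A ccls \<longleftrightarrow> S u = 0"
proof
  assume "u \<in> ker_part A ccls"
  then show "S u = 0"
    unfolding ker_part_def
  proof (induction rule: span_induct)
    case base
    show ?case unfolding subspace_def
      by (simp add: linear_0[OF linear_S] linear_add[OF linear_S] linear_scale[OF linear_S])
  next
    case (step u)
    then obtain p q where u: "u \<in> grX A ccls p q" "q \<ge> 2 * p" by (auto split: if_splits)
    then have "S u = pr (q - 2 * p + 1, q - 1 - 1) (S u)" using S_pU[of "q - 2 * p" "q - 1" u] by (simp add: grX_eq)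
    also have "\<dots> = 0" using u(2) by (intro L.coprim_pr_positive[OF S(1)]) simp
    finally show ?case .
  qed
next
  assume "S u = 0"
  then have neg: "neg u = 0" using S(2)[of u] by (simp add: linear_0[OF linear_\<kappa>])
  have "pU p u \<in> ker_part A ccls" for p
  proof (cases "pU p u = 0")
    case True
    then show ?thesis by (simp add: ker_part_def span_zero)
  next
    case False
    obtain i j where p: "p = (i, j)" by fastforce
    \<comment> \<open>Solves \<open>i = q - 2 * p\<close> and \<open>j = q - 1\<close>: the graded
      piece has \<open>p = m\<close> and \<open>q = j + 1\<close>, and \<open>q \<ge> 2 * p\<close>
      means \<open>i \<ge> 0\<close>.\<close>
    define m where "m = (j + 1 - i) div 2"
    have "\<not> i < 0" using pU_neg[of i j u] neg False by (auto simp: p U.pr_0)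
    moreover have "odd (i + j)" using pU_odd False by (simp add: p)
    then have m: "j + 1 - 2 * m = i" unfolding m_def by presburger
    moreover have "pU p u \<in> grX A ccls m (j + 1)" by (simp add: grX_eq m p U.pr_pr)
    ultimately have "pU p u \<in> (\<Union>p q. if q \<ge> 2 * p then grX A ccls p q else {})"
      by (intro UN_I[of m] UN_I[of "j + 1"]) auto
    then show ?thesis unfolding ker_part_def by (rule span_base)
  qed
  then have "(\<Sum>p | pU p u \<noteq> 0. pU p u) \<in> ker_part A ccls"
    unfolding ker_part_def by (intro span_sum) auto
  then show "u \<in> ker_part A ccls" by (simp add: U.sum_pr)
qed

definition ipX :: "'u \<Rightarrow> 'u \<Rightarrow> real" where "ipX u v = ip (T u) (T v) + ip (S u) (S v)"

lemma inner_product_ipX: "inner_product_on ipX"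
  unfolding inner_product_on_def
proof (intro conjI allI impI)
  show "linear (ipX u)" for u
    by (rule linearI) (simp_all add: ipX_def linear_add[OF linear_T] linear_add[OF linear_S]
        linear_scale[OF linear_T] linear_scale[OF linear_S] L.O.ip_simps algebra_simps)
  show "ipX u v = ipX v u" for u v by (simp add: ipX_def L.O.ip_sym)
  show "ipX u u > 0" if "u \<noteq> 0" for u
  proof -
    have "T u \<noteq> 0 \<or> S u \<noteq> 0" using TS_0 that by blast
    then show ?thesis
      unfolding ipX_def using L.O.ip_pos L.O.ip_nonneg by (auto intro: add_pos_nonneg add_nonneg_pos)
  qed
qed

lemma orthogonal_pU: "orthogonal_grading pU ipX"
proof (intro orthogonal_grading.intro[OF grading_pU] orthogonal_grading_axioms.intro inner_product_ipX)
  fix p q :: "int \<times> int" and u v assume "p \<noteq> q"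
  moreover obtain i j i' j' where pq: "p = (i, j)" "q = (i', j')" by fastforce
  ultimately show "ipX (pU p u) (pU q v) = 0"
    by (simp add: pq ipX_def T_pU S_pU L.O.pr_orthogonal)
qed

lemma induced_ipX: "induced_ip A cls ccls ip ipX"
  unfolding induced_ip_def
proof (intro conjI allI ballI impI)
  show "ipX u v = ip (T u) (T v)" if "u \<in> ker_part A ccls" "v \<in> ker_part A ccls" for u v
    using that by (simp add: ker_part_iff ipX_def L.O.ip_simps)
  show "ipX (\<kappa> x) (\<kappa> y) = ip x y" if "\<forall>z. ip x (N z) = 0 \<and> ip y (N z) = 0" for x y
    using that by (simp add: ipX_def T_\<kappa> S_\<kappa> L.coprim_def L.O.ip_simps)
  show "ipX u (\<kappa> x) = 0" "ipX (\<kappa> x) u = 0" if "u \<in> ker_part A ccls" for u x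
    using that by (simp_all add: ker_part_iff ipX_def T_\<kappa> L.O.ip_simps)
qed

lemma bounded_TS:
  assumes f: "linear f" and TS: "\<And>u. T (f u) = F (T u)" "\<And>u. S (f u) = F (S u)"
    and F: "bounded_wrt ip F"
  shows "bounded_wrt ipX f"
proof -
  obtain C where C: "C \<ge> 0" "\<And>x. ip (F x) (F x) \<le> C * ip x x" using F unfolding bounded_wrt_def by blast
  have "ipX (f u) (f u) \<le> C * ipX u u" for u
    using C(2)[of "T u"] C(2)[of "S u"] by (simp add: ipX_def TS distrib_left)
  then show ?thesis using f C(1) unfolding bounded_wrt_def by blast
qed

text \<open>Corresponds under \<open>(T, S)\<close> to \<open>F\<close> on both summands. The
  description determines an operator as soon as \<open>F\<close> preserves \<open>ker N\<close> and
  \<open>L.coprim\<close>.\<close>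

definition transport :: "('v \<Rightarrow> 'v) \<Rightarrow> 'u \<Rightarrow> 'u" where
  "transport F u = (THE v. T v = F (T u) \<and> S v = F (S u))"

lemma transport:
  assumes "\<And>x. N x = 0 \<Longrightarrow> N (F x) = 0" "\<And>y. y \<in> L.coprim \<Longrightarrow> F y \<in> L.coprim"
  shows "T (transport F u) = F (T u)" "S (transport F u) = F (S u)"
proof -
  have "\<exists>v. T v = F (T u) \<and> S v = F (S u)" using TS_surj assms N_T S(1) by blast
  then have "\<exists>!v. T v = F (T u) \<and> S v = F (S u)" using TS_eqI by metis
  from theI'[OF this] show "T (transport F u) = F (T u)" "S (transport F u) = F (S u)"
    by (simp_all add: transport_def)
qed

lemma linear_transport:
  assumes F: "\<And>x. N x = 0 \<Longrightarrow> N (F x) = 0" "\<And>y. y \<in> L.coprim \<Longrightarrow> F y \<in> L.coprim" and lin: "linear F"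
  shows "linear (transport F)"
proof (rule linearI)
  note s = transport[OF F] linear_add[OF linear_T] linear_add[OF linear_S]
    linear_scale[OF linear_T] linear_scale[OF linear_S] linear_add[OF lin] linear_scale[OF lin]
  show "transport F (u + v) = transport F u + transport F v" for u v by (rule TS_eqI) (simp_all add: s)
  show "transport F (r *\<^sub>R u) = r *\<^sub>R transport F u" for r u by (rule TS_eqI) (simp_all add: s)
qed

section \<open>The Dirac operator and the duality map\<close>

text \<open>The eigenvalue \<open>p\<close> or \<open>p - 1\<close> expressed through
  \<open>i = q - 2 * p\<close> and \<open>j = q - 1\<close>.\<close>

definition eigen :: "int \<times> int \<Rightarrow> int" where
  "eigen = (\<lambda>(i, j). if i \<ge> 0 then (1 + j - i) div 2 else (1 + j - i) div 2 - 1)"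

lemma dirac_eq:
  assumes "dirac_grading A ccls \<Phi>"
  shows "\<Phi> u = U.dmap (\<lambda>p. of_int (eigen p)) u"
proof (rule U.dmap_eqI)
  show "linear \<Phi>" using assms by (simp add: dirac_grading_def)
  fix p u assume u: "pU p u = u"
  obtain i j where p: "p = (i, j)" by fastforce
  show "\<Phi> u = real_of_int (eigen p) *\<^sub>R u"
  proof (cases "u = 0")
    case True
    then show ?thesis using linear_0[OF \<open>linear \<Phi>\<close>] by simp
  next
    case False
    define m where "m = (1 + j - i) div 2"
    have "odd (i + j)" using pU_odd[of i j u] False u by (simp add: p)
    then have m: "j + 1 - 2 * m = i" unfolding m_def by presburger
    then have "u \<in> grX A ccls m (j + 1)" using u by (simp add: grX_eq p)
    then have "\<Phi> u = (if j + 1 \<ge> 2 * m then real_of_int m else real_of_int (m - 1)) *\<^sub>R u"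
      using assms unfolding dirac_grading_def by blast
    moreover have "j + 1 \<ge> 2 * m \<longleftrightarrow> i \<ge> 0" using m by linarith
    ultimately show ?thesis by (simp add: eigen_def p m_def)
  qed
qed

text \<open>On both summands the Dirac operator becomes \<open>L.phi\<close>. On the second one, the
  shift of \<open>(i, j)\<close> by \<open>(-1, 1)\<close> raises \<open>(1 + j - i) div 2\<close>
  by \<open>1\<close>, which the value \<open>p - 1\<close> compensates. The commutator estimate for
  \<open>L.phi\<close> thus carries over.\<close>

lemma TS_dirac:
  assumes "dirac_grading A ccls \<Phi>"
  shows "T (\<Phi> u) = L.phi (T u)" "S (\<Phi> u) = L.phi (S u)"
proof -
  show "T (\<Phi> u) = L.phi (T u)"
  proof (rule L.pr_eqI)
    fix p :: "int \<times> int"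
    obtain i j where p: "p = (i, j)" by fastforce
    have "pr p (T (\<Phi> u)) = T (pU p (\<Phi> u))" by (simp add: T_pU)
    also have "\<dots> = real_of_int (eigen p) *\<^sub>R pr p (T u)"
      by (simp add: dirac_eq[OF assms] U.pr_dmap linear_scale[OF linear_T] T_pU)
    also have "\<dots> = pr p (L.phi (T u))"
    proof (cases "pr p (T u) = 0")
      case False
      have "i \<ge> 0" using L.ker_pr_negative[OF N_T, of i j u] False by (force simp: p)
      moreover have "odd (i + j)" using L.weights[of i j "T u"] False by (simp add: p)
      then have "even (1 + j - i)" by presburger
      ultimately have "real_of_int (eigen p) = real_of_int (1 + j - i) / 2" by (simp add: p eigen_def real_of_int_div)
      then show ?thesis by (simp add: L.phi_def L.pr_dmap p)
    qed (simp add: L.phi_def L.pr_dmap)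
    finally show "pr p (T (\<Phi> u)) = pr p (L.phi (T u))" .
  qed
  show "S (\<Phi> u) = L.phi (S u)"
  proof (rule L.pr_eqI)
    fix p :: "int \<times> int"
    obtain i j where p: "p = (i, j)" by fastforce
    have pr_S: "pr p (S u) = S (pU (i - 1, j + 1) u)" for u by (simp add: S_pU p)
    have "pr p (S (\<Phi> u)) = real_of_int (eigen (i - 1, j + 1)) *\<^sub>R pr p (S u)"
      by (simp add: pr_S dirac_eq[OF assms] U.pr_dmap linear_scale[OF linear_S])
    also have "\<dots> = pr p (L.phi (S u))"
    proof (cases "pr p (S u) = 0")
      case False
      have "i \<le> 0" using L.coprim_pr_positive[OF S(1), of i j u] False by (force simp: p)
      moreover have "odd (i + j)" using L.weights[of i j "S u"] False by (simp add: p)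
      then have "even (1 + j - i)" by presburger
      moreover have "1 + (j + 1) - (i - 1) = (1 + j - i) + 2" by simp
      ultimately have "real_of_int (eigen (i - 1, j + 1)) = real_of_int (1 + j - i) / 2"
        by (simp add: eigen_def real_of_int_div)
      then show ?thesis by (simp add: L.phi_def L.pr_dmap p)
    qed (simp add: L.phi_def L.pr_dmap)
    finally show "pr p (S (\<Phi> u)) = pr p (L.phi (S u))" .
  qed
qed

text \<open>On a graded piece the preimage in the definition of \<open>\<delta>\<close> is the
  vector of \<open>primitive_lift\<close>, a multiple of \<open>A.w\<close> whose factor depends
  only on the first weight. Linearity extends the formula to all of \<open>ker_part\<close>.\<close>

lemma duality_eq:
  assumes \<delta>: "duality_map A cls ccls \<delta>" and u: "u \<in> ker_part A ccls"
  shows "\<delta> u = \<kappa> (L.A.w (L.A.dmap (\<lambda>i. (-1) ^ nat i / fact (nat i)) (T u)))"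
  using u unfolding ker_part_def
proof (induction rule: span_induct)
  case base
  have "linear \<delta>" using \<delta> by (simp add: duality_map_def)
  then show ?case
    unfolding subspace_def
    by (simp add: linear_0 linear_add linear_scale linear_T linear_\<kappa> L.A.linear_w L.A.linear_dmap)
next
  case (step u)
  then obtain p q where u: "u \<in> grX A ccls p q" "q \<ge> 2 * p" by (auto split: if_splits)
  define n where "n = nat (q - 2 * p)"
  have n: "int n = q - 2 * p" using u(2) by (simp add: n_def)
  have x: "pr (int n, q - 1) (T u) = T u" using u(1) by (simp add: n grX_eq flip: T_pU)
  define y where "y = ((-1) ^ n / fact n) *\<^sub>R L.A.w (T u)"
  note lift = L.primitive_lift[OF x N_T, folded y_def]
  have "y \<in> H2 A cls (2 * p - q) (q - 1)" using lift(2) by (simp add: H2_eq n)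
  then have "\<delta> u = \<kappa> y"
    using \<delta> u lift(1) unfolding duality_map_def n_def by blast
  moreover have "L.coarsen fst (int n) (T u) = T u" using x by (metis L.coarsen_pr fst_conv)
  then have "L.A.dmap (\<lambda>i. (-1) ^ nat i / fact (nat i)) (T u) = ((-1) ^ n / fact n) *\<^sub>R T u"
    by (simp add: L.A.dmap_homogeneous)
  ultimately show ?case by (simp add: y_def linear_scale[OF L.A.linear_w])
qed

lemma transport_\<sigma>2:
  assumes "g \<in> SL2"
  shows "T (transport (\<sigma> (mat 1) g) u) = \<sigma> (mat 1) g (T u)"
    "S (transport (\<sigma> (mat 1) g) u) = \<sigma> (mat 1) g (S u)"
    "linear (transport (\<sigma> (mat 1) g))"
  using transport[of "\<sigma> (mat 1) g"] linear_transport[of "\<sigma> (mat 1) g"]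
    L.\<sigma>2_ker[OF assms] L.\<sigma>2_coprim[OF assms] L.linear_B[OF assms] by blast+

text \<open>By \<open>duality_eq\<close>, \<open>\<delta>\<close> is composed of \<open>T\<close>, a
  function of the first weight, \<open>A.w\<close> and \<open>\<kappa>\<close>. The second factor
  commutes with each of these.\<close>

lemma transport_duality:
  assumes \<delta>: "duality_map A cls ccls \<delta>" and u: "u \<in> ker_part A ccls" and g: "g \<in> SL2"
  shows "transport (\<sigma> (mat 1) g) (\<delta> u) = \<delta> (transport (\<sigma> (mat 1) g) u)"
proof -
  let ?g = "\<sigma> (mat 1) g"
  define c :: "int \<Rightarrow> real" where "c = (\<lambda>i. (-1) ^ nat i / fact (nat i))"
  have ker: "transport ?g u \<in> ker_part A ccls"
    using u by (simp add: ker_part_iff transport_\<sigma>2[OF g] linear_0[OF L.linear_B[OF g]])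
  have dm: "L.A.dmap c (?g x) = ?g (L.A.dmap c x)" for x
    by (rule L.A.pr_eqI) (simp add: L.A.pr_dmap L.weight_A_\<sigma>2[OF g] linear_scale[OF L.linear_B[OF g]])
  define y where "y = L.A.w (L.A.dmap c (T u))"
  have "N (L.A.w y) = 0"
  proof -
    have "L.A.w y = L.dmap (\<lambda>(i, j). (-1) powi i) (L.A.dmap c (T u))" by (simp add: y_def L.w1_w1)
    moreover have "N (L.A.dmap c (T u)) = 0"
    proof -
      have "L.A.dmap c x = L.dmap (\<lambda>(i, j). c i) x" for x
      proof (rule L.dmap_eqI[OF L.A.linear_dmap])
        fix p x assume "pr p x = x"
        then have "L.coarsen fst (fst p) x = x" by (metis L.coarsen_pr)
        then show "L.A.dmap c x = (case p of (i, j) \<Rightarrow> c i) *\<^sub>R x"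
          by (simp add: L.A.dmap_homogeneous case_prod_unfold)
      qed
      then show ?thesis by (simp add: L.dmap_ker N_T)
    qed
    ultimately show ?thesis by (simp add: L.dmap_ker)
  qed
  then have y: "y \<in> L.coprim" by (simp add: L.coprim_iff)
  have "transport ?g (\<kappa> y) = \<kappa> (?g y)"
    by (rule TS_eqI) (simp_all add: transport_\<sigma>2[OF g] T_\<kappa> S_\<kappa> y L.\<sigma>2_coprim[OF g] linear_0[OF L.linear_B[OF g]])
  also have "?g y = L.A.w (L.A.dmap c (T (transport ?g u)))"
    by (simp add: y_def transport_\<sigma>2[OF g] dm L.w1_\<sigma>2[OF g])
  finally show ?thesis
    using duality_eq[OF \<delta> u] duality_eq[OF \<delta> ker] by (simp add: y_def c_def)
qed

section \<open>Multiplicities of the eigenvalues\<close>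

text \<open>For \<open>i \<ge> 0\<close> the map \<open>T\<close> embeds the component into
  \<open>ker N\<close>. For \<open>i < 0\<close> the same is done by \<open>S\<close> followed by
  \<open>A.w\<close>, which takes \<open>L.coprim\<close> to \<open>ker N\<close> and changes the
  sign of the first weight.\<close>

lemma pU_finite:
  assumes "compact_space X"
  shows "\<exists>D. \<forall>p. \<exists>B. finite B \<and> card B \<le> D \<and> range (pU p) \<subseteq> span B"
proof -
  obtain D where D: "\<And>i j. \<exists>S. finite S \<and> card S \<le> D \<and> {x. N x = 0 \<and> pr (i, j) x = x} \<subseteq> span S"
    using kernel_finite[OF assms] by blast
  have "\<exists>B. finite B \<and> card B \<le> D \<and> range (pU (i, j)) \<subseteq> span B" for i j
  proof -
    have sub: "subspace (range (pU (i, j)))" by (rule linear_subspace_image[OF linear_pU subspace_UNIV])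
    define f where "f = (if i \<ge> 0 then T else L.A.w \<circ> S)"
    define q where "q = (if i \<ge> 0 then (i, j) else (- (i + 1), j - 1))"
    obtain S0 where S0: "finite S0" "card S0 \<le> D" "{x. N x = 0 \<and> pr q x = x} \<subseteq> span S0"
      using D[of "fst q" "snd q"] by auto
    have w0: "L.A.w x = 0 \<Longrightarrow> x = 0" for x using L.A.w_w_w_w[of x] by (simp add: linear_0[OF L.A.linear_w])
    have f: "linear f" using linear_compose[OF linear_S L.A.linear_w] by (simp add: f_def linear_T)
    have inj: "v = 0" if "v \<in> range (pU (i, j))" "f v = 0" for v
    proof -
      have v: "pU (i, j) v = v" using that(1) by (auto simp: U.pr_pr)
      show ?thesis
      proof (rule TS_0)
        show "T v = 0"
        proof (cases "i \<ge> 0")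
          case False
          then show ?thesis using L.ker_pr_negative[OF N_T, of i j v] T_pU[of "(i, j)" v] v by simp
        qed (use that(2) in \<open>simp add: f_def\<close>)
        show "S v = 0"
        proof (cases "i \<ge> 0")
          case True
          then show ?thesis using L.coprim_pr_positive[OF S(1), of "i + 1" "j - 1" v] S_pU[of i j v] v by simp
        qed (use that(2) w0 in \<open>simp add: f_def\<close>)
      qed
    qed
    have "f ` range (pU (i, j)) \<subseteq> {x. N x = 0 \<and> pr q x = x}"
    proof (intro image_subsetI)
      fix v assume "v \<in> range (pU (i, j))"
      then have v: "pU (i, j) v = v" by (auto simp: U.pr_pr)
      show "f v \<in> {x. N x = 0 \<and> pr q x = x}"
      proof (cases "i \<ge> 0")
        case True
        then show ?thesis using T_pU[of "(i, j)" v] v by (simp add: f_def q_def N_T)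
      next
        case False
        then show ?thesis
          using S_pU[of i j v] v S(1)[of v] L.coprim_iff[of "S v"]
          by (simp add: f_def q_def L.pr_w1 add.commute[of 1])
      qed
    qed
    then have "f ` range (pU (i, j)) \<subseteq> span S0" using S0(3) by blast
    from finite_dimensional_preimage[OF f sub inj S0(1) this] show ?thesis using S0(2) by (meson order_trans)
  qed
  then have "\<exists>B. finite B \<and> card B \<le> D \<and> range (pU p) \<subseteq> span B" for p by (cases p) simp
  then show ?thesis by blast
qed

lemma eigenspace_finite:
  assumes "compact_space X"
  shows "\<exists>D. \<forall>n. \<exists>B. finite B \<and> card B \<le> D \<and> range (U.coarsen eigen n) \<subseteq> span B"
proof -
  obtain D where D: "\<And>p. \<exists>B. finite B \<and> card B \<le> D \<and> range (pU p) \<subseteq> span B"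
    using pU_finite[OF assms] by blast
  obtain B where B: "\<And>p. finite (B p)" "\<And>p. card (B p) \<le> D" "\<And>p u. pU p u \<in> span (B p)"
    using D by (metis rangeI subsetD)
  have "\<exists>B. finite B \<and> card B \<le> 8 * D \<and> range (U.coarsen eigen n) \<subseteq> span B" for n
  proof -
    \<comment> \<open>\<open>T\<close> sees the index \<open>j\<close> and \<open>S\<close> sees
      \<open>j - 1\<close>, both of absolute value at most \<open>1\<close>; hence \<open>j\<close>
      runs from \<open>-1\<close> to \<open>2\<close>. The number \<open>b\<close> tells whether the
      eigenvalue is \<open>p\<close> or \<open>p - 1\<close>. This gives the factor
      \<open>8\<close>.\<close>
    define Q where "Q = (\<lambda>(j, b). (1 + j - 2 * (n + b), j)) ` ({-1..2::int} \<times> {0..1::int})"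
    have Q: "finite Q" "card Q \<le> 8"
    proof -
      show "finite Q" by (simp add: Q_def)
      have "card Q \<le> card ({-1..2::int} \<times> {0..1::int})" unfolding Q_def by (rule card_image_le) simp
      then show "card Q \<le> 8" by simp
    qed
    have mem: "p \<in> Q" if "eigen p = n" and nz: "pU p u \<noteq> 0" for p u
    proof -
      obtain i j where p: "p = (i, j)" by fastforce
      have "pr (i, j) (T u) \<noteq> 0 \<or> pr (i + 1, j - 1) (S u) \<noteq> 0"
        using TS_0[of "pU (i, j) u"] nz by (auto simp: p T_pU S_pU)
      then have "\<bar>j\<bar> \<le> 1 \<or> \<bar>j - 1\<bar> \<le> 1" using L.weights by blast
      then have j: "j \<in> {-1..2}" by auto
      have odd: "odd (i + j)" using pU_odd nz by (simp add: p)
      show ?thesis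
      proof (cases "i \<ge> 0")
        case True
        then have "(1 + j - i) div 2 = n" using that(1) by (simp add: eigen_def p)
        then have "i = 1 + j - 2 * (n + 0)" using odd by presburger
        then show ?thesis unfolding Q_def p by (intro image_eqI[of _ _ "(j, 0)"]) (use j in auto)
      next
        case False
        then have "(1 + j - i) div 2 - 1 = n" using that(1) by (simp add: eigen_def p)
        then have "i = 1 + j - 2 * (n + 1)" using odd by presburger
        then show ?thesis unfolding Q_def p by (intro image_eqI[of _ _ "(j, 1)"]) (use j in auto)
      qed
    qed
    have "U.coarsen eigen n u \<in> span (\<Union>p\<in>Q. B p)" for u
      unfolding U.coarsen_def U.dmap_def
    proof (rule span_sum)
      fix p assume p: "p \<in> {p. pU p u \<noteq> 0}"
      show "(if eigen p = n then 1 else 0) *\<^sub>R pU p u \<in> span (\<Union>p\<in>Q. B p)"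
      proof (cases "eigen p = n")
        case True
        then have "B p \<subseteq> (\<Union>p\<in>Q. B p)" using mem p by blast
        then show ?thesis using True B(3)[of p u] span_mono by auto
      qed (simp add: span_zero)
    qed
    moreover have "card (\<Union>p\<in>Q. B p) \<le> 8 * D"
    proof -
      have "card (\<Union>p\<in>Q. B p) \<le> (\<Sum>p\<in>Q. card (B p))" by (rule card_UN_le[OF Q(1)])
      also have "\<dots> \<le> card Q * D" using sum_bounded_above[of Q "\<lambda>p. card (B p)" D] B(2) by simp
      also have "\<dots> \<le> 8 * D" by (rule mult_right_mono[OF Q(2)]) simp
      finally show ?thesis .
    qed
    ultimately show ?thesis using Q(1) B(1) by (intro exI[of _ "\<Union>p\<in>Q. B p"]) auto
  qed
  then show ?thesis by blast
qed

end

section \<open>Assembly of the two parts of the theorem\<close>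

text \<open>A multiplicative map sends \<open>mat 1\<close> to an idempotent; invertibility then
  forces the lift \<open>h\<close> to preserve the identity.\<close>

lemma SL2_idempotent:
  fixes m :: "real^2^2"
  assumes "m \<in> SL2" "m ** m = m" shows "m = mat 1"
proof -
  have "invertible m" using assms(1) by (simp add: SL2_def invertible_det_nz)
  then obtain k where k: "k ** m = mat 1" unfolding invertible_def by blast
  have "m = (k ** m) ** m" by (simp add: k)
  also have "\<dots> = k ** m" using assms(2) by (simp only: flip: matrix_mul_assoc)
  finally show ?thesis by (simp add: k)
qed

lemma moebius_mat_1: "moebius (mat 1) = id"
  by (rule ext) (simp add: moebius_def mat_def split: option.split)

lemma mat_1_stabilizer:
  assumes "schottky_group g G" shows "mat 1 \<in> stabilizer G W1 W2"
proof -
  obtain S where "free_basis G S" using assms unfolding schottky_group_def by blast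
  then have "word_value [] \<in> G" unfolding free_basis_def by blast
  then show ?thesis by (simp add: stabilizer_def word_value_def moebius_mat_1)
qed

theorem theorem3p14:
  fixes X :: "'x topology" and A :: "'x chart set" and \<omega> :: "'x form" and g :: nat
    and G :: "(complex^2^2) set" and pr :: "complex option \<Rightarrow> 'x"
    and C \<Omega>1 \<Omega>2 U1 U2 :: "complex option set"
    and \<alpha>1 \<alpha>2 :: "complex option \<Rightarrow> complex option"
    and h :: "complex^2^2 \<Rightarrow> real^2^2"
    and cls :: "'x kfam \<Rightarrow> 'v::real_vector"
    and ccls :: "'x kfam \<times> 'x kfam \<Rightarrow> 'u::real_vector"
    and \<sigma> :: "real^2^2 \<Rightarrow> real^2^2 \<Rightarrow> 'v \<Rightarrow> 'v"
    and \<psi> :: "'v \<Rightarrow> 'v \<Rightarrow> real"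
    and \<delta> \<Phi> :: "'u \<Rightarrow> 'u"
  defines "Gt \<equiv> stabilizer G \<Omega>1 \<Omega>2"
  defines "\<rho> \<equiv> \<lambda>\<gamma>. \<sigma> (mat 1) (h \<gamma>)"
  defines "ip \<equiv> polarization_ip \<psi> \<sigma>"
  assumes surface: "riemann_surface X A" "compact_space X" "has_genus X g" "g \<ge> 2"
    and kaehler: "kaehler_form A \<omega>"
    and schottky: "schottky_group g G" "uniformizes G X A pr"
    and curve: "quasi_circle G C"
      "connected_components_of (subtopology P1 (- C)) = {\<Omega>1, \<Omega>2}" "\<Omega>1 \<noteq> \<Omega>2"
    and conformal: "{U1, U2} = hemispheres" "conformal_equiv \<Omega>1 U1 \<alpha>1" "conformal_equiv \<Omega>2 U2 \<alpha>2"
    and lift: "conjugation_lift Gt \<Omega>2 \<alpha>2 h"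
    and module: "polarized_lefschetz_cohomology X A \<omega> cls \<sigma> \<psi>"
    and cone: "cone_cohomology A ccls"
    and duality: "duality_map A cls ccls \<delta>"
    and dirac: "dirac_grading A ccls \<Phi>"
  shows "(\<forall>\<iota> :: 'v \<Rightarrow> 'h::{real_inner, complete_space}. hilbert_completion ip \<iota> \<longrightarrow>
           (\<exists>R. bounded_action Gt \<rho> \<iota> R \<and>
              (\<forall>a\<in>group_ring_image Gt R. bounded_commutator (op_closure \<iota> (PhiTilde A cls)) a))) \<and>
         (\<exists>ipX \<rho>X. inner_product_on ipX \<and> induced_ip A cls ccls ip ipX \<and>
           induced_action A cls ccls \<delta> Gt \<rho> \<rho>X \<and>
           (\<forall>\<iota> :: 'u \<Rightarrow> 'k::{real_inner, complete_space}. hilbert_completion ipX \<iota> \<longrightarrow>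
              self_adjoint_op (op_closure \<iota> \<Phi>) \<and>
              compact_resolvent (op_closure \<iota> \<Phi>) \<and>
              one_summable (op_closure \<iota> \<Phi>) \<and>
              (\<exists>R. bounded_action Gt \<rho>X \<iota> R \<and>
                 (\<forall>a\<in>group_ring_image Gt R. bounded_commutator (op_closure \<iota> \<Phi>) a))))"
proof -
  interpret M: cone_module X A \<omega> cls \<sigma> \<psi> ccls
    by unfold_locales (use surface kaehler module cone in auto)
  have h: "h \<gamma> \<in> SL2" "h (\<gamma> ** \<gamma>') = h \<gamma> ** h \<gamma>'" if "\<gamma> \<in> Gt" "\<gamma>' \<in> Gt" for \<gamma> \<gamma>'
    using lift that unfolding conjugation_lift_def by blast+
  have one: "mat 1 \<in> Gt" unfolding Gt_def by (rule mat_1_stabilizer[OF schottky(1)])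
  have h1: "h (mat 1) = mat 1" using SL2_idempotent[OF h(1)[OF one one]] h(2)[OF one one] by simp
  have \<rho>_mult: "\<rho> (\<gamma> ** \<gamma>') = \<rho> \<gamma> \<circ> \<rho> \<gamma>'" if "\<gamma> \<in> Gt" "\<gamma>' \<in> Gt" for \<gamma> \<gamma>'
    unfolding \<rho>_def h(2)[OF that] by (rule M.L.B.\<tau>_mult[OF h(1) h(1)]) (use that in auto)
  have bounded: "bounded_wrt ip (\<rho> \<gamma>)" if "\<gamma> \<in> Gt" for \<gamma>
    unfolding \<rho>_def ip_def by (rule M.L.bounded_\<sigma>2[OF h(1)[OF that that]])
  have comm: "bounded_wrt ip (\<lambda>x. M.L.phi (\<rho> \<gamma> x) - \<rho> \<gamma> (M.L.phi x))" if "\<gamma> \<in> Gt" for \<gamma>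
    unfolding \<rho>_def ip_def by (rule M.L.bounded_phi_commutator[OF h(1)[OF that that]])
  have PT: "PhiTilde A cls = M.L.phi" by (rule ext) (rule M.PhiTilde_eq)
  \<comment> \<open>This is \<open>\<rho>\<close> on \<open>ker N\<close> and on the complement of
    the image of \<open>N\<close>; \<open>transport_duality\<close> identifies the latter with the
    conjugate by \<open>\<delta>\<close>.\<close>
  define \<rho>X where "\<rho>X \<gamma> = M.transport (\<rho> \<gamma>)" for \<gamma>
  have T: "M.T (\<rho>X \<gamma> u) = \<rho> \<gamma> (M.T u)" and S: "M.S (\<rho>X \<gamma> u) = \<rho> \<gamma> (M.S u)"
    and lin: "linear (\<rho>X \<gamma>)" if "\<gamma> \<in> Gt" for \<gamma> u
    unfolding \<rho>X_def \<rho>_def using M.transport_\<sigma>2[OF h(1)[OF that that]] by auto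
  have lin\<Phi>: "linear \<Phi>" using dirac by (simp add: dirac_grading_def)
  note T\<Phi> = M.TS_dirac[OF dirac]
  have action: "induced_action A cls ccls \<delta> Gt \<rho> \<rho>X"
    unfolding induced_action_def
  proof (intro ballI conjI)
    fix \<gamma> u assume \<gamma>: "\<gamma> \<in> Gt"
    then show "linear (\<rho>X \<gamma>)" by (rule lin)
    assume u: "u \<in> ker_part A ccls"
    show "\<rho>X \<gamma> u \<in> ker_part A ccls"
      using u bounded_wrt_linear[OF bounded[OF \<gamma>]] by (simp add: M.ker_part_iff S[OF \<gamma>] linear_0)
    show "M.T (\<rho>X \<gamma> u) = \<rho> \<gamma> (M.T u)" by (rule T[OF \<gamma>])
    show "\<rho>X \<gamma> (\<delta> u) = \<delta> (\<rho>X \<gamma> u)"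
      unfolding \<rho>X_def \<rho>_def by (rule M.transport_duality[OF duality u h(1)[OF \<gamma> \<gamma>]])
  qed
  obtain D where D: "\<And>n. \<exists>B. finite B \<and> card B \<le> D \<and> range (M.U.coarsen M.eigen n) \<subseteq> span B"
    using M.eigenspace_finite[OF surface(2)] by blast
  have part1: "\<exists>R. bounded_action Gt \<rho> \<iota> R \<and>
      (\<forall>a\<in>group_ring_image Gt R. bounded_commutator (op_closure \<iota> (PhiTilde A cls)) a)"
    if \<iota>: "hilbert_completion ip \<iota>" for \<iota> :: "'v \<Rightarrow> 'h"
  proof -
    interpret completion ip \<iota> by unfold_locales (use \<iota> M.L.inner_product ip_def in auto)
    show ?thesis
      unfolding PT
    proof (rule hilbert_action[OF one _ bounded \<rho>_mult comm])
      show "\<rho> (mat 1) = id" unfolding \<rho>_def h1 by (rule M.L.\<sigma>_1)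
      show "linear M.L.phi" unfolding M.L.phi_def by (rule M.L.linear_dmap)
    qed
  qed
  have part2: "self_adjoint_op (op_closure \<iota> \<Phi>) \<and> compact_resolvent (op_closure \<iota> \<Phi>) \<and> one_summable (op_closure \<iota> \<Phi>) \<and>
      (\<exists>R. bounded_action Gt \<rho>X \<iota> R \<and> (\<forall>a\<in>group_ring_image Gt R. bounded_commutator (op_closure \<iota> \<Phi>) a))"
    if \<iota>: "hilbert_completion M.ipX \<iota>" for \<iota> :: "'u \<Rightarrow> 'k"
  proof -
    \<comment> \<open>Degrees with the same eigenvalue are merged, so that the Dirac operator
      becomes multiplication by the index.\<close>
    interpret O: orthogonal_grading "M.U.coarsen M.eigen" M.ipX
      by (rule orthogonal_grading.orthogonal_coarsen[OF M.orthogonal_pU])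
    interpret Q: diagonal_completion "M.U.coarsen M.eigen" M.ipX \<iota> D
      by unfold_locales (use M.inner_product_ipX \<iota> D in auto)
    have "\<Phi> u = Q.\<Phi> u" for u
      unfolding Q.\<Phi>_def
    proof (rule O.dmap_eqI[OF lin\<Phi>])
      fix n u assume "M.U.coarsen M.eigen n u = u"
      then have "\<Phi> u = \<Phi> (M.U.coarsen M.eigen n u)" by simp
      also have "\<dots> = real_of_int n *\<^sub>R M.U.coarsen M.eigen n u"
        unfolding M.dirac_eq[OF dirac]
        by (rule M.U.pr_eqI) (simp add: M.U.pr_dmap M.U.pr_coarsen linear_scale[OF M.linear_pU])
      finally show "\<Phi> u = real_of_int n *\<^sub>R u" by (simp add: \<open>M.U.coarsen M.eigen n u = u\<close>)
    qed
    then have eq: "\<Phi> = Q.\<Phi>" by blast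
    have "\<exists>R. bounded_action Gt \<rho>X \<iota> R \<and> (\<forall>a\<in>group_ring_image Gt R. bounded_commutator (op_closure \<iota> \<Phi>) a)"
    proof (rule Q.hilbert_action[OF one _ _ _ _ lin\<Phi>])
      show "\<rho>X (mat 1) = id"
      proof
        have "\<rho> (mat 1) = id" unfolding \<rho>_def h1 by (rule M.L.\<sigma>_1)
        then show "\<rho>X (mat 1) u = id u" for u by (intro M.TS_eqI) (simp_all add: T[OF one] S[OF one])
      qed
      show "bounded_wrt M.ipX (\<rho>X \<gamma>)" if "\<gamma> \<in> Gt" for \<gamma>
        by (rule M.bounded_TS[OF lin T S bounded[OF that, unfolded ip_def]]) (use that in auto)
      show "\<rho>X (\<gamma> ** \<gamma>') = \<rho>X \<gamma> \<circ> \<rho>X \<gamma>'" if \<gamma>: "\<gamma> \<in> Gt" "\<gamma>' \<in> Gt" for \<gamma> \<gamma>'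
      proof
        fix u
        have "M.T (M.transport (\<rho> (\<gamma> ** \<gamma>')) u) = \<rho> (\<gamma> ** \<gamma>') (M.T u)"
          "M.S (M.transport (\<rho> (\<gamma> ** \<gamma>')) u) = \<rho> (\<gamma> ** \<gamma>') (M.S u)"
          unfolding \<rho>_def h(2)[OF \<gamma>]
          using M.transport_\<sigma>2[OF SL2_mult[OF h(1)[OF \<gamma>] h(1)[OF \<gamma>(2,1)]]] by auto
        then show "\<rho>X (\<gamma> ** \<gamma>') u = (\<rho>X \<gamma> \<circ> \<rho>X \<gamma>') u"
          unfolding \<rho>X_def[of "\<gamma> ** \<gamma>'"]
          by (intro M.TS_eqI) (simp_all add: T[OF \<gamma>(1)] S[OF \<gamma>(1)] T[OF \<gamma>(2)] S[OF \<gamma>(2)] \<rho>_mult[OF \<gamma>])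
      qed
      show "bounded_wrt M.ipX (\<lambda>u. \<Phi> (\<rho>X \<gamma> u) - \<rho>X \<gamma> (\<Phi> u))" if \<gamma>: "\<gamma> \<in> Gt" for \<gamma>
      proof (rule M.bounded_TS[OF _ _ _ comm[OF \<gamma>, unfolded ip_def]])
        show "linear (\<lambda>u. \<Phi> (\<rho>X \<gamma> u) - \<rho>X \<gamma> (\<Phi> u))"
          using linear_compose[OF lin[OF \<gamma>] lin\<Phi>] linear_compose[OF lin\<Phi> lin[OF \<gamma>]]
          by (intro linear_compose_sub) (simp_all add: o_def)
        show "M.T (\<Phi> (\<rho>X \<gamma> u) - \<rho>X \<gamma> (\<Phi> u)) = M.L.phi (\<rho> \<gamma> (M.T u)) - \<rho> \<gamma> (M.L.phi (M.T u))"
          "M.S (\<Phi> (\<rho>X \<gamma> u) - \<rho>X \<gamma> (\<Phi> u)) = M.L.phi (\<rho> \<gamma> (M.S u)) - \<rho> \<gamma> (M.L.phi (M.S u))" for u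
          by (simp_all add: linear_diff[OF M.linear_T] linear_diff[OF M.linear_S] T\<Phi> T[OF \<gamma>] S[OF \<gamma>])
      qed
    qed
    then show ?thesis
      using Q.self_adjoint Q.compact_resolvent Q.one_summable unfolding eq by blast
  qed
  show ?thesis
    using part1 part2 action M.inner_product_ipX M.induced_ipX unfolding ip_def by blast
qed

end
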